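(* Let $H$ be a quasi-Hopf algebra over a field $k$ with bijective antipode, let $F:{}^H_H\mathcal{YD}\to{}_H\mathcal M$ be the forgetful functor and $R:{}_H\mathcal M\to{}^H_H\mathcal{YD}$ its right adjoint (described in the context), with unit $\eta$ and induced monoidal structure $R^{(2)}$. Then the monoidal adjunction $F\dashv R$ is co-Hopf; that is, for all $X\in{}_H\mathcal M$ and $M\in{}^H_H\mathcal{YD}$ the left and right Hopf operators $$\mathbb H^{(\ell)}_{X,M}=R^{(2)}_{X,F(M)}\circ(\mathrm{id}_{R(X)}\otimes\eta_M):R(X)\otimes M\to R(X\otimes F(M)),$$ $$\mathbb H^{(r)}_{X,M}=R^{(2)}_{F(M),X}\circ(\eta_M\otimes\mathrm{id}_{R(X)}):M\otimes R(X)\to R(F(M)\otimes X)$$ are invertible.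
   Context: Conventions. $k$ is a field, $\otimes=\otimes_k$. For a $k$-algebra $A$, $x\in A^{\otimes n}$ is written $x=x_1\otimes\cdots\otimes x_n$ (summation understood), $x^{-1}=\overline x_1\otimes\cdots\otimes\overline x_n$ if invertible; primes denote independent copies. A quasi-Hopf algebra is $(H,\Delta,\epsilon,\phi,S,\alpha,\beta)$ with $H$ a $k$-algebra, algebra maps $\Delta:H\to H\otimes H$ ($\Delta(h)=h_{(1)}\otimes h_{(2)}$), $\epsilon:H\to k$, an invertible $\phi\in H^{\otimes3}$, an anti-algebra map $S$ and $\alpha,\beta\in H$ such that for all $h$: $h_{(1)}\otimes\Delta(h_{(2)})=\phi(\Delta(h_{(1)})\otimes h_{(2)})\phi^{-1}$; $\epsilon(h_{(1)})h_{(2)}=h=h_{(1)}\epsilon(h_{(2)})$; $(\mathrm{id}\otimes\mathrm{id}\otimes\Delta)(\phi)(\Delta\otimes\mathrm{id}\otimes\mathrm{id})(\phi)=(1\otimes\phi)(\mathrm{id}\otimes\Delta\otimes\mathrm{id})(\phi)(\phi\otimes1)$; $(\mathrm{id}\otimes\epsilon\otimes\mathrm{id})(\phi)=1\otimes1$; $S(h_{(1)})\alpha h_{(2)}=\epsilon(h)\alpha$, $h_{(1)}\beta S(h_{(2)})=\epsilon(h)\beta$; $\phi_1\beta S(\phi_2)\alpha\phi_3=1=S(\overline\phi_1)\alpha\overline\phi_2\beta S(\overline\phi_3)$; and (standing) $\epsilon(\alpha)=\epsilon(\beta)=1$. $\overline S=S^{-1}$. $\Delta(h_{(1)})\otimes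 h_{(2)}=h_{(1,1)}\otimes h_{(1,2)}\otimes h_{(2)}$; $\Delta^{\mathrm{cop}}(h)=h_{(2)}\otimes h_{(1)}$. ${}_H\mathcal M$ is monoidal: $h(v\otimes w)=h_{(1)}v\otimes h_{(2)}w$, unit $k$ via $\epsilon$, associator $(x\otimes y)\otimes z\mapsto\phi_1x\otimes(\phi_2y\otimes\phi_3z)$. Elements: $p^R=\overline\phi_1\otimes\overline\phi_2\beta S(\overline\phi_3)$, $q^R=\phi_1\otimes\overline S(\alpha\phi_3)\phi_2$; $\mathbf a=S(\overline\phi_1\phi_2)\alpha\overline\phi_2\phi_{3(1)}\otimes S(\phi_1)\alpha\overline\phi_3\phi_{3(2)}$; $\mathbf f=(S\otimes S)(\Delta^{\mathrm{cop}}(p^R_1))\cdot\mathbf a\cdot\Delta(p^R_2)$ (invertible); $\chi=(\phi\otimes1)(\Delta\otimes\mathrm{id}\otimes\mathrm{id})(\phi^{-1})$; $\omega=(1\otimes1\otimes1\otimes\overline{\mathbf f}_2\otimes\overline{\mathbf f}_1)(\mathrm{id}\otimes\Delta\otimes S\otimes S)(\chi)(\phi\otimes1\otimes1)\in H^{\otimes5}$. Yetter-Drinfeld modules. An object $V$ of ${}^H_H\mathcal{YD}$ is a left $H$-module with a second kind coaction $\delta^{2nd}_V(v)=v_{[-1]}\otimes v_{[0]}\in H\otimes V$ satisfying $v_{[-1]}\otimes v_{[0][-1]}\otimes v_{[0][0]}=\omega_1(v_{[-1]})_{(1)}\omega_5\otimes\omega_2(v_{[-1]})_{(2)}\omega_4\otimes\omega_3v_{[0]}$,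 $\epsilon(v_{[-1]})v_{[0]}=v$, $\delta^{2nd}_V(hv)=h_{(1,1)}v_{[-1]}S(h_{(2)})\otimes h_{(1,2)}v_{[0]}$. Equivalently, it has a first kind coaction $\delta^{1st}_V(v)=v_{\langle-1\rangle}\otimes v_{\langle0\rangle}$ making $V\otimes X\to X\otimes V$, $v\otimes x\mapsto v_{\langle-1\rangle}x\otimes v_{\langle0\rangle}$ a half-braiding on ${}_H\mathcal M$ (so ${}^H_H\mathcal{YD}$ is identified with the Drinfeld center); the two are related by $\delta^{2nd}_V(v)=(p^R_1v)_{\langle-1\rangle}p^R_2\otimes(p^R_1v)_{\langle0\rangle}$ and $\delta^{1st}_V(v)=q^R_{1(1)}v_{[-1]}S(q^R_2)\otimes q^R_{1(2)}v_{[0]}$. Morphisms are linear maps preserving action and coaction. The monoidal structure of ${}^H_H\mathcal{YD}$ is that of ${}_H\mathcal M$ with $\delta^{1st}_k(1)=1\otimes1$ and $\delta^{1st}_{V\otimes W}(v\otimes w)=\phi_1(\overline\phi_1\phi'_1v)_{\langle-1\rangle}\overline\phi_2(\phi'_2w)_{\langle-1\rangle}\phi'_3\otimes\phi_2(\overline\phi_1\phi'_1v)_{\langle0\rangle}\otimes\phi_3\overline\phi_3(\phi'_2w)_{\langle0\rangle}$. The functor $R$: $R(V)=H\otimes V$ with $h\triangleright(a\otimes v)=h_{(1,1)}aS(h_{(2)})\otimes h_{(1,2)}v$ and $\delta^{2nd}(a\otimes v)=\omega_1a_{(1)}\omega_5\otimes(\omega_2a_{(2)}\omega_4\otimes\omega_3v)$;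 $R(g)=\mathrm{id}_H\otimes g$. It is right adjoint to $F$ with unit $\eta_M(m)=m_{[-1]}\otimes m_{[0]}$ and counit $\varepsilon_V(a\otimes v)=\epsilon(a)v$. Its monoidal structure is $R^{(0)}=\eta_k$, $R^{(2)}_{X,Y}=R(\varepsilon_X\otimes\varepsilon_Y)\circ\eta_{R(X)\otimes R(Y)}$. For a strong monoidal functor $U:\mathcal C\to\mathcal D$ with right adjoint $T$ and unit $i:\mathrm{id}_{\mathcal C}\to TU$, the monoidal adjunction $U\dashv T$ is called co-Hopf if the operators $T^{(2)}_{X,U(M)}\circ(\mathrm{id}_{T(X)}\otimes i_M)$ and $T^{(2)}_{U(M),X}\circ(i_M\otimes\mathrm{id}_{T(X)})$ are invertible for all $X\in\mathcal D$, $M\in\mathcal C$. *)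

theory Defs
  imports "HOL-Algebra.Module"
begin

section \<open>Tensor products of vector spaces\<close>

text \<open>
  A vector space over \<open>K\<close> is a \<open>module\<close> record over a field \<open>K\<close>.  An element of \<open>V \<otimes> W\<close> is a
  class of formal finite sums of pairs (lists of pairs, with concatenation as addition) modulo the
  congruence generated by commutativity, \<open>K\<close>-bilinearity and \<open>0 \<otimes> w = 0\<close>.  That rule has to be
  added because formal sums have no cancellation; \<open>v \<otimes> 0 = v \<otimes> (0 \<odot> 0) = (0 \<odot> v) \<otimes> 0 = 0\<close> follows.
\<close>

type_synonym ('a, 'b) tensor = "('a \<times> 'b) list set"

inductive_set tensor_rel ::
  "('k, 'r) ring_scheme \<Rightarrow> ('k, 'a, 'm) module_scheme \<Rightarrow> ('k, 'b, 'n) module_scheme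
    \<Rightarrow> (('a \<times> 'b) list \<times> ('a \<times> 'b) list) set"
  for K V W where
  refl: "xs \<in> lists (carrier V \<times> carrier W) \<Longrightarrow> (xs, xs) \<in> tensor_rel K V W"
| sym: "(xs, ys) \<in> tensor_rel K V W \<Longrightarrow> (ys, xs) \<in> tensor_rel K V W"
| trans: "(xs, ys) \<in> tensor_rel K V W \<Longrightarrow> (ys, zs) \<in> tensor_rel K V W
    \<Longrightarrow> (xs, zs) \<in> tensor_rel K V W"
| cong: "(xs, xs') \<in> tensor_rel K V W \<Longrightarrow> (ys, ys') \<in> tensor_rel K V W
    \<Longrightarrow> (xs @ ys, xs' @ ys') \<in> tensor_rel K V W"
| comm: "xs \<in> lists (carrier V \<times> carrier W) \<Longrightarrow> ys \<in> lists (carrier V \<times> carrier W)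
    \<Longrightarrow> (xs @ ys, ys @ xs) \<in> tensor_rel K V W"
| add_left: "v \<in> carrier V \<Longrightarrow> v' \<in> carrier V \<Longrightarrow> w \<in> carrier W
    \<Longrightarrow> ([(v \<oplus>\<^bsub>V\<^esub> v', w)], [(v, w), (v', w)]) \<in> tensor_rel K V W"
| add_right: "v \<in> carrier V \<Longrightarrow> w \<in> carrier W \<Longrightarrow> w' \<in> carrier W
    \<Longrightarrow> ([(v, w \<oplus>\<^bsub>W\<^esub> w')], [(v, w), (v, w')]) \<in> tensor_rel K V W"
| smult: "c \<in> carrier K \<Longrightarrow> v \<in> carrier V \<Longrightarrow> w \<in> carrier W
    \<Longrightarrow> ([(c \<odot>\<^bsub>V\<^esub> v, w)], [(v, c \<odot>\<^bsub>W\<^esub> w)]) \<in> tensor_rel K V W"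
| zero: "w \<in> carrier W \<Longrightarrow> ([(\<zero>\<^bsub>V\<^esub>, w)], []) \<in> tensor_rel K V W"

definition tensor_class ::
  "('k, 'r) ring_scheme \<Rightarrow> ('k, 'a, 'm) module_scheme \<Rightarrow> ('k, 'b, 'n) module_scheme
    \<Rightarrow> ('a \<times> 'b) list \<Rightarrow> ('a, 'b) tensor" where
  "tensor_class K V W xs = tensor_rel K V W `` {xs}"

definition pure_tensor ::
  "('k, 'r) ring_scheme \<Rightarrow> ('k, 'a, 'm) module_scheme \<Rightarrow> ('k, 'b, 'n) module_scheme
    \<Rightarrow> 'a \<Rightarrow> 'b \<Rightarrow> ('a, 'b) tensor" where
  "pure_tensor K V W v w = tensor_class K V W [(v, w)]"

definition tensor_rep :: "('a, 'b) tensor \<Rightarrow> ('a \<times> 'b) list" where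
  "tensor_rep x = (SOME xs. xs \<in> x)"

text \<open>
  The operations do not depend on the chosen representatives.  The multiplication and unit are those
  of the tensor product algebra; they are only meaningful if both factors are algebras.
\<close>

definition tensor_prod ::
  "('k, 'r) ring_scheme \<Rightarrow> ('k, 'a, 'm) module_scheme \<Rightarrow> ('k, 'b, 'n) module_scheme
    \<Rightarrow> ('k, ('a, 'b) tensor) module" where
  "tensor_prod K V W =
    \<lparr>carrier = lists (carrier V \<times> carrier W) // tensor_rel K V W,
     mult = (\<lambda>x y. tensor_class K V W
       [(v \<otimes>\<^bsub>V\<^esub> v', w \<otimes>\<^bsub>W\<^esub> w'). (v, w) \<leftarrow> tensor_rep x, (v', w') \<leftarrow> tensor_rep y]),
     one = pure_tensor K V W \<one>\<^bsub>V\<^esub> \<one>\<^bsub>W\<^esub>,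
     zero = tensor_class K V W [],
     add = (\<lambda>x y. tensor_class K V W (tensor_rep x @ tensor_rep y)),
     smult = (\<lambda>c x. tensor_class K V W (map (\<lambda>(v, w). (c \<odot>\<^bsub>V\<^esub> v, w)) (tensor_rep x)))\<rparr>"

text \<open>
  Sweedler-style evaluation: for a \<open>K\<close>-bilinear \<open>f : V \<times> W \<rightarrow> U\<close>, \<open>sw U x f\<close> is the value at \<open>x\<close> of
  the induced linear map \<open>V \<otimes> W \<rightarrow> U\<close>, that is \<open>f x\<^sub>1 x\<^sub>2\<close> with summation understood.  It is only
  used for bilinear \<open>f\<close>, when it is independent of the representative.  Iterated tensor products are
  nested to the right.
\<close>

definition sw :: "('u, 'z) ring_scheme \<Rightarrow> ('a, 'b) tensor \<Rightarrow> ('a \<Rightarrow> 'b \<Rightarrow> 'u) \<Rightarrow> 'u" where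
  "sw U x f = foldr (\<lambda>(v, w) s. f v w \<oplus>\<^bsub>U\<^esub> s) (tensor_rep x) \<zero>\<^bsub>U\<^esub>"

definition sw3 :: "('u, 'z) ring_scheme \<Rightarrow> ('a, ('b, 'c) tensor) tensor
    \<Rightarrow> ('a \<Rightarrow> 'b \<Rightarrow> 'c \<Rightarrow> 'u) \<Rightarrow> 'u" where
  "sw3 U x f = sw U x (\<lambda>a y. sw U y (f a))"

definition sw4 :: "('u, 'z) ring_scheme \<Rightarrow> ('a, ('b, ('c, 'd) tensor) tensor) tensor
    \<Rightarrow> ('a \<Rightarrow> 'b \<Rightarrow> 'c \<Rightarrow> 'd \<Rightarrow> 'u) \<Rightarrow> 'u" where
  "sw4 U x f = sw U x (\<lambda>a y. sw3 U y (f a))"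

definition sw5 :: "('u, 'z) ring_scheme \<Rightarrow> ('a, ('b, ('c, ('d, 'e) tensor) tensor) tensor) tensor
    \<Rightarrow> ('a \<Rightarrow> 'b \<Rightarrow> 'c \<Rightarrow> 'd \<Rightarrow> 'e \<Rightarrow> 'u) \<Rightarrow> 'u" where
  "sw5 U x f = sw U x (\<lambda>a y. sw4 U y (f a))"

definition linear_maps ::
  "('k, 'r) ring_scheme \<Rightarrow> ('k, 'a, 'm) module_scheme \<Rightarrow> ('k, 'b, 'n) module_scheme
    \<Rightarrow> ('a \<Rightarrow> 'b) set" where
  "linear_maps K V W =
    {f \<in> carrier V \<rightarrow> carrier W.
      (\<forall>x \<in> carrier V. \<forall>y \<in> carrier V. f (x \<oplus>\<^bsub>V\<^esub> y) = f x \<oplus>\<^bsub>W\<^esub> f y) \<and>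
      (\<forall>c \<in> carrier K. \<forall>x \<in> carrier V. f (c \<odot>\<^bsub>V\<^esub> x) = c \<odot>\<^bsub>W\<^esub> f x)}"

text \<open>The map \<open>f \<otimes> g\<close> into \<open>V' \<otimes> W'\<close>.\<close>

definition tensor_map ::
  "('k, 'r) ring_scheme \<Rightarrow> ('k, 'a, 'm) module_scheme \<Rightarrow> ('k, 'b, 'n) module_scheme
    \<Rightarrow> ('c \<Rightarrow> 'a) \<Rightarrow> ('d \<Rightarrow> 'b) \<Rightarrow> ('c, 'd) tensor \<Rightarrow> ('a, 'b) tensor" where
  "tensor_map K V' W' f g x =
    sw (tensor_prod K V' W') x (\<lambda>v w. pure_tensor K V' W' (f v) (g w))"


section \<open>Quasi-Hopf algebras\<close>

text \<open>\<open>HOL-Algebra.Module.algebra\<close> is restricted to commutative algebras.\<close>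

locale k_algebra = module K A + ring A for K (structure) and A (structure) +
  assumes smult_mult_left: "\<lbrakk>c \<in> carrier K; a \<in> carrier A; b \<in> carrier A\<rbrakk>
      \<Longrightarrow> (c \<odot>\<^bsub>A\<^esub> a) \<otimes>\<^bsub>A\<^esub> b = c \<odot>\<^bsub>A\<^esub> (a \<otimes>\<^bsub>A\<^esub> b)"
    and smult_mult_right: "\<lbrakk>c \<in> carrier K; a \<in> carrier A; b \<in> carrier A\<rbrakk>
      \<Longrightarrow> a \<otimes>\<^bsub>A\<^esub> (c \<odot>\<^bsub>A\<^esub> b) = c \<odot>\<^bsub>A\<^esub> (a \<otimes>\<^bsub>A\<^esub> b)"

record ('k, 'h) quasi_hopf = "('k, 'h) module" +
  comul :: "'h \<Rightarrow> ('h, 'h) tensor"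
  counit :: "'h \<Rightarrow> 'k"
  reassoc :: "('h, ('h, 'h) tensor) tensor"
  antipode :: "'h \<Rightarrow> 'h"
  qalpha :: 'h
  qbeta :: 'h

context
  fixes K :: "('k, 'r) ring_scheme" and H :: "('k, 'h) quasi_hopf"
begin

abbreviation "H2 \<equiv> tensor_prod K H H"
abbreviation "H3 \<equiv> tensor_prod K H H2"
abbreviation "H4 \<equiv> tensor_prod K H H3"
abbreviation "H5 \<equiv> tensor_prod K H H4"

abbreviation "t2 a b \<equiv> pure_tensor K H H a b"
abbreviation "t3 a b c \<equiv> pure_tensor K H H2 a (t2 b c)"
abbreviation "t4 a b c d \<equiv> pure_tensor K H H3 a (t3 b c d)"
abbreviation "t5 a b c d e \<equiv> pure_tensor K H H4 a (t4 b c d e)"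

abbreviation "reassoc_inv \<equiv> inv\<^bsub>H3\<^esub> (reassoc H)"

text \<open>\<open>iterated_comul h\<close> is \<open>(\<Delta> \<otimes> id)(\<Delta>(h))\<close>, with components \<open>h\<^bsub>(1,1)\<^esub>\<close>, \<open>h\<^bsub>(1,2)\<^esub>\<close>, \<open>h\<^bsub>(2)\<^esub>\<close>.\<close>

definition iterated_comul :: "'h \<Rightarrow> ('h, ('h, 'h) tensor) tensor" where
  "iterated_comul h = sw H3 (comul H h) (\<lambda>a b. sw H3 (comul H a) (\<lambda>a1 a2. t3 a1 a2 b))"

end

locale quasi_hopf_algebra =
  fixes K :: "('k, 'r) ring_scheme" and H :: "('k, 'h) quasi_hopf"
  assumes field: "field K"
    and algebra: "k_algebra K H"
    and comul_linear: "comul H \<in> linear_maps K H (H2 K H)"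
    and comul_hom: "comul H \<in> ring_hom H (H2 K H)"
    and counit_hom: "counit H \<in> ring_hom H K"
    and counit_smult: "\<lbrakk>c \<in> carrier K; h \<in> carrier H\<rbrakk>
      \<Longrightarrow> counit H (c \<odot>\<^bsub>H\<^esub> h) = c \<otimes>\<^bsub>K\<^esub> counit H h"
    and reassoc_unit: "reassoc H \<in> Units (H3 K H)"
    and antipode_linear: "antipode H \<in> linear_maps K H H"
    and antipode_mult: "\<lbrakk>a \<in> carrier H; b \<in> carrier H\<rbrakk>
      \<Longrightarrow> antipode H (a \<otimes>\<^bsub>H\<^esub> b) = antipode H b \<otimes>\<^bsub>H\<^esub> antipode H a"
    and antipode_one: "antipode H \<one>\<^bsub>H\<^esub> = \<one>\<^bsub>H\<^esub>"
    and alpha_closed: "qalpha H \<in> carrier H"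
    and beta_closed: "qbeta H \<in> carrier H"
    and quasi_coassoc: "h \<in> carrier H \<Longrightarrow>
      sw (H3 K H) (comul H h) (\<lambda>a b. pure_tensor K H (H2 K H) a (comul H b))
        = reassoc H \<otimes>\<^bsub>H3 K H\<^esub> iterated_comul K H h \<otimes>\<^bsub>H3 K H\<^esub> reassoc_inv K H"
    and counit_left: "h \<in> carrier H \<Longrightarrow> sw H (comul H h) (\<lambda>a b. counit H a \<odot>\<^bsub>H\<^esub> b) = h"
    and counit_right: "h \<in> carrier H \<Longrightarrow> sw H (comul H h) (\<lambda>a b. counit H b \<odot>\<^bsub>H\<^esub> a) = h"
    and pentagon:
      "sw3 (H4 K H) (reassoc H)
          (\<lambda>a b c. sw (H4 K H) (comul H c) (\<lambda>c1 c2. t4 K H a b c1 c2))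
        \<otimes>\<^bsub>H4 K H\<^esub>
        sw3 (H4 K H) (reassoc H)
          (\<lambda>a b c. sw (H4 K H) (comul H a) (\<lambda>a1 a2. t4 K H a1 a2 b c))
       = pure_tensor K H (H3 K H) \<one>\<^bsub>H\<^esub> (reassoc H)
        \<otimes>\<^bsub>H4 K H\<^esub>
        sw3 (H4 K H) (reassoc H)
          (\<lambda>a b c. sw (H4 K H) (comul H b) (\<lambda>b1 b2. t4 K H a b1 b2 c))
        \<otimes>\<^bsub>H4 K H\<^esub>
        sw3 (H4 K H) (reassoc H) (\<lambda>a b c. t4 K H a b c \<one>\<^bsub>H\<^esub>)"
    and triangle:
      "sw3 (H2 K H) (reassoc H) (\<lambda>a b c. counit H b \<odot>\<^bsub>H2 K H\<^esub> t2 K H a c) = \<one>\<^bsub>H2 K H\<^esub>"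
    and antipode_alpha: "h \<in> carrier H \<Longrightarrow>
      sw H (comul H h) (\<lambda>a b. antipode H a \<otimes>\<^bsub>H\<^esub> qalpha H \<otimes>\<^bsub>H\<^esub> b)
        = counit H h \<odot>\<^bsub>H\<^esub> qalpha H"
    and antipode_beta: "h \<in> carrier H \<Longrightarrow>
      sw H (comul H h) (\<lambda>a b. a \<otimes>\<^bsub>H\<^esub> qbeta H \<otimes>\<^bsub>H\<^esub> antipode H b)
        = counit H h \<odot>\<^bsub>H\<^esub> qbeta H"
    and antipode_reassoc:
      "sw3 H (reassoc H)
        (\<lambda>a b c. a \<otimes>\<^bsub>H\<^esub> qbeta H \<otimes>\<^bsub>H\<^esub> antipode H b \<otimes>\<^bsub>H\<^esub> qalpha H \<otimes>\<^bsub>H\<^esub> c) = \<one>\<^bsub>H\<^esub>"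
    and antipode_reassoc_inv:
      "sw3 H (reassoc_inv K H)
        (\<lambda>a b c. antipode H a \<otimes>\<^bsub>H\<^esub> qalpha H \<otimes>\<^bsub>H\<^esub> b \<otimes>\<^bsub>H\<^esub> qbeta H \<otimes>\<^bsub>H\<^esub> antipode H c) = \<one>\<^bsub>H\<^esub>"
    and counit_alpha: "counit H (qalpha H) = \<one>\<^bsub>K\<^esub>"
    and counit_beta: "counit H (qbeta H) = \<one>\<^bsub>K\<^esub>"

definition bijective_antipode :: "('k, 'h) quasi_hopf \<Rightarrow> bool" where
  "bijective_antipode H \<longleftrightarrow> bij_betw (antipode H) (carrier H) (carrier H)"

definition antipode_inv :: "('k, 'h) quasi_hopf \<Rightarrow> 'h \<Rightarrow> 'h" where
  "antipode_inv H = inv_into (carrier H) (antipode H)"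


section \<open>The elements \<open>p\<^sup>R\<close>, \<open>q\<^sup>R\<close>, \<open>a\<close>, \<open>f\<close>, \<open>\<chi>\<close> and \<open>\<omega>\<close>\<close>

context
  fixes K :: "('k, 'r) ring_scheme" and H :: "('k, 'h) quasi_hopf"
begin

definition pR :: "('h, 'h) tensor" where
  "pR = sw3 (H2 K H) (reassoc_inv K H)
    (\<lambda>a b c. t2 K H a (b \<otimes>\<^bsub>H\<^esub> qbeta H \<otimes>\<^bsub>H\<^esub> antipode H c))"

definition qR :: "('h, 'h) tensor" where
  "qR = sw3 (H2 K H) (reassoc H)
    (\<lambda>a b c. t2 K H a (antipode_inv H (qalpha H \<otimes>\<^bsub>H\<^esub> c) \<otimes>\<^bsub>H\<^esub> b))"

definition twist_a :: "('h, 'h) tensor" where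
  "twist_a =
    sw3 (H2 K H) (reassoc_inv K H) (\<lambda>y1 y2 y3.
    sw3 (H2 K H) (reassoc H) (\<lambda>x1 x2 x3.
    sw (H2 K H) (comul H x3) (\<lambda>x31 x32.
      t2 K H
        (antipode H (y1 \<otimes>\<^bsub>H\<^esub> x2) \<otimes>\<^bsub>H\<^esub> qalpha H \<otimes>\<^bsub>H\<^esub> y2 \<otimes>\<^bsub>H\<^esub> x31)
        (antipode H x1 \<otimes>\<^bsub>H\<^esub> qalpha H \<otimes>\<^bsub>H\<^esub> y3 \<otimes>\<^bsub>H\<^esub> x32))))"

definition twist_f :: "('h, 'h) tensor" where
  "twist_f = sw (H2 K H) pR (\<lambda>p1 p2.
    sw (H2 K H) (comul H p1) (\<lambda>a b. t2 K H (antipode H b) (antipode H a))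
      \<otimes>\<^bsub>H2 K H\<^esub> twist_a \<otimes>\<^bsub>H2 K H\<^esub> comul H p2)"

definition chi :: "('h, ('h, ('h, 'h) tensor) tensor) tensor" where
  "chi = sw3 (H4 K H) (reassoc H) (\<lambda>a b c. t4 K H a b c \<one>\<^bsub>H\<^esub>)
    \<otimes>\<^bsub>H4 K H\<^esub>
    sw3 (H4 K H) (reassoc_inv K H)
      (\<lambda>a b c. sw (H4 K H) (comul H a) (\<lambda>a1 a2. t4 K H a1 a2 b c))"

definition omega :: "('h, ('h, ('h, ('h, 'h) tensor) tensor) tensor) tensor" where
  "omega =
    sw (H5 K H) (inv\<^bsub>H2 K H\<^esub> twist_f) (\<lambda>f1 f2. t5 K H \<one>\<^bsub>H\<^esub> \<one>\<^bsub>H\<^esub> \<one>\<^bsub>H\<^esub> f2 f1)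
    \<otimes>\<^bsub>H5 K H\<^esub>
    sw4 (H5 K H) chi (\<lambda>a b c d.
      sw (H5 K H) (comul H b) (\<lambda>b1 b2. t5 K H a b1 b2 (antipode H c) (antipode H d)))
    \<otimes>\<^bsub>H5 K H\<^esub>
    sw3 (H5 K H) (reassoc H) (\<lambda>a b c. t5 K H a b c \<one>\<^bsub>H\<^esub> \<one>\<^bsub>H\<^esub>)"

end


section \<open>Modules and Yetter--Drinfeld modules\<close>

record ('k, 'h, 'v) hmod = "('k, 'v) module" +
  act :: "'h \<Rightarrow> 'v \<Rightarrow> 'v"

text \<open>The field \<open>coact\<close> is the coaction of the second kind.\<close>

record ('k, 'h, 'v) ydmod = "('k, 'h, 'v) hmod" +
  coact :: "'v \<Rightarrow> ('h, 'v) tensor"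

definition forget :: "('k, 'h, 'v) ydmod \<Rightarrow> ('k, 'h, 'v) hmod" where
  "forget M = hmod.truncate M"

locale left_module =
  fixes K :: "('k, 'r) ring_scheme" and H :: "('k, 'h) quasi_hopf"
    and V :: "('k, 'h, 'v, 'z) hmod_scheme"
  assumes module: "module K V"
    and act_closed: "\<lbrakk>h \<in> carrier H; v \<in> carrier V\<rbrakk> \<Longrightarrow> act V h v \<in> carrier V"
    and act_add_left: "\<lbrakk>h \<in> carrier H; h' \<in> carrier H; v \<in> carrier V\<rbrakk>
      \<Longrightarrow> act V (h \<oplus>\<^bsub>H\<^esub> h') v = act V h v \<oplus>\<^bsub>V\<^esub> act V h' v"
    and act_add_right: "\<lbrakk>h \<in> carrier H; v \<in> carrier V; v' \<in> carrier V\<rbrakk>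
      \<Longrightarrow> act V h (v \<oplus>\<^bsub>V\<^esub> v') = act V h v \<oplus>\<^bsub>V\<^esub> act V h v'"
    and act_smult_left: "\<lbrakk>c \<in> carrier K; h \<in> carrier H; v \<in> carrier V\<rbrakk>
      \<Longrightarrow> act V (c \<odot>\<^bsub>H\<^esub> h) v = c \<odot>\<^bsub>V\<^esub> act V h v"
    and act_smult_right: "\<lbrakk>c \<in> carrier K; h \<in> carrier H; v \<in> carrier V\<rbrakk>
      \<Longrightarrow> act V h (c \<odot>\<^bsub>V\<^esub> v) = c \<odot>\<^bsub>V\<^esub> act V h v"
    and act_mult: "\<lbrakk>h \<in> carrier H; h' \<in> carrier H; v \<in> carrier V\<rbrakk>
      \<Longrightarrow> act V (h \<otimes>\<^bsub>H\<^esub> h') v = act V h (act V h' v)"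
    and act_one: "v \<in> carrier V \<Longrightarrow> act V \<one>\<^bsub>H\<^esub> v = v"

context
  fixes K :: "('k, 'r) ring_scheme" and H :: "('k, 'h) quasi_hopf"
begin

text \<open>\<open>h\<^bsub>(1,1)\<^esub> a S(h\<^bsub>(2)\<^esub>) \<otimes> h\<^bsub>(1,2)\<^esub> v\<close> in \<open>H \<otimes> V\<close>.\<close>

definition adj_tensor :: "('k, 'h, 'v, 'z) hmod_scheme \<Rightarrow> 'h \<Rightarrow> 'h \<Rightarrow> 'v \<Rightarrow> ('h, 'v) tensor" where
  "adj_tensor V h a v = sw3 (tensor_prod K H V) (iterated_comul K H h)
    (\<lambda>h11 h12 h2. pure_tensor K H V (h11 \<otimes>\<^bsub>H\<^esub> a \<otimes>\<^bsub>H\<^esub> antipode H h2) (act V h12 v))"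

text \<open>\<open>\<omega>\<^sub>1 a\<^bsub>(1)\<^esub> \<omega>\<^sub>5 \<otimes> (\<omega>\<^sub>2 a\<^bsub>(2)\<^esub> \<omega>\<^sub>4 \<otimes> \<omega>\<^sub>3 v)\<close> in \<open>H \<otimes> (H \<otimes> V)\<close>.\<close>

definition omega_tensor ::
  "('k, 'h, 'v, 'z) hmod_scheme \<Rightarrow> 'h \<Rightarrow> 'v \<Rightarrow> ('h, ('h, 'v) tensor) tensor" where
  "omega_tensor V a v =
    (let HV = tensor_prod K H V; HHV = tensor_prod K H HV in
     sw5 HHV (omega K H) (\<lambda>w1 w2 w3 w4 w5. sw HHV (comul H a) (\<lambda>a1 a2.
       pure_tensor K H HV (w1 \<otimes>\<^bsub>H\<^esub> a1 \<otimes>\<^bsub>H\<^esub> w5)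
         (pure_tensor K H V (w2 \<otimes>\<^bsub>H\<^esub> a2 \<otimes>\<^bsub>H\<^esub> w4) (act V w3 v)))))"

end

locale yd_module = left_module K H M
  for K :: "('k, 'r) ring_scheme" and H :: "('k, 'h) quasi_hopf" and M :: "('k, 'h, 'm) ydmod" +
  assumes coact_linear: "coact M \<in> linear_maps K M (tensor_prod K H M)"
    and coact_coassoc: "m \<in> carrier M \<Longrightarrow>
      sw (tensor_prod K H (tensor_prod K H M)) (coact M m)
        (\<lambda>a n. pure_tensor K H (tensor_prod K H M) a (coact M n))
      = sw (tensor_prod K H (tensor_prod K H M)) (coact M m) (omega_tensor K H M)"
    and coact_counit: "m \<in> carrier M \<Longrightarrow> sw M (coact M m) (\<lambda>a n. counit H a \<odot>\<^bsub>M\<^esub> n) = m"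
    and coact_act: "\<lbrakk>h \<in> carrier H; m \<in> carrier M\<rbrakk> \<Longrightarrow>
      coact M (act M h m) = sw (tensor_prod K H M) (coact M m) (adj_tensor K H M h)"

definition yd_hom :: "('k, 'r) ring_scheme \<Rightarrow> ('k, 'h) quasi_hopf
    \<Rightarrow> ('k, 'h, 'm) ydmod \<Rightarrow> ('k, 'h, 'n) ydmod \<Rightarrow> ('m \<Rightarrow> 'n) set" where
  "yd_hom K H M N =
    {f \<in> linear_maps K M N.
      (\<forall>h \<in> carrier H. \<forall>m \<in> carrier M. f (act M h m) = act N h (f m)) \<and>
      (\<forall>m \<in> carrier M. coact N (f m) = tensor_map K H N id f (coact M m))}"

text \<open>The invertible morphisms of the category of Yetter--Drinfeld modules.\<close>

definition yd_iso :: "('k, 'r) ring_scheme \<Rightarrow> ('k, 'h) quasi_hopf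
    \<Rightarrow> ('k, 'h, 'm) ydmod \<Rightarrow> ('k, 'h, 'n) ydmod \<Rightarrow> ('m \<Rightarrow> 'n) set" where
  "yd_iso K H M N =
    {f \<in> yd_hom K H M N. \<exists>g \<in> yd_hom K H N M.
      (\<forall>m \<in> carrier M. g (f m) = m) \<and> (\<forall>n \<in> carrier N. f (g n) = n)}"


section \<open>Tensor products of modules and of Yetter--Drinfeld modules\<close>

context
  fixes K :: "('k, 'r) ring_scheme" and H :: "('k, 'h) quasi_hopf"
begin

definition hmod_tensor :: "('k, 'h, 'v, 'y) hmod_scheme \<Rightarrow> ('k, 'h, 'w, 'z) hmod_scheme
    \<Rightarrow> ('k, 'h, ('v, 'w) tensor) hmod" where
  "hmod_tensor V W = module.extend (tensor_prod K V W)
    (hmod.fields (\<lambda>h x. sw (tensor_prod K V W) (comul H h)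
      (\<lambda>h1 h2. tensor_map K V W (act V h1) (act W h2) x)))"

text \<open>The coaction of the first kind determined by the one of the second kind.\<close>

definition coact1 :: "('k, 'h, 'v) ydmod \<Rightarrow> 'v \<Rightarrow> ('h, 'v) tensor" where
  "coact1 V v = (let HV = tensor_prod K H V in
    sw HV (qR K H) (\<lambda>q1 q2. sw HV (comul H q1) (\<lambda>q11 q12. sw HV (coact V v) (\<lambda>a u.
      pure_tensor K H V (q11 \<otimes>\<^bsub>H\<^esub> a \<otimes>\<^bsub>H\<^esub> antipode H q2) (act V q12 u)))))"

text \<open>
  The coaction of the first kind on \<open>V \<otimes> W\<close>; \<open>x\<close> and \<open>z\<close> run over two copies of \<open>\<phi>\<close> and \<open>y\<close> over
  \<open>\<phi>\<^sup>-\<^sup>1\<close>.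
\<close>

definition tensor_coact1 :: "('k, 'h, 'v) ydmod \<Rightarrow> ('k, 'h, 'w) ydmod
    \<Rightarrow> ('v, 'w) tensor \<Rightarrow> ('h, ('v, 'w) tensor) tensor" where
  "tensor_coact1 V W t =
    (let VW = tensor_prod K V W; HVW = tensor_prod K H VW in
     sw HVW t (\<lambda>v w.
     sw3 HVW (reassoc H) (\<lambda>x1 x2 x3.
     sw3 HVW (reassoc_inv K H) (\<lambda>y1 y2 y3.
     sw3 HVW (reassoc H) (\<lambda>z1 z2 z3.
     sw HVW (coact1 V (act V (y1 \<otimes>\<^bsub>H\<^esub> z1) v)) (\<lambda>a v0.
     sw HVW (coact1 W (act W z2 w)) (\<lambda>b w0.
       pure_tensor K H VW
         (x1 \<otimes>\<^bsub>H\<^esub> a \<otimes>\<^bsub>H\<^esub> y2 \<otimes>\<^bsub>H\<^esub> b \<otimes>\<^bsub>H\<^esub> z3)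
         (pure_tensor K V W (act V x2 v0) (act W (x3 \<otimes>\<^bsub>H\<^esub> y3) w0)))))))))"

definition yd_tensor :: "('k, 'h, 'v) ydmod \<Rightarrow> ('k, 'h, 'w) ydmod
    \<Rightarrow> ('k, 'h, ('v, 'w) tensor) ydmod" where
  "yd_tensor V W = hmod.extend (hmod_tensor V W)
    (ydmod.fields (\<lambda>t.
      let HVW = tensor_prod K H (tensor_prod K V W) in
      sw HVW (pR K H) (\<lambda>p1 p2.
      sw HVW (tensor_coact1 V W (act (hmod_tensor V W) p1 t)) (\<lambda>a u.
        pure_tensor K H (tensor_prod K V W) (a \<otimes>\<^bsub>H\<^esub> p2) u))))"


section \<open>The right adjoint \<open>R\<close> of the forgetful functor and its monoidal structure\<close>

definition R_obj :: "('k, 'h, 'v) hmod \<Rightarrow> ('k, 'h, ('h, 'v) tensor) ydmod" where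
  "R_obj V = hmod.extend
    (module.extend (tensor_prod K H V)
      (hmod.fields (\<lambda>h x. sw (tensor_prod K H V) x (adj_tensor K H V h))))
    (ydmod.fields (\<lambda>x. sw (tensor_prod K H (tensor_prod K H V)) x (omega_tensor K H V)))"

text \<open>\<open>R_map W g\<close> is \<open>R(g)\<close> for \<open>g : V \<rightarrow> W\<close>.\<close>

definition R_map :: "('k, 'h, 'w) hmod \<Rightarrow> ('v \<Rightarrow> 'w) \<Rightarrow> ('h, 'v) tensor \<Rightarrow> ('h, 'w) tensor" where
  "R_map W g = tensor_map K H W id g"

definition adj_unit :: "('k, 'h, 'm) ydmod \<Rightarrow> 'm \<Rightarrow> ('h, 'm) tensor" where
  "adj_unit M m = coact M m"

definition adj_counit :: "('k, 'h, 'v) hmod \<Rightarrow> ('h, 'v) tensor \<Rightarrow> 'v" where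
  "adj_counit V x = sw V x (\<lambda>a v. counit H a \<odot>\<^bsub>V\<^esub> v)"

text \<open>\<open>R\<^sup>(\<^sup>2\<^sup>)\<close> from \<open>R(X) \<otimes> R(Y)\<close> to \<open>R(X \<otimes> Y)\<close>.\<close>

definition R2 :: "('k, 'h, 'x) hmod \<Rightarrow> ('k, 'h, 'y) hmod
    \<Rightarrow> (('h, 'x) tensor, ('h, 'y) tensor) tensor \<Rightarrow> ('h, ('x, 'y) tensor) tensor" where
  "R2 X Y = R_map (hmod_tensor X Y) (tensor_map K X Y (adj_counit X) (adj_counit Y))
    \<circ> adj_unit (yd_tensor (R_obj X) (R_obj Y))"

definition hopf_left :: "('k, 'h, 'x) hmod \<Rightarrow> ('k, 'h, 'm) ydmod
    \<Rightarrow> (('h, 'x) tensor, 'm) tensor \<Rightarrow> ('h, ('x, 'm) tensor) tensor" where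
  "hopf_left X M = R2 X (forget M)
    \<circ> tensor_map K (R_obj X) (R_obj (forget M)) id (adj_unit M)"

definition hopf_right :: "('k, 'h, 'x) hmod \<Rightarrow> ('k, 'h, 'm) ydmod
    \<Rightarrow> ('m, ('h, 'x) tensor) tensor \<Rightarrow> ('h, ('m, 'x) tensor) tensor" where
  "hopf_right X M = R2 (forget M) X
    \<circ> tensor_map K (R_obj (forget M)) (R_obj X) (adj_unit M) id"

end

end

theory Submission
 imports Defs
begin

text \<open>
All coherence is done with operators: commuting left actions of \<open>H\<close> on one vector space play the role of
objects, \<open>\<Delta>\<close> tensors two of them, and the reassociator acts through any three. A first kind coaction is a
half-braiding, and the cofree object \<open>R(V) = H \<otimes> V\<close> carries a universal map \<open>\<theta>\<close> with \<open>H \<otimes> V\<close> as target.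
Both Hopf operators correspond to the tensor product of \<open>\<theta>\<close> on \<open>X\<close> with the half-braiding of \<open>M\<close>. The
half-braiding is invertible, on one side by the antipode and on the other by its inverse, so the operators
are linear isomorphisms; they are colinear because the hexagon holds for both tensor factors.
\<close>

text \<open>The order of a tensor product is carried by the order of the actions in
  \<open>dg\<close>, not by the position of the factors in the underlying space: a half-braiding
  maps \<open>Z><W\<close> to \<open>Z><V\<close>, and only the order of its two legs changes. Dual
  objects are never formed. They enter as relations between actions, \<open>equ\<close> for
  evaluations and \<open>eq_at\<close> for coevaluations; the antipode axioms for \<alpha> and
  \<beta> supply both, and most of the coherence is the pentagon with trivial legs struck out. The
  main obstacle is that \<omega>, and with it the coaction of \<open>R(V)\<close>, contains the
  inverse of \<open>twist_f\<close>. The twist compares the reversed tensor product of two duals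
  with the dual of a tensor product. Its inverse \<open>twist_g\<close> is constructed as the
  comparison in the other direction, so that invertibility becomes a statement about nested
  evaluations and coevaluations. Claims about half-braidings on all modules \<open>Z\<close> are
  reduced by naturality to the vector 1 of the regular module.\<close>

abbreviation (input) "tp \<equiv> tensor_prod"
abbreviation (input) "pu \<equiv> pure_tensor"
abbreviation (input) "tm \<equiv> tensor_map"
abbreviation (input) "Lin \<equiv> linear_maps"
abbreviation (input) add_in ("(_ +[_]/ _)" [65,0,66] 65) where "x +[U] y \<equiv> x \<oplus>\<^bsub>U\<^esub> y"
abbreviation (input) smult_in ("(_ *[_]/ _)" [75,0,75] 75) where "c *[U] x \<equiv> c \<odot>\<^bsub>U\<^esub> x"
abbreviation (input) mult_in ("(_ .[_]/ _)" [70,0,71] 70) where "x .[U] y \<equiv> x \<otimes>\<^bsub>U\<^esub> y"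
abbreviation (input) zero_in ("0[_]") where "0[U] \<equiv> \<zero>\<^bsub>U\<^esub>"
abbreviation (input) one_in ("1[_]") where "1[U] \<equiv> \<one>\<^bsub>U\<^esub>"
abbreviation (input) "md \<equiv> module"
abbreviation (input) in_carrier (infix "<:" 50) where "x<:V \<equiv> x \<in> carrier V"

section \<open>Linear and bilinear maps\<close>

lemma lin_mapsI:
 assumes "!!x. x<:V ==> f x<:W"
 and "!!x y. [|x<:V; y<:V|] ==> f (x +[V] y) = f x +[W] f y"
 and "!!c x. [|c<:K; x<:V|] ==> f (c *[V] x) = c *[W] f x"
 shows "f : Lin K V W"
 using assms by (simp add: linear_maps_def)

lemma
 assumes "f : Lin K V W"
 shows lcl: "x<:V ==> f x<:W"
 and linear_maps_add: "[|x<:V; y<:V|] ==> f (x +[V] y) = f x +[W] f y"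
 and linear_maps_smult: "[|c<:K; x<:V|] ==> f (c *[V] x) = c *[W] f x"
 using assms by (auto simp: linear_maps_def)

lemma lin_mp_zero:
 assumes "f : Lin K V W" "md K V" "md K W"
 shows "f 0[V] = 0[W]"
proof -
 interpret V: module K V by fact
 interpret W: module K W by fact
 have "f (0[K] *[V] 0[V]) = 0[K] *[W] f 0[V]"
 using assms(1) by (intro linear_maps_smult) auto
 then show ?thesis
 using lcl[OF assms(1)] by simp
qed

lemma lin_mp_cong:
 assumes "f : Lin K V W" "md K V" "!!x. x<:V ==> f x = g x"
 shows "g : Lin K V W"
proof -
 interpret V: module K V by fact
 show ?thesis
 using assms(1,3) by (auto simp: linear_maps_def Pi_iff)
qed

lemma lin_mp_id: "(%x. x) : Lin K V V"
 by (simp add: linear_maps_def)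

lemma linc:
 assumes "f : Lin K V W" "g : Lin K W U"
 shows "(%x. g (f x)) : Lin K V U"
 using assms by (auto simp: linear_maps_def Pi_iff)

lemma lin_mp_sm_map:
 assumes "md K V" "c<:K"
 shows "(%x. c *[V] x) : Lin K V V"
proof -
 interpret V: module K V by fact
 show ?thesis
 using assms(2) by (intro lin_mapsI)
 (auto simp: V.smult_r_distr V.smult_assoc1[symmetric] V.R.m_comm)
qed

definition bilin where
 "bilin K V W U f \<longleftrightarrow> (\<forall>v \<in> carrier V. f v : Lin K W U) \<and>
 (\<forall>w \<in> carrier W. (%v. f v w) : Lin K V U)"

lemma bilinI:
 assumes "!!v. v<:V ==> f v : Lin K W U"
 and "!!w. w<:W ==> (%v. f v w) : Lin K V U"
 shows "bilin K V W U f"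
 using assms by (simp add: bilin_def)

lemma
 assumes "bilin K V W U f"
 shows bilin_closed: "[|v<:V; w<:W|] ==> f v w<:U"
 and bilin_right: "v<:V ==> f v : Lin K W U"
 and bilin_left: "w<:W ==> (%v. f v w) : Lin K V U"
 using assms by (auto simp: bilin_def linear_maps_def Pi_iff)

lemma
 assumes "bilin K V W U f"
 shows bilin_add_left: "[|v<:V; v'<:V; w<:W|]
 ==> f (v +[V] v') w = f v w +[U] f v' w"
 and bilin_add_right: "[|v<:V; w<:W; w'<:W|]
 ==> f v (w +[W] w') = f v w +[U] f v w'"
 and bilin_smult_left: "[|c<:K; v<:V; w<:W|]
 ==> f (c *[V] v) w = c *[U] f v w"
 and bilin_smult_right: "[|c<:K; v<:V; w<:W|]
 ==> f v (c *[W] w) = c *[U] f v w"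
 using assms by (auto simp: bilin_def linear_maps_def)

lemma bil_comp_lin:
 assumes "bilin K V W U f" "u : Lin K U U'"
 shows "bilin K V W U' (%v w. u (f v w))"
 using assms unfolding bilin_def by (auto intro: linc)

lemma bil_comp_args:
 assumes "bilin K V W U f" "g : Lin K V' V" "h : Lin K W' W"
 shows "bilin K V' W' U (%v w. f (g v) (h w))"
 using assms by (auto simp: bilin_def linear_maps_def Pi_iff)

lemma bil_flip: "bilin K V W U f ==> bilin K W V U (%w v. f v w)"
 by (auto simp: bilin_def)

section \<open>The universal property of the tensor product\<close>

lemma ten_rel_lists:
 assumes "(xs, ys) \<in> tensor_rel K V W" and V: "md K V" and W: "md K W"
 shows "xs \<in> lists (carrier V \<times> carrier W) \<and> ys \<in> lists (carrier V \<times> carrier W)"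
proof -
 interpret V: module K V by fact
 interpret W: module K W by fact
 show ?thesis
 using assms(1) by induction auto
qed

lemma ten_rel_equiv:
 assumes "md K V" "md K W"
 shows "equiv (lists (carrier V \<times> carrier W)) (tensor_rel K V W)"
proof (rule equivI)
 show "tensor_rel K V W \<subseteq> lists (carrier V \<times> carrier W) \<times> lists (carrier V \<times> carrier W)"
 by (rule subrelI) (simp only: mem_Sigma_iff ten_rel_lists[OF _ assms])
 show "refl_on (lists (carrier V \<times> carrier W)) (tensor_rel K V W)"
 by (auto intro: refl_onI tensor_rel.refl)
 show "sym (tensor_rel K V W)"
 by (auto intro: symI tensor_rel.sym)
 show "Relation.trans (tensor_rel K V W)"
 by (auto intro: transI tensor_rel.trans)
qed

lemma ten_cls_eq:
 assumes "(xs, ys) \<in> tensor_rel K V W" "md K V" "md K W"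
 shows "tensor_class K V W xs = tensor_class K V W ys"
 using equiv_class_eq[OF ten_rel_equiv] assms by (metis tensor_class_def)

text \<open>The sum over an explicit list. \<open>sw\<close> sums over the representative picked by
  \<open>tensor_rep\<close>, about which nothing is known except its class, so all inductions run on
  \<open>lsum\<close>.\<close>

definition lsum where
 "lsum U f xs = foldr (%(v, w) s. f v w +[U] s) xs 0[U]"

lemma lsum_simps [simp]:
 "lsum U f [] = 0[U]"
 "lsum U f ((v, w) # xs) = f v w +[U] lsum U f xs"
 by (simp_all add: lsum_def)

lemma sw_lsum: "sw U x f = lsum U f (tensor_rep x)"
 by (simp add: sw_def lsum_def)

lemma lsum_cl:
 assumes "abelian_group U" "xs \<in> lists (A \<times> B)" "!!v w. [|v \<in> A; w \<in> B|] ==> f v w<:U"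
 shows "lsum U f xs<:U"
proof -
 interpret U: abelian_group U by fact
 show ?thesis
 using assms(2,3) by (induction xs) auto
qed

lemma lsum_append:
 assumes "abelian_group U" "xs \<in> lists (A \<times> B)" "ys \<in> lists (A \<times> B)"
 "!!v w. [|v \<in> A; w \<in> B|] ==> f v w<:U"
 shows "lsum U f (xs @ ys) = lsum U f xs +[U] lsum U f ys"
proof -
 interpret U: abelian_group U by fact
 show ?thesis
 using assms(2)
 proof (induction xs)
 case (Cons p xs)
 obtain v w where p: "p = (v, w)" "v \<in> A" "w \<in> B"
 using Cons by (cases p) auto
 have "lsum U f xs<:U" "lsum U f ys<:U"
 using Cons(2) assms(3) by (intro lsum_cl[OF assms(1) _ assms(4)]; simp)+
 then show ?case
 using Cons p assms(4) by (simp add: U.a_assoc)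
 qed (use lsum_cl[OF assms(1) assms(3,4)] in simp)
qed

text \<open>Each generator of the relation is an identity that a bilinear map respects; the list
  operations are absorbed by commutativity and associativity of addition in \<open>U\<close>. This
  makes Sweedler sums independent of the representative.\<close>

lemma lsum_rel:
 assumes "(xs, ys) \<in> tensor_rel K V W" and V: "md K V" and W: "md K W"
 and U: "md K U" and f: "bilin K V W U f"
 shows "lsum U f xs = lsum U f ys"
proof -
 interpret V: module K V by fact
 interpret W: module K W by fact
 interpret U: module K U by fact
 note cl = bilin_closed[OF f]
 note app = lsum_append[OF U.abelian_group_axioms, where f = f and A = "carrier V" and B = "carrier W"]
 note lc = lsum_cl[OF U.abelian_group_axioms, where f = f and A = "carrier V" and B = "carrier W"]
 show ?thesis
 using assms(1)
 proof induction
 case (cong xs xs' ys ys')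
 then show ?case
 using ten_rel_lists[OF cong(1) V W] ten_rel_lists[OF cong(2) V W]
 by (simp add: app cl)
 next
 case (comm xs ys)
 then show ?case
 by (simp add: app cl lc U.a_comm)
 next
 case (zero w)
 then show ?case
 using lin_mp_zero[OF bilin_left[OF f] V U] by simp
 qed (simp_all add: cl bilin_add_left[OF f] bilin_add_right[OF f] bilin_smult_left[OF f]
 bilin_smult_right[OF f] U.a_assoc)
qed

section \<open>The vector space structure on classes of formal sums\<close>

context
 fixes K and V and W
 assumes V: "md K V" and W: "md K W"
begin

interpretation V: module K V by (rule V)
interpretation W: module K W by (rule W)

lemma ten_cls_cl:
 "xs \<in> lists (carrier V \<times> carrier W) ==> tensor_class K V W xs<:(tp K V W)"
 by (simp add: tensor_prod_def tensor_class_def quotientI)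

lemma ten_cls_ex:
 assumes "x<:(tp K V W)"
 obtains xs where "xs \<in> lists (carrier V \<times> carrier W)" "x = tensor_class K V W xs"
 using assms that by (auto simp: tensor_prod_def tensor_class_def quotient_def)

lemma ten_rep_cls:
 assumes "xs \<in> lists (carrier V \<times> carrier W)"
 shows "(xs, tensor_rep (tensor_class K V W xs)) \<in> tensor_rel K V W"
proof -
 have "xs \<in> tensor_class K V W xs"
 using assms by (auto simp: tensor_class_def intro: tensor_rel.refl)
 then have "tensor_rep (tensor_class K V W xs) \<in> tensor_class K V W xs"
 unfolding tensor_rep_def by (rule someI)
 then show ?thesis
 by (simp add: tensor_class_def)
qed

lemma ten_rep_lists:
 assumes "x<:(tp K V W)"
 shows "tensor_rep x \<in> lists (carrier V \<times> carrier W)"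
 using assms ten_cls_ex ten_rep_cls ten_rel_lists[OF _ V W] by metis

lemma ten_add_cls:
 assumes "xs \<in> lists (carrier V \<times> carrier W)" "ys \<in> lists (carrier V \<times> carrier W)"
 shows "tensor_class K V W xs +[tp K V W] tensor_class K V W ys
 = tensor_class K V W (xs @ ys)"
 using assms ten_cls_eq[OF _ V W] tensor_rel.cong[OF ten_rep_cls ten_rep_cls]
 by (simp add: tensor_prod_def) metis

lemma ten_zero_cls: "0[tp K V W] = tensor_class K V W []"
 by (simp add: tensor_prod_def)

lemma sm_lists:
 assumes "xs \<in> lists (carrier V \<times> carrier W)" "c<:K"
 shows "map (%(v, w). (c *[V] v, w)) xs \<in> lists (carrier V \<times> carrier W)"
 using assms by (induction xs) auto

text \<open>Scalar multiplication is defined on representatives, so it has to respect every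
  generator of the relation. Commutativity of \<open>K\<close> enters where the scalar meets the one
  of the rule \<open>smult\<close>.\<close>

lemma ten_rel_sm:
 assumes "(xs, ys) \<in> tensor_rel K V W" "c<:K"
 shows "(map (%(v, w). (c *[V] v, w)) xs, map (%(v, w). (c *[V] v, w)) ys) \<in> tensor_rel K V W"
 using assms(1)
proof induction
 case (refl xs)
 then show ?case
 using assms(2) by (intro tensor_rel.refl) (simp_all only: sm_lists)
next
 case (comm xs ys)
 then show ?case
 using assms(2) by (simp only: map_append, intro tensor_rel.comm) (simp_all only: sm_lists)
next
 case (add_left v v' w)
 then show ?case
 using assms(2) tensor_rel.add_left[of "c *[V] v" V "c *[V] v'"] by (simp add: V.smult_r_distr)
next
 case (smult d v w)
 then have "c *[V] (d *[V] v) = d *[V] (c *[V] v)"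
 using assms(2) by (simp add: V.smult_assoc1[symmetric] V.R.m_comm)
 then show ?case
 using smult assms(2) tensor_rel.smult[of d K "c *[V] v" V w] by simp
qed (use assms(2) in \<open>auto intro: tensor_rel.intros\<close>)

lemma ten_sm_cls:
 assumes "c<:K" "xs \<in> lists (carrier V \<times> carrier W)"
 shows "c *[tp K V W] tensor_class K V W xs
 = tensor_class K V W (map (%(v, w). (c *[V] v, w)) xs)"
 using ten_cls_eq[OF ten_rel_sm[OF ten_rep_cls] V W] assms
 by (simp add: tensor_prod_def)

lemma ten_add_cl:
 assumes "x<:(tp K V W)" "y<:(tp K V W)"
 shows "x +[tp K V W] y<:(tp K V W)"
 using assms by (elim ten_cls_ex) (auto simp: ten_add_cls intro!: ten_cls_cl)

lemma ten_add_comm: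
 assumes "x<:(tp K V W)" "y<:(tp K V W)"
 shows "x +[tp K V W] y = y +[tp K V W] x"
 using assms by (elim ten_cls_ex)
 (auto simp: ten_add_cls intro!: ten_cls_eq[OF _ V W] tensor_rel.comm)

lemma ten_sm_cl:
 assumes "c<:K" "x<:(tp K V W)"
 shows "c *[tp K V W] x<:(tp K V W)"
 using assms by (elim ten_cls_ex)
 (simp only: ten_sm_cls ten_cls_cl sm_lists)

lemma ten_cls_cons:
 assumes "v<:V" "w<:W" "xs \<in> lists (carrier V \<times> carrier W)"
 shows "tensor_class K V W ((v, w) # xs)
 = pu K V W v w +[tp K V W] tensor_class K V W xs"
 using assms by (simp add: pure_tensor_def ten_add_cls)

lemma ten_sm_cls_cons:
 assumes "c<:K" "v<:V" "w<:W" "xs \<in> lists (carrier V \<times> carrier W)"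
 shows "c *[tp K V W] tensor_class K V W ((v, w) # xs)
 = pu K V W (c *[V] v) w +[tp K V W]
 c *[tp K V W] tensor_class K V W xs"
proof -
 have "map (%(v, w). (c *[V] v, w)) xs \<in> lists (carrier V \<times> carrier W)"
 using assms by (intro sm_lists)
 then show ?thesis
 using assms ten_cls_cons[of "c *[V] v" w "map (%(v, w). (c *[V] v, w)) xs"]
 by (simp add: ten_sm_cls)
qed

lemma pure_ten_cl [simp]:
 "[|v<:V; w<:W|] ==> pu K V W v w<:(tp K V W)"
 by (simp add: pure_tensor_def ten_cls_cl)

text \<open>The monoid comes first because its rearrangement rules give the distributive law for
  scalars, from which in turn the additive inverses are obtained.\<close>

lemma ten_comm_monoid: "abelian_monoid (tp K V W)"
proof (rule abelian_monoidI)
 fix x y z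
 assume "x<:(tp K V W)" "y<:(tp K V W)"
 "z<:(tp K V W)"
 then show "x +[tp K V W] y +[tp K V W] z
 = x +[tp K V W] (y +[tp K V W] z)"
 by (elim ten_cls_ex) (auto simp: ten_add_cls)
next
 fix x assume "x<:(tp K V W)"
 then show "0[tp K V W] +[tp K V W] x = x"
 by (elim ten_cls_ex) (auto simp: ten_zero_cls ten_add_cls)
qed (((rule ten_add_cl ten_add_comm, assumption+)
 | simp add: ten_zero_cls ten_cls_cl)+)

interpretation T: abelian_monoid "tp K V W" by (rule ten_comm_monoid)

lemma pure_ten_bil_aux:
 shows "[|v<:V; v'<:V; w<:W|] ==> pu K V W (v +[V] v') w
 = pu K V W v w +[tp K V W] pu K V W v' w"
 and "[|v<:V; w<:W; w'<:W|] ==> pu K V W v (w +[W] w')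
 = pu K V W v w +[tp K V W] pu K V W v w'"
 and "[|c<:K; v<:V; w<:W|] ==> pu K V W (c *[V] v) w
 = c *[tp K V W] pu K V W v w"
 and "[|c<:K; v<:V; w<:W|] ==> pu K V W v (c *[W] w)
 = c *[tp K V W] pu K V W v w"
 and "w<:W ==> pu K V W 0[V] w = 0[tp K V W]"
 by (simp_all add: pure_tensor_def ten_add_cls ten_sm_cls ten_zero_cls
 ten_cls_eq[OF tensor_rel.add_left V W] ten_cls_eq[OF tensor_rel.add_right V W]
 ten_cls_eq[OF tensor_rel.zero V W]
 ten_cls_eq[OF tensor_rel.sym[OF tensor_rel.smult] V W])

lemma ten_sm_add_scalar:
 assumes "c<:K" "d<:K" "xs \<in> lists (carrier V \<times> carrier W)"
 shows "(c +[K] d) *[tp K V W] tensor_class K V W xs =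
 c *[tp K V W] tensor_class K V W xs +[tp K V W]
 d *[tp K V W] tensor_class K V W xs"
 using assms(3)
proof (induction xs)
 case Nil
 then show ?case
 using assms by (simp add: ten_sm_cls ten_add_cls)
next
 case (Cons p xs)
 obtain v w where p: "p = (v, w)" "v<:V" "w<:W"
 using Cons by (cases p) auto
 have step: "e *[tp K V W] tensor_class K V W (p # xs)
 = pu K V W (e *[V] v) w +[tp K V W] e *[tp K V W] tensor_class K V W xs"
 if "e<:K" for e
 using that Cons p by (simp only: ten_sm_cls_cons)
 show ?case
 using assms Cons p step
 by (simp add: V.smult_l_distr pure_ten_bil_aux(1) ten_sm_cl ten_cls_cl
 T.a_ac)
qed

lemma ten_mod: "module K (tp K V W)"
proof (rule moduleI)
 have zero: "0[K] *[tp K V W] x = 0[tp K V W]"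
 if "x<:(tp K V W)" for x
 proof -
 obtain xs where xs: "xs \<in> lists (carrier V \<times> carrier W)" "x = tensor_class K V W xs"
 using \<open>x<:_\<close> by (rule ten_cls_ex)
 show ?thesis
 unfolding xs(2) using xs(1)
 proof (induction xs)
 case (Cons p xs)
 then obtain v w where p: "p = (v, w)" "v<:V" "w<:W"
 by (cases p) auto
 then show ?case
 using Cons ten_sm_cls_cons[of "0[K]" v w xs] by (simp add: pure_ten_bil_aux(5))
 qed (simp add: ten_sm_cls ten_zero_cls)
 qed
 show smult1: "1[K] *[tp K V W] x = x" if "x<:(tp K V W)" for x
 proof -
 obtain xs where xs: "xs \<in> lists (carrier V \<times> carrier W)" "x = tensor_class K V W xs"
 using \<open>x<:_\<close> by (rule ten_cls_ex)
 have "map (%(v, w). (1[K] *[V] v, w)) xs = xs"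
 using xs(1) by (induction xs) auto
 then show ?thesis
 using xs by (simp add: ten_sm_cls)
 qed
 show distr: "(c +[K] d) *[tp K V W] x =
 c *[tp K V W] x +[tp K V W] d *[tp K V W] x"
 if "c<:K" "d<:K" "x<:(tp K V W)" for c d x
 using that by (elim ten_cls_ex) (simp add: ten_sm_add_scalar)
 show "abelian_group (tp K V W)"
 proof (rule abelian_groupI)
 \<comment> \<open>Formal sums have no negatives; the inverse of \<open>x\<close> is (-1) times
   \<open>x\<close>.\<close>
 fix x assume x: "x<:(tp K V W)"
 have "(\<ominus>\<^bsub>K\<^esub> 1[K]) *[tp K V W] x +[tp K V W] x
 = ((\<ominus>\<^bsub>K\<^esub> 1[K]) +[K] 1[K]) *[tp K V W] x"
 using x by (simp add: distr smult1)
 then show "\<exists>y \<in> carrier (tp K V W). y +[tp K V W] x = 0[tp K V W]"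
 using x zero by (intro bexI[of _ "(\<ominus>\<^bsub>K\<^esub> 1[K]) *[tp K V W] x"])
 (auto simp: V.R.l_neg ten_sm_cl)
 qed (simp_all add: T.a_assoc, simp add: T.a_comm)
next
 fix c x y
 assume c: "c<:K" and "x<:(tp K V W)" "y<:(tp K V W)"
 then obtain xs ys where xs: "xs \<in> lists (carrier V \<times> carrier W)" "x = tensor_class K V W xs"
 and ys: "ys \<in> lists (carrier V \<times> carrier W)" "y = tensor_class K V W ys"
 by (metis ten_cls_ex)
 have "map (%(v, w). (c *[V] v, w)) xs \<in> lists (carrier V \<times> carrier W)"
 "map (%(v, w). (c *[V] v, w)) ys \<in> lists (carrier V \<times> carrier W)"
 using c xs ys by (simp_all only: sm_lists)
 then show "c *[tp K V W] (x +[tp K V W] y) =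
 c *[tp K V W] x +[tp K V W] c *[tp K V W] y"
 using c xs ys by (simp add: ten_add_cls ten_sm_cls)
next
 fix c d x
 assume cd: "c<:K" "d<:K" and "x<:(tp K V W)"
 then obtain xs where xs: "xs \<in> lists (carrier V \<times> carrier W)" "x = tensor_class K V W xs"
 by (metis ten_cls_ex)
 have "map (%(v, w). (d *[V] v, w)) xs \<in> lists (carrier V \<times> carrier W)"
 using cd xs by (simp_all only: sm_lists)
 moreover have "map (%(v, w). ((c .[K] d) *[V] v, w)) xs
 = map (%(v, w). (c *[V] v, w)) (map (%(v, w). (d *[V] v, w)) xs)"
 using xs(1) cd by (induction xs) (auto simp: V.smult_assoc1)
 ultimately show "(c .[K] d) *[tp K V W] x
 = c *[tp K V W] (d *[tp K V W] x)"
 using xs cd by (simp add: ten_sm_cls del: map_map map_eq_conv)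
qed (auto simp: V.R.cring_axioms ten_sm_cl)

interpretation T: module K "tp K V W" by (rule ten_mod)

lemma pure_ten_bil: "bilin K V W (tp K V W) (pu K V W)"
 by (intro bilinI lin_mapsI) (simp_all add: pure_ten_bil_aux)

section \<open>Sweedler sums as values of linear maps\<close>

lemma sw_class:
 assumes "md K U" "bilin K V W U f" "xs \<in> lists (carrier V \<times> carrier W)"
 shows "sw U (tensor_class K V W xs) f = lsum U f xs"
 unfolding sw_lsum using lsum_rel[OF ten_rep_cls[OF assms(3)] V W assms(1,2)] by simp

lemma sw_pure:
 assumes "md K U" "bilin K V W U f" "v<:V" "w<:W"
 shows "sw U (pu K V W v w) f = f v w"
proof -
 interpret U: module K U by fact
 show ?thesis
 using assms bilin_closed[OF assms(2)] by (simp add: pure_tensor_def sw_class)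
qed

lemma sw_lin:
 assumes U: "md K U" and f: "bilin K V W U f"
 shows "(%x. sw U x f) : Lin K (tp K V W) U"
proof (rule lin_mapsI)
 interpret U: module K U by fact
 note cl = bilin_closed[OF f]
 note lc = lsum_cl[OF U.abelian_group_axioms, where f = f and A = "carrier V" and B = "carrier W"]
 fix x assume "x<:(tp K V W)"
 then show "sw U x f<:U"
 by (elim ten_cls_ex) (simp add: sw_class U f lc cl)
next
 interpret U: module K U by fact
 fix x y assume "x<:(tp K V W)" "y<:(tp K V W)"
 then show "sw U (x +[tp K V W] y) f = sw U x f +[U] sw U y f"
 by (elim ten_cls_ex)
 (simp add: ten_add_cls sw_class U f bilin_closed[OF f] lsum_append[OF U.abelian_group_axioms])
next
 interpret U: module K U by fact
 note cl = bilin_closed[OF f]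
 note lc = lsum_cl[OF U.abelian_group_axioms, where f = f and A = "carrier V" and B = "carrier W"]
 fix c x assume c: "c<:K" and "x<:(tp K V W)"
 then obtain xs where xs: "xs \<in> lists (carrier V \<times> carrier W)" "x = tensor_class K V W xs"
 by (metis ten_cls_ex)
 have "map (%(v, w). (c *[V] v, w)) xs \<in> lists (carrier V \<times> carrier W)"
 using c xs by (simp_all only: sm_lists)
 moreover have "lsum U f (map (%(v, w). (c *[V] v, w)) xs) = c *[U] lsum U f xs"
 using xs(1)
 proof (induction xs)
 case (Cons p xs)
 then show ?case
 using c lc[of xs] by (cases p) (auto simp: bilin_smult_left[OF f] U.smult_r_distr cl)
 qed (simp add: c)
 ultimately show "sw U (c *[tp K V W] x) f = c *[U] sw U x f"
 using c xs by (simp add: ten_sm_cls sw_class U f)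
qed

lemma ten_induct [consumes 1, case_names zero pure add]:
 assumes "x<:(tp K V W)" and "P 0[tp K V W]"
 and "!!v w. [|v<:V; w<:W|] ==> P (pu K V W v w)"
 and "!!x y. [|x<:(tp K V W); y<:(tp K V W); P x; P y|]
 ==> P (x +[tp K V W] y)"
 shows "P x"
proof -
 obtain xs where xs: "xs \<in> lists (carrier V \<times> carrier W)" "x = tensor_class K V W xs"
 using assms(1) by (rule ten_cls_ex)
 show ?thesis
 unfolding xs(2) using xs(1)
 proof (induction xs)
 case (Cons p xs)
 then have "tensor_class K V W xs<:(tp K V W)"
 by (simp add: ten_cls_cl)
 then show ?case
 using Cons by (cases p) (auto simp: ten_cls_cons intro!: assms(3,4))
 qed (simp add: assms(2) ten_zero_cls[symmetric])
qed

text \<open>Pure tensors span. Most later identities between linear maps are reduced to elements by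
  this lemma or by its variant \<open>ext_pure\<close>.\<close>

lemma ten_ext:
 assumes U: "md K U"
 and f: "f : Lin K (tp K V W) U" and g: "g : Lin K (tp K V W) U"
 and eq: "!!v w. [|v<:V; w<:W|]
 ==> f (pu K V W v w) = g (pu K V W v w)"
 and x: "x<:(tp K V W)"
 shows "f x = g x"
 using x
 by (induction rule: ten_induct)
 (simp_all add: eq linear_maps_add[OF f] linear_maps_add[OF g]
 lin_mp_zero[OF f ten_mod U] lin_mp_zero[OF g ten_mod U])

lemma sw_cl:
 assumes "abelian_group U" "!!v w. [|v<:V; w<:W|] ==> f v w<:U"
 and "x<:(tp K V W)"
 shows "sw U x f<:U"
 unfolding sw_lsum using lsum_cl[OF assms(1) ten_rep_lists[OF assms(3)] assms(2)] by simp

lemma sw_cong: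
 assumes "!!v w. [|v<:V; w<:W|] ==> f v w = g v w"
 and "x<:(tp K V W)"
 shows "sw U x f = sw U x g"
proof -
 have "lsum U f xs = lsum U g xs" if "xs \<in> lists (carrier V \<times> carrier W)" for xs
 using that by (induction xs) (auto simp: assms(1))
 then show ?thesis
 unfolding sw_lsum using ten_rep_lists[OF assms(2)] by simp
qed

text \<open>Both sides sum over the same representative, so \<open>f\<close> may be any function
  with values in \<open>U\<close>. Operators can thus be pulled through a Sweedler sum before
  bilinearity has been checked.\<close>

lemma sw_lin_im:
 assumes u: "u : Lin K U U'" and U: "md K U" "md K U'"
 and cl: "!!v w. [|v<:V; w<:W|] ==> f v w<:U"
 and x: "x<:(tp K V W)"
 shows "u (sw U x f) = sw U' x (%v w. u (f v w))"
proof -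
 interpret U: module K U by fact
 have "u (lsum U f xs) = lsum U' (%v w. u (f v w)) xs" if "xs \<in> lists (carrier V \<times> carrier W)" for xs
 using that
 proof (induction xs)
 case (Cons p xs)
 have "lsum U f xs<:U"
 using Cons by (intro lsum_cl[OF U.abelian_group_axioms _ cl]) auto
 then show ?case
 using Cons by (cases p) (auto simp: linear_maps_add[OF u] cl)
 qed (simp add: lin_mp_zero[OF u U])
 then show ?thesis
 unfolding sw_lsum using ten_rep_lists[OF x] by simp
qed

lemma sw_pure_id:
 assumes "x<:(tp K V W)"
 shows "sw (tp K V W) x (pu K V W) = x"
 by (rule ten_ext[OF ten_mod sw_lin[OF ten_mod pure_ten_bil] lin_mp_id])
 (simp_all add: sw_pure[OF ten_mod pure_ten_bil] assms)

end

section \<open>Tensor products of linear maps and of algebras\<close>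

lemma lin_mp_plus:
 assumes "f : Lin K V W" "g : Lin K V W" "md K W"
 shows "(%x. f x +[W] g x) : Lin K V W"
proof -
 interpret W: module K W by fact
 show ?thesis
 using lcl[OF assms(1)] lcl[OF assms(2)]
 by (intro lin_mapsI)
 (simp_all add: linear_maps_add[OF assms(1)] linear_maps_add[OF assms(2)]
 linear_maps_smult[OF assms(1)] linear_maps_smult[OF assms(2)] W.a_ac W.smult_r_distr)
qed

lemma lin_mp_scale:
 assumes "f : Lin K V W" "c<:K" "md K W"
 shows "(%x. c *[W] f x) : Lin K V W"
 using linc[OF assms(1) lin_mp_sm_map[OF assms(3,2)]] .

lemma bil_zero_l:
 assumes "bilin K V W U f" "md K V" "md K W" "md K U" "w<:W"
 shows "f 0[V] w = 0[U]"
 using lin_mp_zero[OF bilin_left[OF assms(1,5)] assms(2,4)] .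

lemma bil_zero_r:
 assumes "bilin K V W U f" "md K V" "md K W" "md K U" "v<:V"
 shows "f v 0[W] = 0[U]"
 using lin_mp_zero[OF bilin_right[OF assms(1,5)] assms(3,4)] .

lemma bil_lin_lin:
 assumes "!!v. v<:V ==> f v : Lin K W U"
 and "!!v v' w. [|v<:V; v'<:V; w<:W|] ==> f (v +[V] v') w = f v w +[U] f v' w"
 and "!!c v w. [|c<:K; v<:V; w<:W|] ==> f (c *[V] v) w = c *[U] f v w"
 shows "bilin K V W U f"
proof (rule bilinI)
 show "(%v. f v w) : Lin K V U" if "w<:W" for w
 using that by (intro lin_mapsI lcl[OF assms(1)]) (simp_all add: assms(2,3))
qed (rule assms(1))

lemma sw_plus:
 assumes "md K V" "md K W" "md K U" "bilin K V W U f" "bilin K V W U g"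
 and "x<:(tp K V W)"
 shows "sw U x (%v w. f v w +[U] g v w) = sw U x f +[U] sw U x g"
proof -
 have fg: "bilin K V W U (%v w. f v w +[U] g v w)"
 by (intro bilinI lin_mp_plus bilin_left[OF assms(4)] bilin_right[OF assms(4)]
 bilin_left[OF assms(5)] bilin_right[OF assms(5)] assms(3))
 show ?thesis
 by (rule ten_ext[OF assms(1-3) sw_lin[OF assms(1-3) fg]
 lin_mp_plus[OF sw_lin[OF assms(1-4)] sw_lin[OF assms(1-3,5)] assms(3)]])
 (simp_all add: sw_pure[OF assms(1-3)] fg assms)
qed

lemma sw_scale:
 assumes "md K V" "md K W" "md K U" "bilin K V W U f" "c<:K"
 and "x<:(tp K V W)"
 shows "sw U x (%v w. c *[U] f v w) = c *[U] sw U x f"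
 using sw_lin_im[OF assms(1,2) lin_mp_sm_map[OF assms(3,5)] assms(3,3)
 bilin_closed[OF assms(4)] assms(6)] by simp

text \<open>Two sums over the same tensor are joined term by term. This supplies the linearity in
  \<open>t\<close> of operators that are Sweedler sums, such as \<open>tact\<close>.\<close>

lemma sw_lin_par:
 assumes V: "md K V" and W: "md K W" and U: "md K U" and T: "md K T"
 and f: "!!t. t<:T ==> bilin K V W U (f t)"
 and lin: "!!v w. [|v<:V; w<:W|] ==> (%t. f t v w) : Lin K T U"
 and x: "x<:(tp K V W)"
 shows "(%t. sw U x (f t)) : Lin K T U"
proof (rule lin_mapsI)
 interpret T: module K T by fact
 interpret U: module K U by fact
 show "sw U x (f t)<:U" if "t<:T" for t
 using lcl[OF sw_lin[OF V W U f[OF that]] x] .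
 show "sw U x (f (s +[T] t)) = sw U x (f s) +[U] sw U x (f t)"
 if "s<:T" "t<:T" for s t
 unfolding sw_plus[OF V W U f[OF that(1)] f[OF that(2)] x, symmetric]
 by (rule sw_cong[OF V W]) (simp_all add: linear_maps_add[OF lin] that x)
 show "sw U x (f (c *[T] t)) = c *[U] sw U x (f t)"
 if "c<:K" "t<:T" for c t
 unfolding sw_scale[OF V W U f[OF that(2)] that(1) x, symmetric]
 by (rule sw_cong[OF V W]) (simp_all add: linear_maps_smult[OF lin] that x)
qed

lemma ten_map_bil:
 assumes "md K V'" "md K W'" "f : Lin K V V'" "g : Lin K W W'"
 shows "bilin K V W (tp K V' W') (%v w. pu K V' W' (f v) (g w))"
 using bil_comp_args[OF pure_ten_bil] assms by blast

context
 fixes K and V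
 and W and V' and W'
 assumes V: "md K V" and W: "md K W" and V': "md K V'" and W': "md K W'"
begin

lemma ten_map_lin:
 assumes "f : Lin K V V'" "g : Lin K W W'"
 shows "tm K V' W' f g : Lin K (tp K V W) (tp K V' W')"
 using sw_lin[OF V W ten_mod[OF V' W'] ten_map_bil[OF V' W' assms]]
 by (simp add: tensor_map_def[abs_def])

lemma ten_map_pure:
 assumes "f : Lin K V V'" "g : Lin K W W'" "v<:V" "w<:W"
 shows "tm K V' W' f g (pu K V W v w) = pu K V' W' (f v) (g w)"
 using sw_pure[OF V W ten_mod[OF V' W'] ten_map_bil[OF V' W' assms(1,2)] assms(3,4)]
 by (simp add: tensor_map_def)

lemma ten_map_cong:
 assumes "!!v. v<:V ==> f v = f' v" "!!w. w<:W ==> g w = g' w"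
 and "x<:(tp K V W)"
 shows "tm K V' W' f g x = tm K V' W' f' g' x"
 unfolding tensor_map_def using assms by (intro sw_cong[OF V W]) simp_all

end

section \<open>The tensor product of two algebras\<close>

lemma ten_cls_lsum:
 assumes "md K V" "md K W" "xs \<in> lists (carrier V \<times> carrier W)"
 shows "tensor_class K V W xs = lsum (tp K V W) (pu K V W) xs"
 using assms(3)
proof (induction xs)
 case (Cons p xs)
 then show ?case
 by (cases p) (simp add: ten_cls_cons[OF assms(1,2)])
qed (simp add: ten_zero_cls[OF assms(1,2)])

lemma alg_mult_bil:
 assumes "k_algebra K A"
 shows "bilin K A A A (%a b. a .[A] b)"
proof -
 interpret A: k_algebra K A by fact
 show ?thesis
 by (intro bilinI lin_mapsI)
 (simp_all add: A.l_distr A.r_distr A.smult_mult_left A.smult_mult_right)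
qed

text \<open>\<open>tensor_prod\<close> multiplies by listing all pairs of terms; the sum over that
  list has to become an iterated sum before the universal property can be used.\<close>

lemma lsum_concat_map:
 assumes "abelian_group U" "xs \<in> lists (A \<times> B)" "ys \<in> lists (C \<times> D)"
 and cl: "!!v w v' w'. [|v \<in> A; w \<in> B; v' \<in> C; w' \<in> D|] ==> g v v' \<in> E \<and> h w w' \<in> F"
 and f: "!!v w. [|v \<in> E; w \<in> F|] ==> f v w<:U"
 shows "lsum U f [(g v v', h w w'). (v, w) \<leftarrow> xs, (v', w') \<leftarrow> ys]
 = lsum U (%v w. lsum U (%v' w'. f (g v v') (h w w')) ys) xs"
 using assms(2)
proof (induction xs)
 case (Cons p xs)
 obtain v w where p: "p = (v, w)" "v \<in> A" "w \<in> B"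
 using Cons by (cases p) auto
 have one: "[(g v v', h w w'). (v', w') \<leftarrow> ys] \<in> lists (E \<times> F)"
 "lsum U f [(g v v', h w w'). (v', w') \<leftarrow> ys] = lsum U (%v' w'. f (g v v') (h w w')) ys"
 using assms(3) cl[OF p(2,3)] by (induction ys) (auto simp: p)
 have rest: "[(g v v', h w w'). (v, w) \<leftarrow> xs, (v', w') \<leftarrow> ys] \<in> lists (E \<times> F)"
 using Cons(2) assms(3) cl by fastforce
 show ?case
 using lsum_append[OF assms(1) one(1) rest f] one(2) Cons p by simp
qed simp

context
 fixes K and A and B
 assumes A: "k_algebra K A" and B: "k_algebra K B"
begin

interpretation A: k_algebra K A by (rule A)
interpretation B: k_algebra K B by (rule B)
interpretation AB: module K "tp K A B"
 by (rule ten_mod[OF A.module_axioms B.module_axioms])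

abbreviation (input) "AB \<equiv> tp K A B"

lemma ten_mult_bil_aux:
 assumes "v<:A" "w<:B"
 shows "bilin K A B AB (%v' w'. pu K A B (v .[A] v') (w .[B] w'))"
 using assms by (intro ten_map_bil A.module_axioms B.module_axioms lin_mapsI)
 (simp_all add: A.r_distr B.r_distr A.smult_mult_right B.smult_mult_right)

lemma ten_mult_bil_aux':
 assumes "y<:AB"
 shows "bilin K A B AB (%v w. sw AB y (%v' w'. pu K A B (v .[A] v') (w .[B] w')))"
proof (rule bilinI)
 note p = pure_ten_bil[OF A.module_axioms B.module_axioms]
 note m = A.module_axioms B.module_axioms AB.module_axioms
 show "(%w. sw AB y (%v' w'. pu K A B (v .[A] v') (w .[B] w'))) : Lin K B AB"
 if "v<:A" for v
 by (rule sw_lin_par[OF m m(2) ten_mult_bil_aux[OF that] _ assms],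
 assumption,
 rule linc[OF bilin_left[OF alg_mult_bil[OF B]] bilin_right[OF p]])
 (simp_all add: that)
 show "(%v. sw AB y (%v' w'. pu K A B (v .[A] v') (w .[B] w'))) : Lin K A AB"
 if "w<:B" for w
 by (rule sw_lin_par[OF m m(1) ten_mult_bil_aux[OF _ that] _ assms],
 assumption,
 rule linc[OF bilin_left[OF alg_mult_bil[OF A]] bilin_left[OF p]])
 (simp_all add: that)
qed

text \<open>The product is defined through chosen representatives. As an iterated Sweedler sum it is
  seen to be bilinear and independent of the choice.\<close>

lemma ten_mult_sw:
 assumes "x<:AB" "y<:AB"
 shows "x .[AB] y = sw AB x (%v w. sw AB y (%v' w'. pu K A B (v .[A] v') (w .[B] w')))"
proof -
 note m = A.module_axioms B.module_axioms
 note rep = ten_rep_lists[OF m assms(1)] ten_rep_lists[OF m assms(2)]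
 have "[(v .[A] v', w .[B] w'). (v, w) \<leftarrow> tensor_rep x, (v', w') \<leftarrow> tensor_rep y]
 \<in> lists (carrier A \<times> carrier B)"
 using rep by fastforce
 note cls = ten_cls_lsum[OF m this]
 have "x .[AB] y = tensor_class K A B
 [(v .[A] v', w .[B] w'). (v, w) \<leftarrow> tensor_rep x, (v', w') \<leftarrow> tensor_rep y]"
 by (simp add: tensor_prod_def)
 also have "... = lsum AB (pu K A B)
 [(v .[A] v', w .[B] w'). (v, w) \<leftarrow> tensor_rep x, (v', w') \<leftarrow> tensor_rep y]"
 by (rule cls)
 also have "... = lsum AB (%v w. lsum AB (%v' w'. pu K A B (v .[A] v') (w .[B] w'))
 (tensor_rep y)) (tensor_rep x)"
 by (rule lsum_concat_map[OF AB.abelian_group_axioms rep, where E = "carrier A" and F = "carrier B"])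
 (simp_all add: pure_ten_cl[OF m])
 finally show ?thesis
 by (simp add: sw_lsum)
qed

lemma ten_mult_bil: "bilin K AB AB AB (%x y. x .[AB] y)"
proof (rule bilinI)
 note m = A.module_axioms B.module_axioms AB.module_axioms
 show "(%y. x .[AB] y) : Lin K AB AB" if "x<:AB" for x
 by (rule lin_mp_cong[OF sw_lin_par[OF m m(3) ten_mult_bil_aux'
 sw_lin[OF m ten_mult_bil_aux] that] m(3)])
 (simp_all add: ten_mult_sw that)
 show "(%x. x .[AB] y) : Lin K AB AB" if "y<:AB" for y
 by (rule lin_mp_cong[OF sw_lin[OF m ten_mult_bil_aux'[OF that]] m(3)])
 (simp_all add: ten_mult_sw that)
qed

lemma ten_mult_pure:
 assumes "v<:A" "w<:B" "v'<:A" "w'<:B"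
 shows "pu K A B v w .[AB] pu K A B v' w'
 = pu K A B (v .[A] v') (w .[B] w')"
proof -
 note m = A.module_axioms B.module_axioms AB.module_axioms
 show ?thesis
 using assms
 by (simp add: ten_mult_sw pure_ten_cl[OF m(1,2)]
 sw_pure[OF m ten_mult_bil_aux'] sw_pure[OF m ten_mult_bil_aux])
qed

lemma ten_one: "1[AB] = pu K A B 1[A] 1[B]"
 by (simp add: tensor_prod_def)

lemma ten_alg: "k_algebra K AB"
proof -
 note m = A.module_axioms B.module_axioms AB.module_axioms
 note cl = bilin_closed[OF ten_mult_bil]
 note [simp] = cl pure_ten_cl[OF m(1,2)] ten_mult_pure
 bil_zero_l[OF ten_mult_bil m(3,3,3)] bil_zero_r[OF ten_mult_bil m(3,3,3)]
 bilin_add_left[OF ten_mult_bil] bilin_add_right[OF ten_mult_bil]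
 \<comment> \<open>Associativity is reached by relaxing one factor after another from a pure tensor
   to an arbitrary element.\<close>
 have assoc1: "pu K A B a b .[AB] pu K A B a' b' .[AB] z
 = pu K A B a b .[AB] (pu K A B a' b' .[AB] z)"
 if "a<:A" "b<:B" "a'<:A" "b'<:B" "z<:AB" for a b a' b' z
 using that(5) by (induction z rule: ten_induct[OF m(1,2), consumes 1])
 (simp_all add: that A.m_assoc B.m_assoc)
 have assoc2: "pu K A B a b .[AB] y .[AB] z = pu K A B a b .[AB] (y .[AB] z)"
 if "a<:A" "b<:B" "y<:AB" "z<:AB" for a b y z
 using that(3) by (induction y rule: ten_induct[OF m(1,2), consumes 1])
 (simp_all add: that assoc1 del: ten_mult_pure)
 have assoc: "x .[AB] y .[AB] z = x .[AB] (y .[AB] z)"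
 if "x<:AB" "y<:AB" "z<:AB" for x y z
 using that(1) by (induction x rule: ten_induct[OF m(1,2), consumes 1])
 (simp_all add: that assoc2)
 have one: "1[AB]<:AB"
 by (simp add: ten_one)
 have l_one: "1[AB] .[AB] x = x" if "x<:AB" for x
 using that by (induction x rule: ten_induct[OF m(1,2), consumes 1])
 (simp_all add: ten_one)
 have r_one: "x .[AB] 1[AB] = x" if "x<:AB" for x
 using that by (induction x rule: ten_induct[OF m(1,2), consumes 1])
 (simp_all add: ten_one)
 have "ring AB"
 by (intro ringI monoidI AB.abelian_group_axioms) (simp_all add: assoc one l_one r_one)
 then show ?thesis
 by (intro k_algebra.intro AB.module_axioms k_algebra_axioms.intro)
 (simp_all add: bilin_smult_left[OF ten_mult_bil] bilin_smult_right[OF ten_mult_bil])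
qed

end

section \<open>Actions\<close>

definition action where
 "action K A T rh \<longleftrightarrow> bilin K A T T rh \<and>
 (\<forall>h \<in> carrier A. \<forall>k \<in> carrier A. \<forall>t \<in> carrier T. rh (h .[A] k) t = rh h (rh k t)) \<and>
 (\<forall>t \<in> carrier T. rh 1[A] t = t)"

lemma
 assumes "action K A T rh"
 shows action_bilin: "bilin K A T T rh"
 and action_closed: "[|h<:A; t<:T|] ==> rh h t<:T"
 and action_linear: "h<:A ==> rh h : Lin K T T"
 and action_mult: "[|h<:A; k<:A; t<:T|] ==> rh (h .[A] k) t = rh h (rh k t)"
 and action_one: "t<:T ==> rh 1[A] t = t"
 using assms by (auto simp: action_def bilin_closed bilin_right)

definition commuting where
 "commuting A B T rh sg \<longleftrightarrow>
 (\<forall>h \<in> carrier A. \<forall>k \<in> carrier B. \<forall>t \<in> carrier T. rh h (sg k t) = sg k (rh h t))"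

lemma commutingD:
 "[|commuting A B T rh sg; h<:A; k<:B; t<:T|] ==> rh h (sg k t) = sg k (rh h t)"
 by (simp add: commuting_def)

lemma com_sym: "commuting A B T rh sg ==> commuting B A T sg rh"
 by (simp add: commuting_def)

definition tact where
 "tact T rh sg x t = sw T x (%a b. rh a (sg b t))"

lemma tact_bil_aux:
 assumes "bilin K A T T rh" "bilin K B T T sg" "t<:T"
 shows "bilin K A B T (%a b. rh a (sg b t))"
 using bilin_closed[OF assms(2) _ assms(3)]
 by (intro bilinI linc[OF bilin_left[OF assms(2,3)] bilin_right[OF assms(1)]]
 bilin_left[OF assms(1)])

context
 fixes K and A
 and B and T
 assumes A: "k_algebra K A" and B: "k_algebra K B" and T: "md K T"
begin

interpretation A: k_algebra K A by (rule A)
interpretation B: k_algebra K B by (rule B)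
interpretation T: module K T by (rule T)
interpretation AB: k_algebra K "tp K A B" by (rule ten_alg[OF A B])

lemma tact_pure:
 assumes "bilin K A T T rh" "bilin K B T T sg" "a<:A" "b<:B" "t<:T"
 shows "tact T rh sg (pu K A B a b) t = rh a (sg b t)"
 using sw_pure[OF A.module_axioms B.module_axioms T tact_bil_aux[OF assms(1,2,5)] assms(3,4)]
 by (simp add: tact_def)

lemma tact_bil:
 assumes "bilin K A T T rh" "bilin K B T T sg"
 shows "bilin K (tp K A B) T T (tact T rh sg)"
proof (rule bilinI)
 show "tact T rh sg x : Lin K T T" if "x<:(tp K A B)" for x
 using sw_lin_par[OF A.module_axioms B.module_axioms T T tact_bil_aux[OF assms]
 linc[OF bilin_right[OF assms(2)] bilin_right[OF assms(1)]] that]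
 by (simp add: tact_def[abs_def])
 show "(%x. tact T rh sg x t) : Lin K (tp K A B) T" if "t<:T" for t
 using sw_lin[OF A.module_axioms B.module_axioms T tact_bil_aux[OF assms that]]
 by (simp add: tact_def)
qed

text \<open>On pure tensors the product law requires moving an operator of \<open>rh\<close> past
  one of \<open>sg\<close>, which is the commutation hypothesis. Both factors are then extended
  linearly.\<close>

lemma act_tact:
 assumes "action K A T rh" "action K B T sg" "commuting A B T rh sg"
 shows "action K (tp K A B) T (tact T rh sg)"
proof -
 note m = A.module_axioms B.module_axioms AB.module_axioms
 note b = action_bilin[OF assms(1)] action_bilin[OF assms(2)]
 note bi = tact_bil[OF b]
 note mb = ten_mult_bil[OF A B]
 note [simp] = action_closed[OF assms(1)] action_closed[OF assms(2)] bilin_closed[OF bi]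
 bil_zero_l[OF bi m(3) T T] bil_zero_r[OF bi m(3) T T] bilin_add_left[OF bi]
 bilin_add_right[OF bi] tact_pure[OF b] ten_mult_pure[OF A B] pure_ten_cl[OF m(1,2)]
 have m1: "tact T rh sg (pu K A B a b .[tp K A B] y) t
 = tact T rh sg (pu K A B a b) (tact T rh sg y t)"
 if "a<:A" "b<:B" "y<:(tp K A B)" "t<:T" for a b y t
 using that(3) by (induction y rule: ten_induct[OF m(1,2), consumes 1])
 (simp_all add: that AB.r_distr action_mult[OF assms(1)] action_mult[OF assms(2)]
 commutingD[OF assms(3)] linear_maps_add[OF action_linear[OF assms(1)]]
 linear_maps_add[OF action_linear[OF assms(2)]] bil_zero_r[OF b(1) m(1) T T]
 bil_zero_r[OF b(2) m(2) T T] del: bilin_add_right[OF bi])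
 have "tact T rh sg (x .[tp K A B] y) t = tact T rh sg x (tact T rh sg y t)"
 if "x<:(tp K A B)" "y<:(tp K A B)" "t<:T" for x y t
 using that(1) by (induction x rule: ten_induct[OF m(1,2), consumes 1])
 (simp_all add: that AB.l_distr m1 del: tact_pure[OF b])
 moreover have "tact T rh sg 1[tp K A B] t = t" if "t<:T" for t
 using that by (simp add: ten_one[OF A B] action_one[OF assms(1)] action_one[OF assms(2)])
 ultimately show ?thesis
 by (simp add: action_def bi)
qed

lemma com_tact_l:
 assumes "action K A T rh" "action K B T sg" "action K C T \<tau>" "md K C"
 and "commuting A C T rh \<tau>" "commuting B C T sg \<tau>"
 shows "commuting (tp K A B) C T (tact T rh sg) \<tau>"
 unfolding commuting_def
proof (intro ballI)
 fix x c t assume x: "x<:(tp K A B)" and c: "c<:C" and t: "t<:T"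
 have "\<tau> c (tact T rh sg x t) = sw T x (%a b. \<tau> c (rh a (sg b t)))"
 unfolding tact_def
 using t by (intro sw_lin_im[OF A.module_axioms B.module_axioms action_linear[OF assms(3) c] T T _ x])
 (simp add: action_closed[OF assms(1)] action_closed[OF assms(2)])
 also have "... = tact T rh sg x (\<tau> c t)"
 unfolding tact_def
 using c t by (intro sw_cong[OF A.module_axioms B.module_axioms _ x])
 (simp add: commutingD[OF assms(5)] commutingD[OF assms(6)] action_closed[OF assms(1)]
 action_closed[OF assms(2)])
 finally show "tact T rh sg x (\<tau> c t) = \<tau> c (tact T rh sg x t)" by simp
qed

lemma tact_nat:
 assumes "action K A T rh" "action K B T sg" "md K U" "u : Lin K T U"
 and "!!a t. [|a<:A; t<:T|] ==> u (rh a t) = rh' a (u t)"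
 and "!!b t. [|b<:B; t<:T|] ==> u (sg b t) = sg' b (u t)"
 and "x<:(tp K A B)" "t<:T"
 shows "u (tact T rh sg x t) = tact U rh' sg' x (u t)"
proof -
 have "u (tact T rh sg x t) = sw U x (%a b. u (rh a (sg b t)))"
 unfolding tact_def
 by (intro sw_lin_im[OF A.module_axioms B.module_axioms assms(4) T assms(3) _ assms(7)])
 (simp add: action_closed[OF assms(1)] action_closed[OF assms(2)] assms)
 also have "... = tact U rh' sg' x (u t)"
 unfolding tact_def
 using assms(8) by (intro sw_cong[OF A.module_axioms B.module_axioms _ assms(7)])
 (simp add: assms(5,6) action_closed[OF assms(2)])
 finally show ?thesis .
qed

end

section \<open>Actions on a single tensor factor\<close>

definition legL where
 "legL K V W rh h = tm K V W (rh h) (%w. w)"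

definition legR where
 "legR K V W sg h = tm K V W (%v. v) (sg h)"

context
 fixes K and V and W
 assumes V: "md K V" and W: "md K W"
begin

lemma legL_lin:
 "[|action K A V rh; h<:A|]
 ==> legL K V W rh h : Lin K (tp K V W) (tp K V W)"
 unfolding legL_def by (intro ten_map_lin V W action_linear lin_mp_id)

lemma legR_lin:
 "[|action K A W rh; h<:A|]
 ==> legR K V W rh h : Lin K (tp K V W) (tp K V W)"
 unfolding legR_def by (intro ten_map_lin V W action_linear lin_mp_id)

lemma legL_pure:
 "[|action K A V rh; h<:A; v<:V; w<:W|]
 ==> legL K V W rh h (pu K V W v w) = pu K V W (rh h v) w"
 unfolding legL_def by (rule ten_map_pure[OF V W V W action_linear lin_mp_id])

lemma legR_pure:
 "[|action K A W sg; h<:A; v<:V; w<:W|]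
 ==> legR K V W sg h (pu K V W v w) = pu K V W v (sg h w)"
 unfolding legR_def by (rule ten_map_pure[OF V W V W lin_mp_id action_linear])

text \<open>Each operator is linear, so the laws of an action only have to be known on pure
  tensors.\<close>

lemma lin_family_act:
 assumes A: "k_algebra K A" and lin: "!!h. h<:A ==> rh h : Lin K (tp K V W) (tp K V W)"
 and "!!v w. [|v<:V; w<:W|]
 ==> (%h. rh h (pu K V W v w)) : Lin K A (tp K V W)"
 and "!!h k v w. [|h<:A; k<:A; v<:V; w<:W|]
 ==> rh (h .[A] k) (pu K V W v w) = rh h (rh k (pu K V W v w))"
 and "!!v w. [|v<:V; w<:W|] ==> rh 1[A] (pu K V W v w) = pu K V W v w"
 shows "action K A (tp K V W) rh"
proof -
 interpret A: k_algebra K A by fact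
 interpret T: module K "tp K V W" by (rule ten_mod[OF V W])
 note ext = ten_ext[OF V W T.module_axioms]
 have "bilin K A (tp K V W) (tp K V W) rh"
 proof (rule bil_lin_lin)
 fix h h' x assume h: "h<:A" "h'<:A" and x: "x<:(tp K V W)"
 show "rh (h +[A] h') x = rh h x +[tp K V W] rh h' x"
 by (rule ext[OF lin lin_mp_plus[OF lin[OF h(1)] lin[OF h(2)] T.module_axioms] _ x])
 (simp_all add: linear_maps_add[OF assms(3)] h)
 next
 fix c h x assume h: "c<:K" "h<:A" and x: "x<:(tp K V W)"
 show "rh (c *[A] h) x = c *[tp K V W] rh h x"
 by (rule ext[OF lin lin_mp_scale[OF lin[OF h(2)] h(1) T.module_axioms] _ x])
 (simp_all add: linear_maps_smult[OF assms(3)] h)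
 qed (rule lin)
 moreover have "rh (h .[A] k) x = rh h (rh k x)"
 if "h<:A" "k<:A" "x<:(tp K V W)" for h k x
 by (rule ext[OF lin linc[OF lin[OF that(2)] lin[OF that(1)]] _ that(3)])
 (simp_all add: that assms(4))
 moreover have "rh 1[A] x = x" if "x<:(tp K V W)" for x
 by (rule ext[OF lin lin_mp_id _ that]) (simp_all add: assms(5))
 ultimately show ?thesis
 by (simp add: action_def)
qed

lemma act_legL:
 assumes "k_algebra K A" "action K A V rh"
 shows "action K A (tp K V W) (legL K V W rh)"
proof -
 interpret A: k_algebra K A by fact
 show ?thesis
 proof (rule lin_family_act[OF assms(1)])
 show "(%h. legL K V W rh h (pu K V W v w)) : Lin K A (tp K V W)"
 if "v<:V" "w<:W" for v w
 by (rule lin_mp_cong[OF linc[OF bilin_left[OF action_bilin[OF assms(2)] that(1)]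
 bilin_left[OF pure_ten_bil[OF V W] that(2)]] A.module_axioms])
 (simp add: legL_pure[OF assms(2)] that)
 qed (simp_all add: legL_lin[OF assms(2)] legL_pure[OF assms(2)] action_closed[OF assms(2)]
 action_mult[OF assms(2)] action_one[OF assms(2)])
qed

lemma act_legR:
 assumes "k_algebra K A" "action K A W rh"
 shows "action K A (tp K V W) (legR K V W rh)"
proof -
 interpret A: k_algebra K A by fact
 show ?thesis
 proof (rule lin_family_act[OF assms(1)])
 show "(%h. legR K V W rh h (pu K V W v w)) : Lin K A (tp K V W)"
 if "v<:V" "w<:W" for v w
 by (rule lin_mp_cong[OF linc[OF bilin_left[OF action_bilin[OF assms(2)] that(2)]
 bilin_right[OF pure_ten_bil[OF V W] that(1)]] A.module_axioms])
 (simp add: legR_pure[OF assms(2)] that)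
 qed (simp_all add: legR_lin[OF assms(2)] legR_pure[OF assms(2)] action_closed[OF assms(2)]
 action_mult[OF assms(2)] action_one[OF assms(2)])
qed

lemma commutingI_pure:
 assumes "!!h. h<:A ==> rh h : Lin K (tp K V W) (tp K V W)"
 and "!!h. h<:B ==> sg h : Lin K (tp K V W) (tp K V W)"
 and "!!h k v w. [|h<:A; k<:B; v<:V; w<:W|]
 ==> rh h (sg k (pu K V W v w)) = sg k (rh h (pu K V W v w))"
 shows "commuting A B (tp K V W) rh sg"
 unfolding commuting_def
proof (intro ballI)
 fix h k t assume h: "h<:A" and k: "k<:B" and t: "t<:(tp K V W)"
 show "rh h (sg k t) = sg k (rh h t)"
 by (rule ten_ext[OF V W ten_mod[OF V W] linc[OF assms(2)[OF k] assms(1)[OF h]]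
 linc[OF assms(1)[OF h] assms(2)[OF k]] _ t])
 (simp add: assms(3) h k)
qed

lemma com_legL_legR:
 assumes "action K A V rh" "action K B W sg"
 shows "commuting A B (tp K V W) (legL K V W rh) (legR K V W sg)"
 by (rule commutingI_pure)
 (simp_all add: legL_lin[OF assms(1)] legR_lin[OF assms(2)] legL_pure[OF assms(1)]
 legR_pure[OF assms(2)] action_closed[OF assms(1)] action_closed[OF assms(2)])

lemma com_legL_legL:
 assumes "action K A V rh" "action K B V sg" "commuting A B V rh sg"
 shows "commuting A B (tp K V W) (legL K V W rh) (legL K V W sg)"
 by (rule commutingI_pure)
 (simp_all add: legL_lin[OF assms(1)] legL_lin[OF assms(2)] legL_pure[OF assms(1)]
 legL_pure[OF assms(2)] action_closed[OF assms(1)] action_closed[OF assms(2)]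
 commutingD[OF assms(3)])

lemma com_legR_legR:
 assumes "action K A W rh" "action K B W sg" "commuting A B W rh sg"
 shows "commuting A B (tp K V W) (legR K V W rh) (legR K V W sg)"
 by (rule commutingI_pure)
 (simp_all add: legR_lin[OF assms(1)] legR_lin[OF assms(2)] legR_pure[OF assms(1)]
 legR_pure[OF assms(2)] action_closed[OF assms(1)] action_closed[OF assms(2)]
 commutingD[OF assms(3)])

end

section \<open>Operator calculus for a quasi-Hopf algebra\<close>

context quasi_hopf_algebra
begin

abbreviation (input) mult_H (infixl "##" 70) where "x##y \<equiv> x \<otimes>\<^bsub>H\<^esub> y"
abbreviation (input) mult_HH (infixl "**" 70) where "x**y \<equiv> x \<otimes>\<^bsub>H2 K H\<^esub> y"
abbreviation (input) "HH \<equiv> H2 K H"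
abbreviation (input) "S \<equiv> antipode H"
abbreviation (input) "eH \<equiv> \<one>\<^bsub>H\<^esub>"
abbreviation (input) "pt V W \<equiv> pure_tensor K V W"
abbreviation (input) tens (infixr "><" 75) where "V><W \<equiv> tensor_prod K V W"
abbreviation (input) "Lg \<equiv> legL K"
abbreviation (input) "Rg \<equiv> legR K"

sublocale K: field K by (rule field)
sublocale H: k_algebra K H by (rule algebra)

lemma alg_H: "k_algebra K H" by (rule algebra)
lemma alg_H2: "k_algebra K HH" by (rule ten_alg[OF alg_H alg_H])
lemma alg_H3: "k_algebra K (H3 K H)" by (rule ten_alg[OF alg_H alg_H2])
lemma alg_H4: "k_algebra K (H4 K H)" by (rule ten_alg[OF alg_H alg_H3])
lemma alg_H5: "k_algebra K (H5 K H)" by (rule ten_alg[OF alg_H alg_H4])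

lemma mod_H [simp]: "md K H" by (rule H.module_axioms)
lemma mod_H2 [simp]: "md K HH" by (rule k_algebra.axioms[OF alg_H2])
lemma mod_H3 [simp]: "module K (H3 K H)" by (rule k_algebra.axioms[OF alg_H3])
lemma mod_H4 [simp]: "module K (H4 K H)" by (rule k_algebra.axioms[OF alg_H4])
sublocale H2: k_algebra K "HH" by (rule alg_H2)
sublocale H3: k_algebra K "H3 K H" by (rule alg_H3)

lemma De_cl [simp]: "h<:H ==> comul H h<:HH"
 by (rule lcl[OF comul_linear])

lemma De_mult: "[|h<:H; k<:H|]
 ==> comul H (h .[H] k) = comul H h .[HH] comul H k"
 by (rule ring_hom_mult[OF comul_hom])

lemma De_one: "comul H 1[H] = 1[HH]"
 by (rule ring_hom_one[OF comul_hom])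

lemma eps_cl [simp]: "h<:H ==> counit H h<:K"
 by (rule ring_hom_closed[OF counit_hom])

lemma eps_mult: "[|h<:H; k<:H|]
 ==> counit H (h .[H] k) = counit H h .[K] counit H k"
 by (rule ring_hom_mult[OF counit_hom])

lemma eps_one: "counit H 1[H] = 1[K]"
 by (rule ring_hom_one[OF counit_hom])

lemma eps_add: "[|h<:H; k<:H|]
 ==> counit H (h +[H] k) = counit H h +[K] counit H k"
 by (rule ring_hom_add[OF counit_hom])

lemma S_cl [simp]: "h<:H ==> S h<:H"
 by (rule lcl[OF antipode_linear])

lemma phi_cl [simp]: "reassoc H<:(H3 K H)"
 using reassoc_unit by (simp add: Units_def)

lemma phi_inv_cl [simp]: "reassoc_inv K H<:(H3 K H)"
 by (rule H3.Units_inv_closed[OF reassoc_unit])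

lemma phi_l_inv: "reassoc_inv K H .[H3 K H] reassoc H = 1[H3 K H]"
 by (rule H3.Units_l_inv[OF reassoc_unit])

lemma phi_r_inv: "reassoc H .[H3 K H] reassoc_inv K H = 1[H3 K H]"
 by (rule H3.Units_r_inv[OF reassoc_unit])

section \<open>Actions of H as objects of a monoidal category\<close>

abbreviation "lact \<equiv> action K H"
abbreviation "com \<equiv> commuting H H"

definition dg
 where "dg T a b h = tact T a b (comul H h)"

text \<open>For \<open>x = reassoc H\<close> this is the associator from \<open>(a b) c\<close> to
  \<open>a (b c)\<close>; see \<open>Ph_eqv\<close>.\<close>

definition op3
 where "op3 T x a b c = tact T a (tact T b c) x"

definition triv
 where "triv T h t = counit H h *[T] t"

abbreviation "Ph T \<equiv> op3 T (reassoc H)"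
abbreviation "Phi T \<equiv> op3 T (reassoc_inv K H)"

text \<open>Commutation is recorded in both orders because the simplifier is not given
  \<open>com_sym\<close> as a rule.\<close>

primrec legs :: "('k, 't, 'n) module_scheme => ('h => 't => 't) list => bool" where
 "legs T [] \<longleftrightarrow> True"
| "legs T (a # as) \<longleftrightarrow> lact T a \<and> (\<forall>b \<in> set as. com T a b \<and> com T b a) \<and> legs T as"

definition eqv where
 "eqv T U u a b \<longleftrightarrow> (\<forall>h \<in> carrier H. \<forall>t \<in> carrier T. u (a h t) = b h (u t))"

lemma eqvD:
 "[|eqv T U u a b; h<:H; t<:T|] ==> u (a h t) = b h (u t)"
 by (simp add: eqv_def)

text \<open>Used mostly with \<open>dg T a c\<close> in place of \<open>a\<close> and
  \<open>triv T\<close> in place of \<open>b\<close>: then \<open>u\<close> is a map that evaluates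
  the object \<open>a\<close> against the object \<open>c\<close>.\<close>

definition equ where
 "equ T u a b \<longleftrightarrow> (\<forall>h \<in> carrier H. \<forall>t \<in> carrier T. u (a h t) = u (b h t))"

text \<open>The counterpart of \<open>equ\<close> for vectors: if \<open>dg T a c\<close> agrees
  with \<open>triv T\<close> at \<open>t\<close>, then \<open>t\<close> contains a coevaluation of
  \<open>a\<close> with \<open>c\<close>.\<close>

definition eq_at where
 "eq_at t a b \<longleftrightarrow> (\<forall>h \<in> carrier H. a h t = b h t)"

lemma sw3_cong:
 assumes "!!p q r. [|p<:H; q<:H; r<:H|] ==> f p q r = g p q r"
 and "x<:(H3 K H)"
 shows "sw3 U x f = sw3 U x g"
 unfolding sw3_def
 by (rule sw_cong[OF mod_H mod_H2 _ assms(2)]) (rule sw_cong[OF mod_H mod_H assms(1)])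

lemma sw3_lin_im:
 assumes u: "u : Lin K U U'" and U: "md K U" "md K U'"
 and cl: "!!p q r. [|p<:H; q<:H; r<:H|] ==> f p q r<:U"
 and x: "x<:(H3 K H)"
 shows "u (sw3 U x f) = sw3 U' x (%p q r. u (f p q r))"
proof -
 interpret U: module K U by fact
 have "u (sw3 U x f) = sw U' x (%p y. u (sw U y (f p)))"
 unfolding sw3_def
 by (intro sw_lin_im[OF mod_H mod_H2 u U _ x] sw_cl[OF mod_H mod_H U.abelian_group_axioms cl])
 also have "... = sw3 U' x (%p q r. u (f p q r))"
 unfolding sw3_def
 by (intro sw_cong[OF mod_H mod_H2 _ x] sw_lin_im[OF mod_H mod_H u U cl])
 finally show ?thesis .
qed

context
 fixes T
 assumes T [simp]: "md K T"
begin

interpretation T: module K T by (rule T)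

abbreviation diagT (infixr "*." 75)
 where "a*.b \<equiv> dg T a b"

lemma lact_triv [simp]: "lact T (triv T)"
proof -
 have "bilin K H T T (triv T)"
 unfolding triv_def
 by (intro bilinI lin_mp_sm_map T eps_cl lin_mapsI)
 (simp_all add: eps_add counit_smult T.smult_l_distr T.smult_assoc1)
 then show ?thesis
 by (simp add: action_def triv_def eps_mult eps_one T.smult_assoc1)
qed

lemma triv_com [simp]:
 assumes "lact T a"
 shows "com T (triv T) a" "com T a (triv T)"
 using assms
 by (auto simp: commuting_def triv_def linear_maps_smult[OF action_linear[OF assms]])

lemma lact_diag [simp]:
 assumes "lact T a" "lact T b" "com T a b"
 shows "lact T (a*.b)"
proof -
 note act = act_tact[OF alg_H alg_H T assms]
 note cl = bilin_closed[OF action_bilin[OF act]]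
 show ?thesis
 unfolding action_def
 proof (intro conjI ballI)
 show "bilin K H T T (a*.b)"
 unfolding dg_def
 using bil_comp_args[OF action_bilin[OF act] comul_linear lin_mp_id] by simp
 qed (simp_all add: dg_def De_mult De_one action_mult[OF act] action_one[OF act])
qed

lemma com_diag_l [simp]:
 assumes "lact T a" "lact T b" "lact T c" "com T a c" "com T b c"
 shows "com T (a*.b) c"
proof -
 have "commuting HH H T (tact T a b) c"
 using assms by (intro com_tact_l[OF alg_H alg_H T]) simp_all
 then show ?thesis
 by (simp add: commuting_def dg_def)
qed

lemma com_diag_r [simp]:
 assumes "lact T a" "lact T b" "lact T c" "com T c a" "com T c b"
 shows "com T c (a*.b)"
 using com_diag_l[of a b c] assms by (simp add: com_sym)

lemma diag_cl [simp]:
 "[|lact T a; lact T b; com T a b; h<:H; t<:T|] ==> (a*.b) h t<:T"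
 by (rule action_closed[OF lact_diag])

lemma act3:
 assumes "lact T a" "lact T b" "lact T c" "com T a b" "com T a c" "com T b c"
 shows "action K (H3 K H) T (%x. op3 T x a b c)"
 unfolding op3_def
 by (rule act_tact[OF alg_H alg_H2 T assms(1) act_tact[OF alg_H alg_H T assms(2,3,6)]
 com_sym[OF com_tact_l[OF alg_H alg_H T assms(2,3,1) mod_H
 com_sym[OF assms(4)] com_sym[OF assms(5)]]]])

lemma op3_lin [simp]:
 assumes "lact T a" "lact T b" "lact T c" "com T a b" "com T a c" "com T b c" "x<:(H3 K H)"
 shows "op3 T x a b c : Lin K T T"
 using action_linear[OF act3[OF assms(1-6)] assms(7)] by simp

lemma op3_cl [simp]:
 assumes "lact T a" "lact T b" "lact T c" "com T a b" "com T a c" "com T b c" "x<:(H3 K H)"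
 "t<:T"
 shows "op3 T x a b c t<:T"
 using action_closed[OF act3[OF assms(1-6)] assms(7,8)] .

lemma Ph_Phi [simp]:
 assumes "lact T a" "lact T b" "lact T c" "com T a b" "com T a c" "com T b c" "t<:T"
 shows "Ph T a b c (Phi T a b c t) = t" "Phi T a b c (Ph T a b c t) = t"
 using action_mult[OF act3[OF assms(1-6)] phi_cl phi_inv_cl assms(7)]
 action_mult[OF act3[OF assms(1-6)] phi_inv_cl phi_cl assms(7)]
 action_one[OF act3[OF assms(1-6)] assms(7)]
 by (simp_all add: phi_l_inv phi_r_inv)

lemma op3_sw3:
 assumes "lact T a" "lact T b" "lact T c" "x<:(H3 K H)" "t<:T"
 shows "op3 T x a b c t = sw3 T x (%p q r. a p (b q (c r t)))"
 unfolding op3_def tact_def sw3_def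
 using assms
 by (intro sw_cong[OF mod_H mod_H2] sw_lin_im[OF mod_H mod_H action_linear[OF assms(1)] T T])
 (simp_all add: action_closed[OF assms(2)] action_closed[OF assms(3)])

lemma diag_sw: "(a*.b) h t = sw T (comul H h) (%p q. a p (b q t))"
 by (simp add: dg_def tact_def)

lemma diag_cm:
 assumes "lact T a" "lact T b" "com T a b" "h<:H" "t<:T"
 shows "(a*.b) h t = sw T (comul H h) (%p q. b q (a p t))"
 unfolding diag_sw
 by (rule sw_cong[OF mod_H mod_H _ De_cl[OF assms(4)]]) (simp add: commutingD[OF assms(3)] assms)

text \<open>The counit axiom, pushed through the linear map that sends \<open>h\<close> to
  \<open>a h t\<close>.\<close>

lemma diag_triv_l [simp]:
 assumes "lact T a" "h<:H" "t<:T"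
 shows "(triv T*.a) h t = a h t"
proof -
 have "(%h. a h t) : Lin K H T"
 by (rule bilin_left[OF action_bilin[OF assms(1)] assms(3)])
 from sw_lin_im[OF mod_H mod_H this mod_H T _ De_cl[OF assms(2)],
 where f = "%p q. counit H p *[H] q"]
 have "a h t = sw T (comul H h) (%p q. a (counit H p *[H] q) t)"
 using counit_left[OF assms(2)] by simp
 also have "... = (triv T*.a) h t"
 unfolding diag_sw
 by (rule sw_cong[OF mod_H mod_H _ De_cl[OF assms(2)]])
 (simp add: triv_def bilin_smult_left[OF action_bilin[OF assms(1)]] assms)
 finally show ?thesis by simp
qed

lemma diag_triv_r [simp]:
 assumes "lact T a" "h<:H" "t<:T"
 shows "(a*.triv T) h t = a h t"
proof -
 have "(%h. a h t) : Lin K H T"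
 by (rule bilin_left[OF action_bilin[OF assms(1)] assms(3)])
 from sw_lin_im[OF mod_H mod_H this mod_H T _ De_cl[OF assms(2)],
 where f = "%p q. counit H q *[H] p"]
 have "a h t = sw T (comul H h) (%p q. a (counit H q *[H] p) t)"
 using counit_right[OF assms(2)] by simp
 also have "... = (a*.triv T) h t"
 unfolding diag_sw
 by (rule sw_cong[OF mod_H mod_H _ De_cl[OF assms(2)]])
 (simp add: triv_def bilin_smult_left[OF action_bilin[OF assms(1)]]
 linear_maps_smult[OF action_linear[OF assms(1)]] assms)
 finally show ?thesis by simp
qed

lemma it_De_cl [simp]: "h<:H ==> iterated_comul K H h<:(H3 K H)"
 unfolding iterated_comul_def
 by (intro sw_cl[OF mod_H mod_H H3.abelian_group_axioms] De_cl)
 (simp_all add: pure_ten_cl)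

lemma op3_lin_elem:
 assumes "lact T a" "lact T b" "lact T c" "com T a b" "com T a c" "com T b c" "t<:T"
 shows "(%x. op3 T x a b c t) : Lin K (H3 K H) T"
 by (rule bilin_left[OF action_bilin[OF act3[OF assms(1-6)]] assms(7)])

lemma op3_pure:
 assumes "lact T a" "lact T b" "lact T c" "com T a b" "com T a c" "com T b c" "t<:T"
 "p<:H" "y<:HH"
 shows "op3 T (pt H HH p y) a b c t = a p (tact T b c y t)"
 unfolding op3_def
 using assms by (intro tact_pure[OF alg_H alg_H2 T]) (auto intro: action_bilin act_tact[OF alg_H alg_H T])

lemma tact_pure':
 assumes "lact T b" "lact T c" "t<:T" "q<:H" "r<:H"
 shows "tact T b c (t2 K H q r) t = b q (c r t)"
 using assms by (intro tact_pure[OF alg_H alg_H T] action_bilin)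

lemma op3_it_De:
 assumes "lact T a" "lact T b" "lact T c" "com T a b" "com T a c" "com T b c" "t<:T"
 "h<:H"
 shows "op3 T (iterated_comul K H h) a b c t = ((a*.b)*.c) h t"
proof -
 note lin = op3_lin_elem[OF assms(1-7)]
 have "op3 T (iterated_comul K H h) a b c t = sw T (comul H h) (%p r.
 op3 T (sw (H3 K H) (comul H p) (%p1 p2. t3 K H p1 p2 r)) a b c t)"
 unfolding iterated_comul_def
 by (intro sw_lin_im[OF mod_H mod_H lin mod_H3 T] sw_cl[OF mod_H mod_H H3.abelian_group_axioms])
 (simp_all add: assms pure_ten_cl)
 also have "... = sw T (comul H h) (%p r. sw T (comul H p) (%p1 p2. a p1 (b p2 (c r t))))"
 proof (rule sw_cong[OF mod_H mod_H _ De_cl[OF assms(8)]])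
 fix p r assume p: "p<:H" and r: "r<:H"
 have "op3 T (sw (H3 K H) (comul H p) (%p1 p2. t3 K H p1 p2 r)) a b c t
 = sw T (comul H p) (%p1 p2. op3 T (t3 K H p1 p2 r) a b c t)"
 by (intro sw_lin_im[OF mod_H mod_H lin mod_H3 T]) (simp_all add: p r pure_ten_cl)
 also have "... = sw T (comul H p) (%p1 p2. a p1 (b p2 (c r t)))"
 by (rule sw_cong[OF mod_H mod_H _ De_cl[OF p]])
 (simp add: op3_pure tact_pure' assms r pure_ten_cl)
 finally show "op3 T (sw (H3 K H) (comul H p) (%p1 p2. t3 K H p1 p2 r)) a b c t
 = sw T (comul H p) (%p1 p2. a p1 (b p2 (c r t)))" .
 qed
 finally show ?thesis
 by (simp add: diag_sw)
qed

lemma op3_De_r: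
 assumes "lact T a" "lact T b" "lact T c" "com T a b" "com T a c" "com T b c" "t<:T"
 "h<:H"
 shows "op3 T (sw (H3 K H) (comul H h) (%p q. pt H HH p (comul H q))) a b c t
 = (a*.(b*.c)) h t"
proof -
 note lin = op3_lin_elem[OF assms(1-7)]
 have "op3 T (sw (H3 K H) (comul H h) (%p q. pt H HH p (comul H q))) a b c t
 = sw T (comul H h) (%p q. op3 T (pt H HH p (comul H q)) a b c t)"
 by (intro sw_lin_im[OF mod_H mod_H lin mod_H3 T]) (simp_all add: assms pure_ten_cl)
 also have "... = (a*.(b*.c)) h t"
 unfolding diag_sw[of a]
 by (rule sw_cong[OF mod_H mod_H _ De_cl[OF assms(8)]])
 (simp add: op3_pure assms dg_def)
 finally show ?thesis .
qed

text \<open>Quasi-coassociativity read through the action of the threefold tensor power: the two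
  iterated coproducts act as the two bracketings, and the inverse reassociator of the axiom cancels
  against \<open>Ph\<close>.\<close>

lemma Ph_eqv:
 assumes "lact T a" "lact T b" "lact T c" "com T a b" "com T a c" "com T b c" "t<:T"
 "h<:H"
 shows "(a*.(b*.c)) h (Ph T a b c t) = Ph T a b c (((a*.b)*.c) h t)"
proof -
 note act = act3[OF assms(1-6)]
 have "(a*.(b*.c)) h (Ph T a b c t)
 = op3 T (reassoc H .[H3 K H] iterated_comul K H h .[H3 K H] reassoc_inv K H) a b c (Ph T a b c t)"
 using assms op3_De_r[of a b c "Ph T a b c t" h] quasi_coassoc[OF assms(8)] by simp
 also have "... = Ph T a b c (((a*.b)*.c) h t)"
 using assms by (simp add: action_mult[OF act] op3_it_De)
 finally show ?thesis .
qed

lemma Phi_eqv: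
 assumes "lact T a" "lact T b" "lact T c" "com T a b" "com T a c" "com T b c" "t<:T"
 "h<:H"
 shows "((a*.b)*.c) h (Phi T a b c t) = Phi T a b c ((a*.(b*.c)) h t)"
 using Ph_eqv[OF assms(1-6) _ assms(8), of "Phi T a b c t"] assms
 by (metis Ph_Phi op3_cl phi_inv_cl lact_diag com_diag_l com_diag_r diag_cl)

end

end

section \<open>Naturality of the associator and the pentagon\<close>

context quasi_hopf_algebra
begin

text \<open>A linear map that intertwines each leg passes through the Sweedler sum. Nearly every
  later step that moves a map past an associator is an instance.\<close>

lemma op3_nat:
 assumes "md K T" "md K U" "lact T a" "lact T b" "lact T c" "com T b c"
 and u: "u : Lin K T U"
 and "eqv T U u a a'" "eqv T U u b b'" "eqv T U u c c'"
 and "x<:(H3 K H)" "t<:T"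
 shows "u (op3 T x a b c t) = op3 U x a' b' c' (u t)"
 unfolding op3_def
proof (rule tact_nat[where rh' = a' and sg' = "tact U b' c'",
 OF alg_H alg_H2 assms(1,3) act_tact[OF alg_H alg_H assms(1,4-6)] assms(2) u _ _ assms(11,12)])
 show "u (tact T b c y s) = tact U b' c' y (u s)"
 if "y<:HH" "s<:T" for y s
 by (rule tact_nat[where rh' = b' and sg' = c', OF alg_H alg_H assms(1,4,5,2) u _ _ that])
 (simp_all only: eqvD[OF assms(9)] eqvD[OF assms(10)])
qed (simp only: eqvD[OF assms(8)])

lemma eqv_diag:
 assumes "md K T" "md K U" "lact T a" "lact T b"
 and u: "u : Lin K T U"
 and "eqv T U u a a'" "eqv T U u b b'"
 shows "eqv T U u (dg T a b) (dg U a' b')"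
 unfolding eqv_def dg_def
proof (intro ballI)
 fix h t assume h: "h<:H" and t: "t<:T"
 show "u (tact T a b (comul H h) t) = tact U a' b' (comul H h) (u t)"
 by (rule tact_nat[where rh' = a' and sg' = b', OF alg_H alg_H assms(1,3,4,2) u _ _ De_cl[OF h] t])
 (simp_all only: eqvD[OF assms(6)] eqvD[OF assms(7)])
qed

lemma eqv_comp:
 assumes "eqv T U u a b" "eqv U V v b c" "u : Lin K T U"
 shows "eqv T V (%t. v (u t)) a c"
 using assms lcl[OF assms(3)] by (simp add: eqv_def)

lemma eqv_triv:
 assumes "u : Lin K T U"
 shows "eqv T U u (triv T) (triv U)"
 using linear_maps_smult[OF assms] by (simp add: eqv_def triv_def)

definition op4 where
 "op4 T a b c d = tact T a (%y. op3 T y b c d)"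

context
 fixes T
 assumes T [simp]: "md K T"
begin

interpretation T: module K T by (rule T)

abbreviation diagT' (infixr "*." 75)
 where "a*.b \<equiv> dg T a b"

lemma Ph_lin_im:
 assumes "lact T a" "lact T b" "lact T c" "com T a b" "com T a c" "com T b c" "t<:T"
 and "u : Lin K T U" "md K U" "x<:(H3 K H)"
 shows "u (op3 T x a b c t) = sw3 U x (%p q r. u (a p (b q (c r t))))"
 unfolding op3_sw3[OF T assms(1-3,10,7)]
 using assms
 by (intro sw3_lin_im) (simp_all add: action_closed[of K H T])

context
 fixes a b c d
 assumes L: "legs T [a, b, c, d]"
begin

lemma legs4 [simp]:
 "lact T a" "lact T b" "lact T c" "lact T d"
 "com T a b" "com T a c" "com T a d" "com T b c" "com T b d" "com T c d"
 "com T b a" "com T c a" "com T d a" "com T c b" "com T d b" "com T d c"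
 using L by simp_all

lemma act4: "action K (H4 K H) T (op4 T a b c d)"
proof -
 have "commuting (H3 K H) H T (%x. op3 T x b c d) a"
 using com_tact_l[OF alg_H alg_H2 T, of b "tact T c d" H a]
 com_tact_l[OF alg_H alg_H T, of c d H a] act_tact[OF alg_H alg_H T, of c d]
 by (simp add: op3_def[abs_def])
 then show ?thesis
 unfolding op4_def[abs_def]
 by (intro act_tact[OF alg_H alg_H3 T _ act3[OF T] com_sym]) simp_all
qed

lemma op4_pure:
 assumes "p<:H" "q<:H" "r<:H" "s<:H" "t<:T"
 shows "op4 T a b c d (t4 K H p q r s) t = a p (b q (c r (d s t)))"
proof -
 have "op4 T a b c d (t4 K H p q r s) t = a p (op3 T (t3 K H q r s) b c d t)"
 unfolding op4_def
 using assms by (intro tact_pure[OF alg_H alg_H3 T]) (auto intro!: action_bilin act3[OF T] simp: pure_ten_cl)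
 then show ?thesis
 using assms by (simp add: op3_pure[OF T] tact_pure'[OF T] pure_ten_cl)
qed

lemma op4_lin: "t<:T ==> (%x. op4 T a b c d x t) : Lin K (H4 K H) T"
 by (rule bilin_left[OF action_bilin[OF act4]])

lemma op4_sw3:
 assumes "t<:T" "!!p q r. [|p<:H; q<:H; r<:H|] ==> f p q r<:(H4 K H)"
 and "!!p q r. [|p<:H; q<:H; r<:H|] ==> op4 T a b c d (f p q r) t = g p q r"
 shows "op4 T a b c d (sw3 (H4 K H) (reassoc H) f) t = sw3 T (reassoc H) g"
 using sw3_lin_im[OF op4_lin[OF assms(1)] mod_H4 T assms(2) phi_cl]
 sw3_cong[OF assms(3) phi_cl] by simp

lemma op4_De_cl:
 assumes "x<:H" "!!p q. [|p<:H; q<:H|] ==> f p q<:(H4 K H)"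
 shows "sw (H4 K H) (comul H x) f<:(H4 K H)"
 by (rule sw_cl[OF mod_H mod_H module.axioms(2)[OF mod_H4] assms(2) De_cl[OF assms(1)]])

lemma op4_De:
 assumes "t<:T" "x<:H"
 "!!p q. [|p<:H; q<:H|] ==> f p q<:(H4 K H)"
 and "!!p q. [|p<:H; q<:H|] ==> op4 T a b c d (f p q) t = g p q"
 shows "op4 T a b c d (sw (H4 K H) (comul H x) f) t = sw T (comul H x) g"
 using sw_lin_im[OF mod_H mod_H op4_lin[OF assms(1)] mod_H4 T assms(3) De_cl[OF assms(2)]]
 sw_cong[OF mod_H mod_H assms(4) De_cl[OF assms(2)]] by simp

text \<open>Both sides are the action of the pentagon axiom in the fourfold tensor power;
  \<open>e1\<close> to \<open>e5\<close> identify its five factors with associators of (partly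
  composite) legs.\<close>

lemma Ph_pent:
 assumes t: "t<:T"
 shows "Ph T a b (c*.d) (Ph T (a*.b) c d t) = Ph T b c d (Ph T a (b*.c) d (Ph T a b c t))"
proof -
 note [simp] = pure_ten_cl action_closed[of K H T] op4_pure
 have e1: "op4 T a b c d (sw3 (H4 K H) (reassoc H)
 (%p q r. sw (H4 K H) (comul H r) (%r1 r2. t4 K H p q r1 r2))) t = Ph T a b (c*.d) t"
 if "t<:T" for t
 proof -
 have "a p (b q ((c*.d) r t)) = sw T (comul H r) (%r1 r2. a p (b q (c r1 (d r2 t))))"
 if "p<:H" "q<:H" "r<:H" for p q r
 unfolding diag_sw[OF T] using that \<open>t<:T\<close>
 by (intro sw_lin_im[OF mod_H mod_H, where u = "%s. a p (b q s)"]
 linc[OF action_linear action_linear]) simp_all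
 then show ?thesis
 using that by (subst op3_sw3[OF T]) (auto intro!: op4_sw3 op4_De op4_De_cl)
 qed
 have e2: "op4 T a b c d (sw3 (H4 K H) (reassoc H)
 (%p q r. sw (H4 K H) (comul H p) (%p1 p2. t4 K H p1 p2 q r))) t = Ph T (a*.b) c d t"
 if "t<:T" for t
 using that by (subst op3_sw3[OF T])
 (auto intro!: op4_sw3 op4_De op4_De_cl simp: diag_sw[OF T, of a])
 have e3: "op4 T a b c d (sw3 (H4 K H) (reassoc H)
 (%p q r. sw (H4 K H) (comul H q) (%q1 q2. t4 K H p q1 q2 r))) t = Ph T a (b*.c) d t"
 if "t<:T" for t
 proof -
 have "a p ((b*.c) q (d r t)) = sw T (comul H q) (%q1 q2. a p (b q1 (c q2 (d r t))))"
 if "p<:H" "q<:H" "r<:H" for p q r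
 unfolding diag_sw[OF T] using that \<open>t<:T\<close>
 by (intro sw_lin_im[OF mod_H mod_H, where u = "%s. a p s"] action_linear) simp_all
 then show ?thesis
 using that by (subst op3_sw3[OF T]) (auto intro!: op4_sw3 op4_De op4_De_cl)
 qed
 have e4: "op4 T a b c d (sw3 (H4 K H) (reassoc H) (%p q r. t4 K H p q r 1[H])) t = Ph T a b c t"
 if "t<:T" for t
 using that by (subst op3_sw3[OF T]) (auto intro!: op4_sw3 simp: action_one[of K H T])
 have e5: "op4 T a b c d (pt H (H3 K H) 1[H] (reassoc H)) t = Ph T b c d t"
 if "t<:T" for t
 using that unfolding op4_def
 by (subst tact_pure[OF alg_H alg_H3 T])
 (auto intro!: action_bilin act3[OF T] simp: action_one[of K H T])
 have c1: "sw3 (H4 K H) (reassoc H) f<:(H4 K H)"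
 if "!!p q r. [|p<:H; q<:H; r<:H|] ==> f p q r<:(H4 K H)" for f
 unfolding sw3_def
 by (intro sw_cl[OF mod_H mod_H2] sw_cl[OF mod_H mod_H] module.axioms(2)[OF mod_H4]
 phi_cl that)
 interpret H4: k_algebra K "H4 K H" by (rule alg_H4)
 show ?thesis
 using arg_cong[OF pentagon, of "%x. op4 T a b c d x t"] t
 by (simp add: action_mult[OF act4] c1 op4_De_cl e1 e2 e3 e4 e5)
qed

end

end

declare legs4 [simp del]

end

section \<open>Unit constraints\<close>

context quasi_hopf_algebra
begin

context
 fixes T
 assumes T [simp]: "md K T"
begin

interpretation T: module K T by (rule T)

abbreviation diagT'' (infixr "*." 75)
 where "a*.b \<equiv> dg T a b"

text \<open>The triangle axiom as the middle unit constraint: a trivial middle leg turns the second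
  component of \<phi> into a scalar.\<close>

lemma Ph_triv2 [simp]:
 assumes "lact T a" "lact T c" "com T a c" "t<:T"
 shows "Ph T a (triv T) c t = t" "Phi T a (triv T) c t = t"
proof -
 note act = act_tact[OF alg_H alg_H T assms(1-3)]
 note lin = bilin_left[OF action_bilin[OF act] assms(4)]
 have "t = tact T a c (sw3 HH (reassoc H) (%p q r. counit H q *[HH] t2 K H p r)) t"
 using action_one[OF act assms(4)] by (simp add: triangle)
 also have "... = sw3 T (reassoc H) (%p q r. tact T a c (counit H q *[HH] t2 K H p r) t)"
 by (rule sw3_lin_im[OF lin mod_H2 T _ phi_cl]) (simp add: pure_ten_cl)
 also have "... = sw3 T (reassoc H) (%p q r. a p (triv T q (c r t)))"
 by (rule sw3_cong[OF _ phi_cl])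
 (simp add: pure_ten_cl triv_def bilin_smult_left[OF action_bilin[OF act]]
 tact_pure'[OF T] action_closed[of K H T] linear_maps_smult[OF action_linear[OF assms(1)]] assms)
 also have "... = Ph T a (triv T) c t"
 using assms by (simp add: op3_sw3[OF T])
 finally show "Ph T a (triv T) c t = t" by simp
 then show "Phi T a (triv T) c t = t"
 using Ph_Phi(2)[OF T, of a "triv T" c t] assms by simp
qed

text \<open>In \<open>op3\<close> the third leg acts on \<open>t\<close> first and can be replaced
  at once; the other two must be moved next to \<open>t\<close> by commutation.\<close>

lemma at_op3:
 assumes "lact T a" "lact T b" "lact T c" "x<:(H3 K H)" "t<:T"
 shows at_op3_3: "[|lact T c'; eq_at t c c'|] ==> op3 T x a b c t = op3 T x a b c' t"
 and at_op3_2: "[|lact T b'; eq_at t b b'; com T b c; com T b' c|] ==> op3 T x a b c t = op3 T x a b' c t"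
 and at_op3_1: "[|lact T a'; eq_at t a a'; com T a b; com T a c; com T b c; com T a' b; com T a' c|]
 ==> op3 T x a b c t = op3 T x a' b c t"
proof -
 note [simp] = action_closed[of K H T] assms
 show "op3 T x a b c t = op3 T x a b c' t" if c': "lact T c'" "eq_at t c c'"
 proof -
 have "c h t = c' h t" if "h<:H" for h
 using c'(2) that by (simp add: eq_at_def)
 then show ?thesis
 using c'(1) by (simp only: op3_sw3[OF T] assms) (rule sw3_cong[OF _ assms(4)], simp)
 qed
 show "op3 T x a b c t = op3 T x a b' c t" if b': "lact T b'" "eq_at t b b'" "com T b c" "com T b' c"
 proof -
 have "b q (c r t) = b' q (c r t)" if "q<:H" "r<:H" for q r
 using b'(2) that by (simp only: eq_at_def commutingD[OF b'(3)] commutingD[OF b'(4)] assms)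
 then show ?thesis
 using b'(1) by (simp only: op3_sw3[OF T] assms) (rule sw3_cong[OF _ assms(4)], simp)
 qed
 show "op3 T x a b c t = op3 T x a' b c t"
 if a': "lact T a'" "eq_at t a a'" "com T a b" "com T a c" "com T b c" "com T a' b" "com T a' c"
 proof -
 have "a p (b q (c r t)) = a' p (b q (c r t))"
 if "p<:H" "q<:H" "r<:H" for p q r
 using a'(2) that by (simp only: eq_at_def commutingD[OF a'(3)] commutingD[OF a'(4)]
 commutingD[OF a'(6)] commutingD[OF a'(7)] assms action_closed[OF assms(3)])
 then show ?thesis
 using a'(1) by (simp only: op3_sw3[OF T] assms) (rule sw3_cong[OF _ assms(4)], simp)
 qed
qed

lemma at_diag:
 assumes "lact T a" "lact T b" "t<:T"
 shows at_diag_right: "eq_at t b b' ==> eq_at t (a*.b) (a*.b')"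
 and at_diag_left: "[|lact T a'; eq_at t a a'; com T a b; com T a' b|] ==> eq_at t (a*.b) (a'*.b)"
proof -
 show "eq_at t (a*.b) (a*.b')" if "eq_at t b b'"
 unfolding eq_at_def diag_sw[OF T]
 using that by (intro ballI sw_cong[OF mod_H mod_H]) (simp_all add: eq_at_def)
 show "eq_at t (a*.b) (a'*.b)" if "lact T a'" "eq_at t a a'" "com T a b" "com T a' b"
 unfolding eq_at_def
 proof
 fix h assume h: "h<:H"
 show "(a*.b) h t = (a'*.b) h t"
 unfolding diag_cm[OF T assms(1,2) that(3) h assms(3)]
 diag_cm[OF T that(1) assms(2) that(4) h assms(3)]
 using that(2) by (intro sw_cong[OF mod_H mod_H _ De_cl[OF h]]) (simp add: eq_at_def)
 qed
qed

lemma at_triv_diag: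
 assumes "lact T a" "lact T b" "com T a b" "t<:T"
 shows at_triv_diag_left: "eq_at t a (triv T) ==> eq_at t (a*.b) b"
 and at_triv_diag_right: "eq_at t b (triv T) ==> eq_at t (a*.b) a"
proof -
 show "eq_at t (a*.b) b" if "eq_at t a (triv T)"
 using at_diag_left[OF assms(1,2,4) _ that] assms by (simp add: eq_at_def)
 show "eq_at t (a*.b) a" if "eq_at t b (triv T)"
 using at_diag_right[OF assms(1,2,4) that] assms by (simp add: eq_at_def)
qed

text \<open>An intertwiner carries a coevaluation to a coevaluation.\<close>

lemma at_image:
 assumes "eq_at t a b" "eqv T U w a a'" "eqv T U w b b'" "t<:T"
 shows "eq_at (w t) a' b'"
 using assms unfolding eq_at_def eqv_def by metis

lemma op3_commutes:
 assumes "lact T a" "lact T b" "lact T c" "lact T d" "com T a b" "com T a c" "com T b c"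
 "com T a d" "com T b d" "com T c d" "x<:(H3 K H)"
 shows "eqv T T (op3 T x a b c) d d"
 unfolding eqv_def
proof (intro ballI)
 fix h t assume h: "h<:H" and t: "t<:T"
 have "d h (op3 T x a b c t) = op3 T x a b c (d h t)"
 by (rule op3_nat[OF T T assms(1-3,7) action_linear[OF assms(4) h] _ _ _ assms(11) t])
 (simp_all add: eqv_def commutingD[OF assms(8) _ h] commutingD[OF assms(9) _ h]
 commutingD[OF assms(10) _ h])
 then show "op3 T x a b c (d h t) = d h (op3 T x a b c t)" by simp
qed

lemma eqv_Ph [simp]:
 assumes "lact T a" "lact T b" "lact T c" "com T a b" "com T a c" "com T b c"
 shows "eqv T T (Ph T a b c) ((a*.b)*.c) (a*.(b*.c))"
 and "eqv T T (Phi T a b c) (a*.(b*.c)) ((a*.b)*.c)"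
 using assms by (simp_all add: eqv_def Ph_eqv[OF T] Phi_eqv[OF T])

lemma un_triv_diag_aux:
 assumes "u : Lin K T U" "md K U" "lact T a" "lact T b" "h<:H" "t<:T"
 shows "u ((a*.b) h t) = sw U (comul H h) (%p q. u (a p (b q t)))"
 unfolding diag_sw[OF T]
 by (rule sw_lin_im[OF mod_H mod_H assms(1) T assms(2) _ De_cl[OF assms(5)]])
 (simp add: action_closed[OF assms(3)] action_closed[OF assms(4)] assms(6))

context
 fixes U and u
 assumes U: "md K U" and u: "u : Lin K T U"
begin

text \<open>The mirror image of \<open>at_op3\<close>: here a leg has to be brought to the outside,
  where it meets \<open>u\<close>.\<close>

lemma un_op3:
 assumes "lact T a" "lact T b" "lact T c" "com T a b" "com T a c" "com T b c"
 "x<:(H3 K H)" "t<:T"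
 shows under_op3_1: "[|lact T a'; com T a' b; com T a' c; equ T u a a'|]
 ==> u (op3 T x a b c t) = u (op3 T x a' b c t)"
 and under_op3_2: "[|lact T b'; com T a b'; com T b' c; equ T u b b'|]
 ==> u (op3 T x a b c t) = u (op3 T x a b' c t)"
 and under_op3_3: "[|lact T c'; com T a c'; com T b c'; equ T u c c'|]
 ==> u (op3 T x a b c t) = u (op3 T x a b c' t)"
proof -
 note [simp] = action_closed[of K H T]
 note lin = Ph_lin_im[OF T _ _ _ _ _ _ assms(8) u U assms(7)]
 show "u (op3 T x a b c t) = u (op3 T x a' b c t)"
 if "lact T a'" "com T a' b" "com T a' c" "equ T u a a'"
 using assms that by (subst (1 2) lin) (auto simp: equ_def intro!: sw3_cong)
 show "u (op3 T x a b c t) = u (op3 T x a b' c t)"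
 if "lact T b'" "com T a b'" "com T b' c" "equ T u b b'"
 using assms that by (subst (1 2) lin)
 (auto simp: equ_def commutingD[OF assms(4)] commutingD[OF that(2)] intro!: sw3_cong)
 show "u (op3 T x a b c t) = u (op3 T x a b c' t)"
 if "lact T c'" "com T a c'" "com T b c'" "equ T u c c'"
 using assms that by (subst (1 2) lin)
 (auto simp: equ_def commutingD[OF assms(5)] commutingD[OF that(2)]
 commutingD[OF assms(6)] commutingD[OF that(3)] intro!: sw3_cong)
qed

lemma un_diag:
 assumes "lact T a" "lact T b"
 shows under_diag_left: "[|lact T a'; equ T u a a'|] ==> equ T u (a*.b) (a'*.b)"
 and under_diag_right: "[|lact T b'; equ T u b b'; com T a b; com T a b'|] ==> equ T u (a*.b) (a*.b')"
proof -
 note [simp] = action_closed[of K H T]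
 show "equ T u (a*.b) (a'*.b)" if "lact T a'" "equ T u a a'"
 using assms that by (auto simp: equ_def un_triv_diag_aux[OF u U] intro!: sw_cong[OF mod_H mod_H])
 show "equ T u (a*.b) (a*.b')" if "lact T b'" "equ T u b b'" "com T a b" "com T a b'"
 using assms that
 by (auto simp: equ_def un_triv_diag_aux[OF u U] commutingD[OF that(3)]
 commutingD[OF that(4)] intro!: sw_cong[OF mod_H mod_H])
qed

lemma un_triv_diag:
 assumes "lact T a" "lact T b" "com T a b"
 shows under_triv_diag_left: "equ T u a (triv T) ==> equ T u (a*.b) b"
 and under_triv_diag_right: "equ T u b (triv T) ==> equ T u (a*.b) a"
proof -
 show "equ T u (a*.b) b" if "equ T u a (triv T)"
 using under_diag_left[OF assms(1,2) _ that] assms by (simp add: equ_def)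
 show "equ T u (a*.b) a" if "equ T u b (triv T)"
 using under_diag_right[OF assms(1,2) _ that] assms by (simp add: equ_def)
qed

end

lemma un_comp:
 assumes "equ T u a b" "eqv T T w a a" "eqv T T w b b" "w : Lin K T T"
 shows "equ T (%t. u (w t)) a b"
 using assms lcl[OF assms(4)] by (simp add: equ_def eqv_def)

text \<open>Kelly's argument: the pentagon with two unit legs, together with the middle unit
  constraint, forces this constraint to be the identity.\<close>

lemma Ph_triv1 [simp]:
 assumes "lact T b" "lact T c" "com T b c" "t<:T"
 shows "Ph T (triv T) b c t = t" "Phi T (triv T) b c t = t"
proof -
 let ?i = "triv T"
 note [simp] = com_sym[OF assms(3)]
 have "Ph T ?i b c s = s" if s: "s<:T" for s
 proof -
 \<comment> \<open>With this preimage one of the associators in the pentagon produces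
   \<open>s\<close> itself.\<close>
 let ?t = "Phi T ?i b c s"
 have t: "?t<:T"
 using assms s by simp
 have "Ph T ?i (?i*.b) c ?t = Ph T ?i b c ?t"
 using assms t by (intro at_op3_2) (simp_all add: eq_at_def)
 then have "Ph T ?i b c s = Ph T ?i b c (Ph T ?i (?i*.b) c (Ph T ?i ?i b ?t))"
 using assms s t by simp
 also have "... = Ph T ?i ?i (b*.c) (Ph T (?i*.?i) b c ?t)"
 using assms t by (subst Ph_pent[OF T]) simp_all
 also have "... = Ph T (?i*.?i) b c ?t"
 using assms t by simp
 also have "... = Ph T ?i b c ?t"
 using assms t by (intro at_op3_1) (simp_all add: eq_at_def)
 also have "... = s"
 using assms s by simp
 finally show ?thesis .
 qed
 then show "Ph T (triv T) b c t = t" "Phi T (triv T) b c t = t"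
 using assms Ph_Phi(2)[OF T, of "triv T" b c t] by simp_all
qed

text \<open>Here the pentagon makes the associator idempotent; being invertible, it is the
  identity.\<close>

lemma Ph_triv3 [simp]:
 assumes "lact T a" "lact T b" "com T a b" "t<:T"
 shows "Ph T a b (triv T) t = t" "Phi T a b (triv T) t = t"
proof -
 let ?i = "triv T"
 note [simp] = com_sym[OF assms(3)]
 have "Ph T a b ?i s = s" if s: "s<:T" for s
 proof -
 have cl: "Ph T a b ?i s<:T"
 using assms s by simp
 have "Ph T a b ?i (Ph T a b ?i s) = Ph T a (b*.?i) ?i (Ph T a b ?i s)"
 using assms cl by (intro at_op3_2) (simp_all add: eq_at_def)
 also have "... = Ph T b ?i ?i (Ph T a (b*.?i) ?i (Ph T a b ?i s))"
 using assms s by simp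
 also have "... = Ph T a b (?i*.?i) (Ph T (a*.b) ?i ?i s)"
 using assms s by (subst Ph_pent[OF T]) simp_all
 also have "... = Ph T a b (?i*.?i) s"
 using assms s by simp
 also have "... = Ph T a b ?i s"
 using assms s by (intro at_op3_3) (simp_all add: eq_at_def)
 finally have "Phi T a b ?i (Ph T a b ?i (Ph T a b ?i s)) = Phi T a b ?i (Ph T a b ?i s)"
 by simp
 then show ?thesis
 using assms s cl by simp
 qed
 then show "Ph T a b (triv T) t = t" "Phi T a b (triv T) t = t"
 using assms Ph_Phi(2)[OF T, of a b "triv T" t] by simp_all
qed

text \<open>A leg that is trivial at \<open>t\<close> may be replaced by the unit object, whose
  constraints are identities. This strikes associators out of the pentagon in the coherence lemmas
  below.\<close>

lemma Ph_at_triv: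
 assumes "lact T a" "lact T b" "lact T c" "com T a b" "com T a c" "com T b c" "t<:T"
 shows "eq_at t a (triv T) ==> Ph T a b c t = t" "eq_at t a (triv T) ==> Phi T a b c t = t"
 and "eq_at t b (triv T) ==> Ph T a b c t = t" "eq_at t b (triv T) ==> Phi T a b c t = t"
 and "eq_at t c (triv T) ==> Ph T a b c t = t" "eq_at t c (triv T) ==> Phi T a b c t = t"
proof -
 note r = at_op3[OF assms(1-3) _ assms(7)] and [simp] = assms
 show "Ph T a b c t = t" "Phi T a b c t = t" if "eq_at t a (triv T)"
 by (simp_all only: r(3)[OF _ lact_triv[OF T] that] phi_cl phi_inv_cl assms
 triv_com T Ph_triv1)
 show "Ph T a b c t = t" "Phi T a b c t = t" if "eq_at t b (triv T)"
 by (simp_all only: r(2)[OF _ lact_triv[OF T] that] phi_cl phi_inv_cl assms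
 triv_com T Ph_triv2)
 show "Ph T a b c t = t" "Phi T a b c t = t" if "eq_at t c (triv T)"
 by (simp_all only: r(1)[OF _ lact_triv[OF T] that] phi_cl phi_inv_cl assms
 triv_com T Ph_triv3)
qed

lemma Ph_un_triv:
 assumes "u : Lin K T U" "md K U"
 and "lact T a" "lact T b" "lact T c" "com T a b" "com T a c" "com T b c" "t<:T"
 shows "equ T u a (triv T) ==> u (Ph T a b c t) = u t"
 and "equ T u a (triv T) ==> u (Phi T a b c t) = u t"
 and "equ T u b (triv T) ==> u (Ph T a b c t) = u t"
 and "equ T u b (triv T) ==> u (Phi T a b c t) = u t"
 and "equ T u c (triv T) ==> u (Ph T a b c t) = u t"
 and "equ T u c (triv T) ==> u (Phi T a b c t) = u t"
proof -
 note r = un_op3[OF assms(2,1) assms(3-8) _ assms(9) lact_triv[OF T]]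
 show "u (Ph T a b c t) = u t" "u (Phi T a b c t) = u t" if "equ T u a (triv T)"
 by (simp_all only: r(1)[OF _ _ _ that] phi_cl phi_inv_cl assms
 triv_com T Ph_triv1)
 show "u (Ph T a b c t) = u t" "u (Phi T a b c t) = u t" if "equ T u b (triv T)"
 by (simp_all only: r(2)[OF _ _ _ that] phi_cl phi_inv_cl assms
 triv_com T Ph_triv2)
 show "u (Ph T a b c t) = u t" "u (Phi T a b c t) = u t" if "equ T u c (triv T)"
 by (simp_all only: r(3)[OF _ _ _ that] phi_cl phi_inv_cl assms
 triv_com T Ph_triv3)
qed

end

end

section \<open>Consequences of the pentagon\<close>

context quasi_hopf_algebra
begin

context
 fixes T
 assumes T [simp]: "md K T"
begin

interpretation T: module K T by (rule T)

abbreviation diagT6 (infixr "*." 75)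
 where "a*.b \<equiv> dg T a b"

lemma op3_cm:
 assumes "lact T a" "lact T b" "lact T c" "lact T d" "lact T e" "lact T f"
 "com T a b" "com T a c" "com T b c" "com T d e" "com T d f" "com T e f"
 "com T a d" "com T b d" "com T c d" "com T a e" "com T b e" "com T c e"
 "com T a f" "com T b f" "com T c f"
 "x<:(H3 K H)" "y<:(H3 K H)" "t<:T"
 shows "op3 T x a b c (op3 T y d e f t) = op3 T y d e f (op3 T x a b c t)"
 using assms by (intro op3_nat[OF T T] op3_commutes[OF T]) simp_all

context
 fixes a b c d e
 assumes L: "legs T [a, b, c, d, e]"
begin

text \<open>Reassociating inside one composite leg commutes with the associator of the outer legs;
  the digit in the name is the position of the composite leg.\<close>

lemma nat_Ph:
 assumes "x<:(H3 K H)" "t<:T"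
 shows nat1_Ph: "Ph T a b c (op3 T x ((a*.b)*.c) d e t) = op3 T x (a*.(b*.c)) d e (Ph T a b c t)"
 and nat2_Ph: "Ph T a b c (op3 T x d ((a*.b)*.c) e t) = op3 T x d (a*.(b*.c)) e (Ph T a b c t)"
 and nat3_Ph: "Ph T a b c (op3 T x d e ((a*.b)*.c) t) = op3 T x d e (a*.(b*.c)) (Ph T a b c t)"
 and nat1_Phi: "Phi T a b c (op3 T x (a*.(b*.c)) d e t) = op3 T x ((a*.b)*.c) d e (Phi T a b c t)"
 and nat2_Phi: "Phi T a b c (op3 T x d (a*.(b*.c)) e t) = op3 T x d ((a*.b)*.c) e (Phi T a b c t)"
 and nat3_Phi: "Phi T a b c (op3 T x d e (a*.(b*.c)) t) = op3 T x d e ((a*.b)*.c) (Phi T a b c t)"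
proof -
 note [simp] = L[simplified] assms
 note com = op3_commutes[OF T, where a = a and b = b and c = c]
 show "Ph T a b c (op3 T x ((a*.b)*.c) d e t) = op3 T x (a*.(b*.c)) d e (Ph T a b c t)"
 by (rule op3_nat[OF T T]) (simp_all add: eqv_Ph com)
 show "Ph T a b c (op3 T x d ((a*.b)*.c) e t) = op3 T x d (a*.(b*.c)) e (Ph T a b c t)"
 by (rule op3_nat[OF T T]) (simp_all add: eqv_Ph com)
 show "Ph T a b c (op3 T x d e ((a*.b)*.c) t) = op3 T x d e (a*.(b*.c)) (Ph T a b c t)"
 by (rule op3_nat[OF T T]) (simp_all add: eqv_Ph com)
 show "Phi T a b c (op3 T x (a*.(b*.c)) d e t) = op3 T x ((a*.b)*.c) d e (Phi T a b c t)"
 by (rule op3_nat[OF T T]) (simp_all add: eqv_Ph com)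
 show "Phi T a b c (op3 T x d (a*.(b*.c)) e t) = op3 T x d ((a*.b)*.c) e (Phi T a b c t)"
 by (rule op3_nat[OF T T]) (simp_all add: eqv_Ph com)
 show "Phi T a b c (op3 T x d e (a*.(b*.c)) t) = op3 T x d e ((a*.b)*.c) (Phi T a b c t)"
 by (rule op3_nat[OF T T]) (simp_all add: eqv_Ph com)
qed

end

text \<open>Two consequences of the pentagon for a vector that is invariant under two of the legs, such as
 one created by \<open>be\<close>.\<close>

lemma coev_shift_r:
 assumes L: "legs T [z, v, l, r]" and t: "t<:T" and ct: "eq_at t (l*.r) (triv T)"
 shows "Phi T z (v*.l) r (Phi T v l r t) = Ph T z v l (Phi T (z*.v) l r t)"
proof -
 note [simp] = L[simplified] t
 let ?s = "Phi T (z*.v) l r t"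
 have "Ph T v l r (Ph T z (v*.l) r (Ph T z v l ?s)) = Ph T z v (l*.r) (Ph T (z*.v) l r ?s)"
 by (rule Ph_pent[OF T, symmetric]) simp_all
 also have "... = t"
 by (simp add: Ph_at_triv(5)[OF T] ct)
 finally have "Phi T z (v*.l) r (Phi T v l r (Ph T v l r (Ph T z (v*.l) r (Ph T z v l ?s))))
 = Phi T z (v*.l) r (Phi T v l r t)"
 by simp
 then show ?thesis by simp
qed

lemma coev_shift_l:
 assumes L: "legs T [w, l, r, z]" and t: "t<:T" and ct: "eq_at t (l*.r) (triv T)"
 shows "Ph T (w*.l) r z (Phi T w l r t) = Phi T w l (r*.z) (Ph T l r z t)"
proof -
 note [simp] = L[simplified] t
 let ?s = "Phi T w l r t"
 have "Ph T w l (r*.z) (Ph T (w*.l) r z ?s) = Ph T l r z (Ph T w (l*.r) z (Ph T w l r ?s))"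
 by (rule Ph_pent[OF T]) simp_all
 also have "... = Ph T l r z t"
 by (simp add: Ph_at_triv(3)[OF T] ct)
 finally have "Phi T w l (r*.z) (Ph T w l (r*.z) (Ph T (w*.l) r z ?s)) = Phi T w l (r*.z) (Ph T l r z t)"
 by simp
 then show ?thesis by simp
qed

lemma at_op3_cm:
 assumes "eq_at t d d'" "lact T a" "lact T b" "lact T c" "lact T d" "lact T d'" "com T a b" "com T a c"
 "com T b c" "com T a d" "com T b d" "com T c d" "com T a d'" "com T b d'" "com T c d'"
 "x<:(H3 K H)" "t<:T"
 shows "eq_at (op3 T x a b c t) d d'"
 using assms by (intro at_image[where U = T, OF T assms(1)] op3_commutes[OF T]) simp_all

lemma un_op3_cm:
 assumes "equ T u d d'" "lact T a" "lact T b" "lact T c" "lact T d" "lact T d'" "com T a b"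
 "com T a c" "com T b c" "com T a d" "com T b d" "com T c d" "com T a d'" "com T b d'" "com T c d'"
 "x<:(H3 K H)"
 shows "equ T (%t. u (op3 T x a b c t)) d d'"
 using assms by (intro un_comp[OF T assms(1)] op3_commutes[OF T]) simp_all

section \<open>Snake identities under an evaluating map\<close>

context
 fixes U and u
 assumes U [simp]: "md K U" and u [simp]: "u : Lin K T U"
begin

lemma comp_op3_lin:
 assumes "lact T a" "lact T b" "lact T c" "com T a b" "com T a c" "com T b c" "x<:(H3 K H)"
 "v : Lin K T U"
 shows "(%t. v (op3 T x a b c t)) : Lin K T U"
 using assms by (intro linc[OF op3_lin[OF T]])

lemmas comp_op3_linear1 [simp] = comp_op3_lin[where v = u, OF _ _ _ _ _ _ _ u]

lemma comp_op3_linear2 [simp]: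
 assumes "legs T [a, b, c]" "legs T [d, e, f]" "x<:(H3 K H)" "y<:(H3 K H)"
 shows "(%t. u (op3 T x a b c (op3 T y d e f t))) : Lin K T U"
 using assms by (intro comp_op3_lin[where v = "%t. u (op3 T x a b c t)"]) simp_all

lemma comp_op3_linear3 [simp]:
 assumes "legs T [a, b, c]" "legs T [d, e, f]" "legs T [a', b', c']"
 "x<:(H3 K H)" "y<:(H3 K H)" "z<:(H3 K H)"
 shows "(%t. u (op3 T x a b c (op3 T y d e f (op3 T z a' b' c' t)))) : Lin K T U"
 using assms by (intro comp_op3_lin[where v = "%t. u (op3 T x a b c (op3 T y d e f t))"]) simp_all

text \<open>A coevaluation of \<open>l\<close> with \<open>r'\<close> is followed by an evaluation
  of \<open>r\<close> against \<open>l\<close>; the spectator \<open>y\<close> drops out of the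
  resulting snake.\<close>

lemma coll_shift_r:
 assumes L: "legs T [y, r, l, r']" and t [simp]: "t<:T"
 and "equ T u (r*.l) (triv T)" "eq_at t (l*.r') (triv T)"
 shows "u (Ph T y r l (Phi T (y*.r) l r' t)) = u (Phi T r l r' t)"
proof -
 note [simp] = L[simplified]
 show ?thesis
 using assms(3) by (subst coev_shift_r[symmetric]) (simp_all add: Ph_un_triv(4)[OF T u U] assms(4))
qed

text \<open>The snake with its spectator \<open>w\<close> on the left and the other
  orientation.\<close>

lemma coll_shift_l:
 assumes L: "legs T [w, l, r, z]" and t [simp]: "t<:T"
 and "equ T u (r*.z) (triv T)" "eq_at t (l*.r) (triv T)"
 shows "u (Ph T (w*.l) r z (Phi T w l r t)) = u (Ph T l r z t)"
proof -
 note [simp] = L[simplified]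
 show ?thesis
 using assms(3) by (subst coev_shift_l) (simp_all add: Ph_un_triv(6)[OF T u U] assms(4))
qed

text \<open>Two evaluations and one coevaluation strike three of the five associators from the
  pentagon. The two that remain are the two ways of contracting the zigzag.\<close>

lemma zigzag_swap:
 assumes L: "legs T [a, b, c, w]" and t [simp]: "t<:T"
 and cu: "equ T u (a*.b) (triv T)" "equ T u (c*.w) (triv T)"
 and ct: "eq_at t (b*.c) (triv T)"
 shows "u (Phi T a b c t) = u (Ph T b c w t)"
proof -
 note [simp] = L[simplified]
 let ?s = "Phi T a b c t"
 have "u ?s = u (Ph T a b (c*.w) (Ph T (a*.b) c w ?s))"
 using cu by (simp add: Ph_un_triv(5)[OF T u U] Ph_un_triv(1)[OF T u U])
 also have "... = u (Ph T b c w (Ph T a (b*.c) w (Ph T a b c ?s)))"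
 by (subst Ph_pent[OF T]) simp_all
 also have "... = u (Ph T b c w t)"
 using ct by (simp add: Ph_at_triv(3)[OF T])
 finally show ?thesis .
qed

text \<open>Nested evaluations undo nested coevaluations: what is left is one reassociation on
  \<open>b c f\<close> and one on \<open>a d e\<close>. This is the coherence behind
  \<open>twist_f_twist_g\<close>.\<close>

lemma double_dual_r:
 assumes L: "legs T [a, b, c, d, e, f]" and t [simp]: "t<:T"
 and cu: "equ T u (b*.c) (triv T)"
 and ct: "eq_at t (c*.f) (triv T)" "eq_at t (d*.e) (triv T)"
 shows "u (Phi T b c d (Ph T a b (c*.d) (Phi T (a*.b) (c*.d) e (Phi T c d e (Phi T (a*.b) c f t)))))
 = u (Phi T a d e (Phi T b c f t))"
proof -
 note [simp] = L[simplified]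
 let ?t1 = "Phi T (a*.b) c f t"
 let ?X = "Phi T ((a*.b)*.c) d e ?t1"
 have "eq_at ?t1 (d*.e) (triv T)"
 by (rule at_op3_cm[OF ct(2)]) simp_all
 then have "Phi T (a*.b) (c*.d) e (Phi T c d e ?t1) = Ph T (a*.b) c d ?X"
 by (intro coev_shift_r) simp_all
 then have "u (Phi T b c d (Ph T a b (c*.d) (Phi T (a*.b) (c*.d) e (Phi T c d e ?t1))))
 = u (Phi T b c d (Ph T a b (c*.d) (Ph T (a*.b) c d ?X)))"
 by simp
 also have "... = u (Ph T a (b*.c) d (Ph T a b c ?X))"
 by (subst Ph_pent[OF T]) simp_all
 also have "... = u (Ph T a b c ?X)"
 using cu by (simp add: Ph_un_triv(3)[OF T u U])
 also have "... = u (Phi T (a*.(b*.c)) d e (Ph T a b c ?t1))"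
 by (subst nat1_Ph) simp_all
 also have "... = u (Phi T a d e (Ph T a b c ?t1))"
 using cu by (intro under_op3_1[OF T U u] under_triv_diag_right[OF T U u]) simp_all
 also have "Ph T a b c ?t1 = Phi T a (b*.c) f (Phi T b c f t)"
 using ct(1) by (intro coev_shift_r[symmetric]) simp_all
 also have "u (Phi T a d e (Phi T a (b*.c) f (Phi T b c f t))) = u (Phi T a d e (Phi T b c f t))"
 by (rule Ph_un_triv(4)[OF T _ U, where u = "%t. u (Phi T a d e t)"])
 (simp_all add: un_op3_cm[OF cu])
 finally show ?thesis .
qed

text \<open>The evaluation of \<open>q\<close> against \<open>c d\<close> absorbs the associators
  around it, and only the snake on \<open>d e d'\<close> survives.\<close>

lemma double_dual_l_aux:
 assumes L: "legs T [q, c, d, e, d']" and t [simp]: "t<:T"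
 and cu: "equ T u (q*.(c*.d)) (triv T)" "equ T u (e*.d') (triv T)"
 and ct: "eq_at t (d*.e) (triv T)"
 shows "u (Phi T q (c*.d) e (Phi T c d e (Phi T q c d' t))) = u (Ph T d e d' t)"
proof -
 note [simp] = L[simplified]
 let ?X = "Phi T q c d' t"
 let ?Z = "Phi T c d e ?X"
 let ?Y = "Phi T q (c*.d) e ?Z"
 have "u ?Y = u (Ph T q (c*.d) (e*.d') (Ph T (q*.(c*.d)) e d' ?Y))"
 using cu by (simp add: Ph_un_triv(5)[OF T u U] Ph_un_triv(1)[OF T u U])
 also have "... = u (Ph T (c*.d) e d' (Ph T q ((c*.d)*.e) d' ?Z))"
 by (subst Ph_pent[OF T]) simp_all
 also have "Ph T q ((c*.d)*.e) d' ?Z = Phi T c d e (Ph T q (c*.(d*.e)) d' ?X)"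
 by (rule nat2_Phi[symmetric]) simp_all
 also have "eq_at ?X (d*.e) (triv T)"
 by (rule at_op3_cm[OF ct]) simp_all
 then have "Ph T q (c*.(d*.e)) d' ?X = Ph T q c d' ?X"
 by (intro at_op3_2[OF T] at_triv_diag_right[OF T]) simp_all
 then have "Ph T q (c*.(d*.e)) d' ?X = t"
 by simp
 also have "Ph T (c*.d) e d' (Phi T c d e t) = Phi T c d (e*.d') (Ph T d e d' t)"
 by (rule coev_shift_l[OF _ _ ct]) simp_all
 also have "u ... = u (Ph T d e d' t)"
 using cu by (simp add: Ph_un_triv(6)[OF T u U])
 finally show ?thesis .
qed

text \<open>Contracting \<open>f\<close> with \<open>c'\<close> isolates the snake
  \<open>Ph T c f c'\<close>, applied before everything else; what follows it has the shape treated
  in \<open>double_dual_l_aux\<close>. It serves \<open>twist_g_twist_a\<close>.\<close>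

lemma double_dual_l:
 assumes L: "legs T [q, c, d, e, f, c', d']" and t [simp]: "t<:T"
 and cu: "equ T u (q*.(c*.d)) (triv T)" "equ T u (f*.c') (triv T)"
 and ct: "eq_at t (c*.f) (triv T)" "eq_at t (d*.e) (triv T)"
 shows "u (Phi T f c' d' (Ph T e f (c'*.d') (Phi T q (c*.d) e (Phi T c d e (Phi T q c f t)))))
 = u (Phi T q (c*.d) e (Phi T c d e (Phi T q c d' (Ph T c f c' t))))"
proof -
 note [simp] = L[simplified]
 let ?W = "c'*.d'"
 let ?Z = "Phi T q c f t"
 let ?R = "Ph T c f ?W t"
 have 1: "equ T (%s. u (Phi T f c' d' s)) (q*.(c*.d)) (triv T)"
 by (rule un_op3_cm[OF cu(1)]) simp_all
 \<comment> \<open>Enlarging the leg \<open>e\<close> by the evaluated product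
   \<open>q (c d)\<close> makes the outer associator natural for the two associators below
   it.\<close>
 have "u (Phi T f c' d' (Ph T e f ?W (Phi T q (c*.d) e (Phi T c d e ?Z))))
 = u (Phi T f c' d' (Ph T ((q*.(c*.d))*.e) f ?W (Phi T q (c*.d) e (Phi T c d e ?Z))))"
 by (rule under_op3_1[OF T U, where u = "%s. u (Phi T f c' d' s)", symmetric])
 (simp_all add: under_triv_diag_left[OF T U _ _ _ _ 1])
 also have "Ph T ((q*.(c*.d))*.e) f ?W (Phi T q (c*.d) e (Phi T c d e ?Z))
 = Phi T q (c*.d) e (Ph T (q*.((c*.d)*.e)) f ?W (Phi T c d e ?Z))"
 by (rule nat1_Phi[symmetric]) simp_all
 also have "Ph T (q*.((c*.d)*.e)) f ?W (Phi T c d e ?Z)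
 = Phi T c d e (Ph T (q*.(c*.(d*.e))) f ?W ?Z)"
 proof (rule op3_nat[OF T T, symmetric])
 show "eqv T T (Phi T c d e) (q*.(c*.(d*.e))) (q*.((c*.d)*.e))"
 by (rule eqv_diag[OF T T]) (simp_all add: eqv_Ph op3_commutes[OF T])
 qed (simp_all add: op3_commutes[OF T])
 also have "eq_at ?Z (d*.e) (triv T)"
 by (rule at_op3_cm[OF ct(2)]) simp_all
 then have "Ph T (q*.(c*.(d*.e))) f ?W ?Z = Ph T (q*.c) f ?W ?Z"
 by (intro at_op3_1[OF T] at_diag_right[OF T] at_triv_diag_right[OF T]) simp_all
 also have "... = Phi T q c (f*.?W) ?R"
 by (rule coev_shift_l[OF _ _ ct(1)]) simp_all
 also have "Phi T f c' d' (Phi T q (c*.d) e (Phi T c d e (Phi T q c (f*.?W) ?R)))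
 = Phi T q (c*.d) e (Phi T c d e (Phi T f c' d' (Phi T q c (f*.?W) ?R)))"
 by (simp add: op3_cm[of f c' d' q "c*.d" e] op3_cm[of f c' d' c d e])
 also have "Phi T f c' d' (Phi T q c (f*.?W) ?R) = Phi T q c ((f*.c')*.d') (Phi T f c' d' ?R)"
 by (rule nat3_Phi) simp_all
 also have "Phi T f c' d' ?R = Ph T c (f*.c') d' (Ph T c f c' t)"
 proof -
 have "Ph T c f ?W (Ph T (c*.f) c' d' t) = Ph T f c' d' (Ph T c (f*.c') d' (Ph T c f c' t))"
 by (rule Ph_pent[OF T]) simp_all
 then show ?thesis
 by (simp add: Ph_at_triv(1)[OF T] ct(1))
 qed
 also have "u (Phi T q (c*.d) e (Phi T c d e (Phi T q c ((f*.c')*.d') (Ph T c (f*.c') d' (Ph T c f c' t)))))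
 = u (Phi T q (c*.d) e (Phi T c d e (Phi T q c d' (Ph T c (f*.c') d' (Ph T c f c' t)))))"
 proof (rule under_op3_3[OF T U, where u = "%s. u (Phi T q (c*.d) e (Phi T c d e s))"])
 have "equ T (%s. u (Phi T q (c*.d) e (Phi T c d e s))) (f*.c') (triv T)"
 by (rule un_op3_cm[OF un_op3_cm[OF cu(2)]]) simp_all
 then show "equ T (%s. u (Phi T q (c*.d) e (Phi T c d e s))) ((f*.c')*.d') d'"
 by (intro under_triv_diag_left[OF T U]) simp_all
 qed simp_all
 also have "... = u (Phi T q (c*.d) e (Phi T c d e (Phi T q c d' (Ph T c f c' t))))"
 proof (rule Ph_un_triv(3)[OF T _ U, where u = "%s. u (Phi T q (c*.d) e (Phi T c d e (Phi T q c d' s)))"])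
 show "equ T (%s. u (Phi T q (c*.d) e (Phi T c d e (Phi T q c d' s)))) (f*.c') (triv T)"
 by (rule un_op3_cm[OF un_op3_cm[OF un_op3_cm[OF cu(2)]]]) simp_all
 qed simp_all
 finally show ?thesis .
qed

text \<open>On the left \<open>r1\<close> is evaluated against \<open>z\<close> and then
  \<open>r2\<close> against \<open>z'\<close>; on the right the product \<open>r2 r1\<close> is
  evaluated against \<open>z z'\<close>. The two bracketings differ by pentagons and by associators
  with an evaluated leg.\<close>

lemma cofree_coherence:
 assumes L: "legs T [p, w, r2, r1, z, z']" and t [simp]: "t<:T"
 and cu: "equ T u (r1*.z) (triv T)" "equ T u (r2*.z') (triv T)"
 shows "u (Ph T w r2 z' (Ph T p (w*.r2) z' (Ph T (p*.(w*.r2)) r1 z (Ph T p w r2 (Phi T (p*.w) r2 r1 t)))))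
 = u (Phi T r1 z z' (Ph T r2 r1 (z*.z') (Ph T (p*.w) (r2*.r1) (z*.z') (Ph T ((p*.w)*.(r2*.r1)) z z' t))))"
proof -
 note [simp] = L[simplified]
 let ?y = "p*.w"
 let ?s = "Phi T ?y r2 r1 t"
 let ?s1 = "Ph T (?y*.r2) r1 z ?s"
 have "Ph T (p*.(w*.r2)) r1 z (Ph T p w r2 ?s) = Ph T p w r2 ?s1"
 by (rule nat1_Ph[symmetric]) simp_all
 moreover have "Ph T w r2 z' (Ph T p (w*.r2) z' (Ph T p w r2 ?s1)) = Ph T p w (r2*.z') (Ph T ?y r2 z' ?s1)"
 by (rule Ph_pent[OF T, symmetric]) simp_all
 ultimately have "u (Ph T w r2 z' (Ph T p (w*.r2) z' (Ph T (p*.(w*.r2)) r1 z (Ph T p w r2 ?s))))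
 = u (Ph T ?y r2 z' ?s1)"
 using cu(2) by (simp add: Ph_un_triv(5)[OF T u U])
 \<comment> \<open>The evaluated pair \<open>r1 z\<close> is inserted here and in the next step, to
   create the legs that the pentagon for \<open>r1\<close>, \<open>z\<close> and \<open>z'\<close>
   needs.\<close>
 also have "... = u (Ph T ?y r2 ((r1*.z)*.z') ?s1)"
 using cu(1) by (intro under_op3_3[OF T U u, symmetric] under_triv_diag_left[OF T U u]) simp_all
 also have "... = u (Ph T ?y r2 ((r1*.z)*.z') (Ph T (?y*.r2) (r1*.z) z' ?s1))"
 proof (rule Ph_un_triv(3)[OF T _ U, where u = "%s. u (Ph T ?y r2 ((r1*.z)*.z') s)", symmetric])
 show "equ T (%s. u (Ph T ?y r2 ((r1*.z)*.z') s)) (r1*.z) (triv T)"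
 unfolding equ_def
 proof (intro ballI)
 fix h s assume h [simp]: "h<:H" and s [simp]: "s<:T"
 have e: "u (Ph T ?y r2 ((r1*.z)*.z') v) = u (Ph T ?y r2 z' v)" if "v<:T" for v
 using cu(1) that by (intro under_op3_3[OF T U u] under_triv_diag_left[OF T U u]) simp_all
 have "equ T (%s. u (Ph T ?y r2 z' s)) (r1*.z) (triv T)"
 by (rule un_op3_cm[OF cu(1)]) simp_all
 then show "u (Ph T ?y r2 ((r1*.z)*.z') ((r1*.z) h s)) = u (Ph T ?y r2 ((r1*.z)*.z') (triv T h s))"
 using e[of "(r1*.z) h s"] e[of "triv T h s"] action_closed[OF lact_triv[OF T] h s]
 by (simp add: equ_def)
 qed
 qed simp_all
 also have "Ph T (?y*.r2) (r1*.z) z' ?s1 = Phi T r1 z z' (Ph T (?y*.r2) r1 (z*.z') (Ph T ((?y*.r2)*.r1) z z' ?s))"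
 by (subst Ph_pent[OF T]) simp_all
 also have "Ph T ?y r2 ((r1*.z)*.z') ... = Phi T r1 z z' (Ph T ?y r2 (r1*.(z*.z'))
 (Ph T (?y*.r2) r1 (z*.z') (Ph T ((?y*.r2)*.r1) z z' ?s)))"
 by (rule nat3_Phi[symmetric]) simp_all
 also have "Ph T ((?y*.r2)*.r1) z z' ?s = Phi T ?y r2 r1 (Ph T (?y*.(r2*.r1)) z z' t)"
 by (rule nat1_Phi[symmetric]) simp_all
 also have "Ph T ?y r2 (r1*.(z*.z')) (Ph T (?y*.r2) r1 (z*.z')
 (Phi T ?y r2 r1 (Ph T (?y*.(r2*.r1)) z z' t)))
 = Ph T r2 r1 (z*.z') (Ph T ?y (r2*.r1) (z*.z') (Ph T (?y*.(r2*.r1)) z z' t))"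
 by (subst Ph_pent[OF T]) simp_all
 finally show ?thesis .
qed

text \<open>The evaluation of \<open>p\<close> against \<open>l\<close> is brought inside, so that
  \<open>y\<close> takes part only in the first and the last associator. This isolates the core of
  the left Hopf operator in \<open>lbij_hopfL\<close>.\<close>

lemma hopf_l_coherence:
 assumes L: "legs T [y, p, l, m, r]" and t [simp]: "t<:T"
 and cu: "equ T u (p*.l) (triv T)"
 shows "u (Ph T y p l (Phi T (y*.p) l m (Phi T (y*.p) (l*.m) r t)))
 = u (Phi T y m r (Phi T p l m (Phi T p (l*.m) r (Ph T y p ((l*.m)*.r) t))))"
proof -
 note [simp] = L[simplified]
 let ?s = "Phi T (y*.p) (l*.m) r t"
 have 1: "Ph T y p l (Phi T (y*.p) l m ?s) = Phi T y (p*.l) m (Phi T p l m (Ph T y p (l*.m) ?s))"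
 proof -
 let ?v = "Phi T (y*.p) l m ?s"
 have "Ph T y p (l*.m) (Ph T (y*.p) l m ?v) = Ph T p l m (Ph T y (p*.l) m (Ph T y p l ?v))"
 by (rule Ph_pent[OF T]) simp_all
 then show ?thesis by simp
 qed
 have 2: "Ph T y p (l*.m) ?s = Phi T y (p*.(l*.m)) r (Phi T p (l*.m) r (Ph T y p ((l*.m)*.r) t))"
 proof -
 have "Ph T y p ((l*.m)*.r) (Ph T (y*.p) (l*.m) r ?s)
 = Ph T p (l*.m) r (Ph T y (p*.(l*.m)) r (Ph T y p (l*.m) ?s))"
 by (rule Ph_pent[OF T]) simp_all
 then show ?thesis by simp
 qed
 let ?q = "Phi T p (l*.m) r (Ph T y p ((l*.m)*.r) t)"
 have "u (Ph T y p l (Phi T (y*.p) l m ?s)) = u (Phi T p l m (Ph T y p (l*.m) ?s))"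
 unfolding 1 using cu by (simp add: Ph_un_triv(4)[OF T u U])
 also have "... = u (Phi T y ((p*.l)*.m) r (Phi T p l m ?q))"
 unfolding 2 by (subst nat2_Phi) simp_all
 also have "... = u (Phi T y m r (Phi T p l m ?q))"
 using cu by (intro under_op3_2[OF T U u] under_triv_diag_left[OF T U u]) simp_all
 finally show ?thesis .
qed

end

end

end

section \<open>Legs given by multiplication\<close>

lemma (in quasi_hopf_algebra) tensor_module_simp [simp]:
 "[|module K V; md K W|] ==> module K (V><W)"
 by (rule ten_mod)

context quasi_hopf_algebra
begin

lemma lact_legL [simp]:
 "[|module K V; md K W; lact V rh|] ==> lact (V><W) (Lg V W rh)"
 by (rule act_legL[OF _ _ alg_H])

lemma lact_legR [simp]:
 "[|module K V; md K W; lact W rh|] ==> lact (V><W) (Rg V W rh)"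
 by (rule act_legR[OF _ _ alg_H])

lemma com_leg [simp]:
 assumes "md K V" "md K W"
 shows "[|lact V rh; lact W sg|] ==> com (V><W) (Lg V W rh) (Rg V W sg)"
 and "[|lact V rh; lact W sg|] ==> com (V><W) (Rg V W sg) (Lg V W rh)"
 and "[|lact V rh; lact V rh'; com V rh rh'|] ==> com (V><W) (Lg V W rh) (Lg V W rh')"
 and "[|lact W sg; lact W sg'; com W sg sg'|] ==> com (V><W) (Rg V W sg) (Rg V W sg')"
 by (rule com_legL_legR[OF assms] com_sym[OF com_legL_legR[OF assms]]
 com_legL_legL[OF assms] com_legR_legR[OF assms]; assumption)+

lemma leg_pure [simp]:
 assumes "md K V" "md K W" "h<:H" "v<:V" "w<:W"
 shows "lact V rh ==> Lg V W rh h (pt V W v w) = pt V W (rh h v) w"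
 and "lact W sg ==> Rg V W sg h (pt V W v w) = pt V W v (sg h w)"
 using assms by (simp_all add: legL_pure legR_pure)

lemma lin_pure:
 assumes "md K V" "md K W"
 shows "v<:V ==> pt V W v : Lin K W (V><W)"
 and "w<:W ==> (%v. pt V W v w) : Lin K V (V><W)"
 using pure_ten_bil[OF assms] by (simp_all add: bilin_def)

lemma diag_legR_pure:
 assumes "md K V" "md K W" "lact W rh" "lact W sg" "h<:H" "v<:V" "w<:W"
 shows "dg (V><W) (Rg V W rh) (Rg V W sg) h (pt V W v w)
 = pt V W v (dg W rh sg h w)"
proof -
 have "pt V W v (dg W rh sg h w)
 = sw (V><W) (comul H h) (%p q. pt V W v (rh p (sg q w)))"
 unfolding diag_sw[OF assms(2)] using assms
 by (intro sw_lin_im[OF mod_H mod_H lin_pure(1)]) (simp_all add: action_closed[of K H W])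
 also have "... = dg (V><W) (Rg V W rh) (Rg V W sg) h (pt V W v w)"
 unfolding diag_sw[OF ten_mod[OF assms(1,2)]] using assms
 by (intro sw_cong[OF mod_H mod_H]) (simp_all add: action_closed[of K H W])
 finally show ?thesis by simp
qed

lemma diag_legL_pure:
 assumes "md K V" "md K W" "lact V rh" "lact V sg" "h<:H" "v<:V" "w<:W"
 shows "dg (V><W) (Lg V W rh) (Lg V W sg) h (pt V W v w)
 = pt V W (dg V rh sg h v) w"
proof -
 have "pt V W (dg V rh sg h v) w
 = sw (V><W) (comul H h) (%p q. pt V W (rh p (sg q v)) w)"
 unfolding diag_sw[OF assms(1)] using assms
 by (intro sw_lin_im[OF mod_H mod_H lin_pure(2)]) (simp_all add: action_closed[of K H V])
 also have "... = dg (V><W) (Lg V W rh) (Lg V W sg) h (pt V W v w)"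
 unfolding diag_sw[OF ten_mod[OF assms(1,2)]] using assms
 by (intro sw_cong[OF mod_H mod_H]) (simp_all add: action_closed[of K H V])
 finally show ?thesis by simp
qed

definition lmul where
 "lmul A s h x = s h .[A] x"

definition rmul where
 "rmul A s h x = x .[A] s h"

definition alg_hom where
 "alg_hom A s \<longleftrightarrow> s : Lin K H A \<and> s 1[H] = 1[A] \<and>
 (\<forall>h \<in> carrier H. \<forall>k \<in> carrier H. s (h .[H] k) = s h .[A] s k)"

definition alg_antihom where
 "alg_antihom A s \<longleftrightarrow> s : Lin K H A \<and> s 1[H] = 1[A] \<and>
 (\<forall>h \<in> carrier H. \<forall>k \<in> carrier H. s (h .[H] k) = s k .[A] s h)"

context
 fixes A
 assumes A: "k_algebra K A"
begin

interpretation A: k_algebra K A by (rule A)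

lemma alg_hom_cl: "[|alg_hom A s; h<:H|] ==> s h<:A"
 by (auto simp: alg_hom_def lcl)

lemma alg_antihom_cl: "[|alg_antihom A s; h<:H|] ==> s h<:A"
 by (auto simp: alg_antihom_def lcl)

lemma lact_lmul [simp]:
 assumes "alg_hom A s"
 shows "lact A (lmul A s)"
proof -
 have s: "s : Lin K H A"
 using assms by (simp add: alg_hom_def)
 have "bilin K H A A (lmul A s)"
 using bil_comp_args[OF alg_mult_bil[OF A] s lin_mp_id] by (simp add: lmul_def[abs_def])
 then show ?thesis
 using assms alg_hom_cl[OF assms]
 by (simp add: action_def lmul_def alg_hom_def A.m_assoc)
qed

lemma lact_rmul [simp]:
 assumes "alg_antihom A s"
 shows "lact A (rmul A s)"
proof -
 have s: "s : Lin K H A"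
 using assms by (simp add: alg_antihom_def)
 have "bilin K H A A (rmul A s)"
 using bil_comp_args[OF bil_flip[OF alg_mult_bil[OF A]] s lin_mp_id]
 by (simp add: rmul_def[abs_def])
 then show ?thesis
 using assms alg_antihom_cl[OF assms]
 by (simp add: action_def rmul_def alg_antihom_def A.m_assoc)
qed

lemma com_mul [simp]:
 assumes "alg_hom A s" "alg_antihom A s'"
 shows "com A (lmul A s) (rmul A s')" "com A (rmul A s') (lmul A s)"
 using alg_hom_cl[OF assms(1)] alg_antihom_cl[OF assms(2)]
 by (simp_all add: commuting_def lmul_def rmul_def A.m_assoc)

end

lemma t2_cl [simp]: "[|p<:H; q<:H|] ==> t2 K H p q<:HH"
 by (simp add: pure_ten_cl)

lemma t2_mult [simp]:
 "[|p<:H; q<:H; p'<:H; q'<:H|]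
 ==> t2 K H p q**t2 K H p' q' = t2 K H (p##p') (q##q')"
 by (rule ten_mult_pure[OF alg_H alg_H])

lemma one_HH: "1[HH] = t2 K H 1[H] 1[H]"
 by (rule ten_one[OF alg_H alg_H])

lemma lin_t2:
 shows "p<:H ==> t2 K H p : Lin K H HH"
 and "q<:H ==> (%p. t2 K H p q) : Lin K H HH"
 by (simp_all add: lin_pure)

lemma comul_t2: "h<:H ==> sw HH (comul H h) (%p q. t2 K H p q) = comul H h"
 by (rule sw_pure_id[OF mod_H mod_H]) simp

lemma S_alg_antihom [simp]: "alg_antihom H S"
 by (simp add: alg_antihom_def antipode_linear antipode_one antipode_mult)

lemma id_alg_hom [simp]: "alg_hom H (%h. h)"
 by (simp add: alg_hom_def lin_mp_id)

lemma De_alg_hom [simp]: "alg_hom HH (comul H)"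
 by (simp add: alg_hom_def comul_linear De_one De_mult)

section \<open>The multiplication legs of the square of H\<close>

abbreviation "i1 h \<equiv> t2 K H h 1[H]"
abbreviation "i2 h \<equiv> t2 K H 1[H] h"
abbreviation "S1 h \<equiv> t2 K H (S h) 1[H]"
abbreviation "S2 h \<equiv> t2 K H 1[H] (S h)"
abbreviation "SD h \<equiv> comul H (S h)"

lemma incl_alg_hom [simp]: "alg_hom HH (%h. i1 h)" "alg_hom HH (%h. i2 h)"
 by (simp_all add: alg_hom_def lin_t2 one_HH)

lemma incl_alg_antihom [simp]:
 "alg_antihom HH (%h. S1 h)" "alg_antihom HH (%h. S2 h)" "alg_antihom HH (%h. SD h)"
 by (simp_all add: alg_antihom_def linc[OF antipode_linear lin_t2(1)]
 linc[OF antipode_linear lin_t2(2)] linc[OF antipode_linear comul_linear]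
 one_HH antipode_one antipode_mult De_one De_mult)

abbreviation "lm1 \<equiv> lmul HH (%h. i1 h)"
abbreviation "lm2 \<equiv> lmul HH (%h. i2 h)"
abbreviation "lmD \<equiv> lmul HH (comul H)"
text \<open>Since S reverses products, right multiplication by its values is again a left action of
  \<open>H\<close>. These legs play the duals of \<open>lm1\<close>, \<open>lm2\<close> and
  \<open>lmD\<close>.\<close>

abbreviation "rm1 \<equiv> rmul HH (%h. S1 h)"
abbreviation "rm2 \<equiv> rmul HH (%h. S2 h)"
abbreviation "rmD \<equiv> rmul HH (%h. SD h)"

lemmas alg_simps [simp] = alg_H alg_H2

lemma com_lm_rm [simp]: "com HH lm1 lm2" "com HH lm2 lm1" "com HH rm1 rm2" "com HH rm2 rm1"
proof -
 show "com HH lm1 lm2" "com HH lm2 lm1"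
 by (simp_all add: commuting_def lmul_def H2.m_assoc[symmetric])
 show "com HH rm1 rm2" "com HH rm2 rm1"
 by (simp_all add: commuting_def rmul_def H2.m_assoc)
qed

lemma diag_lm:
 assumes "h<:H" "x<:HH"
 shows "dg HH lm1 lm2 h x = comul H h**x"
proof -
 have "comul H h**x = sw HH (comul H h) (%p q. t2 K H p q)**x"
 by (simp add: comul_t2 assms)
 also have "... = sw HH (comul H h) (%p q. t2 K H p q**x)"
 using assms by (intro sw_lin_im[OF mod_H mod_H bilin_left[OF alg_mult_bil[OF alg_H2]]]) simp_all
 also have "... = dg HH lm1 lm2 h x"
 unfolding diag_sw[OF mod_H2]
 using assms by (intro sw_cong[OF mod_H mod_H]) (simp_all add: lmul_def H2.m_assoc[symmetric])
 finally show ?thesis by simp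
qed

end

section \<open>The twist is invertible\<close>

context quasi_hopf_algebra
begin

lemmas H2_lin_mult = bilin_left[OF alg_mult_bil[OF alg_H2]] bilin_right[OF alg_mult_bil[OF alg_H2]]

lemma H2_mult_lin [simp]:
 shows "y<:HH ==> (%x. x**y) : Lin K HH HH"
 and "y<:HH ==> (%x. y**x) : Lin K HH HH"
 by (simp_all add: H2_lin_mult)

lemma alpha_beta_cl [simp]: "qalpha H<:H" "qbeta H<:H"
 by (rule alpha_closed beta_closed)+

abbreviation "aal \<equiv> t2 K H (qalpha H) (qalpha H)"
abbreviation "bbe \<equiv> t2 K H (qbeta H) (qbeta H)"
abbreviation "Dal \<equiv> comul H (qalpha H)"
abbreviation "Dbe \<equiv> comul H (qbeta H)"

text \<open>If the terms of a sum are images of terms in \<open>H\<close> under one linear map, the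
  sum can be taken in \<open>H\<close>. This is how antipode axioms are carried into larger tensor
  products.\<close>

lemma sw_H_lin:
 assumes "u : Lin K H U" "md K U" "h<:H"
 and "!!p q. [|p<:H; q<:H|] ==> f p q<:H"
 and "!!p q. [|p<:H; q<:H|] ==> g p q = u (f p q)"
 shows "sw U (comul H h) g = u (sw H (comul H h) f)"
proof -
 have "sw U (comul H h) g = sw U (comul H h) (%p q. u (f p q))"
 using assms by (intro sw_cong[OF mod_H mod_H]) simp_all
 also have "... = u (sw H (comul H h) f)"
 using assms by (intro sw_lin_im[OF mod_H mod_H, symmetric]) simp_all
 finally show ?thesis .
qed

lemma sw3_H_lin:
 assumes "u : Lin K H U" "md K U" "x<:(H3 K H)"
 and "!!p q r. [|p<:H; q<:H; r<:H|] ==> f p q r<:H"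
 and "!!p q r. [|p<:H; q<:H; r<:H|] ==> g p q r = u (f p q r)"
 shows "sw3 U x g = u (sw3 H x f)"
proof -
 have "sw3 U x g = sw3 U x (%p q r. u (f p q r))"
 using assms by (intro sw3_cong) simp_all
 also have "... = u (sw3 H x f)"
 using assms by (intro sw3_lin_im[symmetric]) simp_all
 finally show ?thesis .
qed

text \<open>The antipode axiom for \<alpha>, in the first factor, in the second factor and under
  \<Delta>. Each has the form of invariance that \<open>EV_co\<close> asks for.\<close>

lemma alpha_invariant:
 assumes "h<:H"
 shows "sw HH (comul H h) (%p q. S1 p**aal**i1 q) = counit H h *[HH] aal"
 and "sw HH (comul H h) (%p q. S2 p**aal**i2 q) = counit H h *[HH] aal"
 and "sw HH (comul H h) (%p q. SD p**Dal**comul H q) = counit H h *[HH] Dal"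
proof -
 have "sw HH (comul H h) (%p q. S1 p**aal**i1 q)
 = t2 K H (sw H (comul H h) (%p q. S p##qalpha H##q)) (qalpha H)"
 by (rule sw_H_lin[where u = "%x. t2 K H x (qalpha H)"]) (simp_all add: lin_t2 assms)
 then show "sw HH (comul H h) (%p q. S1 p**aal**i1 q) = counit H h *[HH] aal"
 using assms by (simp add: antipode_alpha linear_maps_smult[OF lin_t2(2)])
 have "sw HH (comul H h) (%p q. S2 p**aal**i2 q)
 = t2 K H (qalpha H) (sw H (comul H h) (%p q. S p##qalpha H##q))"
 by (rule sw_H_lin[where u = "%x. t2 K H (qalpha H) x"]) (simp_all add: lin_t2 assms)
 then show "sw HH (comul H h) (%p q. S2 p**aal**i2 q) = counit H h *[HH] aal"
 using assms by (simp add: antipode_alpha linear_maps_smult[OF lin_t2(1)])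
 have "sw HH (comul H h) (%p q. SD p**Dal**comul H q)
 = comul H (sw H (comul H h) (%p q. S p##qalpha H##q))"
 by (rule sw_H_lin[where u = "comul H"]) (simp_all add: comul_linear De_mult assms)
 then show "sw HH (comul H h) (%p q. SD p**Dal**comul H q) = counit H h *[HH] Dal"
 using assms by (simp add: antipode_alpha linear_maps_smult[OF comul_linear])
qed

lemma beta_invariant:
 assumes "h<:H"
 shows "sw HH (comul H h) (%p q. i1 p**bbe**S1 q) = counit H h *[HH] bbe"
 and "sw HH (comul H h) (%p q. i2 p**bbe**S2 q) = counit H h *[HH] bbe"
 and "sw HH (comul H h) (%p q. comul H p**Dbe**SD q) = counit H h *[HH] Dbe"
proof -
 have "sw HH (comul H h) (%p q. i1 p**bbe**S1 q)
 = t2 K H (sw H (comul H h) (%p q. p##qbeta H##S q)) (qbeta H)"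
 by (rule sw_H_lin[where u = "%x. t2 K H x (qbeta H)"]) (simp_all add: lin_t2 assms)
 then show "sw HH (comul H h) (%p q. i1 p**bbe**S1 q) = counit H h *[HH] bbe"
 using assms by (simp add: antipode_beta linear_maps_smult[OF lin_t2(2)])
 have "sw HH (comul H h) (%p q. i2 p**bbe**S2 q)
 = t2 K H (qbeta H) (sw H (comul H h) (%p q. p##qbeta H##S q))"
 by (rule sw_H_lin[where u = "%x. t2 K H (qbeta H) x"]) (simp_all add: lin_t2 assms)
 then show "sw HH (comul H h) (%p q. i2 p**bbe**S2 q) = counit H h *[HH] bbe"
 using assms by (simp add: antipode_beta linear_maps_smult[OF lin_t2(1)])
 have "sw HH (comul H h) (%p q. comul H p**Dbe**SD q)
 = comul H (sw H (comul H h) (%p q. p##qbeta H##S q))"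
 by (rule sw_H_lin[where u = "comul H"]) (simp_all add: comul_linear De_mult assms)
 then show "sw HH (comul H h) (%p q. comul H p**Dbe**SD q) = counit H h *[HH] Dbe"
 using assms by (simp add: antipode_beta linear_maps_smult[OF comul_linear])
qed

lemma De_S_phi:
 "sw3 HH (reassoc H) (%p q r. comul H p**Dbe**SD q**Dal**comul H r) = 1[HH]"
proof -
 have "sw3 HH (reassoc H) (%p q r. comul H p**Dbe**SD q**Dal**comul H r)
 = comul H (sw3 H (reassoc H) (%p q r. p##qbeta H##S q##qalpha H##r))"
 by (rule sw3_H_lin) (simp_all add: comul_linear De_mult)
 then show ?thesis
 by (simp add: antipode_reassoc De_one)
qed

lemma De_S_phi_inv:
 "sw3 HH (reassoc_inv K H) (%p q r. SD p**Dal**comul H q**Dbe**SD r) = 1[HH]"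
proof -
 have "sw3 HH (reassoc_inv K H) (%p q r. SD p**Dal**comul H q**Dbe**SD r)
 = comul H (sw3 H (reassoc_inv K H) (%p q r. S p##qalpha H##q##qbeta H##S r))"
 by (rule sw3_H_lin) (simp_all add: comul_linear De_mult)
 then show ?thesis
 by (simp add: antipode_reassoc_inv De_one)
qed

lemma lmul_apply: "x<:A ==> lmul A s h x = s h .[A] x"
 and rmul_apply: "x<:A ==> rmul A s h x = x .[A] s h"
 by (simp_all add: lmul_def rmul_def)

section \<open>Evaluation and insertion of an element of the square of H\<close>

abbreviation "T2 \<equiv> HH><HH"
abbreviation "pT2 x w \<equiv> pt HH HH x w"
abbreviation "ll \<equiv> Lg HH HH"
abbreviation "lr \<equiv> Rg HH HH"

text \<open>The pairing of a dual object, acting on the right of \<open>x\<close>, with an object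
  acting on the left of \<open>w\<close>; \<open>m\<close> takes the place of \<alpha>.\<close>

definition EV where
 "EV m t = sw HH t (%x w. x**m**w)"

lemma EV_bilin: "m<:HH ==> bilin K HH HH HH (%x w. x**m**w)"
 by (rule bil_comp_args[where V' = HH and g = "%x. x**m" and h = "%x. x",
 OF alg_mult_bil[OF alg_H2] _ lin_mp_id]) simp

lemma EV_lin [simp]: "m<:HH ==> EV m : Lin K T2 HH"
 using sw_lin[OF mod_H2 mod_H2 mod_H2 EV_bilin] by (simp add: EV_def[abs_def])

lemma EV_pure [simp]:
 "[|m<:HH; x<:HH; w<:HH|] ==> EV m (pT2 x w) = x**m**w"
 using sw_pure[OF mod_H2 mod_H2 mod_H2 EV_bilin] by (simp add: EV_def)

lemma pT2_cl [simp]: "[|x<:HH; w<:HH|] ==> pT2 x w<:T2"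
 by (simp add: pure_ten_cl)

lemma rmul_lmul_cl [simp]:
 assumes "h<:H" "x<:HH"
 shows "alg_hom HH s ==> lmul HH s h x<:HH"
 and "alg_antihom HH s ==> rmul HH s h x<:HH"
 and "alg_hom HH s ==> s h<:HH"
 and "alg_antihom HH s ==> s h<:HH"
 using assms alg_hom_cl[OF alg_H2] alg_antihom_cl[OF alg_H2]
 by (auto simp: lmul_def rmul_def)

lemma lact_lin [simp]: "[|lact T rh; h<:H|] ==> rh h : Lin K T T"
 by (rule action_linear)

lemma lact_cl: "[|lact T rh; h<:H; t<:T|] ==> rh h t<:T"
 by (rule action_closed)

text \<open>Collapsing by a map follows from the corresponding invariance of the inserted element.\<close>

lemma eq_un_pure:
 assumes "md K V" "md K W" "md K U" "u : Lin K (V><W) U"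
 and "lact (V><W) rh" "lact (V><W) sg"
 and "!!h v w. [|h<:H; v<:V; w<:W|]
 ==> u (rh h (pt V W v w)) = u (sg h (pt V W v w))"
 shows "equ (V><W) u rh sg"
 unfolding equ_def
proof (intro ballI)
 fix h t assume h: "h<:H" and t: "t<:(V><W)"
 show "u (rh h t) = u (sg h t)"
 by (rule ten_ext[OF assms(1-3) linc[OF lact_lin[OF assms(5) h] assms(4)]
 linc[OF lact_lin[OF assms(6) h] assms(4)] _ t])
 (simp add: assms(7) h)
qed

lemma eqv_pure:
 assumes "md K V" "md K W" "md K U" "u : Lin K (V><W) U"
 and "lact (V><W) rh" "lact U sg"
 and "!!h v w. [|h<:H; v<:V; w<:W|]
 ==> u (rh h (pt V W v w)) = sg h (u (pt V W v w))"
 shows "eqv (V><W) U u rh sg"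
 unfolding eqv_def
proof (intro ballI)
 fix h t assume h: "h<:H" and t: "t<:(V><W)"
 show "u (rh h t) = sg h (u t)"
 by (rule ten_ext[OF assms(1-3) linc[OF lact_lin[OF assms(5) h] assms(4)]
 linc[OF assms(4) lact_lin[OF assms(6) h]] _ t])
 (simp add: assms(7) h)
qed

text \<open>The two legs meet around \<open>m\<close> and form \<open>s p**m**s' q\<close>, so
  invariance of \<open>m\<close> is exactly the collapse.\<close>

lemma EV_co:
 assumes m: "m<:HH" and s: "alg_antihom HH s" and s': "alg_hom HH s'"
 and inv: "!!h. h<:H ==> sw HH (comul H h) (%p q. s p**m**s' q) = counit H h *[HH] m"
 shows "equ T2 (EV m) (dg T2 (ll (rmul HH s)) (lr (lmul HH s'))) (triv T2)"
proof (rule eq_un_pure[OF mod_H2 mod_H2 mod_H2])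
 fix h x w assume h [simp]: "h<:H" and x [simp]: "x<:HH" and w [simp]: "w<:HH"
 have [simp]: "(%y. x**y**w) : Lin K HH HH"
 using linc[of "%y. x**y" K HH HH "%y. y**w" HH] by simp
 have "EV m (dg T2 (ll (rmul HH s)) (lr (lmul HH s')) h (pT2 x w))
 = sw HH (comul H h) (%p q. EV m (ll (rmul HH s) p (lr (lmul HH s') q (pT2 x w))))"
 using m s s' by (intro un_triv_diag_aux) simp_all
 also have "... = sw HH (comul H h) (%p q. x**(s p**m**s' q)**w)"
 using m s s' by (intro sw_cong[OF mod_H mod_H]) (simp_all add: lmul_def rmul_def H2.m_assoc)
 also have "... = x**(sw HH (comul H h) (%p q. s p**m**s' q))**w"
 using m s s' by (intro sw_lin_im[OF mod_H mod_H, where u = "%y. x**y**w", symmetric]) simp_all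
 also have "... = EV m (triv T2 h (pT2 x w))"
 using m by (simp add: inv triv_def linear_maps_smult[OF EV_lin] H2.smult_mult_left H2.smult_mult_right)
 finally show "EV m (dg T2 (ll (rmul HH s)) (lr (lmul HH s')) h (pT2 x w)) = EV m (triv T2 h (pT2 x w))" .
qed (use m s s' in simp_all)

text \<open>The dual of \<open>EV_co\<close>: an invariant element placed in a tensor factor is a
  coevaluation.\<close>

lemma ins_invariant:
 assumes "n<:HH" "alg_antihom HH s" "alg_hom HH s'" "x<:HH"
 and inv: "!!h. h<:H ==> sw HH (comul H h) (%p q. s' p**n**s q) = counit H h *[HH] n"
 shows "eq_at n (dg HH (lmul HH s') (rmul HH s)) (triv HH)"
 and "eq_at (pT2 x n) (dg T2 (lr (lmul HH s')) (lr (rmul HH s))) (triv T2)"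
proof -
 have n: "dg HH (lmul HH s') (rmul HH s) h n = counit H h *[HH] n" if h: "h<:H" for h
 proof -
 have "dg HH (lmul HH s') (rmul HH s) h n = sw HH (comul H h) (%p q. s' p**n**s q)"
 unfolding diag_sw[OF mod_H2] using assms h
 by (intro sw_cong[OF mod_H mod_H]) (simp_all add: lmul_def rmul_def H2.m_assoc)
 then show ?thesis
 using inv[OF h] by simp
 qed
 show "eq_at n (dg HH (lmul HH s') (rmul HH s)) (triv HH)"
 by (simp add: eq_at_def n triv_def)
 show "eq_at (pT2 x n) (dg T2 (lr (lmul HH s')) (lr (rmul HH s))) (triv T2)"
 unfolding eq_at_def
 proof
 fix h assume h: "h<:H"
 have "dg T2 (lr (lmul HH s')) (lr (rmul HH s)) h (pT2 x n)
 = pT2 x (dg HH (lmul HH s') (rmul HH s) h n)"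
 using assms h by (intro diag_legR_pure) simp_all
 then show "dg T2 (lr (lmul HH s')) (lr (rmul HH s)) h (pT2 x n) = triv T2 h (pT2 x n)"
 using assms h by (simp add: n triv_def linear_maps_smult[OF lin_pure(1)])
 qed
qed

lemma diag_lr_lm:
 assumes "h<:H" "t<:T2"
 shows "dg T2 (lr lm1) (lr lm2) h t = lr lmD h t"
 by (rule ten_ext[OF mod_H2 mod_H2 ten_mod[OF mod_H2 mod_H2] _ _ _ assms(2)])
 (simp_all add: assms diag_legR_pure diag_lm lmul_apply)

text \<open>\<open>twist_a\<close> evaluates \<open>(V* \<otimes> W*) \<otimes> (W \<otimes> V)\<close> in two steps, first the inner and then the outer pair.\<close>

lemma sw3_cl:
 assumes "md K U" "!!p q r. [|p<:H; q<:H; r<:H|] ==> f p q r<:U"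
 and "x<:(H3 K H)"
 shows "sw3 U x f<:U"
 unfolding sw3_def
 by (intro sw_cl[OF mod_H mod_H2] sw_cl[OF mod_H mod_H] module.axioms(2)[OF assms(1)] assms)

text \<open>Splits the defining formula into factors that each depend on at most one component of a
  reassociator, so that each of them becomes one leg in \<open>EV_twist_a\<close>.\<close>

lemma twist_a_alt:
 "twist_a K H = sw3 HH (reassoc_inv K H) (%y1 y2 y3. sw3 HH (reassoc H) (%x1 x2 x3.
 S1 x2**S2 x1**S1 y1**aal**i1 y2**i2 y3**comul H x3))"
 unfolding twist_a_def
proof (intro sw3_cong phi_cl phi_inv_cl)
 fix y1 y2 y3 x1 x2 x3
 assume [simp]: "y1<:H" "y2<:H" "y3<:H"
 "x1<:H" "x2<:H" "x3<:H"
 have "S1 x2**S2 x1**S1 y1**aal**i1 y2**i2 y3**comul H x3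
 = S1 x2**S2 x1**S1 y1**aal**i1 y2**i2 y3**sw HH (comul H x3) (%p q. t2 K H p q)"
 by (simp add: comul_t2)
 also have "... = sw HH (comul H x3) (%p q. S1 x2**S2 x1**S1 y1**aal**i1 y2**i2 y3**t2 K H p q)"
 by (intro sw_lin_im[OF mod_H mod_H H2_mult_lin(2)]) simp_all
 also have "... = sw HH (comul H x3) (%x31 x32. t2 K H (S (y1##x2)##qalpha H##y2##x31)
 (S x1##qalpha H##y3##x32))"
 by (intro sw_cong[OF mod_H mod_H]) (simp_all add: antipode_mult)
 finally show "sw HH (comul H x3) (%x31 x32. t2 K H (S (y1##x2)##qalpha H##y2##x31)
 (S x1##qalpha H##y3##x32)) = S1 x2**S2 x1**S1 y1**aal**i1 y2**i2 y3**comul H x3" by simp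
qed

lemma twist_a_cl [simp]: "twist_a K H<:HH"
 unfolding twist_a_alt by (intro sw3_cl mod_H2) simp_all

text \<open>\<open>rm1\<close> is paired with \<open>lm1\<close> inside and \<open>rm2\<close> with
  \<open>lm2\<close> outside, the nesting that the dual of a tensor product requires; \<Delta> of
  the third component is the diagonal leg of \<open>lm1\<close> and \<open>lm2\<close>.\<close>

lemma EV_twist_a:
 assumes "t<:T2"
 shows "EV (twist_a K H) t = EV aal (Phi T2 (ll rm1) (lr lm1) (lr lm2)
 (Ph T2 (ll rm2) (ll rm1) (dg T2 (lr lm1) (lr lm2)) t))"
proof (rule ten_ext[OF mod_H2 mod_H2 mod_H2 _ _ _ assms])
 let ?c = "dg T2 (lr lm1) (lr lm2)"
 show "(%t. EV aal (Phi T2 (ll rm1) (lr lm1) (lr lm2) (Ph T2 (ll rm2) (ll rm1) ?c t))) : Lin K T2 HH"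
 by (intro linc[OF _ EV_lin] linc[OF op3_lin op3_lin]) simp_all
 fix x w assume x [simp]: "x<:HH" and w [simp]: "w<:HH"
 have lin: "(%y. x**y**w) : Lin K HH HH"
 using linc[of "%y. x**y" K HH HH "%y. y**w" HH] by simp
 have c: "?c h (pT2 x w) = pT2 x (comul H h**w)" if "h<:H" for h
 using that by (simp add: diag_lr_lm lmul_def)
 have "EV aal (Phi T2 (ll rm1) (lr lm1) (lr lm2) (Ph T2 (ll rm2) (ll rm1) ?c (pT2 x w)))
 = sw3 HH (reassoc_inv K H) (%y1 y2 y3. EV aal (ll rm1 y1 (lr lm1 y2 (lr lm2 y3
 (Ph T2 (ll rm2) (ll rm1) ?c (pT2 x w))))))"
 by (intro Ph_lin_im[of T2 _ _ _ _ _ HH]) simp_all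
 also have "... = sw3 HH (reassoc_inv K H) (%y1 y2 y3. sw3 HH (reassoc H) (%x1 x2 x3.
 EV aal (ll rm1 y1 (lr lm1 y2 (lr lm2 y3 (ll rm2 x1 (ll rm1 x2 (?c x3 (pT2 x w)))))))))"
 proof (rule sw3_cong[OF _ phi_inv_cl])
 fix y1 y2 y3 assume [simp]: "y1<:H" "y2<:H" "y3<:H"
 show "EV aal (ll rm1 y1 (lr lm1 y2 (lr lm2 y3 (Ph T2 (ll rm2) (ll rm1) ?c (pT2 x w)))))
 = sw3 HH (reassoc H) (%x1 x2 x3.
 EV aal (ll rm1 y1 (lr lm1 y2 (lr lm2 y3 (ll rm2 x1 (ll rm1 x2 (?c x3 (pT2 x w))))))))"
 by (rule Ph_lin_im[of T2 _ _ _ _ _ HH, where u = "%s. EV aal (ll rm1 y1 (lr lm1 y2 (lr lm2 y3 s)))"])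
 (simp_all add: linc[OF linc[OF linc[OF lact_lin lact_lin] lact_lin] EV_lin])
 qed
 also have "... = sw3 HH (reassoc_inv K H) (%y1 y2 y3. sw3 HH (reassoc H) (%x1 x2 x3.
 x**(S1 x2**S2 x1**S1 y1**aal**i1 y2**i2 y3**comul H x3)**w))"
 by (intro sw3_cong phi_cl phi_inv_cl)
 (simp add: c lmul_def rmul_def H2.m_assoc del: t2_mult)
 also have "... = sw3 HH (reassoc_inv K H) (%y1 y2 y3. x**sw3 HH (reassoc H) (%x1 x2 x3.
 S1 x2**S2 x1**S1 y1**aal**i1 y2**i2 y3**comul H x3)**w)"
 by (intro sw3_cong phi_inv_cl sw3_lin_im[OF lin, symmetric]) simp_all
 also have "... = x**twist_a K H**w"
 unfolding twist_a_alt
 by (intro sw3_lin_im[OF lin, symmetric] sw3_cl) simp_all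
 finally show "EV (twist_a K H) (pT2 x w) = EV aal (Phi T2 (ll rm1) (lr lm1) (lr lm2)
 (Ph T2 (ll rm2) (ll rm1) ?c (pT2 x w)))" by simp
qed simp

end

section \<open>Invariance and intertwining properties of the twist\<close>

context quasi_hopf_algebra
begin

lemma sm_cl_simp [simp]:
 "[|module K V; c<:K; v<:V|] ==> c *[V] v<:V"
 by (rule module.smult_closed)

text \<open>After reassociation the inner pair \<open>b c\<close> collapses, then the outer pair
  \<open>a d\<close>. In other words, the dual of \<open>c d\<close> is the product of the duals in
  reverse order.\<close>

lemma nested_co:
 assumes [simp]: "md K T" "md K U" "u : Lin K T U" and L: "legs T [a, b, c, d]"
 and cu: "equ T u (dg T b c) (triv T)" "equ T u (dg T a d) (triv T)"
 shows "equ T (%t. u (Phi T b c d (Ph T a b (dg T c d) t))) (dg T (dg T a b) (dg T c d)) (triv T)"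
 unfolding equ_def
proof (intro ballI)
 fix h t assume [simp]: "h<:H" "t<:T"
 note [simp] = L[simplified]
 let ?s = "Ph T a b (dg T c d) t"
 have "Ph T a b (dg T c d) (dg T (dg T a b) (dg T c d) h t)
 = dg T a (dg T b (dg T c d)) h ?s"
 by (simp add: Ph_eqv)
 moreover have "eqv T T (Phi T b c d) (dg T a (dg T b (dg T c d))) (dg T a (dg T (dg T b c) d))"
 by (rule eqv_diag) (simp_all add: eqv_Ph op3_commutes)
 then have "Phi T b c d (dg T a (dg T b (dg T c d)) h ?s)
 = dg T a (dg T (dg T b c) d) h (Phi T b c d ?s)"
 by (simp add: eqv_def)
 moreover have "equ T u (dg T a (dg T (dg T b c) d)) (dg T a d)"
 using cu(1) by (intro under_diag_right[of T U] under_triv_diag_left[of T U]) simp_all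
 ultimately have "u (Phi T b c d (Ph T a b (dg T c d) (dg T (dg T a b) (dg T c d) h t)))
 = u (dg T a d h (Phi T b c d ?s))"
 by (simp add: equ_def)
 also have "... = u (triv T h (Phi T b c d ?s))"
 using cu(2) by (simp add: equ_def)
 also have "triv T h (Phi T b c d ?s) = Phi T b c d (triv T h ?s)"
 using eqvD[OF eqv_triv[of "Phi T b c d" T T], of h ?s] by simp
 also have "triv T h ?s = Ph T a b (dg T c d) (triv T h t)"
 using eqvD[OF eqv_triv[of "Ph T a b (dg T c d)" T T], of h t] by simp
 finally show "u (Phi T b c d (Ph T a b (dg T c d) (dg T (dg T a b) (dg T c d) h t)))
 = u (Phi T b c d (Ph T a b (dg T c d) (triv T h t)))" .
qed

text \<open>This is (S \<otimes> S) applied to the co-opposite coproduct, the shape of the first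
  factor of \<open>twist_f\<close>.\<close>

definition acop where
 "acop h = sw HH (comul H h) (%p q. t2 K H (S q) (S p))"

abbreviation "rmsg \<equiv> rmul HH acop"

lemma S_cop_bil: "bilin K H H HH (%p q. t2 K H (S q) (S p))"
 using bil_flip[OF bil_comp_args[OF pure_ten_bil[OF mod_H mod_H] antipode_linear antipode_linear]] .

lemma S_cop_lin [simp]: "acop : Lin K H HH"
 using linc[OF comul_linear sw_lin[OF mod_H mod_H mod_H2 S_cop_bil]]
 by (simp add: acop_def[abs_def])

lemma S_cop_cl [simp]: "h<:H ==> acop h<:HH"
 by (rule lcl[OF S_cop_lin])

lemma diag_rm:
 assumes "h<:H" "x<:HH"
 shows "dg HH rm2 rm1 h x = x**acop h"
proof -
 have "x**acop h = sw HH (comul H h) (%p q. x**t2 K H (S q) (S p))"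
 unfolding acop_def
 using assms by (intro sw_lin_im[OF mod_H mod_H]) simp_all
 also have "... = dg HH rm2 rm1 h x"
 unfolding diag_sw[OF mod_H2]
 using assms by (intro sw_cong[OF mod_H mod_H]) (simp_all add: rmul_def H2.m_assoc)
 finally show ?thesis by simp
qed

text \<open>\<open>dg HH rm2 rm1\<close> is an action, and it is right multiplication by
  \<open>acop\<close>; evaluating the laws of an action at 1 gives those of an
  antihomomorphism.\<close>

lemma S_cop_antihom [simp]: "alg_antihom HH acop"
proof -
 have act: "lact HH (dg HH rm2 rm1)"
 by simp
 have "acop (h##k) = acop k**acop h" if "h<:H" "k<:H" for h k
 using action_mult[OF act that, of "1[HH]"] that by (simp add: diag_rm)
 moreover have "acop 1[H] = 1[HH]"
 using action_one[OF act, of "1[HH]"] by (simp add: diag_rm)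
 ultimately show ?thesis
 by (simp add: alg_antihom_def)
qed

lemma diag_ll_rm:
 assumes "h<:H" "t<:T2"
 shows "dg T2 (ll rm2) (ll rm1) h t = ll rmsg h t"
 by (rule ten_ext[OF mod_H2 mod_H2 ten_mod[OF mod_H2 mod_H2] _ _ _ assms(2)])
 (simp_all add: assms diag_legL_pure diag_rm rmul_apply)

text \<open>\<open>nested_co\<close> applied to the two evaluations of \<open>EV_twist_a\<close>,
  and read off at the pure tensor of units.\<close>

lemma twist_a_invariant:
 assumes h: "h<:H"
 shows "sw HH (comul H h) (%p q. acop p**twist_a K H**comul H q) = counit H h *[HH] twist_a K H"
proof -
 let ?o = "pT2 1[HH] 1[HH]"
 let ?d = "dg T2 (dg T2 (ll rm2) (ll rm1)) (dg T2 (lr lm1) (lr lm2))"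
 have cu: "equ T2 (EV aal) (dg T2 (ll rm1) (lr lm1)) (triv T2)"
 "equ T2 (EV aal) (dg T2 (ll rm2) (lr lm2)) (triv T2)"
 using EV_co[OF _ _ _ alpha_invariant(1)] EV_co[OF _ _ _ alpha_invariant(2)] by simp_all
 have "equ T2 (%t. EV aal (Phi T2 (ll rm1) (lr lm1) (lr lm2)
 (Ph T2 (ll rm2) (ll rm1) (dg T2 (lr lm1) (lr lm2)) t))) ?d (triv T2)"
 by (rule nested_co[where U = HH, OF _ _ _ _ cu]) simp_all
 then have "equ T2 (EV (twist_a K H)) ?d (triv T2)"
 by (simp add: equ_def EV_twist_a lact_cl[of T2])
 then have "EV (twist_a K H) (?d h ?o) = counit H h *[HH] EV (twist_a K H) ?o"
 using h by (simp add: equ_def triv_def linear_maps_smult[OF EV_lin])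
 moreover have "EV (twist_a K H) (?d h ?o) = sw HH (comul H h) (%p q. acop p**twist_a K H**comul H q)"
 proof -
 have "EV (twist_a K H) (?d h ?o) = sw HH (comul H h) (%p q. EV (twist_a K H)
 (dg T2 (ll rm2) (ll rm1) p (dg T2 (lr lm1) (lr lm2) q ?o)))"
 using h by (intro un_triv_diag_aux) simp_all
 also have "... = sw HH (comul H h) (%p q. acop p**twist_a K H**comul H q)"
 using h by (intro sw_cong[OF mod_H mod_H])
 (simp_all add: diag_lr_lm diag_ll_rm lmul_apply rmul_apply)
 finally show ?thesis .
 qed
 ultimately show ?thesis
 using h by simp
qed

lemma sw_pR:
 assumes "md K U" "bilin K H H U F"
 shows "sw U (pR K H) F = sw3 U (reassoc_inv K H) (%a b c. F a (b##qbeta H##S c))"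
proof -
 have "sw U (pR K H) F = sw3 U (reassoc_inv K H) (%a b c. sw U (t2 K H a (b##qbeta H##S c)) F)"
 unfolding pR_def
 by (rule sw3_lin_im[OF sw_lin[OF mod_H mod_H assms] mod_H2 assms(1)]) simp_all
 also have "... = sw3 U (reassoc_inv K H) (%a b c. F a (b##qbeta H##S c))"
 by (intro sw3_cong phi_inv_cl sw_pure[OF mod_H mod_H assms]) simp_all
 finally show ?thesis .
qed

lemma twist_f_alt:
 "twist_f K H = sw3 HH (reassoc_inv K H)
 (%y1 y2 y3. acop y1**twist_a K H**comul H (y2##qbeta H##S y3))"
proof -
 have "bilin K H H HH (%p q. acop p**twist_a K H**comul H q)"
 by (rule bil_comp_args[OF alg_mult_bil[OF alg_H2] _ comul_linear])
 (rule linc[OF S_cop_lin], simp)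
 from sw_pR[OF mod_H2 this] show ?thesis
 by (simp add: twist_f_def acop_def)
qed

lemma twist_f_cl [simp]: "twist_f K H<:HH"
 unfolding twist_f_alt by (intro sw3_cl mod_H2) simp_all

text \<open>Right multiplication by \<open>twist_f\<close> is half a snake: insert
  \<Delta>(\<beta>), reassociate, and evaluate with \<open>twist_a\<close>. By
  \<open>twist_f_eqv\<close> it turns the leg \<open>rmsg\<close> into the leg
  \<open>rmD\<close>.\<close>

lemma twist_f_mult:
 assumes x [simp]: "x<:HH"
 shows "x**twist_f K H = EV (twist_a K H) (Phi T2 (ll rmsg) (lr lmD) (lr rmD) (pT2 x Dbe))"
proof -
 have "EV (twist_a K H) (Phi T2 (ll rmsg) (lr lmD) (lr rmD) (pT2 x Dbe))
 = sw3 HH (reassoc_inv K H) (%y1 y2 y3. EV (twist_a K H) (ll rmsg y1 (lr lmD y2 (lr rmD y3 (pT2 x Dbe)))))"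
 by (intro Ph_lin_im[of T2 _ _ _ _ _ HH]) simp_all
 also have "... = sw3 HH (reassoc_inv K H)
 (%y1 y2 y3. x**(acop y1**twist_a K H**comul H (y2##qbeta H##S y3)))"
 by (intro sw3_cong phi_inv_cl) (simp add: lmul_apply rmul_apply De_mult H2.m_assoc)
 also have "... = x**twist_f K H"
 unfolding twist_f_alt by (intro sw3_lin_im[symmetric]) simp_all
 finally show ?thesis by simp
qed

lemma EV_eqv:
 assumes "m<:HH"
 shows "alg_hom HH s ==> eqv T2 HH (EV m) (ll (lmul HH s)) (lmul HH s)"
 and "alg_antihom HH s' ==> eqv T2 HH (EV m) (lr (rmul HH s')) (rmul HH s')"
proof -
 show "eqv T2 HH (EV m) (ll (lmul HH s)) (lmul HH s)" if "alg_hom HH s"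
 using assms that by (intro eqv_pure) (simp_all add: lmul_apply H2.m_assoc)
 show "eqv T2 HH (EV m) (lr (rmul HH s')) (rmul HH s')" if "alg_antihom HH s'"
 using assms that by (intro eqv_pure) (simp_all add: rmul_apply H2.m_assoc)
qed

text \<open>At the inserted \<Delta>(\<beta>) the legs \<open>?B\<close> and \<open>?C\<close>
  cancel, and after the associator \<open>?A\<close> and \<open>?B\<close> cancel under the
  evaluation. So the action of \<open>h\<close> travels from \<open>?A\<close> to
  \<open>?C\<close>.\<close>

lemma twist_f_eqv:
 assumes h [simp]: "h<:H"
 shows "acop h**twist_f K H = twist_f K H**SD h"
proof -
 let ?A = "ll rmsg" and ?B = "lr lmD" and ?C = "lr rmD" and ?t = "pT2 1[HH] Dbe"
 let ?a = "EV (twist_a K H)"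
 have "eq_at ?t (dg T2 ?B ?C) (triv T2)"
 by (rule ins_invariant(2)) (simp_all add: beta_invariant)
 then have "eq_at ?t (dg T2 ?A (dg T2 ?B ?C)) ?A"
 by (intro at_triv_diag_right) simp_all
 then have "pT2 (acop h) Dbe = dg T2 ?A (dg T2 ?B ?C) h ?t"
 by (simp add: eq_at_def rmul_apply)
 then have "acop h**twist_f K H = ?a (Phi T2 ?A ?B ?C (dg T2 ?A (dg T2 ?B ?C) h ?t))"
 by (simp add: twist_f_mult)
 also have "... = ?a (dg T2 (dg T2 ?A ?B) ?C h (Phi T2 ?A ?B ?C ?t))"
 by (subst Phi_eqv) simp_all
 also have "equ T2 ?a (dg T2 ?A ?B) (triv T2)"
 by (rule EV_co) (simp_all add: twist_a_invariant)
 then have "equ T2 ?a (dg T2 (dg T2 ?A ?B) ?C) ?C"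
 by (intro under_triv_diag_left[of T2 HH]) simp_all
 then have "?a (dg T2 (dg T2 ?A ?B) ?C h (Phi T2 ?A ?B ?C ?t)) = ?a (?C h (Phi T2 ?A ?B ?C ?t))"
 by (simp add: equ_def)
 also have "... = ?a (Phi T2 ?A ?B ?C ?t)**SD h"
 using EV_eqv(2)[of "twist_a K H" "%h. SD h"]
 by (simp add: eqv_def rmul_apply lcl[OF EV_lin])
 also have "?a (Phi T2 ?A ?B ?C ?t) = twist_f K H"
 using twist_f_mult[of "1[HH]"] by simp
 finally show ?thesis .
qed

abbreviation "T3 \<equiv> T2><HH"
abbreviation "pT3 s w \<equiv> pt T2 HH s w"
abbreviation "lll rh \<equiv> Lg T2 HH (ll rh)"
abbreviation "llr rh \<equiv> Lg T2 HH (lr rh)"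
abbreviation "l3 \<equiv> Rg T2 HH"

definition EV2 where
 "EV2 m = tm K HH HH (EV m) (%w. w)"

lemma pT3_cl [simp]: "[|s<:T2; w<:HH|] ==> pT3 s w<:T3"
 by (simp add: pure_ten_cl)

lemma EV_cl [simp]: "[|m<:HH; t<:T2|] ==> EV m t<:HH"
 by (rule lcl[OF EV_lin])

context
 fixes m assumes m [simp]: "m<:HH"
begin

lemma EV2_lin [simp]: "EV2 m : Lin K T3 T2"
 unfolding EV2_def by (intro ten_map_lin lin_mp_id) simp_all

lemma EV2_pure [simp]: "[|s<:T2; w<:HH|] ==> EV2 m (pT3 s w) = pT2 (EV m s) w"
 unfolding EV2_def by (rule ten_map_pure) (simp_all add: lin_mp_id)

lemma EV_EV2_lin [simp]: "m'<:HH ==> (%t. EV m' (EV2 m t)) : Lin K T3 HH"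
 by (rule linc[OF EV2_lin EV_lin])

lemma EV2_eqv:
 shows "alg_antihom HH s ==> eqv T3 T2 (EV2 m) (llr (rmul HH s)) (ll (rmul HH s))"
 and "lact HH rh ==> eqv T3 T2 (EV2 m) (l3 rh) (lr rh)"
proof -
 show "eqv T3 T2 (EV2 m) (llr (rmul HH s)) (ll (rmul HH s))" if "alg_antihom HH s"
 using that eqvD[OF EV_eqv(2)[of m s]]
 by (intro eqv_pure) (simp_all add: lact_cl[of T2])
 show "eqv T3 T2 (EV2 m) (l3 rh) (lr rh)" if "lact HH rh"
 using that by (intro eqv_pure) (simp_all add: lact_cl[of HH])
qed

text \<open>The inner evaluation already collapses the pair; the outer one is linear and preserves
  this.\<close>

lemma EV2_co_l:
 assumes [simp]: "m'<:HH" and "lact T2 rh" "lact T2 sg" "com T2 rh sg" "equ T2 (EV m) (dg T2 rh sg) (triv T2)"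
 shows "equ T3 (%t. EV m' (EV2 m t)) (dg T3 (Lg T2 HH rh) (Lg T2 HH sg)) (triv T3)"
proof (rule eq_un_pure[where U = HH])
 fix h v w assume h: "h<:H" and v: "v<:T2" and w: "w<:HH"
 then show "EV m' (EV2 m (dg T3 (Lg T2 HH rh) (Lg T2 HH sg) h (pT3 v w)))
 = EV m' (EV2 m (triv T3 h (pT3 v w)))"
 using assms
 by (simp add: diag_legL_pure equ_def triv_def linear_maps_smult[OF EV_lin]
 linear_maps_smult[OF EV2_lin] linear_maps_smult[OF lin_pure(2), symmetric])
qed (use assms in simp_all)

text \<open>\<open>EV2 m\<close> carries the two legs to legs of \<open>T2\<close>, where
  \<open>EV_co\<close> applies to the outer evaluation.\<close>

lemma EV2_co_r:
 assumes [simp]: "m'<:HH" and "alg_antihom HH s" "alg_hom HH s'"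
 and "!!h. h<:H ==> sw HH (comul H h) (%p q. s p**m'**s' q) = counit H h *[HH] m'"
 shows "equ T3 (%t. EV m' (EV2 m t)) (dg T3 (llr (rmul HH s)) (l3 (lmul HH s'))) (triv T3)"
 unfolding equ_def
proof (intro ballI)
 fix h t assume h: "h<:H" and t: "t<:T3"
 have "eqv T3 T2 (EV2 m) (dg T3 (llr (rmul HH s)) (l3 (lmul HH s'))) (dg T2 (ll (rmul HH s)) (lr (lmul HH s')))"
 using assms by (intro eqv_diag EV2_eqv) simp_all
 then show "EV m' (EV2 m (dg T3 (llr (rmul HH s)) (l3 (lmul HH s')) h t)) = EV m' (EV2 m (triv T3 h t))"
 using EV_co[OF assms] eqvD[OF eqv_triv[OF EV2_lin] h t] h t
 lcl[OF EV2_lin t]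
 by (simp add: eqv_def equ_def)
qed

end

lemma ins_invariant3:
 assumes "n<:HH" "alg_antihom HH s" "alg_hom HH s'" "x<:HH" "w<:HH"
 and "!!h. h<:H ==> sw HH (comul H h) (%p q. s' p**n**s q) = counit H h *[HH] n"
 shows "eq_at (pT3 (pT2 x n) w) (dg T3 (llr (lmul HH s')) (llr (rmul HH s))) (triv T3)"
 using ins_invariant(2)[OF assms(1-4,6)] assms
 by (simp add: eq_at_def diag_legL_pure triv_def linear_maps_smult[OF lin_pure(2)])

text \<open>An instance of \<open>zigzag_swap\<close>: contracting one way gives
  \<open>twist_f\<close> times \<Delta>(\<alpha>), the other way gives \<open>twist_a\<close> times
  \<Delta> of the antipode axiom for \<phi>.\<close>

lemma twist_f_De_alpha: "twist_f K H**Dal = twist_a K H"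
proof -
 let ?A = "lll rmsg" and ?B = "llr lmD" and ?C = "llr rmD" and ?W = "l3 lmD"
 let ?t = "pT3 (pT2 1[HH] Dbe) 1[HH]"
 let ?u = "%t. EV Dal (EV2 (twist_a K H) t)"
 have "?u (Phi T3 ?A ?B ?C ?t) = ?u (Ph T3 ?B ?C ?W ?t)"
 proof (rule zigzag_swap[where U = HH])
 show "equ T3 ?u (dg T3 ?A ?B) (triv T3)"
 by (rule EV2_co_l, simp_all, rule EV_co) (simp_all add: twist_a_invariant)
 show "equ T3 ?u (dg T3 ?C ?W) (triv T3)"
 by (rule EV2_co_r) (simp_all add: alpha_invariant)
 show "eq_at ?t (dg T3 ?B ?C) (triv T3)"
 by (rule ins_invariant3) (simp_all add: beta_invariant)
 qed simp_all
 moreover have "?u (Phi T3 ?A ?B ?C ?t) = twist_f K H**Dal"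
 proof -
 have "?u (Phi T3 ?A ?B ?C ?t) = sw3 HH (reassoc_inv K H) (%y1 y2 y3. ?u (?A y1 (?B y2 (?C y3 ?t))))"
 by (intro Ph_lin_im[of T3 _ _ _ _ _ HH]) simp_all
 also have "... = sw3 HH (reassoc_inv K H)
 (%y1 y2 y3. (acop y1**twist_a K H**comul H (y2##qbeta H##S y3))**Dal)"
 by (intro sw3_cong phi_inv_cl) (simp add: lmul_apply rmul_apply De_mult H2.m_assoc)
 also have "... = twist_f K H**Dal"
 unfolding twist_f_alt by (intro sw3_lin_im[where u = "%x. x**Dal", symmetric]) simp_all
 finally show ?thesis .
 qed
 moreover have "?u (Ph T3 ?B ?C ?W ?t) = twist_a K H"
 proof -
 have "?u (Ph T3 ?B ?C ?W ?t) = sw3 HH (reassoc H) (%p q r. ?u (?B p (?C q (?W r ?t))))"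
 by (intro Ph_lin_im[of T3 _ _ _ _ _ HH]) simp_all
 also have "... = sw3 HH (reassoc H)
 (%p q r. twist_a K H**(comul H p**Dbe**SD q**Dal**comul H r))"
 by (intro sw3_cong phi_cl) (simp add: lmul_apply rmul_apply H2.m_assoc)
 also have "... = twist_a K H**sw3 HH (reassoc H) (%p q r. comul H p**Dbe**SD q**Dal**comul H r)"
 by (intro sw3_lin_im[symmetric]) simp_all
 finally show ?thesis
 by (simp add: De_S_phi)
 qed
 ultimately show ?thesis by simp
qed

end

section \<open>Construction of the inverse of the twist\<close>

context quasi_hopf_algebra
begin

text \<open>For a vector that contains coevaluations of \<open>c f\<close> and of
  \<open>d e\<close>, this reassociation makes \<open>q\<close> ready to be evaluated against
  \<open>c d\<close>. Afterwards \<open>e f\<close>, the reversed product of the duals, takes the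
  place of \<open>q\<close>; see \<open>codual_eqv\<close>.\<close>

definition codual where
 "codual T q c d e f t = Phi T q (dg T c d) e (Phi T c d e (Phi T q c f t))"

lemma codual_cl [simp]:
 "[|module K T; legs T [q, c, d, e, f]; t<:T|] ==> codual T q c d e f t<:T"
 by (simp add: codual_def)

lemma codual_nat:
 assumes [simp]: "md K T" "md K T'" and L: "legs T [q, c, d, e, f]"
 and w: "w : Lin K T T'"
 and i: "eqv T T' w q q'" "eqv T T' w c c'" "eqv T T' w d d'"
 "eqv T T' w e e'" "eqv T T' w f f'" and [simp]: "t<:T"
 shows "w (codual T q c d e f t) = codual T' q' c' d' e' f' (w t)"
proof -
 note [simp] = L[simplified]
 have "w (codual T q c d e f t)
 = Phi T' q' (dg T' c' d') e' (w (Phi T c d e (Phi T q c f t)))"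
 unfolding codual_def by (rule op3_nat) (simp_all add: w i eqv_diag)
 also have "w (Phi T c d e (Phi T q c f t)) = Phi T' c' d' e' (w (Phi T q c f t))"
 by (rule op3_nat) (simp_all add: w i)
 also have "w (Phi T q c f t) = Phi T' q' c' f' (w t)"
 by (rule op3_nat) (simp_all add: w i)
 finally show ?thesis
 by (simp add: codual_def)
qed

text \<open>The coevaluated pairs are trivial at \<open>t\<close>, so the action on \<open>q\<close>
  may be spread over all legs. After the associators \<open>q (c d)\<close> collapses under
  \<open>u\<close>, and only \<open>e f\<close> is left.\<close>

lemma codual_eqv:
 assumes [simp]: "md K T" "md K U" and u [simp]: "u : Lin K T U"
 and L: "legs T [q, c, d, e, f]"
 and cu: "equ T u (dg T q (dg T c d)) (triv T)"
 and ct: "eq_at t (dg T c f) (triv T)" "eq_at t (dg T d e) (triv T)"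
 and [simp]: "t<:T" "h<:H"
 shows "u (codual T q c d e f (q h t)) = u (dg T e f h (codual T q c d e f t))"
proof -
 note [simp] = L[simplified]
 let ?s1 = "Phi T q c f t"
 let ?s2 = "Phi T c d e ?s1"
 let ?s3 = "Phi T q (dg T c d) e ?s2"
 have "eq_at t (dg T q (dg T c f)) q"
 using ct(1) by (intro at_triv_diag_right) simp_all
 then have "q h t = dg T q (dg T c f) h t"
 by (simp add: eq_at_def)
 moreover have "Phi T q c f (dg T q (dg T c f) h t) = dg T (dg T q c) f h ?s1"
 by (simp add: Phi_eqv)
 moreover have "dg T (dg T q c) f h ?s1 = dg T (dg T q (dg T c (dg T d e))) f h ?s1"
 proof -
 have "eq_at ?s1 (dg T d e) (triv T)"
 by (rule at_op3_cm[OF _ ct(2)]) simp_all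
 then have "eq_at ?s1 (dg T (dg T q (dg T c (dg T d e))) f) (dg T (dg T q c) f)"
 by (intro at_diag_left at_diag_right at_triv_diag_right) simp_all
 then show ?thesis
 by (simp add: eq_at_def)
 qed
 moreover have "Phi T c d e (dg T (dg T q (dg T c (dg T d e))) f h ?s1)
 = dg T (dg T q (dg T (dg T c d) e)) f h ?s2"
 proof -
 have "eqv T T (Phi T c d e) (dg T (dg T q (dg T c (dg T d e))) f)
 (dg T (dg T q (dg T (dg T c d) e)) f)"
 by (intro eqv_diag eqv_Ph op3_commutes) simp_all
 then show ?thesis
 by (simp add: eqv_def)
 qed
 moreover have "Phi T q (dg T c d) e (dg T (dg T q (dg T (dg T c d) e)) f h ?s2)
 = dg T (dg T (dg T q (dg T c d)) e) f h ?s3"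
 proof -
 have "eqv T T (Phi T q (dg T c d) e) (dg T (dg T q (dg T (dg T c d) e)) f)
 (dg T (dg T (dg T q (dg T c d)) e) f)"
 by (rule eqv_diag) (simp_all add: eqv_Ph op3_commutes)
 then show ?thesis
 by (simp add: eqv_def)
 qed
 moreover have "u (dg T (dg T (dg T q (dg T c d)) e) f h ?s3) = u (dg T e f h ?s3)"
 proof -
 have "equ T u (dg T (dg T (dg T q (dg T c d)) e) f) (dg T e f)"
 using cu by (intro under_diag_left[of T U] under_triv_diag_left[of T U]) simp_all
 then show ?thesis
 by (simp add: equ_def)
 qed
 ultimately show ?thesis
 by (simp only: codual_def)
qed

lemma EVDe_co:
 "equ T2 (EV Dal) (dg T2 (ll rmD) (dg T2 (lr lm1) (lr lm2))) (triv T2)"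
proof -
 have "equ T2 (EV Dal) (dg T2 (lr lm1) (lr lm2)) (lr lmD)"
 by (simp add: equ_def diag_lr_lm)
 then have "equ T2 (EV Dal) (dg T2 (ll rmD) (dg T2 (lr lm1) (lr lm2))) (dg T2 (ll rmD) (lr lmD))"
 by (intro under_diag_right[of T2 HH]) simp_all
 moreover have "equ T2 (EV Dal) (dg T2 (ll rmD) (lr lmD)) (triv T2)"
 by (rule EV_co) (simp_all add: alpha_invariant)
 ultimately show ?thesis
 by (simp add: equ_def)
qed

abbreviation "codual2 q \<equiv> codual T2 q (lr lm1) (lr lm2) (lr rm2) (lr rm1)"

text \<open>Right multiplication by the prospective inverse of \<open>twist_f\<close>. Where
  \<open>twist_f\<close> uses \<open>twist_a\<close> and \<Delta>(\<beta>), this uses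
  \<Delta>(\<alpha>) and \<beta> \<otimes> \<beta>.\<close>

definition twist_g_map where
 "twist_g_map x = EV Dal (codual2 (ll rmD) (pT2 x bbe))"

definition twist_g where
 "twist_g = twist_g_map 1[HH]"

lemma bbe_invariant:
 assumes "x<:HH"
 shows "eq_at (pT2 x bbe) (dg T2 (lr lm1) (lr rm1)) (triv T2)"
 and "eq_at (pT2 x bbe) (dg T2 (lr lm2) (lr rm2)) (triv T2)"
 by (rule ins_invariant(2); simp add: beta_invariant assms)+

lemma ten_map_l_lin [simp]:
 "v : Lin K HH HH ==> tm K HH HH v (%w. w) : Lin K T2 T2"
 by (intro ten_map_lin lin_mp_id) simp_all

lemma ten_map_l_pure [simp]:
 "[|v : Lin K HH HH; x<:HH; w<:HH|]
 ==> tm K HH HH v (%w. w) (pT2 x w) = pT2 (v x) w"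
 by (rule ten_map_pure) (simp_all add: lin_mp_id)

lemma ten_map_l_eqv:
 assumes v [simp]: "v : Lin K HH HH"
 shows "lact HH rh ==> eqv T2 T2 (tm K HH HH v (%w. w)) (lr rh) (lr rh)"
 and "[|lact HH rh; lact HH sg; eqv HH HH v rh sg|]
 ==> eqv T2 T2 (tm K HH HH v (%w. w)) (ll rh) (ll sg)"
proof -
 note [simp] = lcl[OF v]
 show "eqv T2 T2 (tm K HH HH v (%w. w)) (lr rh) (lr rh)" if "lact HH rh"
 using that by (intro eqv_pure) (simp_all add: lact_cl[of HH])
 show "eqv T2 T2 (tm K HH HH v (%w. w)) (ll rh) (ll sg)"
 if "lact HH rh" "lact HH sg" "eqv HH HH v rh sg"
 using that(1,2) eqvD[OF that(3)]
 by (intro eqv_pure) (simp_all add: lact_cl[of HH])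
qed

lemma twist_g_map_cl [simp]: "x<:HH ==> twist_g_map x<:HH"
 by (simp add: twist_g_map_def)

lemma twist_g_cl [simp]: "twist_g<:HH"
 by (simp add: twist_g_def)

text \<open>Left multiplication in the first factor of \<open>T2\<close> commutes with all five legs
  of \<open>codual2\<close>. Hence \<open>twist_g_map\<close> is right multiplication by its value
  at 1.\<close>

lemma twist_g_map_mult:
 assumes [simp]: "y<:HH" "x<:HH"
 shows "twist_g_map (y**x) = y**twist_g_map x"
proof -
 let ?w = "tm K HH HH (%x. y**x) (%w. w)"
 have "twist_g_map (y**x) = EV Dal (codual2 (ll rmD) (?w (pT2 x bbe)))"
 by (simp add: twist_g_map_def)
 also have "codual2 (ll rmD) (?w (pT2 x bbe)) = ?w (codual2 (ll rmD) (pT2 x bbe))"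
 by (rule codual_nat[symmetric])
 (simp_all add: ten_map_l_eqv eqv_def[of HH HH] rmul_apply H2.m_assoc)
 also have "EV Dal ... = y**twist_g_map x"
 unfolding twist_g_map_def
 by (rule ten_ext[OF mod_H2 mod_H2 mod_H2 linc[OF ten_map_l_lin EV_lin]
 linc[OF EV_lin H2_mult_lin(2)]])
 (simp_all add: H2.m_assoc)
 finally show ?thesis .
qed

lemma twist_g_mult: "x<:HH ==> x**twist_g = twist_g_map x"
 using twist_g_map_mult[of x "1[HH]"] by (simp add: twist_g_def)

lemma twist_g_map_lin [simp]: "twist_g_map : Lin K HH HH"
 by (rule lin_mp_cong[OF H2_mult_lin(1)[OF twist_g_cl]]) (simp_all add: twist_g_mult)

lemma twist_g_eqv:
 assumes h [simp]: "h<:H" and x [simp]: "x<:HH"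
 shows "twist_g_map (x**SD h) = twist_g_map x**acop h"
proof -
 have "twist_g_map (x**SD h) = EV Dal (codual2 (ll rmD) (ll rmD h (pT2 x bbe)))"
 by (simp add: twist_g_map_def rmul_apply)
 also have "... = EV Dal (dg T2 (lr rm2) (lr rm1) h (codual2 (ll rmD) (pT2 x bbe)))"
 by (rule codual_eqv[where U = HH]) (simp_all add: EVDe_co bbe_invariant)
 also have "... = dg HH rm2 rm1 h (EV Dal (codual2 (ll rmD) (pT2 x bbe)))"
 proof -
 have "eqv T2 HH (EV Dal) (dg T2 (lr rm2) (lr rm1)) (dg HH rm2 rm1)"
 by (intro eqv_diag EV_eqv(2)) simp_all
 then show ?thesis
 by (simp add: eqv_def)
 qed
 finally show ?thesis
 by (simp add: twist_g_map_def diag_rm)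
qed

text \<open>Moving \<open>twist_f\<close> through \<open>codual2\<close> replaces the leg
  \<open>rmD\<close> by the reversed product \<open>?A\<close>, and with \<Delta>(\<alpha>) it forms
  \<open>twist_a\<close>. Then \<open>double_dual_r\<close> leaves two separate snakes, each an
  antipode axiom for the inverse of \<phi> in one tensor factor.\<close>

lemma twist_f_twist_g: "twist_f K H**twist_g = 1[HH]"
proof -
 let ?w = "tm K HH HH (%x. x**twist_f K H) (%w. w)"
 let ?A = "dg T2 (ll rm2) (ll rm1)"
 let ?t = "pT2 1[HH] bbe"
 let ?s = "codual2 ?A ?t"
 have A: "eqv T2 T2 ?w ?A (ll rmD)"
 proof -
 have "eqv T2 T2 ?w (ll rmsg) (ll rmD)"
 by (rule ten_map_l_eqv(2))
 (simp_all add: eqv_def rmul_apply H2.m_assoc twist_f_eqv)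
 then show ?thesis
 by (simp add: eqv_def diag_ll_rm)
 qed
 have "twist_f K H**twist_g = EV Dal (codual2 (ll rmD) (?w ?t))"
 by (simp add: twist_g_mult twist_g_map_def)
 also have "codual2 (ll rmD) (?w ?t) = ?w ?s"
 by (rule codual_nat[symmetric]) (simp_all add: ten_map_l_eqv A)
 also have "EV Dal (?w ?s) = EV (twist_a K H) ?s"
 by (rule ten_ext[OF mod_H2 mod_H2 mod_H2 linc[OF ten_map_l_lin EV_lin]
 EV_lin])
 (simp_all add: H2.m_assoc twist_f_De_alpha[symmetric])
 also have "... = EV aal (Phi T2 (ll rm1) (lr lm1) (lr lm2)
 (Ph T2 (ll rm2) (ll rm1) (dg T2 (lr lm1) (lr lm2)) ?s))"
 by (simp add: EV_twist_a)
 also have "... = EV aal (Phi T2 (ll rm2) (lr lm2) (lr rm2) (Phi T2 (ll rm1) (lr lm1) (lr rm1) ?t))"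
 unfolding codual_def
 by (rule double_dual_r[where U = HH])
 (simp_all add: EV_co alpha_invariant bbe_invariant)
 also have "... = sw3 HH (reassoc_inv K H) (%y1 y2 y3. EV aal (ll rm2 y1 (lr lm2 y2 (lr rm2 y3
 (Phi T2 (ll rm1) (lr lm1) (lr rm1) ?t)))))"
 by (intro Ph_lin_im[of T2 _ _ _ _ _ HH]) simp_all
 also have "... = sw3 HH (reassoc_inv K H) (%y1 y2 y3. sw3 HH (reassoc_inv K H) (%z1 z2 z3.
 EV aal (ll rm2 y1 (lr lm2 y2 (lr rm2 y3 (ll rm1 z1 (lr lm1 z2 (lr rm1 z3 ?t))))))))"
 proof (rule sw3_cong[OF _ phi_inv_cl])
 fix y1 y2 y3 assume [simp]: "y1<:H" "y2<:H" "y3<:H"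
 show "EV aal (ll rm2 y1 (lr lm2 y2 (lr rm2 y3 (Phi T2 (ll rm1) (lr lm1) (lr rm1) ?t))))
 = sw3 HH (reassoc_inv K H) (%z1 z2 z3.
 EV aal (ll rm2 y1 (lr lm2 y2 (lr rm2 y3 (ll rm1 z1 (lr lm1 z2 (lr rm1 z3 ?t)))))))"
 by (rule Ph_lin_im[of T2 _ _ _ _ _ HH, where u = "%s. EV aal (ll rm2 y1 (lr lm2 y2 (lr rm2 y3 s)))"])
 (simp_all add: linc[OF linc[OF linc[OF lact_lin lact_lin] lact_lin] EV_lin])
 qed
 also have "... = sw3 HH (reassoc_inv K H) (%y1 y2 y3. sw3 HH (reassoc_inv K H) (%z1 z2 z3.
 t2 K H (S z1##qalpha H##z2##qbeta H##S z3) (S y1##qalpha H##y2##qbeta H##S y3)))"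
 by (intro sw3_cong phi_inv_cl) (simp add: lmul_apply rmul_apply one_HH H.m_assoc)
 also have "... = sw3 HH (reassoc_inv K H) (%y1 y2 y3.
 t2 K H 1[H] (S y1##qalpha H##y2##qbeta H##S y3))"
 proof (rule sw3_cong[OF _ phi_inv_cl])
 fix y1 y2 y3 assume [simp]: "y1<:H" "y2<:H" "y3<:H"
 let ?b = "S y1##qalpha H##y2##qbeta H##S y3"
 have "sw3 HH (reassoc_inv K H) (%z1 z2 z3. t2 K H (S z1##qalpha H##z2##qbeta H##S z3) ?b)
 = t2 K H (sw3 H (reassoc_inv K H) (%z1 z2 z3. S z1##qalpha H##z2##qbeta H##S z3)) ?b"
 by (rule sw3_H_lin[where u = "%x. t2 K H x ?b"]) (simp_all add: lin_t2)
 then show "sw3 HH (reassoc_inv K H) (%z1 z2 z3. t2 K H (S z1##qalpha H##z2##qbeta H##S z3) ?b)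
 = t2 K H 1[H] ?b"
 by (simp add: antipode_reassoc_inv)
 qed
 also have "... = t2 K H 1[H] (sw3 H (reassoc_inv K H) (%z1 z2 z3. S z1##qalpha H##z2##qbeta H##S z3))"
 by (rule sw3_H_lin) (simp_all add: lin_t2)
 finally show ?thesis
 by (simp add: antipode_reassoc_inv one_HH)
qed

lemma alpha_invariant_half:
 assumes "h<:H"
 shows "sw HH (comul H h) (%p q. S2 p**i2 (qalpha H)**i2 q) = counit H h *[HH] i2 (qalpha H)"
proof -
 have "sw HH (comul H h) (%p q. S2 p**i2 (qalpha H)**i2 q)
 = i2 (sw H (comul H h) (%p q. S p##qalpha H##q))"
 by (rule sw_H_lin) (simp_all add: lin_t2 assms)
 then show ?thesis
 using assms by (simp add: antipode_alpha linear_maps_smult[OF lin_t2(1)])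
qed

lemma beta_invariant_half:
 assumes "h<:H"
 shows "sw HH (comul H h) (%p q. i2 p**i2 (qbeta H)**S2 q) = counit H h *[HH] i2 (qbeta H)"
proof -
 have "sw HH (comul H h) (%p q. i2 p**i2 (qbeta H)**S2 q)
 = i2 (sw H (comul H h) (%p q. p##qbeta H##S q))"
 by (rule sw_H_lin) (simp_all add: lin_t2 assms)
 then show ?thesis
 using assms by (simp add: antipode_beta linear_maps_smult[OF lin_t2(1)])
qed

lemma EV2_cl [simp]: "[|m<:HH; t<:T3|] ==> EV2 m t<:T2"
 by (rule lcl[OF EV2_lin])

lemma EV2De_co:
 assumes [simp]: "m<:HH"
 shows "equ T3 (%t. EV m (EV2 Dal t)) (dg T3 (lll rmD) (dg T3 (llr lm1) (llr lm2))) (triv T3)"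
proof -
 let ?u = "%t. EV m (EV2 Dal t)" and ?q = "lll rmD" and ?c = "llr lm1" and ?d = "llr lm2"
 have "dg T3 ?c ?d h t = Lg T2 HH (dg T2 (lr lm1) (lr lm2)) h t"
 if "h<:H" "t<:T3" for h t
 by (rule ten_ext[OF _ mod_H2 ten_mod[OF ten_mod[OF mod_H2 mod_H2] mod_H2] _ _ _ that(2)])
 (simp_all add: diag_legL_pure that)
 then have "equ T3 ?u (dg T3 ?c ?d) (Lg T2 HH (dg T2 (lr lm1) (lr lm2)))"
 by (simp add: equ_def)
 then have "equ T3 ?u (dg T3 ?q (dg T3 ?c ?d))
 (dg T3 ?q (Lg T2 HH (dg T2 (lr lm1) (lr lm2))))"
 by (intro under_diag_right[of T3 HH]) simp_all
 moreover have "equ T3 ?u (dg T3 ?q (Lg T2 HH (dg T2 (lr lm1) (lr lm2)))) (triv T3)"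
 by (rule EV2_co_l) (simp_all add: EVDe_co)
 ultimately show ?thesis
 by (simp add: equ_def)
qed

text \<open>Two snakes are contracted one after the other. The one in the first factor of
  \<open>HH\<close> reduces \<alpha> \<otimes> \<alpha> and \<beta> \<otimes> \<beta> to
  \<open>i2 (qalpha H)\<close> and \<open>i2 (qbeta H)\<close>, which are consumed by the one in the
  second factor. The outer factors \<open>x\<close> and \<open>w\<close> allow the identity to be
  used under an evaluation.\<close>

lemma twist_g_twist_a:
 assumes x [simp]: "x<:HH" and w [simp]: "w<:HH"
 shows "twist_g_map x**twist_a K H**w = x**Dal**w"
proof -
 let ?q = "lll rmD" and ?c = "llr lm1" and ?d = "llr lm2" and ?e = "llr rm2" and ?f = "llr rm1"
 and ?c' = "l3 lm1" and ?d' = "l3 lm2"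
 let ?t = "pT3 (pT2 x bbe) w" and ?t' = "pT3 (pT2 x (i2 (qbeta H))) w"
 let ?u = "%t. EV aal (EV2 Dal t)" and ?u' = "%t. EV (i2 (qalpha H)) (EV2 Dal t)"
 \<comment> \<open>The part of the reassociation with which the legs \<open>?f\<close> and
   \<open>?c'\<close> commute; it is carried along while the first snake is summed.\<close>
 let ?Y = "%s. Phi T3 ?q (dg T3 ?c ?d) ?e (Phi T3 ?c ?d ?e (Phi T3 ?q ?c ?d' s))"
 let ?cd = "codual T3 ?q ?c ?d ?e ?f ?t"
 have Y: "?Y s<:T3" if "s<:T3" for s
 using that by simp
 have "Phi T3 ?q ?c ?d' : Lin K T3 T3" "Phi T3 ?c ?d ?e : Lin K T3 T3"
 "Phi T3 ?q (dg T3 ?c ?d) ?e : Lin K T3 T3"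
 by simp_all
 note Y = Y linc[OF linc[OF this(1,2)] this(3)]
 have pT2g: "pT2 (twist_g_map x) w = EV2 Dal ?cd"
 proof -
 have i: "eqv T2 T3 (%s. pT3 s w) rh (Lg T2 HH rh)" if "lact T2 rh" for rh
 using that by (simp add: eqv_def)
 have "pT3 (codual2 (ll rmD) (pT2 x bbe)) w = ?cd"
 by (rule codual_nat[where w = "%s. pT3 s w"]) (simp_all add: lin_pure i)
 moreover have "EV2 Dal (pT3 (codual2 (ll rmD) (pT2 x bbe)) w) = pT2 (twist_g_map x) w"
 by (simp add: twist_g_map_def)
 ultimately show ?thesis by simp
 qed
 have "twist_g_map x**twist_a K H**w = EV (twist_a K H) (pT2 (twist_g_map x) w)"
 by simp
 also have "... = EV aal (Phi T2 (ll rm1) (lr lm1) (lr lm2)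
 (Ph T2 (ll rm2) (ll rm1) (dg T2 (lr lm1) (lr lm2)) (EV2 Dal ?cd)))"
 by (subst EV_twist_a) (simp_all add: pT2g)
 also have "... = ?u (Phi T3 ?f ?c' ?d' (Ph T3 ?e ?f (dg T3 ?c' ?d') ?cd))"
 proof -
 have "EV2 Dal (Phi T3 ?f ?c' ?d' (Ph T3 ?e ?f (dg T3 ?c' ?d') ?cd))
 = Phi T2 (ll rm1) (lr lm1) (lr lm2) (EV2 Dal (Ph T3 ?e ?f (dg T3 ?c' ?d') ?cd))"
 by (rule op3_nat) (simp_all add: EV2_eqv)
 moreover have "EV2 Dal (Ph T3 ?e ?f (dg T3 ?c' ?d') ?cd)
 = Ph T2 (ll rm2) (ll rm1) (dg T2 (lr lm1) (lr lm2)) (EV2 Dal ?cd)"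
 by (rule op3_nat) (simp_all add: EV2_eqv eqv_diag)
 ultimately show ?thesis by simp
 qed
 also have "... = ?u (?Y (Ph T3 ?c ?f ?c' ?t))"
 unfolding codual_def
 proof (rule double_dual_l[where U = HH])
 show "equ T3 ?u (dg T3 ?q (dg T3 ?c ?d)) (triv T3)"
 by (rule EV2De_co) simp
 show "equ T3 ?u (dg T3 ?f ?c') (triv T3)"
 by (rule EV2_co_r) (simp_all add: alpha_invariant)
 show "eq_at ?t (dg T3 ?c ?f) (triv T3)" "eq_at ?t (dg T3 ?d ?e) (triv T3)"
 by (rule ins_invariant3; simp add: beta_invariant)+
 qed simp_all
 also have "... = sw3 HH (reassoc H) (%p k r. ?u (?Y (?c p (?f k (?c' r ?t)))))"
 by (rule Ph_lin_im[of T3 _ _ _ _ _ HH, where u = "%s. ?u (?Y s)"])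
 (simp_all add: Y linc[OF Y(2) EV_EV2_lin])
 also have "... = ?u' (?Y (pT3 (pT2 x (i1 (sw3 H (reassoc H) (%p k r. p##qbeta H##S k##qalpha H##r))
 ** i2 (qbeta H))) w))"
 proof (rule sw3_H_lin[where u = "%z. ?u' (?Y (pT3 (pT2 x (i1 z**i2 (qbeta H))) w))"])
 show "(%z. ?u' (?Y (pT3 (pT2 x (i1 z**i2 (qbeta H))) w))) : Lin K H HH"
 using linc[OF linc[OF linc[OF linc[OF linc[OF
 lin_t2(2) H2_mult_lin(1)] lin_pure(1)] lin_pure(2)] Y(2)] EV_EV2_lin] by simp
 fix p k r assume [simp]: "p<:H" "k<:H" "r<:H"
 let ?z = "S k##qalpha H##r"
 \<comment> \<open>Under the evaluations the legs \<open>?f\<close> and \<open>?c'\<close> have the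
   same effect as right multiplication of the second factor by \<open>i1 ?z\<close>, once \<alpha>
   in the first slot has been absorbed into \<open>?z\<close>. With this map the terms of the snake
   become one element next to \<beta>.\<close>
 let ?n = "tm K HH HH (%x. x) (%y. y**i1 ?z)"
 let ?\<nu> = "tm K T2 HH ?n (%w. w)"
 have n: "?n : Lin K T2 T2"
 by (intro ten_map_lin lin_mp_id) simp_all
 have np [simp]: "?n (pT2 v y) = pT2 v (y**i1 ?z)" if "v<:HH" "y<:HH" for v y
 using that by (intro ten_map_pure) (simp_all add: lin_mp_id)
 have \<nu>: "?\<nu> : Lin K T3 T3"
 by (intro ten_map_lin lin_mp_id n) simp_all
 have \<nu>p: "?\<nu> (pT3 v y) = pT3 (?n v) y" if "v<:T2" "y<:HH" for v y
 using that n by (intro ten_map_pure) (simp_all add: lin_mp_id)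
 have iL: "eqv T3 T3 ?\<nu> (Lg T2 HH rh) (Lg T2 HH rh)"
 if "lact T2 rh" "eqv T2 T2 ?n rh rh" for rh
 using that(1) eqvD[OF that(2)]
 by (intro eqv_pure) (simp_all add: \<nu> \<nu>p lact_cl[of T2] lcl[OF n])
 have iR: "eqv T3 T3 ?\<nu> (l3 rh) (l3 rh)" if "lact HH rh" for rh
 using that by (intro eqv_pure) (simp_all add: \<nu> \<nu>p lact_cl[of HH] lcl[OF n])
 have nl: "eqv T2 T2 ?n (ll rh) (ll rh)" if "lact HH rh" for rh
 using that by (intro eqv_pure) (simp_all add: n lact_cl[of HH])
 have nr: "eqv T2 T2 ?n (lr lm1) (lr lm1)" "eqv T2 T2 ?n (lr lm2) (lr lm2)"
 "eqv T2 T2 ?n (lr rm2) (lr rm2)"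
 by (rule eqv_pure; simp add: n lmul_apply rmul_apply H2.m_assoc)+
 have \<nu>Y: "?\<nu> (?Y s) = ?Y (?\<nu> s)" if s [simp]: "s<:T3" for s
 proof -
 have "?\<nu> (Phi T3 ?q ?c ?d' s) = Phi T3 ?q ?c ?d' (?\<nu> s)"
 by (rule op3_nat) (simp_all add: \<nu> iL iR nl nr)
 moreover have "?\<nu> (Phi T3 ?c ?d ?e (Phi T3 ?q ?c ?d' s)) = Phi T3 ?c ?d ?e (?\<nu> (Phi T3 ?q ?c ?d' s))"
 by (rule op3_nat) (simp_all add: \<nu> iL iR nl nr)
 moreover have "?\<nu> (?Y s) = Phi T3 ?q (dg T3 ?c ?d) ?e (?\<nu> (Phi T3 ?c ?d ?e (Phi T3 ?q ?c ?d' s)))"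
 by (rule op3_nat) (simp_all add: \<nu> iL iR nl nr eqv_diag)
 ultimately show ?thesis by simp
 qed
 have u\<nu>: "?u (?f k (?c' r s)) = ?u' (?\<nu> s)" if "s<:T3" for s
 proof (rule ten_ext[OF _ mod_H2 mod_H2 _ _ _ that])
 fix v y assume v: "v<:T2" and y: "y<:HH"
 have 1: "EV Dal (lr rm1 k v) = EV Dal v**S1 k"
 using v eqvD[OF EV_eqv(2)[of Dal "%h. S1 h"]] by (simp add: rmul_apply)
 have 2: "EV Dal (?n v) = EV Dal v**i1 ?z"
 by (rule ten_ext[OF mod_H2 mod_H2 mod_H2 linc[OF n EV_lin]
 linc[OF EV_lin H2_mult_lin(1)] _ v]) (simp_all add: H2.m_assoc)
 have "S1 k**aal**i1 r = i1 ?z**i2 (qalpha H)"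
 by simp
 then have "EV Dal v**(S1 k**aal**i1 r)**y = EV Dal v**(i1 ?z**i2 (qalpha H))**y"
 by (simp only:)
 then show "?u (?f k (?c' r (pT3 v y))) = ?u' (?\<nu> (pT3 v y))"
 using v y by (simp add: \<nu>p lcl[OF n] lact_cl[of T2] 1 2 lmul_apply H2.m_assoc del: t2_mult)
 qed (simp_all add: linc[OF linc[OF lact_lin lact_lin] EV_EV2_lin]
 linc[OF \<nu> EV_EV2_lin] del: EV2_pure)
 have "lmul HH (%h. i1 h) p (rmul HH (%h. S1 h) k bbe) = rmul HH (%h. S1 h) k (lmul HH (%h. i1 h) p bbe)"
 by (simp add: lmul_apply rmul_apply H.m_assoc)
 then have "?c p (?f k (?c' r ?t)) = ?f k (?c' r (?c p ?t))"
 by simp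
 moreover have "?Y (?f k s) = ?f k (?Y s)" "?Y (?c' r s) = ?c' r (?Y s)" if "s<:T3" for s
 using that eqvD[OF op3_commutes[of T3]] by simp_all
 moreover have cp: "?c p ?t<:T3" "?c' r (?c p ?t)<:T3"
 by simp_all
 ultimately have "?u (?Y (?c p (?f k (?c' r ?t)))) = ?u (?f k (?c' r (?Y (?c p ?t))))"
 by (simp only:)
 also have "... = ?u' (?Y (?\<nu> (?c p ?t)))"
 using u\<nu>[OF Y(1)[OF cp(1)]] \<nu>Y[OF cp(1)] by (simp only:)
 also have "?\<nu> (?c p ?t) = pT3 (pT2 x (i1 (p##qbeta H##S k##qalpha H##r)**i2 (qbeta H))) w"
 by (simp add: \<nu>p lmul_apply) (simp add: H.m_assoc)
 finally show "?u (?Y (?c p (?f k (?c' r ?t))))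
 = ?u' (?Y (pT3 (pT2 x (i1 (p##qbeta H##S k##qalpha H##r)**i2 (qbeta H))) w))" .
 qed simp_all
 also have "... = ?u' (?Y ?t')"
 by (simp add: antipode_reassoc)
 also have "... = ?u' (Ph T3 ?d ?e ?d' ?t')"
 proof (rule double_dual_l_aux[where U = HH])
 show "equ T3 ?u' (dg T3 ?e ?d') (triv T3)"
 by (rule EV2_co_r) (simp_all only: alpha_invariant_half, simp_all)
 show "eq_at ?t' (dg T3 ?d ?e) (triv T3)"
 by (rule ins_invariant3) (simp_all only: beta_invariant_half, simp_all)
 qed (simp_all add: EV2De_co)
 also have "... = sw3 HH (reassoc H) (%p k r. ?u' (?d p (?e k (?d' r ?t'))))"
 by (intro Ph_lin_im[of T3 _ _ _ _ _ HH]) simp_all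
 also have "... = sw3 HH (reassoc H) (%p k r. x**Dal**i2 (p##qbeta H##S k##qalpha H##r)**w)"
 proof (intro sw3_cong phi_cl)
 fix p k r assume [simp]: "p<:H" "k<:H" "r<:H"
 have "i2 p**i2 (qbeta H)**S2 k**i2 (qalpha H)**i2 r = i2 (p##qbeta H##S k##qalpha H##r)"
 by simp
 then have "x**Dal**(i2 p**i2 (qbeta H)**S2 k**i2 (qalpha H)**i2 r)**w
 = x**Dal**i2 (p##qbeta H##S k##qalpha H##r)**w"
 by (simp only:)
 then show "?u' (?d p (?e k (?d' r ?t'))) = x**Dal**i2 (p##qbeta H##S k##qalpha H##r)**w"
 by (simp add: lmul_apply rmul_apply H2.m_assoc del: t2_mult)
 qed
 also have "... = x**Dal**i2 (sw3 H (reassoc H) (%p k r. p##qbeta H##S k##qalpha H##r))**w"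
 proof (rule sw3_H_lin[where u = "%z. x**Dal**i2 z**w"])
 show "(%z. x**Dal**i2 z**w) : Lin K H HH"
 using linc[OF linc[OF lin_t2(1) H2_mult_lin(2)] H2_mult_lin(1)]
 by simp
 qed simp_all
 also have "... = x**Dal**w"
 by (simp add: antipode_reassoc one_HH[symmetric])
 finally show ?thesis .
qed

text \<open>Moving \<open>twist_g\<close> through the associator turns \<open>rmsg\<close> into
  \<open>rmD\<close>, and with \<open>twist_a\<close> it forms \<Delta>(\<alpha>). What remains is
  \<Delta> of an antipode axiom.\<close>

lemma twist_g_twist_f: "twist_g**twist_f K H = 1[HH]"
proof -
 let ?B = "lr lmD" and ?C = "lr rmD"
 let ?w = "tm K HH HH twist_g_map (%w. w)"
 let ?t = "pT2 1[HH] Dbe"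
 have "twist_g**twist_f K H = EV (twist_a K H) (Phi T2 (ll rmsg) ?B ?C (?w ?t))"
 by (simp add: twist_f_mult twist_g_def)
 also have "Phi T2 (ll rmsg) ?B ?C (?w ?t) = ?w (Phi T2 (ll rmD) ?B ?C ?t)"
 proof (rule op3_nat[symmetric])
 show "eqv T2 T2 ?w (ll rmD) (ll rmsg)"
 by (rule ten_map_l_eqv(2))
 (simp_all add: eqv_def rmul_apply twist_g_eqv)
 qed (simp_all add: ten_map_l_eqv)
 also have "EV (twist_a K H) ... = EV Dal (Phi T2 (ll rmD) ?B ?C ?t)"
 by (rule ten_ext[OF mod_H2 mod_H2 mod_H2 linc[OF ten_map_l_lin EV_lin]
 EV_lin]) (simp_all add: twist_g_twist_a)
 also have "... = sw3 HH (reassoc_inv K H) (%p q r. EV Dal (ll rmD p (?B q (?C r ?t))))"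
 by (intro Ph_lin_im[of T2 _ _ _ _ _ HH]) simp_all
 also have "... = sw3 HH (reassoc_inv K H) (%p q r. SD p**Dal**comul H q**Dbe**SD r)"
 by (intro sw3_cong phi_inv_cl) (simp add: lmul_apply rmul_apply H2.m_assoc)
 finally show ?thesis
 by (simp add: De_S_phi_inv)
qed

lemma twist_f_inv: "inv\<^bsub>HH\<^esub> twist_f K H = twist_g"
 by (rule H2.inv_unique'[symmetric]) (simp_all add: twist_f_twist_g twist_g_twist_f)

end

section \<open>Half-braidings\<close>

context quasi_hopf_algebra
begin

lemma lin_mp_id_simp [simp]: "(%x. x) : Lin K V V"
 by (rule lin_mp_id)

lemma tm_simps [simp]:
 assumes "md K V" "md K W" "md K V'" "md K W'"
 and "f : Lin K V V'" "g : Lin K W W'"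
 shows "tm K V' W' f g : Lin K (V><W) (V'><W')"
 and "[|v<:V; w<:W|]
 ==> tm K V' W' f g (pt V W v w) = pt V' W' (f v) (g w)"
 using assms ten_map_lin[OF assms(1-4)] ten_map_pure[OF assms(1-4)] by simp_all

lemma pure_cl [simp]:
 "[|module K V; md K W; v<:V; w<:W|]
 ==> pt V W v w<:(V><W)"
 by (rule pure_ten_cl)

lemma ten_map_eqv:
 assumes [simp]: "md K V" "md K W" "md K V'" "md K W'"
 and f [simp]: "f : Lin K V V'" and g [simp]: "g : Lin K W W'"
 shows "[|lact V rh; lact V' rh'; eqv V V' f rh rh'|]
 ==> eqv (V><W) (V'><W') (tm K V' W' f g) (Lg V W rh) (Lg V' W' rh')"
 and "[|lact W sg; lact W' sg'; eqv W W' g sg sg'|]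
 ==> eqv (V><W) (V'><W') (tm K V' W' f g) (Rg V W sg) (Rg V' W' sg')"
proof -
 note [simp] = lcl[OF f] lcl[OF g]
 show "eqv (V><W) (V'><W') (tm K V' W' f g) (Lg V W rh) (Lg V' W' rh')"
 if "lact V rh" "lact V' rh'" "eqv V V' f rh rh'"
 using that(1,2) eqvD[OF that(3)]
 by (intro eqv_pure) (simp_all add: lact_cl[of V])
 show "eqv (V><W) (V'><W') (tm K V' W' f g) (Rg V W sg) (Rg V' W' sg')"
 if "lact W sg" "lact W' sg'" "eqv W W' g sg sg'"
 using that(1,2) eqvD[OF that(3)]
 by (intro eqv_pure) (simp_all add: lact_cl[of W])
qed

lemma eqv_id [simp]: "eqv V V (%x. x) rh rh"
 by (simp add: eqv_def)

lemma pure_eqv: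
 assumes "md K V" "md K W"
 shows "[|lact V rh; w<:W|] ==> eqv V (V><W) (%v. pt V W v w) rh (Lg V W rh)"
 and "[|lact W sg; v<:V|] ==> eqv W (V><W) (pt V W v) sg (Rg V W sg)"
 using assms by (simp_all add: eqv_def)

abbreviation "L \<equiv> lmul H (%h. h)"
abbreviation "R \<equiv> rmul H S"
abbreviation "tmL V' W f \<equiv> tm K V' W f (%w. w)"
abbreviation "tmR V W' g \<equiv> tm K V W' (%v. v) g"

lemma tmL_trans:
 assumes "md K V" "md K W" "md K V'" "md K V''"
 and f: "f : Lin K V V'" and f': "f' : Lin K V' V''" and t: "t<:(V><W)"
 shows "tmL V'' W f' (tmL V' W f t) = tmL V'' W (%v. f' (f v)) t"
 using assms linc[OF f f']
 by (intro ten_ext[OF assms(1,2) _ linc[OF tm_simps(1) tm_simps(1)] _ _ t])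
 (simp_all add: lcl[OF f])

text \<open>Extends \<open>g\<close> to a module \<open>Z\<close>: the first component of
  \<open>g\<close> acts on \<open>Z\<close> through \<open>z\<close>. For a first kind coaction this
  is the half-braiding of \<open>W\<close> with \<open>Z\<close>, with \<open>Z\<close> kept as the
  first factor on both sides.\<close>

definition chat where
 "chat Z V g z t = sw (Z><V) t (%s w. tmL Z V (%h. z h s) (g w))"

lemma lact_orbit_lin [simp]: "[|lact T z; s<:T|] ==> (%h. z h s) : Lin K H T"
 by (rule bilin_left[OF action_bilin])

context
 fixes Z and V
 and W and g and z
 assumes mods [simp]: "md K Z" "md K V" "md K W"
 and g [simp]: "g : Lin K W (H><V)" and z [simp]: "lact Z z"
begin

interpretation Z: module K Z by (rule mods)
interpretation SV: module K "Z><V" by simp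

lemma g_closed [simp]: "w<:W ==> g w<:(H><V)"
 by (rule lcl[OF g])

lemma chat_bil: "bilin K Z W (Z><V) (%s w. tmL Z V (%h. z h s) (g w))"
proof (rule bil_lin_lin)
 fix s assume s: "s<:Z"
 then show "(%w. tmL Z V (%h. z h s) (g w)) : Lin K W (Z><V)"
 by (intro linc[OF g]) simp
next
 fix s s' w assume [simp]: "s<:Z" "s'<:Z" and w: "w<:W"
 have plus: "(%h. z h (s +[Z] s')) : Lin K H Z" by simp
 show "tmL Z V (%h. z h (s +[Z] s')) (g w)
 = tmL Z V (%h. z h s) (g w) +[Z><V] tmL Z V (%h. z h s') (g w)"
 by (rule ten_ext[OF mod_H mods(2) SV.module_axioms _ lin_mp_plus _ g_closed[OF w]])
 (simp_all add: SV.module_axioms plus linear_maps_add[OF action_linear[OF z]]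
 linear_maps_add[OF lin_pure(2)] lact_cl[OF z])
next
 fix c s w assume c [simp]: "c<:K" and [simp]: "s<:Z" and w: "w<:W"
 have scale: "(%h. z h (c *[Z] s)) : Lin K H Z" by simp
 show "tmL Z V (%h. z h (c *[Z] s)) (g w) = c *[Z><V] tmL Z V (%h. z h s) (g w)"
 by (rule ten_ext[OF mod_H mods(2) SV.module_axioms _ lin_mp_scale _ g_closed[OF w]])
 (simp_all add: SV.module_axioms scale linear_maps_smult[OF action_linear[OF z]]
 linear_maps_smult[OF lin_pure(2)] lact_cl[OF z])
qed

lemma chat_lin [simp]: "chat Z V g z : Lin K (Z><W) (Z><V)"
 using sw_lin[OF mods(1,3) SV.module_axioms chat_bil] by (simp add: chat_def[abs_def])

lemma chat_cl [simp]: "t<:(Z><W) ==> chat Z V g z t<:(Z><V)"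
 by (rule lcl[OF chat_lin])

lemma chat_pure [simp]:
 "[|s<:Z; w<:W|] ==> chat Z V g z (pt Z W s w) = tmL Z V (%h. z h s) (g w)"
 using sw_pure[OF mods(1,3) SV.module_axioms chat_bil] by (simp add: chat_def)

lemma chat_nat_l:
 assumes [simp]: "md K S''" "lact S'' z'" and f [simp]: "f : Lin K Z S''"
 and i: "eqv Z S'' f z z'" and t: "t<:(Z><W)"
 shows "tmL S'' V f (chat Z V g z t) = chat S'' V g z' (tmL S'' W f t)"
proof (rule ten_ext[OF mods(1,3) _ linc[OF chat_lin] linc[OF tm_simps(1)] _ t])
 show "chat S'' V g z' : Lin K (S''><W) (S''><V)"
 unfolding chat_def using sw_lin[OF _ mods(3) _ quasi_hopf_algebra.chat_bil[OF quasi_hopf_algebra_axioms assms(1) mods(2,3) g assms(2)]]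
 by simp
 fix s w assume [simp]: "s<:Z" "w<:W"
 have fs [simp]: "f s<:S''"
 by (rule lcl[OF f]) simp
 have c: "chat S'' V g z' (pt S'' W (f s) w) = tmL S'' V (%h. z' h (f s)) (g w)"
 unfolding chat_def
 using sw_pure[OF assms(1) mods(3) _ quasi_hopf_algebra.chat_bil[OF quasi_hopf_algebra_axioms assms(1) mods(2,3) g assms(2)]]
 by simp
 have "tmL S'' V f (tmL Z V (%h. z h s) (g w)) = tmL S'' V (%h. f (z h s)) (g w)"
 by (rule tmL_trans[where V = H and V' = Z]) simp_all
 also have "... = tmL S'' V (%h. z' h (f s)) (g w)"
 by (rule ten_map_cong[OF mod_H mods(2) assms(1) mods(2)]) (simp_all add: eqvD[OF i])
 finally show "tmL S'' V f (chat Z V g z (pt Z W s w))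
 = chat S'' V g z' (tmL S'' W f (pt Z W s w))"
 by (simp add: c)
qed simp_all

end

lemma chat_nat_r:
 assumes [simp]: "md K Z" "md K V" "md K W" "md K V'" "md K W'"
 and g [simp]: "g : Lin K W (H><V)"
 and g' [simp]: "g' : Lin K W' (H><V')" and z [simp]: "lact Z z"
 and k [simp]: "k : Lin K V V'" and l [simp]: "l : Lin K W W'"
 and eq: "!!w. w<:W ==> g' (l w) = tmR H V' k (g w)" and t: "t<:(Z><W)"
 shows "tmR Z V' k (chat Z V g z t) = chat Z V' g' z (tmR Z W' l t)"
proof (rule ten_ext[OF assms(1,3) _ linc[OF chat_lin tm_simps(1)]
 linc[OF tm_simps(1) chat_lin] _ t])
 fix s w assume [simp]: "s<:Z" "w<:W"
 have [simp]: "l w<:W'"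
 by (rule lcl[OF l]) simp
 have "tmR Z V' k (tmL Z V (%h. z h s) x) = tmL Z V' (%h. z h s) (tmR H V' k x)"
 if x: "x<:(H><V)" for x
 by (rule ten_ext[OF mod_H assms(2) _ linc[OF tm_simps(1) tm_simps(1)]
 linc[OF tm_simps(1) tm_simps(1)] _ x])
 (simp_all add: lcl[OF k] lact_cl[OF z])
 then show "tmR Z V' k (chat Z V g z (pt Z W s w))
 = chat Z V' g' z (tmR Z W' l (pt Z W s w))"
 by (simp add: eq lcl[OF g])
qed simp_all

lemma chat_eqv_l:
 assumes [simp]: "md K Z" "md K V" "md K W" "g : Lin K W (H><V)"
 "lact Z z" and rh: "lact Z rh" "com Z rh z"
 shows "eqv (Z><W) (Z><V) (chat Z V g z) (Lg Z W rh) (Lg Z V rh)"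
 unfolding eqv_def legL_def
proof (intro ballI)
 fix h t assume h: "h<:H" and t: "t<:(Z><W)"
 show "chat Z V g z (tmL Z W (rh h) t) = tmL Z V (rh h) (chat Z V g z t)"
 by (rule chat_nat_l[where W = W and Z = Z, symmetric])
 (simp_all add: rh h t eqv_def commutingD[OF rh(2)])
qed

lemma chat_eqv_r:
 assumes [simp]: "md K Z" "md K V" "md K W" "g : Lin K W (H><V)"
 "lact Z z" and rh: "lact W rh" "lact V rh'" "eqv W (H><V) g rh (Rg H V rh')"
 shows "eqv (Z><W) (Z><V) (chat Z V g z) (Rg Z W rh) (Rg Z V rh')"
 unfolding eqv_def legR_def
proof (intro ballI)
 fix h t assume h: "h<:H" and t: "t<:(Z><W)"
 show "chat Z V g z (tmR Z W (rh h) t) = tmR Z V (rh' h) (chat Z V g z t)"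
 by (rule chat_nat_r[where W = W and W' = W, symmetric])
 (simp_all add: rh(1,2) h t eqvD[OF rh(3)] legR_def[symmetric])
qed

text \<open>A map \<open>g\<close> from \<open>W\<close> to \<open>H \<otimes> V\<close> for which \<open>w \<otimes> x \<mapsto> g(w)(x \<otimes> 1)\<close> is a morphism from \<open>W \<otimes> X\<close> to
 \<open>X \<otimes> V\<close> for all modules \<open>X\<close>.\<close>

definition first_kind where
 "first_kind W a V b g \<longleftrightarrow> g : Lin K W (H><V) \<and>
 (\<forall>h \<in> carrier H. \<forall>w \<in> carrier W.
 chat H V g L (dg (H><W) (Rg H W a) (Lg H W L) h (pt H W 1[H] w))
 = dg (H><V) (Lg H V L) (Rg H V b) h (g w))"

lemma fst1_k_lin: "first_kind W a V b g ==> g : Lin K W (H><V)"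
 by (simp add: first_kind_def)

lemma lact_orbit_eqv: "[|lact T z; s<:T|] ==> eqv H T (%h. z h s) L z"
 by (simp add: eqv_def lmul_def action_mult[of K H T])

lemma orbit_map_eqv:
 assumes [simp]: "md K Z" "md K U" "lact Z z" "lact U rh" "s<:Z"
 shows "eqv (H><U) (Z><U) (tmL Z U (%h. z h s)) (Rg H U rh) (Rg Z U rh)"
 and "eqv (H><U) (Z><U) (tmL Z U (%h. z h s)) (Lg H U L) (Lg Z U z)"
proof -
 have [simp]: "(%h. z h s) : Lin K H Z"
 by (rule lact_orbit_lin) simp_all
 show "eqv (H><U) (Z><U) (tmL Z U (%h. z h s)) (Rg H U rh) (Rg Z U rh)"
 by (rule ten_map_eqv) simp_all
 show "eqv (H><U) (Z><U) (tmL Z U (%h. z h s)) (Lg H U L) (Lg Z U z)"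
 by (rule ten_map_eqv) (simp_all add: lact_orbit_eqv)
qed

text \<open>\<open>first_kind\<close> speaks only of the vector 1 in the regular module. The pure
  tensor of \<open>s\<close> and \<open>w\<close> is the image of that of 1 and \<open>w\<close>
  under the orbit map of \<open>s\<close>, and every map involved is natural for it.\<close>

lemma fst1_k_eqv:
 assumes [simp]: "md K Z" "md K V" "md K W" "lact Z z" "lact W a" "lact V b"
 and g: "first_kind W a V b g"
 shows "eqv (Z><W) (Z><V) (chat Z V g z)
 (dg (Z><W) (Rg Z W a) (Lg Z W z))
 (dg (Z><V) (Lg Z V z) (Rg Z V b))"
proof (rule eqv_pure)
 note [simp] = fst1_k_lin[OF g]
 show "chat Z V g z : Lin K (Z><W) (Z><V)"
 by simp
 fix h s w assume [simp]: "h<:H" "s<:Z" "w<:W"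
 let ?f = "%h. z h s"
 note i = orbit_map_eqv[OF assms(1) _ assms(4)] and zi = lact_orbit_eqv[OF assms(4)]
 note one = action_one[OF assms(4)]
 let ?o = "pt H W 1[H] w"
 have p: "pt Z W s w = tmL Z W ?f ?o"
 by (simp add: one)
 have "dg (Z><W) (Rg Z W a) (Lg Z W z) h (tmL Z W ?f ?o)
 = tmL Z W ?f (dg (H><W) (Rg H W a) (Lg H W L) h ?o)"
 by (rule eqvD[OF eqv_diag, symmetric]) (simp_all add: i[OF assms(3,5)])
 moreover have "chat Z V g z (tmL Z W ?f (dg (H><W) (Rg H W a) (Lg H W L) h ?o))
 = tmL Z V ?f (chat H V g L (dg (H><W) (Rg H W a) (Lg H W L) h ?o))"
 by (rule chat_nat_l[symmetric]) (simp_all add: zi)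
 moreover have "chat H V g L (dg (H><W) (Rg H W a) (Lg H W L) h ?o)
 = dg (H><V) (Lg H V L) (Rg H V b) h (g w)"
 using g by (simp add: first_kind_def)
 moreover have "tmL Z V ?f (dg (H><V) (Lg H V L) (Rg H V b) h (g w))
 = dg (Z><V) (Lg Z V z) (Rg Z V b) h (tmL Z V ?f (g w))"
 by (rule eqvD[OF eqv_diag]) (simp_all add: i[OF assms(2,6)] lcl[OF fst1_k_lin[OF g]])
 ultimately show "chat Z V g z (dg (Z><W) (Rg Z W a) (Lg Z W z) h (pt Z W s w))
 = dg (Z><V) (Lg Z V z) (Rg Z V b) h (chat Z V g z (pt Z W s w))"
 by (simp only: p) (simp add: one)
qed simp_all

text \<open>By naturality \<open>chat\<close> is determined by its values at 1, so a competitor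
  \<open>G\<close> is compared on orbit maps only.\<close>

lemma chat_eqI:
 assumes [simp]: "md K Z" "md K V" "md K W" "lact Z z"
 "g : Lin K W (H><V)"
 and G: "G : Lin K (Z><W) (Z><V)"
 and eq: "!!s w. [|s<:Z; w<:W|]
 ==> G (tmL Z W (%h. z h s) (pt H W 1[H] w)) = tmL Z V (%h. z h s) (g w)"
 and t: "t<:(Z><W)"
 shows "chat Z V g z t = G t"
proof (rule ten_ext[OF assms(1,3) _ chat_lin G _ t])
 fix s w assume "s<:Z" "w<:W"
 then show "chat Z V g z (pt Z W s w) = G (pt Z W s w)"
 using eq[of s w] by (simp add: action_one[OF assms(4)])
qed simp_all

end

context quasi_hopf_algebra
begin

lemma diag_cong:
 assumes "md K T" "lact T b" "h<:H" "t<:T"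
 and "!!h t. [|h<:H; t<:T|] ==> a h t = a' h t"
 and "!!h t. [|h<:H; t<:T|] ==> b h t = b' h t"
 shows "dg T a b h t = dg T a' b' h t"
 unfolding diag_sw[OF assms(1)]
 using assms by (intro sw_cong[OF mod_H mod_H]) (simp_all add: lact_cl[OF assms(2)] flip: assms(6))

lemma op3_cong:
 assumes "md K T" "lact T b" "lact T c" "com T b c" "x<:(H3 K H)" "t<:T"
 and "!!h t. [|h<:H; t<:T|] ==> a h t = a' h t"
 and "!!h t. [|h<:H; t<:T|] ==> b h t = b' h t"
 and "!!h t. [|h<:H; t<:T|] ==> c h t = c' h t"
 shows "op3 T x a b c t = op3 T x a' b' c' t"
proof -
 have e: "tact T b c y t = tact T b' c' y t" if "y<:HH" for y
 unfolding tact_def using assms that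
 by (intro sw_cong[OF mod_H mod_H]) (simp_all add: lact_cl[OF assms(3)] flip: assms(8,9))
 have cl: "tact T b c y t<:T" if "y<:HH" for y
 using action_closed[OF act_tact[OF alg_H alg_H assms(1-4)] that assms(6)] .
 show ?thesis
 unfolding op3_def tact_def[of T a] tact_def[of T a']
 using assms cl by (intro sw_cong[OF mod_H mod_H2]) (simp_all flip: e)
qed

lemma diag_legR:
 assumes "md K V" "md K W" "lact W rh" "lact W sg" "com W rh sg" "h<:H"
 "t<:(V><W)"
 shows "dg (V><W) (Rg V W rh) (Rg V W sg) h t = Rg V W (dg W rh sg) h t"
proof (rule ten_ext[OF assms(1,2) ten_mod[OF assms(1,2)] _ _ _ assms(7)])
 have "lact W (dg W rh sg)"
 using assms by simp
 then show "Rg V W (dg W rh sg) h : Lin K (V><W) (V><W)"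
 using assms by (intro action_linear[OF lact_legR]) simp_all
 show "dg (V><W) (Rg V W rh) (Rg V W sg) h : Lin K (V><W) (V><W)"
 using assms by (intro action_linear[OF lact_diag]) simp_all
qed (use assms in \<open>simp_all add: diag_legR_pure\<close>)

lemma ext_pure:
 assumes "md K V" "md K W" "md K U"
 and "f : Lin K (V><W) U" "g : Lin K (V><W) U"
 and "x<:(V><W)"
 and "!!v w. [|v<:V; w<:W|] ==> f (pt V W v w) = g (pt V W v w)"
 shows "f x = g x"
 by (rule ten_ext[OF assms(1-5,7,6)])

section \<open>Coactions of the first and of the second kind\<close>

text \<open>The action on \<open>R(V)\<close>, read as \<open>V\<close> placed between the regular
  module and its dual: the legs \<open>L\<close> and \<open>R\<close> both act on the factor
  \<open>H\<close>.\<close>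

definition ract where
 "ract V b = dg (H><V) (dg (H><V) (Lg H V L) (Rg H V b)) (Lg H V R)"

lemma com_LR [simp]: "com H L R" "com H R L"
 by simp_all

lemma lact_ract [simp]: "[|module K V; lact V b|] ==> lact (H><V) (ract V b)"
 by (simp add: ract_def)

definition almap where
 "almap V = tmL H V (%a. a##qalpha H)"

lemma H_mult_lin [simp]:
 shows "y<:H ==> (%x. x##y) : Lin K H H"
 and "y<:H ==> (%x. y##x) : Lin K H H"
 using bilin_left[OF alg_mult_bil[OF alg_H]] bilin_right[OF alg_mult_bil[OF alg_H]] by simp_all

lemma almap_simps [simp]:
 assumes "md K V"
 shows "almap V : Lin K (H><V) (H><V)"
 and "[|a<:H; v<:V|] ==> almap V (pt H V a v) = pt H V (a##qalpha H) v"
 using assms by (simp_all add: almap_def)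

text \<open>Evaluation of the dual leg \<open>R\<close> of \<open>H><V\<close> against
  \<open>Z\<close>, with \<alpha> in between.\<close>

definition evm where
 "evm Z V z = chat Z V (almap V) z"

text \<open>The map from \<open>R(V)\<close> times \<open>Z\<close> to \<open>Z\<close> times
  \<open>V\<close>: reassociate until \<open>R\<close> meets \<open>z\<close>, then evaluate. The
  leg \<open>L\<close> takes over the action on \<open>Z\<close>, by
  \<open>evm_eqv_mult\<close>.\<close>

definition thetahat where
 "thetahat Z V b z t = evm Z V z (Ph (Z><(H><V))
 (dg (Z><(H><V)) (Rg Z (H><V) (Lg H V L)) (Rg Z (H><V) (Rg H V b)))
 (Rg Z (H><V) (Lg H V R)) (Lg Z (H><V) z) t)"

definition theta where
 "theta V b r = thetahat H V b L (pt H (H><V) 1[H] r)"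

text \<open>From the first kind to the second: insert \<beta>, reassociate, apply the half-braiding.
  In elements this is the formula with \<open>pR\<close>; see \<open>second_pR\<close>.\<close>

definition second where
 "second W a V g w = chat H V g L
 (Phi (H><W) (Rg H W a) (Lg H W L) (Lg H W R) (pt H W (qbeta H) w))"

context
 fixes Z and V
 and z
 assumes mods [simp]: "md K Z" "md K V" and z [simp]: "lact Z z"
begin

lemma evm_lin [simp]: "evm Z V z : Lin K (Z><(H><V)) (Z><V)"
 by (simp add: evm_def)

lemma evm_cl [simp]: "t<:(Z><(H><V)) ==> evm Z V z t<:(Z><V)"
 by (rule lcl[OF evm_lin])

lemma evm_pure [simp]:
 assumes [simp]: "s<:Z" "a<:H" "v<:V"
 shows "evm Z V z (pt Z (H><V) s (pt H V a v)) = pt Z V (z (a##qalpha H) s) v"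
 by (simp add: evm_def)

lemma evm_eqv_l:
 "[|lact Z rh; com Z rh z|]
 ==> eqv (Z><(H><V)) (Z><V) (evm Z V z) (Lg Z (H><V) rh) (Lg Z V rh)"
 unfolding evm_def by (intro chat_eqv_l) simp_all

lemma evm_eqv_r:
 assumes [simp]: "lact V rh"
 shows "eqv (Z><(H><V)) (Z><V) (evm Z V z) (Rg Z (H><V) (Rg H V rh)) (Rg Z V rh)"
 unfolding evm_def
 by (intro chat_eqv_r eqv_pure) (simp_all add: lact_cl[of V])

lemma eqv_pure2:
 assumes "u : Lin K (Z><(H><V)) U" "md K U" "lact (Z><(H><V)) rh" "lact U sg"
 and "!!h s a v. [|h<:H; s<:Z; a<:H; v<:V|]
 ==> u (rh h (pt Z (H><V) s (pt H V a v))) = sg h (u (pt Z (H><V) s (pt H V a v)))"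
 shows "eqv (Z><(H><V)) U u rh sg"
proof (rule eqv_pure)
 fix h s r assume [simp]: "h<:H" "s<:Z" and r: "r<:(H><V)"
 have "rh h : Lin K (Z><(H><V)) (Z><(H><V))" "sg h : Lin K U U"
 using assms(3,4) by simp_all
 note l = linc[OF linc[OF lin_pure(1) this(1)] assms(1)]
 linc[OF linc[OF lin_pure(1) assms(1)] this(2)]
 show "u (rh h (pt Z (H><V) s r)) = sg h (u (pt Z (H><V) s r))"
 by (rule ext_pure[OF mod_H mods(2) assms(2) l r]) (simp_all add: assms(5))
qed (use assms in simp_all)

lemma evm_eqv_mult:
 "eqv (Z><(H><V)) (Z><V) (evm Z V z) (Rg Z (H><V) (Lg H V L)) (Lg Z V z)"
 by (rule eqv_pure2)
 (simp_all add: lmul_apply H.m_assoc action_mult[OF z] lact_cl[OF z])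

text \<open>Between \<open>a\<close> and the action on \<open>s\<close> the two legs produce the
  antipode axiom for \<alpha>.\<close>

lemma evm_co:
 "equ (Z><(H><V)) (evm Z V z)
 (dg (Z><(H><V)) (Rg Z (H><V) (Lg H V R)) (Lg Z (H><V) z)) (triv (Z><(H><V)))"
proof -
 let ?T = "Z><(H><V)"
 let ?d = "dg ?T (Rg Z (H><V) (Lg H V R)) (Lg Z (H><V) z)"
 have "eqv ?T (Z><V) (evm Z V z) ?d (triv (Z><V))"
 proof (rule eqv_pure2)
 fix h s a v assume [simp]: "h<:H" "s<:Z" "a<:H" "v<:V"
 let ?t = "pt Z (H><V) s (pt H V a v)"
 have "evm Z V z (?d h ?t) = sw (Z><V) (comul H h) (%p q. evm Z V z
 (Rg Z (H><V) (Lg H V R) p (Lg Z (H><V) z q ?t)))"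
 by (intro un_triv_diag_aux) simp_all
 also have "... = pt Z V (z (a##sw H (comul H h) (%p q. S p##qalpha H##q)) s) v"
 proof (rule sw_H_lin[where u = "%x. pt Z V (z (a##x) s) v"])
 show "(%x. pt Z V (z (a##x) s) v) : Lin K H (Z><V)"
 by (rule linc[OF linc[OF H_mult_lin(2)
 bilin_left[OF action_bilin[OF z]]] lin_pure(2)]) simp_all
 qed (simp_all add: rmul_apply H.m_assoc action_mult[OF z] lact_cl[OF z])
 also have "... = triv (Z><V) h (evm Z V z ?t)"
 by (simp add: antipode_alpha triv_def H.smult_mult_right bilin_smult_left[OF action_bilin[OF z]]
 linear_maps_smult[OF lin_pure(2)] lact_cl[OF z])
 finally show "evm Z V z (?d h ?t) = triv (Z><V) h (evm Z V z ?t)" .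
 qed simp_all
 then show ?thesis
 using eqvD[OF eqv_triv[OF evm_lin]]
 by (simp add: equ_def eqv_def)
qed

context
 fixes b
 assumes b [simp]: "lact V b"
begin

lemma thetahat_lin [simp]: "thetahat Z V b z : Lin K (Z><(H><V)) (Z><V)"
 unfolding thetahat_def[abs_def] by (rule linc[OF op3_lin evm_lin]) simp_all

lemma thetahat_cl [simp]: "t<:(Z><(H><V)) ==> thetahat Z V b z t<:(Z><V)"
 by (rule lcl[OF thetahat_lin])

lemma legR_ract:
 assumes "h<:H" "t<:(Z><(H><V))"
 shows "Rg Z (H><V) (ract V b) h t = dg (Z><(H><V))
 (dg (Z><(H><V)) (Rg Z (H><V) (Lg H V L)) (Rg Z (H><V) (Rg H V b)))
 (Rg Z (H><V) (Lg H V R)) h t"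
proof -
 have "dg (Z><(H><V))
 (dg (Z><(H><V)) (Rg Z (H><V) (Lg H V L)) (Rg Z (H><V) (Rg H V b)))
 (Rg Z (H><V) (Lg H V R)) h t
 = dg (Z><(H><V)) (Rg Z (H><V) (dg (H><V) (Lg H V L) (Rg H V b)))
 (Rg Z (H><V) (Lg H V R)) h t"
 using assms by (intro diag_cong) (simp_all add: diag_legR)
 then show ?thesis
 using assms by (simp add: diag_legR ract_def)
qed

text \<open>After the associator the legs \<open>R\<close> and \<open>z\<close> are adjacent and
  collapse under \<open>evm\<close>; \<open>L\<close> and \<open>b\<close> remain as the diagonal
  action on the target.\<close>

lemma thetahat_eqv:
 "eqv (Z><(H><V)) (Z><V) (thetahat Z V b z)
 (dg (Z><(H><V)) (Rg Z (H><V) (ract V b)) (Lg Z (H><V) z))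
 (dg (Z><V) (Lg Z V z) (Rg Z V b))"
 unfolding eqv_def
proof (intro ballI)
 fix h t assume h [simp]: "h<:H" and t [simp]: "t<:(Z><(H><V))"
 let ?T = "Z><(H><V)"
 let ?P = "Rg Z (H><V) (Lg H V L)" and ?b = "Rg Z (H><V) (Rg H V b)"
 and ?R = "Rg Z (H><V) (Lg H V R)" and ?z = "Lg Z (H><V) z"
 let ?Y = "dg ?T ?P ?b"
 have "thetahat Z V b z (dg ?T (Rg Z (H><V) (ract V b)) ?z h t)
 = thetahat Z V b z (dg ?T (dg ?T ?Y ?R) ?z h t)"
 by (rule arg_cong[where f = "thetahat Z V b z"], rule diag_cong) (simp_all add: legR_ract)
 also have "... = evm Z V z (dg ?T ?Y (dg ?T ?R ?z) h (Ph ?T ?Y ?R ?z t))"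
 unfolding thetahat_def by (subst Ph_eqv) simp_all
 also have "... = evm Z V z (?Y h (Ph ?T ?Y ?R ?z t))"
 proof -
 have "equ ?T (evm Z V z) (dg ?T ?Y (dg ?T ?R ?z)) ?Y"
 by (rule under_triv_diag_right[where U = "Z><V"]) (simp_all add: evm_co)
 then show ?thesis by (simp add: equ_def)
 qed
 also have "... = dg (Z><V) (Lg Z V z) (Rg Z V b) h (thetahat Z V b z t)"
 proof -
 have "eqv ?T (Z><V) (evm Z V z) ?Y (dg (Z><V) (Lg Z V z) (Rg Z V b))"
 by (rule eqv_diag) (simp_all add: evm_eqv_mult evm_eqv_r)
 then show ?thesis by (simp add: eqv_def thetahat_def)
 qed
 finally show "thetahat Z V b z (dg ?T (Rg Z (H><V) (ract V b)) ?z h t)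
 = dg (Z><V) (Lg Z V z) (Rg Z V b) h (thetahat Z V b z t)" .
qed

end

end

lemma theta_lin [simp]:
 assumes "md K V" "lact V b"
 shows "theta V b : Lin K (H><V) (H><V)"
 unfolding theta_def[abs_def]
 using assms by (intro linc[OF lin_pure(1) thetahat_lin]) simp_all

lemma thetahat_nat_l:
 assumes [simp]: "md K Z" "md K S''" "md K V" "lact V b" "lact Z z" "lact S'' z'"
 and f [simp]: "f : Lin K Z S''" and i: "eqv Z S'' f z z'"
 and t [simp]: "t<:(Z><(H><V))"
 shows "tmL S'' V f (thetahat Z V b z t) = thetahat S'' V b z' (tmL S'' (H><V) f t)"
proof -
 let ?X = "Ph (Z><(H><V))
 (dg (Z><(H><V)) (Rg Z (H><V) (Lg H V L)) (Rg Z (H><V) (Rg H V b)))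
 (Rg Z (H><V) (Lg H V R)) (Lg Z (H><V) z) t"
 have "tmL S'' V f (evm Z V z ?X) = evm S'' V z' (tmL S'' (H><V) f ?X)"
 unfolding evm_def by (rule chat_nat_l) (simp_all add: i)
 also have "tmL S'' (H><V) f ?X = Ph (S''><(H><V))
 (dg (S''><(H><V)) (Rg S'' (H><V) (Lg H V L)) (Rg S'' (H><V) (Rg H V b)))
 (Rg S'' (H><V) (Lg H V R)) (Lg S'' (H><V) z') (tmL S'' (H><V) f t)"
 by (rule op3_nat) (simp_all add: ten_map_eqv eqv_diag i)
 finally show ?thesis by (simp add: thetahat_def)
qed

lemma thetahat_nat_r:
 assumes [simp]: "md K Z" "md K V'" "md K V" "lact V b" "lact V' b'" "lact Z z"
 and k [simp]: "k : Lin K V V'" and i: "eqv V V' k b b'"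
 and t [simp]: "t<:(Z><(H><V))"
 shows "tmR Z V' k (thetahat Z V b z t) = thetahat Z V' b' z (tmR Z (H><V') (tmR H V' k) t)"
proof -
 let ?X = "Ph (Z><(H><V))
 (dg (Z><(H><V)) (Rg Z (H><V) (Lg H V L)) (Rg Z (H><V) (Rg H V b)))
 (Rg Z (H><V) (Lg H V R)) (Lg Z (H><V) z) t"
 have e: "almap V' (tmR H V' k r) = tmR H V' k (almap V r)" if r: "r<:(H><V)" for r
 by (rule ext_pure[OF mod_H assms(3) _ linc[OF tm_simps(1) almap_simps(1)]
 linc[OF almap_simps(1) tm_simps(1)] r])
 (simp_all add: lcl[OF k])
 have "tmR Z V' k (evm Z V z ?X) = evm Z V' z (tmR Z (H><V') (tmR H V' k) ?X)"
 unfolding evm_def by (rule chat_nat_r[where W = "H><V"]) (simp_all add: e)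
 also have "tmR Z (H><V') (tmR H V' k) ?X = Ph (Z><(H><V'))
 (dg (Z><(H><V')) (Rg Z (H><V') (Lg H V' L)) (Rg Z (H><V') (Rg H V' b')))
 (Rg Z (H><V') (Lg H V' R)) (Lg Z (H><V') z) (tmR Z (H><V') (tmR H V' k) t)"
 by (rule op3_nat) (simp_all add: ten_map_eqv eqv_diag i)
 finally show ?thesis by (simp add: thetahat_def)
qed

lemma chat_theta:
 assumes [simp]: "md K Z" "md K V" "lact V b" "lact Z z" and t: "t<:(Z><(H><V))"
 shows "chat Z V (theta V b) z t = thetahat Z V b z t"
proof (rule chat_eqI[OF _ _ _ _ _ _ _ t])
 fix s r assume [simp]: "s<:Z" "r<:(H><V)"
 show "thetahat Z V b z (tmL Z (H><V) (%h. z h s) (pt H (H><V) 1[H] r)) = tmL Z V (%h. z h s) (theta V b r)"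
 unfolding theta_def
 by (rule thetahat_nat_l[symmetric]) (simp_all add: lact_orbit_eqv)
qed simp_all

lemma theta_fst1_k:
 assumes [simp]: "md K V" "lact V b"
 shows "first_kind (H><V) (ract V b) V b (theta V b)"
 unfolding first_kind_def
 by (simp add: chat_theta eqvD[OF thetahat_eqv] theta_def)

section \<open>The two kinds of coaction determine each other\<close>

context
 fixes V and b
 assumes V [simp]: "md K V" and b [simp]: "lact V b"
begin

lemma beta_invariant_pure:
 assumes [simp]: "md K W" "w<:W"
 shows "eq_at (pt H W (qbeta H) w) (dg (H><W) (Lg H W L) (Lg H W R)) (triv (H><W))"
 unfolding eq_at_def
proof
 fix h assume [simp]: "h<:H"
 have "dg H L R h (qbeta H) = sw H (comul H h) (%p q. p##qbeta H##S q)"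
 unfolding diag_sw[OF mod_H]
 by (intro sw_cong[OF mod_H mod_H]) (simp_all add: lmul_apply rmul_apply H.m_assoc)
 then show "dg (H><W) (Lg H W L) (Lg H W R) h (pt H W (qbeta H) w) = triv (H><W) h (pt H W (qbeta H) w)"
 by (simp add: diag_legL_pure antipode_beta triv_def linear_maps_smult[OF lin_pure(2)])
qed

text \<open>A vector of \<open>R(V)\<close> is recovered from its image under the universal map \<open>R(V) \<otimes> X \<rightarrow> X \<otimes> V\<close>.\<close>

lemma second_theta:
 assumes r: "r<:(H><V)"
 shows "second (H><V) (ract V b) V (theta V b) r = r"
proof -
 let ?T = "H><(H><V)"
 let ?P = "Rg H (H><V) (Lg H V L)" and ?b = "Rg H (H><V) (Rg H V b)"
 and ?R = "Rg H (H><V) (Lg H V R)" and ?l = "Lg H (H><V) L" and ?r = "Lg H (H><V) R"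
 let ?Y = "dg ?T ?P ?b" and ?t = "pt H (H><V) (qbeta H)"
 let ?u = "evm H V L"
 have "second (H><V) (ract V b) V (theta V b) r = ?u (Ph ?T ?Y ?R ?l (Phi ?T (dg ?T ?Y ?R) ?l ?r (?t r)))"
 proof -
 have "Phi ?T (Rg H (H><V) (ract V b)) ?l ?r (?t r) = Phi ?T (dg ?T ?Y ?R) ?l ?r (?t r)"
 by (rule op3_cong[OF _ _ _ _ _ _ legR_ract[where z = L]]) (simp_all add: r)
 then show ?thesis
 using r by (simp add: second_def chat_theta thetahat_def)
 qed
 also have "... = ?u (Phi ?T ?R ?l ?r (?t r))"
 by (rule coll_shift_r[where U = "H><V"]) (simp_all add: evm_co beta_invariant_pure r)
 also have "... = r"
 proof (rule ext_pure[OF mod_H V _ _ lin_mp_id r])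
 show "(%r. ?u (Phi ?T ?R ?l ?r (?t r))) : Lin K (H><V) (H><V)"
 by (rule linc[OF linc[OF lin_pure(1) op3_lin] evm_lin]) simp_all
 fix a v assume [simp]: "a<:H" "v<:V"
 have "?u (Phi ?T ?R ?l ?r (?t (pt H V a v)))
 = sw3 (H><V) (reassoc_inv K H) (%p q r. ?u (?R p (?l q (?r r (?t (pt H V a v))))))"
 by (rule Ph_lin_im) simp_all
 also have "... = pt H V (a##sw3 H (reassoc_inv K H) (%p q r. S p##qalpha H##q##qbeta H##S r)) v"
 proof (rule sw3_H_lin[where u = "%x. pt H V (a##x) v"])
 show "(%x. pt H V (a##x) v) : Lin K H (H><V)"
 by (rule linc[OF H_mult_lin(2) lin_pure(2)]) simp_all
 qed (simp_all add: lmul_apply rmul_apply H.m_assoc)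
 finally show "?u (Phi ?T ?R ?l ?r (?t (pt H V a v))) = pt H V a v"
 by (simp add: antipode_reassoc_inv)
 qed simp_all
 finally show ?thesis .
qed

context
 fixes W and a and g
 assumes W [simp]: "md K W" and a [simp]: "lact W a" and g: "first_kind W a V b g"
begin

lemma second_lin [simp]: "second W a V g : Lin K W (H><V)"
 unfolding second_def[abs_def]
 by (rule linc[OF linc[OF lin_pure(1) op3_lin] chat_lin])
 (simp_all add: fst1_k_lin[OF g])

text \<open>At the inserted \<beta> the pair \<open>?l ?r\<close> is trivial, so \<open>a\<close>
  may be enlarged to \<open>a (l r)\<close>. The associator and the half-braiding turn this into the
  three legs of \<open>ract\<close>.\<close>

lemma second_eqv: "eqv W (H><V) (second W a V g) a (ract V b)"
 unfolding eqv_def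
proof (intro ballI)
 fix h w assume [simp]: "h<:H" "w<:W"
 let ?T = "H><W"
 let ?a = "Rg H W a" and ?l = "Lg H W L" and ?r = "Lg H W R" and ?t = "pt H W (qbeta H) w"
 note [simp] = fst1_k_lin[OF g]
 have "eq_at ?t (dg ?T ?a (dg ?T ?l ?r)) ?a"
 by (rule at_triv_diag_right) (simp_all add: beta_invariant_pure)
 then have "pt H W (qbeta H) (a h w) = dg ?T ?a (dg ?T ?l ?r) h ?t"
 by (simp add: eq_at_def)
 then have "second W a V g (a h w) = chat H V g L (dg ?T (dg ?T ?a ?l) ?r h (Phi ?T ?a ?l ?r ?t))"
 by (simp add: second_def Phi_eqv)
 moreover have "eqv ?T (H><V) (chat H V g L) (dg ?T (dg ?T ?a ?l) ?r) (ract V b)"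
 unfolding ract_def
 by (rule eqv_diag) (simp_all add: fst1_k_eqv[OF _ _ _ _ _ _ g] chat_eqv_l)
 ultimately show "second W a V g (a h w) = ract V b h (second W a V g w)"
 by (simp add: second_def eqv_def)
qed

text \<open>The converse of \<open>second_theta\<close>. The \<beta> inserted by
  \<open>second\<close> and the \<alpha> of \<open>evm\<close> form a snake around the
  half-braiding, which the antipode axiom for \<phi> contracts.\<close>

lemma thetahat_second:
 assumes [simp]: "md K Z" "lact Z z" "s<:Z" "w<:W"
 shows "thetahat Z V b z (pt Z (H><V) s (second W a V g w)) = chat Z V g z (pt Z W s w)"
proof -
 let ?T = "Z><(H><W)" and ?U = "Z><(H><V)" and ?HW = "H><W"
 let ?c = "tmR Z (H><V) (chat H V g L)"
 let ?a = "Rg Z ?HW (Rg H W a)" and ?l = "Rg Z ?HW (Lg H W L)"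
 and ?r = "Rg Z ?HW (Lg H W R)" and ?z = "Lg Z ?HW z"
 let ?t = "pt Z ?HW s (pt H W (qbeta H) w)"
 let ?u = "%t. evm Z V z (?c t)"
 note [simp] = fst1_k_lin[OF g]
 have cl: "?c t<:?U" if "t<:?T" for t
 by (rule lcl[OF tm_simps(1) that]) simp_all
 have ct: "eq_at ?t (dg ?T ?l ?r) (triv ?T)"
 using beta_invariant_pure[of W w]
 by (simp add: eq_at_def diag_legR_pure triv_def linear_maps_smult[OF lin_pure(1)])
 have c: "eqv ?T ?U ?c (dg ?T ?a ?l)
 (dg ?U (Rg Z (H><V) (Lg H V L)) (Rg Z (H><V) (Rg H V b)))"
 proof -
 have "eqv ?T ?U ?c (Rg Z ?HW (dg ?HW (Rg H W a) (Lg H W L)))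
 (Rg Z (H><V) (dg (H><V) (Lg H V L) (Rg H V b)))"
 by (rule ten_map_eqv(2)) (simp_all add: fst1_k_eqv[OF _ _ _ _ _ _ g])
 then show ?thesis
 by (simp add: eqv_def diag_legR cl)
 qed
 have cr: "eqv ?T ?U ?c ?r (Rg Z (H><V) (Lg H V R))"
 "eqv ?T ?U ?c ?z (Lg Z (H><V) z)"
 by (rule ten_map_eqv; simp add: chat_eqv_l)+
 have "pt Z (H><V) s (second W a V g w) = ?c (Phi ?T ?a ?l ?r ?t)"
 proof -
 have 1: "pt Z ?HW s (Phi ?HW (Rg H W a) (Lg H W L) (Lg H W R) (pt H W (qbeta H) w)) = Phi ?T ?a ?l ?r ?t"
 by (rule op3_nat) (simp_all add: pure_eqv lin_pure)
 show ?thesis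
 unfolding second_def by (subst 1[symmetric]) simp
 qed
 then have "thetahat Z V b z (pt Z (H><V) s (second W a V g w))
 = ?u (Ph ?T (dg ?T ?a ?l) ?r ?z (Phi ?T ?a ?l ?r ?t))"
 unfolding thetahat_def
 using op3_nat[of ?T ?U "dg ?T ?a ?l" ?r ?z ?c _ _ _ "reassoc H" "Phi ?T ?a ?l ?r ?t", OF _ _ _ _ _ _ _ c cr]
 by simp
 also have "... = ?u (Ph ?T ?l ?r ?z ?t)"
 proof (rule coll_shift_l[where U = "Z><V"])
 have "eqv ?T ?U ?c (dg ?T ?r ?z) (dg ?U (Rg Z (H><V) (Lg H V R)) (Lg Z (H><V) z))"
 by (rule eqv_diag) (simp_all add: cr)
 then show "equ ?T ?u (dg ?T ?r ?z) (triv ?T)"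
 using evm_co[of Z V z] eqvD[OF eqv_triv[of ?c ?T ?U]]
 by (simp add: equ_def eqv_def cl)
 show "?u : Lin K ?T (Z><V)"
 by (rule linc[OF tm_simps(1) evm_lin]) simp_all
 qed (simp_all add: ct)
 also have "... = sw3 (Z><V) (reassoc H) (%p q r. ?u (?l p (?r q (?z r ?t))))"
 proof (rule Ph_lin_im)
 show "?u : Lin K ?T (Z><V)"
 by (rule linc[OF tm_simps(1) evm_lin]) simp_all
 qed simp_all
 also have "... = chat Z V g z (pt Z W (z (sw3 H (reassoc H) (%p q r. p##qbeta H##S q##qalpha H##r)) s) w)"
 proof (rule sw3_H_lin[where u = "%x. chat Z V g z (pt Z W (z x s) w)"])
 show "(%x. chat Z V g z (pt Z W (z x s) w)) : Lin K H (Z><V)"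
 by (rule linc[OF linc[OF bilin_left[OF action_bilin[OF assms(2)]] lin_pure(2)] chat_lin])
 simp_all
 fix p q r assume [simp]: "p<:H" "q<:H" "r<:H"
 let ?x = "p##qbeta H##S q"
 have gw: "g w<:(H><V)"
 by (rule lcl[OF fst1_k_lin[OF g]]) simp
 have "evm Z V z (pt Z (H><V) (z r s) (tmL H V (%h. L h ?x) y))
 = tmL Z V (%h. z h (z (?x##qalpha H##r) s)) y" if y: "y<:(H><V)" for y
 by (rule ext_pure[OF mod_H V _ linc[OF linc[OF tm_simps(1) lin_pure(1)] evm_lin]
 tm_simps(1) y])
 (simp_all add: lmul_apply lact_cl[of Z] H.m_assoc action_mult[OF assms(2)])
 then show "?u (?l p (?r q (?z r ?t))) = chat Z V g z (pt Z W (z (p##qbeta H##S q##qalpha H##r) s) w)"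
 using gw by (simp add: lmul_apply rmul_apply lact_cl[of Z] H.m_assoc)
 qed simp_all
 finally show ?thesis
 by (simp add: antipode_reassoc action_one[OF assms(2)])
qed

end

end

end

section \<open>The coaction of R(V) by associators\<close>

context quasi_hopf_algebra
begin

lemma diag_legL:
 assumes "md K V" "md K W" "lact V rh" "lact V sg" "com V rh sg" "h<:H"
 "t<:(V><W)"
 shows "dg (V><W) (Lg V W rh) (Lg V W sg) h t = Lg V W (dg V rh sg) h t"
proof (rule ext_pure[OF assms(1,2) ten_mod[OF assms(1,2)] _ _ assms(7)])
 have "lact V (dg V rh sg)"
 using assms by simp
 then show "Lg V W (dg V rh sg) h : Lin K (V><W) (V><W)"
 using assms by (intro action_linear[OF lact_legL]) simp_all
 show "dg (V><W) (Lg V W rh) (Lg V W sg) h : Lin K (V><W) (V><W)"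
 using assms by (intro action_linear[OF lact_diag]) simp_all
qed (use assms in \<open>simp_all add: diag_legL_pure\<close>)

lemma legR_cong:
 assumes "md K V" "md K W" "h<:H" "t<:(V><W)"
 and "!!w. w<:W ==> rh h w = rh' h w"
 shows "Rg V W rh h t = Rg V W rh' h t"
 unfolding legR_def using assms by (intro ten_map_cong[of K V W]) simp_all

definition ins where
 "ins V v = tmR H (H><V) (%q. pt H V q v)"

text \<open>\<Delta> doubles the factor \<open>H\<close>, and \<open>twist_g\<close> corrects how
  right multiplications are doubled; see \<open>dup_eqv\<close>.\<close>

definition dup where
 "dup V r = sw (H><(H><V)) r (%a v. ins V v (comul H a**twist_g))"

text \<open>The coaction of \<open>R(V)\<close> in terms of reassociators; see \<open>omega_ten_nabla\<close>.\<close>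

definition nabla where
 "nabla V b r = (let HV = H><V; T = H><HV; p = Lg H HV L; q = Rg H HV (Lg H V L);
 c = Rg H HV (Rg H V b); q' = Rg H HV (Lg H V R); p' = Lg H HV R in
 Ph T p (dg T q c) q' (Phi T (dg T p (dg T q c)) q' p' (Ph T p q c (dup V r))))"

context
 fixes V
 assumes V [simp]: "md K V"
begin

interpretation HHV: module K "H><(H><V)" by simp

lemma ins_lin [simp]: "v<:V ==> ins V v : Lin K HH (H><(H><V))"
 by (simp add: ins_def lin_pure)

lemma ins_cl [simp]: "[|v<:V; x<:HH|] ==> ins V v x<:(H><(H><V))"
 by (rule lcl[OF ins_lin])

lemma ins_pure [simp]:
 "[|v<:V; p<:H; q<:H|] ==> ins V v (t2 K H p q) = pt H (H><V) p (pt H V q v)"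
 by (simp add: ins_def lin_pure)

lemma ins_bil: "bilin K V HH (H><(H><V)) (ins V)"
proof (rule bil_lin_lin)
 interpret V: module K V by (rule V)
 fix v v' x assume [simp]: "v<:V" "v'<:V" and x: "x<:HH"
 show "ins V (v +[V] v') x = ins V v x +[H><(H><V)] ins V v' x"
 by (rule ext_pure[OF mod_H mod_H HHV.module_axioms _ lin_mp_plus x])
 (simp_all add: HHV.module_axioms linear_maps_add[OF lin_pure(1)])
next
 interpret V: module K V by (rule V)
 fix c v x assume [simp]: "c<:K" "v<:V" and x: "x<:HH"
 show "ins V (c *[V] v) x = c *[H><(H><V)] ins V v x"
 by (rule ext_pure[OF mod_H mod_H HHV.module_axioms _ lin_mp_scale x])
 (simp_all add: HHV.module_axioms linear_maps_smult[OF lin_pure(1)])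
qed simp

lemma dup_bil: "bilin K H V (H><(H><V)) (%a v. ins V v (comul H a**twist_g))"
 by (rule bil_comp_args[OF bil_flip[OF ins_bil] linc[OF comul_linear H2_mult_lin(1)] lin_mp_id])
 simp

lemma dup_lin [simp]: "dup V : Lin K (H><V) (H><(H><V))"
 using sw_lin[OF mod_H V HHV.module_axioms dup_bil] by (simp add: dup_def[abs_def])

lemma dup_cl [simp]: "r<:(H><V) ==> dup V r<:(H><(H><V))"
 by (rule lcl[OF dup_lin])

lemma dup_pure [simp]: "[|a<:H; v<:V|] ==> dup V (pt H V a v) = ins V v (comul H a**twist_g)"
 using sw_pure[OF mod_H V HHV.module_axioms dup_bil] by (simp add: dup_def)

lemma ins_eqv:
 assumes [simp]: "v<:V"
 shows "eqv HH (H><(H><V)) (ins V v) lm1 (Lg H (H><V) L)"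
 and "eqv HH (H><(H><V)) (ins V v) lm2 (Rg H (H><V) (Lg H V L))"
 and "eqv HH (H><(H><V)) (ins V v) rm1 (Lg H (H><V) R)"
 and "eqv HH (H><(H><V)) (ins V v) rm2 (Rg H (H><V) (Lg H V R))"
 by (rule eqv_pure; simp add: lmul_apply rmul_apply)+

text \<open>\<Delta>(S h) on the right has to pass \<open>twist_g\<close> and comes out as
  \<open>acop h\<close>. This is the product of the two dual legs in reverse order.\<close>

lemma dup_eqv:
 shows "eqv (H><V) (H><(H><V)) (dup V) (Lg H V L)
 (dg (H><(H><V)) (Lg H (H><V) L) (Rg H (H><V) (Lg H V L)))"
 and "eqv (H><V) (H><(H><V)) (dup V) (Lg H V R)
 (dg (H><(H><V)) (Rg H (H><V) (Lg H V R)) (Lg H (H><V) R))"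
 and "lact V b ==> eqv (H><V) (H><(H><V)) (dup V) (Rg H V b) (Rg H (H><V) (Rg H V b))"
proof -
 let ?T = "H><(H><V)"
 show "eqv (H><V) ?T (dup V) (Lg H V L) (dg ?T (Lg H (H><V) L) (Rg H (H><V) (Lg H V L)))"
 proof (rule eqv_pure)
 fix h a v assume [simp]: "h<:H" "a<:H" "v<:V"
 have "eqv HH ?T (ins V v) (dg HH lm1 lm2) (dg ?T (Lg H (H><V) L) (Rg H (H><V) (Lg H V L)))"
 by (rule eqv_diag) (simp_all add: ins_eqv)
 from eqvD[OF this, of h "comul H a**twist_g"]
 show "dup V (Lg H V L h (pt H V a v))
 = dg ?T (Lg H (H><V) L) (Rg H (H><V) (Lg H V L)) h (dup V (pt H V a v))"
 by (simp add: lmul_apply diag_lm De_mult H2.m_assoc)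
 qed simp_all
 show "eqv (H><V) ?T (dup V) (Lg H V R) (dg ?T (Rg H (H><V) (Lg H V R)) (Lg H (H><V) R))"
 proof (rule eqv_pure)
 fix h a v assume [simp]: "h<:H" "a<:H" "v<:V"
 have "eqv HH ?T (ins V v) (dg HH rm2 rm1) (dg ?T (Rg H (H><V) (Lg H V R)) (Lg H (H><V) R))"
 by (rule eqv_diag) (simp_all add: ins_eqv)
 from eqvD[OF this, of h "comul H a**twist_g"]
 show "dup V (Lg H V R h (pt H V a v))
 = dg ?T (Rg H (H><V) (Lg H V R)) (Lg H (H><V) R) h (dup V (pt H V a v))"
 by (simp add: rmul_apply diag_rm De_mult twist_g_mult twist_g_eqv)
 qed simp_all
 show "eqv (H><V) ?T (dup V) (Rg H V b) (Rg H (H><V) (Rg H V b))" if b [simp]: "lact V b"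
 proof (rule eqv_pure)
 fix h a v assume h [simp]: "h<:H" "a<:H" "v<:V"
 have bv [simp]: "b h v<:V"
 by (rule lact_cl[OF b]) simp_all
 have "ins V (b h v) x = Rg H (H><V) (Rg H V b) h (ins V v x)" if x: "x<:HH" for x
 by (rule ext_pure[OF mod_H mod_H HHV.module_axioms _ linc[OF ins_lin
 action_linear[OF lact_legR[OF mod_H _ lact_legR[OF mod_H V b]] h(1)]] x]) simp_all
 then show "dup V (Rg H V b h (pt H V a v)) = Rg H (H><V) (Rg H V b) h (dup V (pt H V a v))"
 by simp
 qed simp_all
qed

context
 fixes b
 assumes b [simp]: "lact V b"
begin

lemma nabla_lin [simp]: "nabla V b : Lin K (H><V) (H><(H><V))"
 unfolding nabla_def[abs_def] Let_def
 by (rule linc[OF linc[OF linc[OF dup_lin op3_lin] op3_lin] op3_lin])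
 simp_all

lemma nabla_cl [simp]: "r<:(H><V) ==> nabla V b r<:(H><(H><V))"
 by (rule lcl[OF nabla_lin])

text \<open>\<open>dup\<close> produces the bracketing \<open>((p q) c) (q' p')\<close>. The three
  associators of \<open>nabla\<close> rebracket it to \<open>(p ((q c) q')) p'\<close>, which is the
  action on \<open>R(R(V))\<close>.\<close>

lemma nabla_eqv: "eqv (H><V) (H><(H><V)) (nabla V b) (ract V b) (ract (H><V) (ract V b))"
proof -
 let ?T = "H><(H><V)"
 let ?p = "Lg H (H><V) L" and ?q = "Rg H (H><V) (Lg H V L)" and ?c = "Rg H (H><V) (Rg H V b)"
 and ?q' = "Rg H (H><V) (Lg H V R)" and ?p' = "Lg H (H><V) R"
 have 1: "eqv (H><V) ?T (dup V) (ract V b) (dg ?T (dg ?T (dg ?T ?p ?q) ?c) (dg ?T ?q' ?p'))"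
 unfolding ract_def by (intro eqv_diag) (simp_all add: dup_eqv)
 have 2: "eqv ?T ?T (Ph ?T ?p ?q ?c) (dg ?T (dg ?T (dg ?T ?p ?q) ?c) (dg ?T ?q' ?p'))
 (dg ?T (dg ?T ?p (dg ?T ?q ?c)) (dg ?T ?q' ?p'))"
 by (rule eqv_diag) (simp_all add: op3_commutes)
 have 3: "eqv ?T ?T (Phi ?T (dg ?T ?p (dg ?T ?q ?c)) ?q' ?p')
 (dg ?T (dg ?T ?p (dg ?T ?q ?c)) (dg ?T ?q' ?p'))
 (dg ?T (dg ?T (dg ?T ?p (dg ?T ?q ?c)) ?q') ?p')"
 by simp
 have 4: "eqv ?T ?T (Ph ?T ?p (dg ?T ?q ?c) ?q')
 (dg ?T (dg ?T (dg ?T ?p (dg ?T ?q ?c)) ?q') ?p')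
 (dg ?T (dg ?T ?p (dg ?T (dg ?T ?q ?c) ?q')) ?p')"
 by (rule eqv_diag) (simp_all add: op3_commutes)
 have 5: "eqv (H><V) ?T (nabla V b) (ract V b) (dg ?T (dg ?T ?p (dg ?T (dg ?T ?q ?c) ?q')) ?p')"
 unfolding nabla_def[abs_def] Let_def
 by (rule eqv_comp[OF eqv_comp[OF eqv_comp[OF 1 2] 3] 4])
 (rule linc[OF linc[OF dup_lin op3_lin] op3_lin]
 linc[OF dup_lin op3_lin] dup_lin; simp)+
 have 6: "ract (H><V) (ract V b) h t = dg ?T (dg ?T ?p (dg ?T (dg ?T ?q ?c) ?q')) ?p' h t"
 if "h<:H" "t<:?T" for h t
 unfolding ract_def[of "H><V"]
 proof (rule diag_cong)
 fix h t assume "h<:H" "t<:?T"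
 then show "dg ?T ?p (Rg H (H><V) (ract V b)) h t = dg ?T ?p (dg ?T (dg ?T ?q ?c) ?q') h t"
 by (intro diag_cong) (simp_all add: legR_ract[where z = L])
 qed (simp_all add: that)
 from 5 6 show ?thesis
 by (simp add: eqv_def)
qed

end

end

text \<open>This is \<open>cofree_coherence\<close> with the innermost associator of
  \<open>nabla\<close> moved to the outside, where \<open>u\<close> turns it into the associator of
  the target.\<close>

lemma nabla_coherence:
 assumes [simp]: "md K T" "md K U" and u [simp]: "u : Lin K T U"
 and L: "legs T [p, q, b, r2, r1, z, z']" and t [simp]: "t<:T"
 and cu: "equ T u (dg T r1 z) (triv T)" "equ T u (dg T r2 z') (triv T)"
 and i: "eqv T U u p \<zeta>" "eqv T U u q \<zeta>'" "eqv T U u b b'"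
 shows "u (Ph T (dg T q b) r2 z' (Ph T p (dg T (dg T q b) r2) z' (Ph T (dg T p (dg T (dg T q b) r2)) r1 z
 (Ph T p (dg T q b) r2 (Phi T (dg T p (dg T q b)) r2 r1 (Ph T p q b t))))))
 = Ph U \<zeta> \<zeta>' b' (u (Phi T r1 z z' (Ph T r2 r1 (dg T z z') (Ph T (dg T (dg T p q) b) (dg T r2 r1) (dg T z z')
 (Ph T (dg T (dg T (dg T p q) b) (dg T r2 r1)) z z' t)))))"
proof -
 note [simp] = L[simplified]
 let ?w = "dg T q b" and ?y = "dg T (dg T p q) b" and ?r = "dg T r2 r1" and ?z = "dg T z z'"
 have "u (Ph T ?w r2 z' (Ph T p (dg T ?w r2) z' (Ph T (dg T p (dg T ?w r2)) r1 z
 (Ph T p ?w r2 (Phi T (dg T p ?w) r2 r1 (Ph T p q b t))))))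
 = u (Phi T r1 z z' (Ph T r2 r1 ?z (Ph T (dg T p ?w) ?r ?z (Ph T (dg T (dg T p ?w) ?r) z z' (Ph T p q b t)))))"
 by (rule cofree_coherence[where U = U]) (simp_all add: cu)
 also have "Ph T (dg T (dg T p ?w) ?r) z z' (Ph T p q b t) = Ph T p q b (Ph T (dg T ?y ?r) z z' t)"
 by (rule op3_nat[symmetric]) (simp_all add: op3_commutes eqv_diag)
 also have "Ph T (dg T p ?w) ?r ?z (Ph T p q b (Ph T (dg T ?y ?r) z z' t))
 = Ph T p q b (Ph T ?y ?r ?z (Ph T (dg T ?y ?r) z z' t))"
 by (rule nat1_Ph[symmetric]) simp_all
 also have "Ph T r2 r1 ?z (Ph T p q b (Ph T ?y ?r ?z (Ph T (dg T ?y ?r) z z' t)))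
 = Ph T p q b (Ph T r2 r1 ?z (Ph T ?y ?r ?z (Ph T (dg T ?y ?r) z z' t)))"
 by (rule op3_cm) simp_all
 also have "Phi T r1 z z' (Ph T p q b (Ph T r2 r1 ?z (Ph T ?y ?r ?z (Ph T (dg T ?y ?r) z z' t))))
 = Ph T p q b (Phi T r1 z z' (Ph T r2 r1 ?z (Ph T ?y ?r ?z (Ph T (dg T ?y ?r) z z' t))))"
 by (rule op3_cm) simp_all
 also have "u (Ph T p q b (Phi T r1 z z' (Ph T r2 r1 ?z (Ph T ?y ?r ?z (Ph T (dg T ?y ?r) z z' t)))))
 = Ph U \<zeta> \<zeta>' b' (u (Phi T r1 z z' (Ph T r2 r1 ?z (Ph T ?y ?r ?z (Ph T (dg T ?y ?r) z z' t)))))"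
 by (rule op3_nat) (simp_all add: i)
 finally show ?thesis .
qed

section \<open>The hexagon of the universal map\<close>

context
 fixes Z and V
 and z z'
 assumes mods [simp]: "md K Z" "md K V" and z [simp]: "lact Z z" "lact Z z'"
 and zz [simp]: "com Z z z'" "com Z z' z"
begin

abbreviation (input) "T4 \<equiv> Z><(H><(H><V))"
abbreviation (input) "u4 t \<equiv> evm Z V z' (evm Z (H><V) z t)"

lemma u4_lin [simp]: "(%t. u4 t) : Lin K T4 (Z><V)"
 by (rule linc[OF evm_lin evm_lin]) simp_all

lemma u4_co:
 shows "equ T4 (%t. u4 t) (dg T4 (Rg Z (H><(H><V)) (Lg H (H><V) R)) (Lg Z (H><(H><V)) z)) (triv T4)"
 and "equ T4 (%t. u4 t) (dg T4 (Rg Z (H><(H><V)) (Rg H (H><V) (Lg H V R))) (Lg Z (H><(H><V)) z')) (triv T4)"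
proof -
 show "equ T4 (%t. u4 t) (dg T4 (Rg Z (H><(H><V)) (Lg H (H><V) R)) (Lg Z (H><(H><V)) z)) (triv T4)"
 using evm_co[of Z "H><V" z] by (simp add: equ_def)
 have i: "eqv T4 (Z><(H><V)) (evm Z (H><V) z)
 (dg T4 (Rg Z (H><(H><V)) (Rg H (H><V) (Lg H V R))) (Lg Z (H><(H><V)) z'))
 (dg (Z><(H><V)) (Rg Z (H><V) (Lg H V R)) (Lg Z (H><V) z'))"
 by (rule eqv_diag) (simp_all add: evm_eqv_l evm_eqv_r)
 have tr: "eqv T4 (Z><(H><V)) (evm Z (H><V) z) (triv T4) (triv (Z><(H><V)))"
 by (rule eqv_triv) simp
 show "equ T4 (%t. u4 t) (dg T4 (Rg Z (H><(H><V)) (Rg H (H><V) (Lg H V R))) (Lg Z (H><(H><V)) z')) (triv T4)"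
 using evm_co[of Z V z'] i tr
 by (simp add: equ_def eqv_def)
qed

text \<open>The twist relates the evaluation of \<open>a\<close> against the diagonal of two commuting actions to the two
 successive evaluations of the components of \<open>De(a)\<close>.\<close>

lemma u4_dup:
 assumes t: "t<:(Z><(H><V))"
 defines "r1 \<equiv> Rg Z (H><(H><V)) (Lg H (H><V) R)"
 and "r2 \<equiv> Rg Z (H><(H><V)) (Rg H (H><V) (Lg H V R))"
 and "l \<equiv> Lg Z (H><(H><V)) z" and "l' \<equiv> Lg Z (H><(H><V)) z'"
 shows "u4 (Phi T4 r1 l l' (Ph T4 r2 r1 (dg T4 l l') (tmR Z (H><(H><V)) (dup V) t)))
 = evm Z V (dg Z z z') t"
proof -
 interpret SV: module K "Z><V" by simp
 have lin: "(%t. u4 (Phi T4 r1 l l' (Ph T4 r2 r1 (dg T4 l l') (tmR Z (H><(H><V)) (dup V) t))))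
 : Lin K (Z><(H><V)) (Z><V)"
 unfolding r1_def r2_def l_def l'_def
 by (rule linc[OF linc[OF linc[OF tm_simps(1) op3_lin] op3_lin] u4_lin])
 simp_all
 have tact: "action K HH Z (tact Z z z')"
 by (rule act_tact[OF alg_H alg_H]) simp_all
 have "u4 (Phi T4 r1 l l' (Ph T4 r2 r1 (dg T4 l l') (pt Z (H><(H><V)) s (ins V v (comul H a**twist_g)))))
 = pt Z V (dg Z z z' (a##qalpha H) s) v"
 if [simp]: "s<:Z" "a<:H" "v<:V" for s a v
 proof -
 \<comment> \<open>This map realises the multiplication legs of \<open>T2\<close> as the legs
   \<open>r1\<close>, \<open>r2\<close>, \<open>l\<close> and \<open>l'\<close>, so that the results
   on \<open>twist_a\<close> and \<open>twist_g\<close> can be used on \<open>T4\<close>.\<close>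
 define \<kappa> where "\<kappa> t = sw T4 t (%x w. pt Z (H><(H><V)) (tact Z z z' w s) (ins V v x))" for t
 define \<psi> where "\<psi> y = pt Z V (tact Z z z' y s) v" for y
 have ts: "(%w. tact Z z z' w s) : Lin K HH Z"
 by (rule bilin_left[OF action_bilin[OF tact]]) simp
 have ts_cl [simp]: "tact Z z z' w s<:Z" if "w<:HH" for w
 by (rule lcl[OF ts that])
 have bl: "bilin K HH HH T4 (%x w. pt Z (H><(H><V)) (tact Z z z' w s) (ins V v x))"
 by (rule bil_comp_args[OF bil_flip[OF pure_ten_bil] ins_lin ts]) simp_all
 have \<kappa>_lin [simp]: "\<kappa> : Lin K T2 T4"
 using sw_lin[OF mod_H2 mod_H2 _ bl] by (simp add: \<kappa>_def[abs_def])
 have \<kappa>_pure [simp]: "\<kappa> (pT2 x w) = pt Z (H><(H><V)) (tact Z z z' w s) (ins V v x)"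
 if "x<:HH" "w<:HH" for x w
 using sw_pure[OF mod_H2 mod_H2 _ bl that] by (simp add: \<kappa>_def)
 have \<psi>_lin [simp]: "\<psi> : Lin K HH (Z><V)"
 unfolding \<psi>_def[abs_def] by (rule linc[OF ts lin_pure(2)]) simp_all
 have \<kappa>_i: "eqv T2 T4 \<kappa> (ll rm1) r1" "eqv T2 T4 \<kappa> (ll rm2) r2"
 "eqv T2 T4 \<kappa> (lr lm1) l" "eqv T2 T4 \<kappa> (lr lm2) l'"
 proof -
 show "eqv T2 T4 \<kappa> (ll rm1) r1" "eqv T2 T4 \<kappa> (ll rm2) r2"
 unfolding r1_def r2_def
 by (rule eqv_pure; simp add: lact_cl[of HH] eqvD[OF ins_eqv(3)] eqvD[OF ins_eqv(4)])+
 have "tact Z z z' (i1 h**w) s = z h (tact Z z z' w s)" "tact Z z z' (i2 h**w) s = z' h (tact Z z z' w s)"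
 if "h<:H" "w<:HH" for h w
 using that by (simp_all add: action_mult[OF tact] tact_pure' action_one[of K H Z] lact_cl[of Z])
 then show "eqv T2 T4 \<kappa> (lr lm1) l" "eqv T2 T4 \<kappa> (lr lm2) l'"
 unfolding l_def l'_def
 by (intro eqv_pure; simp add: lact_cl[of HH] lmul_apply)+
 qed
 have u4\<kappa>: "u4 (\<kappa> t) = \<psi> (EV aal t)" if t: "t<:T2" for t
 proof (rule ext_pure[OF mod_H2 mod_H2 SV.module_axioms linc[OF \<kappa>_lin u4_lin]
 linc[OF EV_lin \<psi>_lin] t])
 fix x w assume x: "x<:HH" and [simp]: "w<:HH"
 have "u4 (pt Z (H><(H><V)) s' (ins V v x)) = pt Z V (tact Z z z' (x**aal) s') v"
 if [simp]: "s'<:Z" for s'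
 proof (rule ext_pure[OF mod_H mod_H SV.module_axioms
 linc[OF linc[OF ins_lin lin_pure(1)] u4_lin]
 linc[OF linc[OF H2_mult_lin(1) bilin_left[OF action_bilin[OF tact]]] lin_pure(2)] x])
 fix p q assume [simp]: "p<:H" "q<:H"
 show "u4 (pt Z (H><(H><V)) s' (ins V v (t2 K H p q))) = pt Z V (tact Z z z' (t2 K H p q**aal) s') v"
 by (simp add: tact_pure' lact_cl[of Z] commutingD[of H H Z z z'])
 qed simp_all
 then show "u4 (\<kappa> (pT2 x w)) = \<psi> (EV aal (pT2 x w))"
 using x by (simp add: \<psi>_def action_mult[OF tact])
 qed simp_all
 let ?t = "pT2 (comul H a**twist_g) 1[HH]"
 have "pt Z (H><(H><V)) s (ins V v (comul H a**twist_g)) = \<kappa> ?t"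
 by (simp add: action_one[OF tact])
 moreover have "Ph T4 r2 r1 (dg T4 l l') (\<kappa> ?t) = \<kappa> (Ph T2 (ll rm2) (ll rm1) (dg T2 (lr lm1) (lr lm2)) ?t)"
 by (rule op3_nat[symmetric]) (simp_all add: \<kappa>_i eqv_diag)
 moreover have "Phi T4 r1 l l' (\<kappa> (Ph T2 (ll rm2) (ll rm1) (dg T2 (lr lm1) (lr lm2)) ?t))
 = \<kappa> (Phi T2 (ll rm1) (lr lm1) (lr lm2) (Ph T2 (ll rm2) (ll rm1) (dg T2 (lr lm1) (lr lm2)) ?t))"
 by (rule op3_nat[symmetric]) (simp_all add: \<kappa>_i eqv_diag)
 moreover have "u4 (\<kappa> (Phi T2 (ll rm1) (lr lm1) (lr lm2) (Ph T2 (ll rm2) (ll rm1) (dg T2 (lr lm1) (lr lm2)) ?t)))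
 = \<psi> (EV aal (Phi T2 (ll rm1) (lr lm1) (lr lm2) (Ph T2 (ll rm2) (ll rm1) (dg T2 (lr lm1) (lr lm2)) ?t)))"
 by (rule u4\<kappa>) simp
 moreover have "... = \<psi> (EV (twist_a K H) ?t)"
 by (subst EV_twist_a) simp_all
 ultimately have "u4 (Phi T4 r1 l l' (Ph T4 r2 r1 (dg T4 l l') (pt Z (H><(H><V)) s (ins V v (comul H a**twist_g)))))
 = \<psi> (EV (twist_a K H) ?t)"
 by (simp only:)
 also have "EV (twist_a K H) ?t = comul H (a##qalpha H)"
 using twist_g_twist_a[of "comul H a" "1[HH]"] by (simp add: twist_g_mult De_mult)
 finally show ?thesis
 by (simp add: \<psi>_def dg_def[of Z])
 qed
 then have "u4 (Phi T4 r1 l l' (Ph T4 r2 r1 (dg T4 l l') (tmR Z (H><(H><V)) (dup V) (pt Z (H><V) s r))))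
 = evm Z V (dg Z z z') (pt Z (H><V) s r)" if s [simp]: "s<:Z" and r: "r<:(H><V)" for s r
 by (intro ext_pure[OF mod_H mods(2) SV.module_axioms linc[OF lin_pure(1) lin]
 linc[OF lin_pure(1) evm_lin] r]) simp_all
 then show ?thesis
 by (intro ext_pure[OF mods(1) _ SV.module_axioms lin evm_lin t]) simp_all
qed

context
 fixes b
 assumes b [simp]: "lact V b"
begin

lemma legR2_ract:
 assumes "h<:H" "t<:T4"
 shows "Rg Z (H><(H><V)) (Rg H (H><V) (ract V b)) h t
 = dg T4 (dg T4 (Rg Z (H><(H><V)) (Rg H (H><V) (Lg H V L)))
 (Rg Z (H><(H><V)) (Rg H (H><V) (Rg H V b))))
 (Rg Z (H><(H><V)) (Rg H (H><V) (Lg H V R))) h t"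
proof -
 let ?HHV = "H><(H><V)"
 let ?q = "Rg H (H><V) (Lg H V L)" and ?c = "Rg H (H><V) (Rg H V b)" and ?q' = "Rg H (H><V) (Lg H V R)"
 have "Rg Z ?HHV (Rg H (H><V) (ract V b)) h t = Rg Z ?HHV (dg ?HHV (dg ?HHV ?q ?c) ?q') h t"
 by (rule legR_cong) (simp_all add: assms legR_ract[where z = L])
 also have "... = dg T4 (Rg Z ?HHV (dg ?HHV ?q ?c)) (Rg Z ?HHV ?q') h t"
 by (rule diag_legR[symmetric]) (simp_all add: assms)
 also have "... = dg T4 (dg T4 (Rg Z ?HHV ?q) (Rg Z ?HHV ?c)) (Rg Z ?HHV ?q') h t"
 by (rule diag_cong) (simp_all add: assms diag_legR)
 finally show ?thesis .
qed

text \<open>All steps are rewritten as operators on \<open>T4\<close>. Then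
  \<open>nabla_coherence\<close> rebrackets, and \<open>u4_dup\<close> merges the two evaluations
  into one against \<open>dg Z z z'\<close>.\<close>

lemma thetahat_nabla:
 assumes s [simp]: "s<:Z" and r [simp]: "r<:(H><V)"
 shows "thetahat Z V b z' (Ph (Z><(H><V)) (Lg Z (H><V) z) (Rg Z (H><V) (ract V b)) (Lg Z (H><V) z')
 (thetahat Z (H><V) (ract V b) z (pt Z (H><(H><V)) s (nabla V b r))))
 = Ph (Z><V) (Lg Z V z) (Lg Z V z') (Rg Z V b) (thetahat Z V b (dg Z z z')
 (Ph (Z><(H><V)) (Rg Z (H><V) (ract V b)) (Lg Z (H><V) z) (Lg Z (H><V) z') (pt Z (H><V) s r)))"
proof -
 let ?HHV = "H><(H><V)" and ?U1 = "Z><(H><V)"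
 define p q c r1 r2 l l' where [simp]: "p = Rg Z ?HHV (Lg H (H><V) L)" "q = Rg Z ?HHV (Rg H (H><V) (Lg H V L))"
 "c = Rg Z ?HHV (Rg H (H><V) (Rg H V b))" "r1 = Rg Z ?HHV (Lg H (H><V) R)"
 "r2 = Rg Z ?HHV (Rg H (H><V) (Lg H V R))" "l = Lg Z ?HHV z" "l' = Lg Z ?HHV z'"
 have L: "legs T4 [p, q, c, r2, r1, l, l']" by simp
 have legs [simp]: "lact T4 p" "lact T4 q" "lact T4 c" "lact T4 r1" "lact T4 r2" "lact T4 l" "lact T4 l'"
 "com T4 p q" "com T4 p c" "com T4 p r1" "com T4 p r2" "com T4 p l" "com T4 p l'"
 "com T4 q c" "com T4 q r1" "com T4 q r2" "com T4 q l" "com T4 q l'"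
 "com T4 c r1" "com T4 c r2" "com T4 c l" "com T4 c l'"
 "com T4 r1 l" "com T4 r1 l'" "com T4 r2 r1" "com T4 r2 l" "com T4 r2 l'" "com T4 l l'"
 "com T4 r1 p" "com T4 r1 q" "com T4 r1 c" "com T4 r1 r2" "com T4 r2 p" "com T4 r2 q" "com T4 r2 c"
 by simp_all
 note defs = p_q_c_r1_r2_l_l'_def
 note defs [simp del]
 have rr: "Rg Z ?HHV (Rg H (H><V) (ract V b)) h t = dg T4 (dg T4 q c) r2 h t"
 if "h<:H" "t<:T4" for h t
 unfolding defs by (rule legR2_ract[OF that])
 let ?w = "dg T4 q c"
 define x where "x = pt Z ?HHV s (dup V r)"
 have x [simp]: "x<:T4" by (simp add: x_def)
 \<comment> \<open>\<open>A\<close> to \<open>D\<close> express the coaction, the two universal maps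
   and the associator between them on \<open>T4\<close>, with both evaluations postponed to the
   end.\<close>
 have A: "pt Z ?HHV s (nabla V b r) = Ph T4 p ?w r2 (Phi T4 (dg T4 p ?w) r2 r1 (Ph T4 p q c x))"
 proof -
 let ?p = "Lg H (H><V) L" and ?q = "Rg H (H><V) (Lg H V L)" and ?c = "Rg H (H><V) (Rg H V b)"
 and ?q' = "Rg H (H><V) (Lg H V R)" and ?p' = "Lg H (H><V) R" and ?i = "pt Z ?HHV s"
 have i: "?i : Lin K ?HHV T4" "eqv ?HHV T4 ?i ?p p" "eqv ?HHV T4 ?i ?q q"
 "eqv ?HHV T4 ?i ?c c" "eqv ?HHV T4 ?i ?q' r2" "eqv ?HHV T4 ?i ?p' r1"
 unfolding defs by (simp_all add: lin_pure pure_eqv)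
 have "?i (Ph ?HHV ?p ?q ?c (dup V r)) = Ph T4 p q c x"
 unfolding x_def by (rule op3_nat) (simp_all add: i)
 moreover have "?i (Phi ?HHV (dg ?HHV ?p (dg ?HHV ?q ?c)) ?q' ?p' y) = Phi T4 (dg T4 p ?w) r2 r1 (?i y)"
 if "y<:?HHV" for y
 by (rule op3_nat) (simp_all add: i eqv_diag that)
 moreover have "?i (Ph ?HHV ?p (dg ?HHV ?q ?c) ?q' y) = Ph T4 p ?w r2 (?i y)" if "y<:?HHV" for y
 by (rule op3_nat) (simp_all add: i eqv_diag that)
 ultimately show ?thesis
 by (simp add: nabla_def Let_def)
 qed
 have B: "thetahat Z (H><V) (ract V b) z t = evm Z (H><V) z (Ph T4 (dg T4 p (dg T4 ?w r2)) r1 l t)"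
 if "t<:T4" for t
 unfolding thetahat_def defs(1,4,6)[symmetric]
 by (rule arg_cong[where f = "evm Z (H><V) z"], rule op3_cong, simp_all add: that)
 (rule diag_cong, simp_all add: rr)
 have i: "eqv T4 ?U1 (evm Z (H><V) z) p (Lg Z (H><V) z)"
 "eqv T4 ?U1 (evm Z (H><V) z) l' (Lg Z (H><V) z')"
 "eqv T4 ?U1 (evm Z (H><V) z) q (Rg Z (H><V) (Lg H V L))"
 "eqv T4 ?U1 (evm Z (H><V) z) c (Rg Z (H><V) (Rg H V b))"
 "eqv T4 ?U1 (evm Z (H><V) z) r2 (Rg Z (H><V) (Lg H V R))"
 unfolding defs by (simp_all add: evm_eqv_l evm_eqv_r evm_eqv_mult)
 have C: "Ph ?U1 (Lg Z (H><V) z) (Rg Z (H><V) (ract V b)) (Lg Z (H><V) z') (evm Z (H><V) z t)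
 = evm Z (H><V) z (Ph T4 p (dg T4 ?w r2) l' t)" if t: "t<:T4" for t
 proof (rule op3_nat[symmetric])
 show "eqv T4 ?U1 (evm Z (H><V) z) (dg T4 ?w r2) (Rg Z (H><V) (ract V b))"
 using evm_eqv_r[of Z "H><V" z "ract V b"] by (simp add: eqv_def flip: rr)
 qed (simp_all add: i t)
 have D: "thetahat Z V b z' (evm Z (H><V) z t) = u4 (Ph T4 ?w r2 l' t)" if t: "t<:T4" for t
 unfolding thetahat_def
 by (rule arg_cong[where f = "evm Z V z'"], rule op3_nat[symmetric])
 (simp_all add: i t eqv_diag)
 have "thetahat Z V b z' (Ph ?U1 (Lg Z (H><V) z) (Rg Z (H><V) (ract V b)) (Lg Z (H><V) z')
 (thetahat Z (H><V) (ract V b) z (pt Z ?HHV s (nabla V b r))))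
 = u4 (Ph T4 ?w r2 l' (Ph T4 p (dg T4 ?w r2) l' (Ph T4 (dg T4 p (dg T4 ?w r2)) r1 l
 (Ph T4 p ?w r2 (Phi T4 (dg T4 p ?w) r2 r1 (Ph T4 p q c x))))))"
 unfolding A by (simp add: B C D)
 also have "... = Ph (Z><V) (Lg Z V z) (Lg Z V z') (Rg Z V b) (u4 (Phi T4 r1 l l' (Ph T4 r2 r1 (dg T4 l l')
 (Ph T4 (dg T4 (dg T4 p q) c) (dg T4 r2 r1) (dg T4 l l')
 (Ph T4 (dg T4 (dg T4 (dg T4 p q) c) (dg T4 r2 r1)) l l' x)))))"
 proof (rule nabla_coherence[OF _ _ u4_lin L])
 show "equ T4 (%t. u4 t) (dg T4 r1 l) (triv T4)" "equ T4 (%t. u4 t) (dg T4 r2 l') (triv T4)"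
 unfolding defs by (rule u4_co)+
 have e: "eqv ?U1 (Z><V) (evm Z V z') (Lg Z (H><V) z) (Lg Z V z)"
 "eqv ?U1 (Z><V) (evm Z V z') (Rg Z (H><V) (Lg H V L)) (Lg Z V z')"
 "eqv ?U1 (Z><V) (evm Z V z') (Rg Z (H><V) (Rg H V b)) (Rg Z V b)"
 by (simp_all add: evm_eqv_l evm_eqv_r evm_eqv_mult)
 show "eqv T4 (Z><V) (%t. u4 t) p (Lg Z V z)"
 by (rule eqv_comp[OF i(1) e(1)]) simp
 show "eqv T4 (Z><V) (%t. u4 t) q (Lg Z V z')"
 by (rule eqv_comp[OF i(3) e(2)]) simp
 show "eqv T4 (Z><V) (%t. u4 t) c (Rg Z V b)"
 by (rule eqv_comp[OF i(4) e(3)]) simp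
 qed simp_all
 also have "u4 (Phi T4 r1 l l' (Ph T4 r2 r1 (dg T4 l l')
 (Ph T4 (dg T4 (dg T4 p q) c) (dg T4 r2 r1) (dg T4 l l')
 (Ph T4 (dg T4 (dg T4 (dg T4 p q) c) (dg T4 r2 r1)) l l' x))))
 = thetahat Z V b (dg Z z z') (Ph ?U1 (Rg Z (H><V) (ract V b)) (Lg Z (H><V) z) (Lg Z (H><V) z') (pt Z (H><V) s r))"
 proof -
 let ?q = "Rg Z (H><V) (Lg H V L)" and ?c = "Rg Z (H><V) (Rg H V b)" and ?q' = "Rg Z (H><V) (Lg H V R)"
 and ?l = "Lg Z (H><V) z" and ?l' = "Lg Z (H><V) z'" and ?d = "tmR Z ?HHV (dup V)"
 let ?y = "Ph ?U1 (dg ?U1 (dg ?U1 ?q ?c) ?q') ?l ?l' (pt Z (H><V) s r)"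
 have d: "eqv ?U1 T4 ?d ?q (dg T4 p q)" "eqv ?U1 T4 ?d ?c c"
 "eqv ?U1 T4 ?d ?q' (dg T4 r2 r1)" "eqv ?U1 T4 ?d ?l l" "eqv ?U1 T4 ?d ?l' l'"
 proof -
 have "eqv ?U1 T4 ?d ?q (Rg Z ?HHV (dg ?HHV (Lg H (H><V) L) (Rg H (H><V) (Lg H V L))))"
 "eqv ?U1 T4 ?d ?q' (Rg Z ?HHV (dg ?HHV (Rg H (H><V) (Lg H V R)) (Lg H (H><V) R)))"
 by (rule ten_map_eqv(2); simp add: dup_eqv)+
 moreover have "?d t<:T4" if "t<:?U1" for t
 by (rule lcl[OF tm_simps(1) that]) simp_all
 ultimately show "eqv ?U1 T4 ?d ?q (dg T4 p q)" "eqv ?U1 T4 ?d ?q' (dg T4 r2 r1)"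
 unfolding defs by (simp_all add: eqv_def diag_legR)
 show "eqv ?U1 T4 ?d ?c c" "eqv ?U1 T4 ?d ?l l" "eqv ?U1 T4 ?d ?l' l'"
 unfolding defs by (rule ten_map_eqv; simp add: dup_eqv)+
 qed
 have "x = ?d (pt Z (H><V) s r)"
 by (simp add: x_def)
 moreover have "?d ?y = Ph T4 (dg T4 (dg T4 (dg T4 p q) c) (dg T4 r2 r1)) l l' (?d (pt Z (H><V) s r))"
 by (rule op3_nat) (simp_all add: d eqv_diag)
 moreover have "?d (Ph ?U1 (dg ?U1 ?q ?c) ?q' (dg ?U1 ?l ?l') ?y)
 = Ph T4 (dg T4 (dg T4 p q) c) (dg T4 r2 r1) (dg T4 l l') (?d ?y)"
 by (rule op3_nat) (simp_all add: d eqv_diag)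
 moreover have "u4 (Phi T4 r1 l l' (Ph T4 r2 r1 (dg T4 l l') (?d (Ph ?U1 (dg ?U1 ?q ?c) ?q' (dg ?U1 ?l ?l') ?y))))
 = evm Z V (dg Z z z') (Ph ?U1 (dg ?U1 ?q ?c) ?q' (dg ?U1 ?l ?l') ?y)"
 unfolding defs by (rule u4_dup) simp
 moreover have "Ph ?U1 (dg ?U1 ?q ?c) ?q' (dg ?U1 ?l ?l') ?y = Ph ?U1 (dg ?U1 ?q ?c) ?q' (Lg Z (H><V) (dg Z z z')) ?y"
 by (rule op3_cong) (simp_all add: diag_legL)
 moreover have "?y = Ph ?U1 (Rg Z (H><V) (ract V b)) ?l ?l' (pt Z (H><V) s r)"
 by (rule op3_cong) (simp_all add: legR_ract[where z = z])
 ultimately show ?thesis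
 by (simp only: thetahat_def)
 qed
 finally show ?thesis .
qed

end

end

end

lemma tmL_bil:
 assumes "md K A" "md K V" "md K W" "md K V'" "bilin K A V V' rh"
 shows "bilin K A (tp K V W) (tp K V' W) (%a. tm K V' W (rh a) (%w. w))"
proof (rule bil_lin_lin)
 interpret T: module K "tp K V' W" by (rule ten_mod[OF assms(4,3)])
 interpret A: module K A by fact
 have lin: "tm K V' W (rh a) (%w. w) : Lin K (tp K V W) (tp K V' W)"
 if "a<:A" for a
 using that by (intro ten_map_lin assms bilin_right[OF assms(5)] lin_mp_id)
 have p: "tm K V' W (rh a) (%w. w) (pu K V W v w) = pu K V' W (rh a v) w"
 if "a<:A" "v<:V" "w<:W" for a v w
 using that by (intro ten_map_pure assms bilin_right[OF assms(5)] lin_mp_id)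
 note pb = pure_ten_bil[OF assms(4,3)]
 show "tm K V' W (rh a) (%w. w) : Lin K (tp K V W) (tp K V' W)" if "a<:A" for a
 by (rule lin[OF that])
 fix a x assume a: "a<:A" and x: "x<:(tp K V W)"
 show "tm K V' W (rh (a +[A] a')) (%w. w) x
 = tm K V' W (rh a) (%w. w) x +[tp K V' W] tm K V' W (rh a') (%w. w) x"
 if "a'<:A" for a'
 by (rule ten_ext[OF assms(2,3) T.module_axioms lin lin_mp_plus[OF lin lin T.module_axioms] _ x])
 (simp_all add: a that p bilin_add_left[OF assms(5)] bilin_add_left[OF pb] bilin_closed[OF assms(5)])
 show "tm K V' W (rh (c *[A] a)) (%w. w) x = c *[tp K V' W] tm K V' W (rh a) (%w. w) x"
 if "c<:K" for c
 by (rule ten_ext[OF assms(2,3) T.module_axioms lin lin_mp_scale[OF lin that T.module_axioms] _ x])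
 (simp_all add: a that p bilin_smult_left[OF assms(5)] bilin_smult_left[OF pb] bilin_closed[OF assms(5)])
qed

lemma tmR_bil:
 assumes "md K A" "md K V" "md K W" "md K W'" "bilin K A W W' rh"
 shows "bilin K A (tp K V W) (tp K V W') (%a. tm K V W' (%v. v) (rh a))"
proof (rule bil_lin_lin)
 interpret T: module K "tp K V W'" by (rule ten_mod[OF assms(2,4)])
 interpret A: module K A by fact
 have lin: "tm K V W' (%v. v) (rh a) : Lin K (tp K V W) (tp K V W')"
 if "a<:A" for a
 using that by (intro ten_map_lin assms bilin_right[OF assms(5)] lin_mp_id)
 have p: "tm K V W' (%v. v) (rh a) (pu K V W v w) = pu K V W' v (rh a w)"
 if "a<:A" "v<:V" "w<:W" for a v w
 using that by (intro ten_map_pure assms bilin_right[OF assms(5)] lin_mp_id)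
 note pb = pure_ten_bil[OF assms(2,4)]
 show "tm K V W' (%v. v) (rh a) : Lin K (tp K V W) (tp K V W')" if "a<:A" for a
 by (rule lin[OF that])
 fix a x assume a: "a<:A" and x: "x<:(tp K V W)"
 show "tm K V W' (%v. v) (rh (a +[A] a')) x
 = tm K V W' (%v. v) (rh a) x +[tp K V W'] tm K V W' (%v. v) (rh a') x"
 if "a'<:A" for a'
 by (rule ten_ext[OF assms(2,3) T.module_axioms lin lin_mp_plus[OF lin lin T.module_axioms] _ x])
 (simp_all add: a that p bilin_add_left[OF assms(5)] bilin_add_right[OF pb] bilin_closed[OF assms(5)])
 show "tm K V W' (%v. v) (rh (c *[A] a)) x = c *[tp K V W'] tm K V W' (%v. v) (rh a) x"
 if "c<:K" for c
 by (rule ten_ext[OF assms(2,3) T.module_axioms lin lin_mp_scale[OF lin that T.module_axioms] _ x])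
 (simp_all add: a that p bilin_smult_left[OF assms(5)] bilin_smult_right[OF pb] bilin_closed[OF assms(5)])
qed

lemma sw_eqI:
 assumes "md K V" "md K W" "md K U" "F : Lin K (tp K V W) U"
 and "!!v w. [|v<:V; w<:W|] ==> f v w = F (pu K V W v w)"
 and "x<:(tp K V W)"
 shows "sw U x f = F x"
proof -
 have "F x = F (sw (tp K V W) x (pu K V W))"
 using sw_pure_id[OF assms(1,2,6)] by simp
 also have "... = sw U x (%v w. F (pu K V W v w))"
 using pure_ten_cl[OF assms(1,2)]
 by (intro sw_lin_im[OF assms(1,2,4) ten_mod[OF assms(1,2)] assms(3) _ assms(6)])
 also have "... = sw U x f"
 by (rule sw_cong[OF assms(1,2) _ assms(6)]) (simp add: assms(5))
 finally show ?thesis by simp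
qed

section \<open>Sweedler sums with four and five components\<close>

context quasi_hopf_algebra
begin

lemma sw4_eqI:
 assumes U: "md K U" and F: "F : Lin K (H4 K H) U"
 and eq: "!!a b c d. [|a<:H; b<:H; c<:H; d<:H|] ==> f a b c d = F (t4 K H a b c d)"
 and "x<:(H4 K H)"
 shows "sw4 U x f = F x"
 unfolding sw4_def
proof (rule sw_eqI[OF mod_H mod_H3 U F _ assms(4)])
 fix a x assume [simp]: "a<:H" and x: "x<:(H3 K H)"
 show "sw3 U x (f a) = F (pt H (H3 K H) a x)"
 unfolding sw3_def
 proof (rule sw_eqI[OF mod_H mod_H2 U linc[OF lin_pure(1) F] _ x])
 fix b x assume [simp]: "b<:H" and x: "x<:HH"
 show "sw U x (f a b) = F (pt H (H3 K H) a (pt H HH b x))"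
 by (rule sw_eqI[OF mod_H mod_H U linc[OF lin_pure(1) linc[OF lin_pure(1) F]] _ x])
 (simp_all add: eq)
 qed simp_all
qed

lemma sw5_eqI:
 assumes U: "md K U" and F: "F : Lin K (H5 K H) U"
 and eq: "!!a b c d e. [|a<:H; b<:H; c<:H; d<:H; e<:H|]
 ==> f a b c d e = F (t5 K H a b c d e)"
 and "x<:(H5 K H)"
 shows "sw5 U x f = F x"
 unfolding sw5_def
proof (rule sw_eqI[OF mod_H mod_H4 U F _ assms(4)])
 fix a x assume [simp]: "a<:H" and x: "x<:(H4 K H)"
 show "sw4 U x (f a) = F (pt H (H4 K H) a x)"
 by (rule sw4_eqI[OF U linc[OF lin_pure(1) F] _ x]) (simp_all add: eq)
qed

lemma H5_ext:
 assumes "md K U" "F : Lin K (H5 K H) U" "G : Lin K (H5 K H) U" "x<:(H5 K H)"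
 and "!!a b c d e. [|a<:H; b<:H; c<:H; d<:H; e<:H|]
 ==> F (t5 K H a b c d e) = G (t5 K H a b c d e)"
 shows "F x = G x"
 using sw5_eqI[OF assms(1,2) _ assms(4), of "%a b c d e. F (t5 K H a b c d e)"]
 sw5_eqI[OF assms(1,3) assms(5) assms(4)] by simp

lemma sw4_lin_im:
 assumes u: "u : Lin K U U'" and U: "md K U" "md K U'"
 and cl: "!!p q r s. [|p<:H; q<:H; r<:H; s<:H|] ==> f p q r s<:U"
 and x: "x<:(H4 K H)"
 shows "u (sw4 U x f) = sw4 U' x (%p q r s. u (f p q r s))"
proof -
 interpret U: module K U by fact
 have "u (sw4 U x f) = sw U' x (%p y. u (sw3 U y (f p)))"
 unfolding sw4_def
 by (intro sw_lin_im[OF mod_H mod_H3 u U _ x] sw3_cl cl U)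
 also have "... = sw4 U' x (%p q r s. u (f p q r s))"
 unfolding sw4_def
 by (intro sw_cong[OF mod_H mod_H3 _ x] sw3_lin_im[OF u U cl])
 finally show ?thesis .
qed

lemma sw4_cl:
 assumes "md K U" "!!p q r s. [|p<:H; q<:H; r<:H; s<:H|] ==> f p q r s<:U"
 and "x<:(H4 K H)"
 shows "sw4 U x f<:U"
proof -
 interpret U: module K U by fact
 show ?thesis
 unfolding sw4_def by (intro sw_cl[OF mod_H mod_H3 U.abelian_group_axioms] sw3_cl assms)
qed

lemma sw_H_cl:
 assumes "md K U" "!!p q. [|p<:H; q<:H|] ==> f p q<:U" "x<:HH"
 shows "sw U x f<:U"
proof -
 interpret U: module K U by fact
 show ?thesis
 by (intro sw_cl[OF mod_H mod_H U.abelian_group_axioms] assms)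
qed

section \<open>The coaction of the cofree module\<close>

lemma t5_mult:
 assumes "a<:H" "b<:H" "c<:H" "d<:H" "e<:H"
 "a'<:H" "b'<:H" "c'<:H" "d'<:H" "e'<:H"
 shows "t5 K H a b c d e .[H5 K H] t5 K H a' b' c' d' e'
 = t5 K H (a##a') (b##b') (c##c') (d##d') (e##e')"
 using assms by (simp add: ten_mult_pure[OF alg_H alg_H4] ten_mult_pure[OF alg_H alg_H3]
 ten_mult_pure[OF alg_H alg_H2])

text \<open>The components of \<omega> on \<open>H><(H><V)\<close>: the first three act from the
  left, the last two by right multiplication. This is not an action of the fivefold tensor power,
  since the last two slots reverse products.\<close>

definition om where
 "om V b t w = (let HV = H><V; T = H><HV in
 tact T (Lg H HV L) (tact T (Rg H HV (Lg H V L)) (tact T (Rg H HV (Rg H V b))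
 (tact T (Rg H HV (Lg H V (rmul H (%h. h)))) (Lg H HV (rmul H (%h. h)))))) w t)"

context
 fixes V and b
 assumes V [simp]: "md K V" and b [simp]: "lact V b"
begin

abbreviation (input) "rH \<equiv> rmul H (%h. h)"
abbreviation (input) "l1 \<equiv> Lg H (H><V) L"
abbreviation (input) "l2 \<equiv> Rg H (H><V) (Lg H V L)"
abbreviation (input) "l3' \<equiv> Rg H (H><V) (Rg H V b)"
abbreviation (input) "r4 \<equiv> Rg H (H><V) (Lg H V rH)"
abbreviation (input) "r5 \<equiv> Lg H (H><V) rH"
abbreviation (input) "T3V \<equiv> H><(H><V)"

lemma rH_bilin: "bilin K H H H rH"
 using bil_flip[OF alg_mult_bil[OF alg_H]] by (simp add: rmul_def[abs_def])

lemma r_bilin: "bilin K H T3V T3V r4" "bilin K H T3V T3V r5"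
 unfolding legL_def legR_def by (intro tmL_bil tmR_bil rH_bilin; simp)+

lemma l_bilin: "bilin K H T3V T3V l1" "bilin K H T3V T3V l2" "bilin K H T3V T3V l3'"
 by (rule action_bilin; simp)+

lemma om_bilin: "bilin K T3V (H5 K H) T3V (om V b)"
 unfolding om_def[abs_def] Let_def
 by (rule bil_flip, intro tact_bil[OF alg_H alg_H4] tact_bil[OF alg_H alg_H3] tact_bil[OF alg_H alg_H2]
 tact_bil[OF alg_H alg_H] l_bilin r_bilin) simp_all

lemmas om_lin = bilin_right[OF om_bilin] bilin_left[OF om_bilin]
lemmas om_cl = bilin_closed[OF om_bilin]

lemma om_t5:
 assumes "w1<:H" "w2<:H" "w3<:H" "w4<:H" "w5<:H" "t<:T3V"
 shows "om V b t (t5 K H w1 w2 w3 w4 w5) = l1 w1 (l2 w2 (l3' w3 (r4 w4 (r5 w5 t))))"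
proof -
 note b1 = tact_bil[OF alg_H alg_H _ r_bilin]
 note b2 = tact_bil[OF alg_H alg_H2 _ l_bilin(3) b1]
 note b3 = tact_bil[OF alg_H alg_H3 _ l_bilin(2) b2]
 show ?thesis
 unfolding om_def Let_def
 using assms
 by (simp add: tact_pure[OF alg_H alg_H4 _ l_bilin(1) b3] tact_pure[OF alg_H alg_H3 _ l_bilin(2) b2]
 tact_pure[OF alg_H alg_H2 _ l_bilin(3) b1] tact_pure[OF alg_H alg_H _ r_bilin])
qed

lemma r_pure:
 assumes "w<:H" "p<:H" "q<:H" "v<:V"
 shows "r4 w (pt H (H><V) p (pt H V q v)) = pt H (H><V) p (pt H V (q##w) v)"
 and "r5 w (pt H (H><V) p (pt H V q v)) = pt H (H><V) (p##w) (pt H V q v)"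
proof -
 have [simp]: "rH w : Lin K H H"
 by (rule bilin_right[OF rH_bilin assms(1)])
 have "tmL H V (rH w) : Lin K (H><V) (H><V)"
 by simp
 then show "r4 w (pt H (H><V) p (pt H V q v)) = pt H (H><V) p (pt H V (q##w) v)"
 and "r5 w (pt H (H><V) p (pt H V q v)) = pt H (H><V) (p##w) (pt H V q v)"
 using assms by (simp_all add: legL_def legR_def rmul_apply)
qed

lemma om_pure:
 assumes "w1<:H" "w2<:H" "w3<:H" "w4<:H" "w5<:H"
 and "p<:H" "q<:H" "v<:V"
 shows "om V b (pt H (H><V) p (pt H V q v)) (t5 K H w1 w2 w3 w4 w5)
 = pt H (H><V) (w1##p##w5) (pt H V (w2##q##w4) (b w3 v))"
 using assms by (simp add: om_t5 r_pure lmul_apply lact_cl[of V] H.m_assoc)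

lemma om_ext:
 assumes "md K U" "F : Lin K T3V U" "G : Lin K T3V U" "t<:T3V"
 and "!!p q v. [|p<:H; q<:H; v<:V|]
 ==> F (pt H (H><V) p (pt H V q v)) = G (pt H (H><V) p (pt H V q v))"
 shows "F t = G t"
proof (rule ext_pure[OF mod_H _ assms(1-4)])
 show "F (pt H (H><V) p x) = G (pt H (H><V) p x)" if "p<:H" and x: "x<:(H><V)" for p x
 by (rule ext_pure[OF mod_H V assms(1) linc[OF lin_pure(1) assms(2)]
 linc[OF lin_pure(1) assms(3)] x]) (simp_all add: assms(5) that)
qed simp

interpretation H5: k_algebra K "H5 K H" by (rule alg_H5)

lemma H5_mult_lin:
 shows "y<:(H5 K H) ==> (%x. x .[H5 K H] y) : Lin K (H5 K H) (H5 K H)"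
 and "y<:(H5 K H) ==> (%x. y .[H5 K H] x) : Lin K (H5 K H) (H5 K H)"
 using bilin_left[OF alg_mult_bil[OF alg_H5]] bilin_right[OF alg_mult_bil[OF alg_H5]] by simp_all

lemma om_mult_t5:
 assumes [simp]: "p<:H" "q<:H" "r<:H" and y: "y<:(H5 K H)" and t: "t<:T3V"
 shows "om V b t (y .[H5 K H] t5 K H p q r 1[H] 1[H]) = om V b (l1 p (l2 q (l3' r t))) y"
proof (rule H5_ext[OF _ linc[OF H5_mult_lin(1) om_lin(1)] om_lin(1) y])
 fix a b' c d e
 assume [simp]: "a<:H" "b'<:H" "c<:H" "d<:H" "e<:H"
 have "(%t. l1 p (l2 q (l3' r t))) : Lin K T3V T3V"
 by (rule linc[OF linc[OF bilin_right[OF l_bilin(3)] bilin_right[OF l_bilin(2)]] bilin_right[OF l_bilin(1)]])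
 simp_all
 then have lin: "(%t. om V b (l1 p (l2 q (l3' r t))) (t5 K H a b' c d e)) : Lin K T3V T3V"
 by (rule linc[OF _ om_lin(2)]) simp
 show "om V b t (t5 K H a b' c d e .[H5 K H] t5 K H p q r 1[H] 1[H]) = om V b (l1 p (l2 q (l3' r t))) (t5 K H a b' c d e)"
 proof (rule om_ext[OF _ om_lin(2) lin t])
 fix x y v assume [simp]: "x<:H" "y<:H" "v<:V"
 show "om V b (pt H (H><V) x (pt H V y v)) (t5 K H a b' c d e .[H5 K H] t5 K H p q r 1[H] 1[H])
 = om V b (l1 p (l2 q (l3' r (pt H (H><V) x (pt H V y v))))) (t5 K H a b' c d e)"
 by (simp add: t5_mult om_pure lmul_apply lact_cl[of V] H.m_assoc action_mult[OF b])
 qed simp_all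
qed (use t in \<open>simp_all add: lact_cl[of T3V]\<close>)

lemma om_t5_mult:
 assumes [simp]: "p<:H" "q<:H" "v<:V" and x: "x<:HH" and y: "y<:(H5 K H)"
 shows "om V b (ins V v x) (t5 K H 1[H] 1[H] 1[H] q p .[H5 K H] y) = om V b (ins V v (x**t2 K H p q)) y"
proof (rule H5_ext[OF _ linc[OF H5_mult_lin(2) om_lin(1)] om_lin(1) y])
 fix a b' c d e
 assume [simp]: "a<:H" "b'<:H" "c<:H" "d<:H" "e<:H"
 show "om V b (ins V v x) (t5 K H 1[H] 1[H] 1[H] q p .[H5 K H] t5 K H a b' c d e) = om V b (ins V v (x**t2 K H p q)) (t5 K H a b' c d e)"
 by (rule ext_pure[OF mod_H mod_H _ linc[OF ins_lin om_lin(2)]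
 linc[OF linc[OF H2_mult_lin(1) ins_lin] om_lin(2)] x])
 (simp_all add: t5_mult om_pure H.m_assoc)
qed (simp_all add: x)

text \<open>The factors of \<omega> are peeled off one at a time. In the first three slots the
  rightmost factor acts first; in the last two the leftmost does, which is
  \<open>om_twist_mult\<close>.\<close>

lemma om_mult_phi:
 assumes y: "y<:(H5 K H)" and t: "t<:T3V"
 shows "om V b t (y .[H5 K H] sw3 (H5 K H) (reassoc H) (%p q r. t5 K H p q r 1[H] 1[H])) = om V b (Ph T3V l1 l2 l3' t) y"
proof -
 have "om V b t (y .[H5 K H] sw3 (H5 K H) (reassoc H) (%p q r. t5 K H p q r 1[H] 1[H]))
 = sw3 T3V (reassoc H) (%p q r. om V b t (y .[H5 K H] t5 K H p q r 1[H] 1[H]))"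
 by (rule sw3_lin_im[OF linc[OF H5_mult_lin(2)[OF y] om_lin(1)[OF t]]]) simp_all
 also have "... = sw3 T3V (reassoc H) (%p q r. om V b (l1 p (l2 q (l3' r t))) y)"
 by (rule sw3_cong) (simp_all add: om_mult_t5 y t)
 also have "... = om V b (Ph T3V l1 l2 l3' t) y"
 by (rule Ph_lin_im[where u = "%t. om V b t y", symmetric]) (simp_all add: t om_lin(2)[OF y])
 finally show ?thesis .
qed

lemma om_twist_mult:
 assumes [simp]: "v<:V" and x: "x<:HH" and y: "y<:(H5 K H)" and g: "g<:HH"
 shows "om V b (ins V v x) (sw (H5 K H) g (%p q. t5 K H 1[H] 1[H] 1[H] q p) .[H5 K H] y) = om V b (ins V v (x**g)) y"
proof -
 have "om V b (ins V v x) (sw (H5 K H) g (%p q. t5 K H 1[H] 1[H] 1[H] q p) .[H5 K H] y)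
 = sw T3V g (%p q. om V b (ins V v x) (t5 K H 1[H] 1[H] 1[H] q p .[H5 K H] y))"
 by (rule sw_lin_im[OF mod_H mod_H linc[OF H5_mult_lin(1)[OF y] om_lin(1)]])
 (simp_all add: x g)
 also have "... = om V b (ins V v (x**g)) y"
 by (rule sw_eqI[where F = "%g. om V b (ins V v (x**g)) y",
 OF mod_H mod_H _ linc[OF linc[OF H2_mult_lin(2) ins_lin] om_lin(2)] _ g])
 (simp_all add: om_t5_mult x y)
 finally show ?thesis .
qed

lemma r_S:
 assumes "w<:H"
 shows "r4 (S w) = Rg H (H><V) (Lg H V R) w" "r5 (S w) = Lg H (H><V) R w"
 by (simp_all add: legL_def legR_def rmul_def[abs_def])

lemma t4_closed': "[|x<:H; y<:H; z<:H; w<:H|] ==> t4 K H x y z w<:(H4 K H)"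
 by simp

text \<open>S in the last two slots turns right multiplications into dual legs, and \<Delta> in the
  second slot makes the second of the four legs diagonal.\<close>

lemma om_chi:
 assumes t: "t<:T3V" and x: "x<:(H4 K H)"
 shows "om V b t (sw4 (H5 K H) x (%a b' c d. sw (H5 K H) (comul H b') (%b1 b2. t5 K H a b1 b2 (S c) (S d))))
 = op4 T3V l1 (dg T3V l2 l3') (Rg H (H><V) (Lg H V R)) (Lg H (H><V) R) x t"
proof -
 let ?q = "Rg H (H><V) (Lg H V R)" and ?p = "Lg H (H><V) R"
 have L: "legs T3V [l1, dg T3V l2 l3', ?q, ?p]" by simp
 have "om V b t (sw4 (H5 K H) x (%a b' c d. sw (H5 K H) (comul H b') (%b1 b2. t5 K H a b1 b2 (S c) (S d))))
 = sw4 T3V x (%a b' c d. om V b t (sw (H5 K H) (comul H b') (%b1 b2. t5 K H a b1 b2 (S c) (S d))))"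
 by (rule sw4_lin_im[OF om_lin(1)[OF t]]) (intro sw_H_cl | simp add: x)+
 also have "... = op4 T3V l1 (dg T3V l2 l3') ?q ?p x t"
 proof (rule sw4_eqI[where F = "%x. op4 T3V l1 (dg T3V l2 l3') ?q ?p x t", OF _ op4_lin[OF _ L t] _ x])
 fix a b' c d assume [simp]: "a<:H" "b'<:H" "c<:H" "d<:H"
 let ?s = "?q c (?p d t)"
 have s [simp]: "?s<:T3V"
 by (simp add: lact_cl[of T3V] t)
 have "om V b t (sw (H5 K H) (comul H b') (%b1 b2. t5 K H a b1 b2 (S c) (S d)))
 = sw T3V (comul H b') (%b1 b2. om V b t (t5 K H a b1 b2 (S c) (S d)))"
 by (rule sw_lin_im[OF mod_H mod_H om_lin(1)[OF t]]) simp_all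
 also have "... = sw T3V (comul H b') (%b1 b2. l1 a (l2 b1 (l3' b2 ?s)))"
 by (rule sw_cong[OF mod_H mod_H]) (simp_all add: om_t5 t r_S)
 also have "... = l1 a (dg T3V l2 l3' b' ?s)"
 unfolding diag_sw[OF tensor_module_simp[OF mod_H tensor_module_simp[OF mod_H V]]]
 by (rule sw_lin_im[OF mod_H mod_H, symmetric]) (simp_all add: lact_cl[of T3V])
 also have "... = op4 T3V l1 (dg T3V l2 l3') ?q ?p (t4 K H a b' c d) t"
 by (rule op4_pure[OF _ L, symmetric]) (simp_all add: t)
 finally show "om V b t (sw (H5 K H) (comul H b') (%b1 b2. t5 K H a b1 b2 (S c) (S d)))
 = op4 T3V l1 (dg T3V l2 l3') ?q ?p (t4 K H a b' c d) t" .
 qed simp_all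
 finally show ?thesis .
qed

end

lemma op4_chi:
 assumes T [simp]: "md K T" and L: "legs T [a, b, c, d]" and t: "t<:T"
 shows "op4 T a b c d (chi K H) t = Ph T a b c (Phi T (dg T a b) c d t)"
proof -
 note [simp] = L[simplified] op4_pure[OF T L] lact_cl[of T]
 have closed: "sw3 (H4 K H) x f<:(H4 K H)"
 if "x<:(H3 K H)" "!!p q r. [|p<:H; q<:H; r<:H|] ==> f p q r<:(H4 K H)" for f x
 using that by (intro sw3_cl) simp_all
 have X: "op4 T a b c d (sw3 (H4 K H) (reassoc H) (%p q r. t4 K H p q r 1[H])) t = Ph T a b c t"
 if t: "t<:T" for t
 proof -
 have "op4 T a b c d (sw3 (H4 K H) (reassoc H) (%p q r. t4 K H p q r 1[H])) t
 = sw3 T (reassoc H) (%p q r. op4 T a b c d (t4 K H p q r 1[H]) t)"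
 by (rule sw3_lin_im[OF op4_lin[OF T L t]]) simp_all
 also have "... = sw3 T (reassoc H) (%p q r. a p (b q (c r t)))"
 by (rule sw3_cong) (simp_all add: t action_one[of K H T])
 also have "... = Ph T a b c t"
 by (rule op3_sw3[symmetric]) (simp_all add: t)
 finally show ?thesis .
 qed
 have Y: "op4 T a b c d (sw3 (H4 K H) (reassoc_inv K H) (%p q r. sw (H4 K H) (comul H p) (%p1 p2. t4 K H p1 p2 q r))) t
 = Phi T (dg T a b) c d t"
 proof -
 have "op4 T a b c d (sw3 (H4 K H) (reassoc_inv K H) (%p q r. sw (H4 K H) (comul H p) (%p1 p2. t4 K H p1 p2 q r))) t
 = sw3 T (reassoc_inv K H) (%p q r. op4 T a b c d (sw (H4 K H) (comul H p) (%p1 p2. t4 K H p1 p2 q r)) t)"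
 by (rule sw3_lin_im[OF op4_lin[OF T L t]]) (simp_all add: sw_H_cl)
 also have "... = sw3 T (reassoc_inv K H) (%p q r. dg T a b p (c q (d r t)))"
 proof (rule sw3_cong)
 fix p q r assume [simp]: "p<:H" "q<:H" "r<:H"
 have "op4 T a b c d (sw (H4 K H) (comul H p) (%p1 p2. t4 K H p1 p2 q r)) t
 = sw T (comul H p) (%p1 p2. op4 T a b c d (t4 K H p1 p2 q r) t)"
 by (rule sw_lin_im[OF mod_H mod_H op4_lin[OF T L t]]) simp_all
 also have "... = dg T a b p (c q (d r t))"
 unfolding diag_sw[OF T] by (rule sw_cong[OF mod_H mod_H]) (simp_all add: t)
 finally show "op4 T a b c d (sw (H4 K H) (comul H p) (%p1 p2. t4 K H p1 p2 q r)) t = dg T a b p (c q (d r t))" .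
 qed simp
 also have "... = Phi T (dg T a b) c d t"
 by (rule op3_sw3[symmetric]) (simp_all add: t)
 finally show ?thesis .
 qed
 show ?thesis
 unfolding chi_def
 using t by (simp add: action_mult[OF act4[OF T L]] closed sw_H_cl X Y)
qed

lemma chi_cl: "chi K H<:(H4 K H)"
proof -
 interpret H4: k_algebra K "H4 K H" by (rule alg_H4)
 show ?thesis
 unfolding chi_def by (intro H4.m_closed sw3_cl sw_H_cl) simp_all
qed

text \<open>The factors of \<omega> are the stages of \<open>nabla\<close>: the inverse twist enters
  \<open>dup\<close>, \<phi> is the innermost associator and \<chi> supplies the two outer
  ones.\<close>

lemma omega_ten_nabla:
 assumes V [simp]: "md K V" and b [simp]: "lact V (act V)" and a [simp]: "a<:H" and v [simp]: "v<:V"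
 shows "omega_tensor K H V a v = nabla V (act V) (pt H V a v)"
proof -
 interpret H5: k_algebra K "H5 K H" by (rule alg_H5)
 let ?T = "H><(H><V)" and ?om = "om V (act V)"
 define A where "A = sw (H5 K H) (inv\<^bsub>HH\<^esub> twist_f K H) (%f1 f2. t5 K H 1[H] 1[H] 1[H] f2 f1)"
 define B where "B = sw4 (H5 K H) (chi K H) (%a b c d. sw (H5 K H) (comul H b) (%b1 b2. t5 K H a b1 b2 (S c) (S d)))"
 define C where "C = sw3 (H5 K H) (reassoc H) (%a b c. t5 K H a b c 1[H] 1[H])"
 have cl [simp]: "A<:(H5 K H)" "B<:(H5 K H)" "C<:(H5 K H)"
 unfolding A_def B_def C_def
 by (intro sw_H_cl sw4_cl sw3_cl chi_cl; simp add: twist_f_inv)+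
 have om: "omega K H = A .[H5 K H] (B .[H5 K H] C)"
 by (simp add: omega_def A_def[symmetric] B_def[symmetric] C_def[symmetric] H5.m_assoc)
 have om_B: "?om t B = Ph ?T (Lg H (H><V) L) (dg ?T (Rg H (H><V) (Lg H V L)) (Rg H (H><V) (Rg H V (act V))))
 (Rg H (H><V) (Lg H V R)) (Phi ?T (dg ?T (Lg H (H><V) L) (dg ?T (Rg H (H><V) (Lg H V L))
 (Rg H (H><V) (Rg H V (act V))))) (Rg H (H><V) (Lg H V R)) (Lg H (H><V) R) t)"
 if "t<:?T" for t
 unfolding B_def om_chi[OF V b that chi_cl] by (rule op4_chi) (simp_all add: that)
 have lin: "?om (ins V v (comul H a)) : Lin K (H5 K H) ?T"
 by (rule om_lin(1)) simp_all
 have "omega_tensor K H V a v = ?om (ins V v (comul H a)) (omega K H)"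
 unfolding omega_tensor_def Let_def
 proof (rule sw5_eqI[OF _ lin])
 fix w1 w2 w3 w4 w5
 assume [simp]: "w1<:H" "w2<:H" "w3<:H" "w4<:H" "w5<:H"
 show "sw ?T (comul H a) (%a1 a2. pt H (H><V) (w1##a1##w5) (pt H V (w2##a2##w4) (act V w3 v)))
 = ?om (ins V v (comul H a)) (t5 K H w1 w2 w3 w4 w5)"
 by (rule sw_eqI[where F = "%x. ?om (ins V v x) (t5 K H w1 w2 w3 w4 w5)",
 OF mod_H mod_H _ linc[OF ins_lin om_lin(2)]]) (simp_all add: om_pure)
 qed (simp_all add: om)
 also have "... = ?om (dup V (pt H V a v)) (B .[H5 K H] C)"
 unfolding om A_def by (subst om_twist_mult) (simp_all add: twist_f_inv)
 also have "... = nabla V (act V) (pt H V a v)"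
 unfolding C_def nabla_def Let_def
 by (subst om_mult_phi) (simp_all add: om_B)
 finally show ?thesis .
qed

end

context quasi_hopf_algebra
begin

section \<open>Counits\<close>

text \<open>Apply \<epsilon> to the antipode axiom for \<alpha> and use \<epsilon>(\<alpha>) =
  1.\<close>

lemma eps_S: "h<:H ==> counit H (S h) = counit H h"
proof -
 assume h [simp]: "h<:H"
 \<comment> \<open>The counit is followed by the unit of \<open>H\<close> so that the sums have
   their values in a module.\<close>
 let ?e = "%h. counit H h *[H] 1[H]"
 have lin: "?e : Lin K H H"
 using bilin_left[OF action_bilin[OF lact_triv[OF mod_H]]] by (simp add: triv_def)
 have "?e (S h) = ?e (S (sw H (comul H h) (%p q. counit H q *[H] p)))"
 by (simp add: counit_right)
 also have "... = ?e (sw H (comul H h) (%p q. S (counit H q *[H] p)))"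
 by (subst sw_lin_im[OF mod_H mod_H antipode_linear]) simp_all
 also have "... = sw H (comul H h) (%p q. ?e (S (counit H q *[H] p)))"
 by (rule sw_lin_im[OF mod_H mod_H lin]) simp_all
 also have "... = sw H (comul H h) (%p q. ?e (S p##qalpha H##q))"
 by (rule sw_cong[OF mod_H mod_H])
 (simp_all add: linear_maps_smult[OF antipode_linear] counit_smult eps_mult counit_alpha K.m_comm)
 also have "... = ?e (sw H (comul H h) (%p q. S p##qalpha H##q))"
 by (rule sw_lin_im[OF mod_H mod_H lin, symmetric]) simp_all
 also have "... = ?e h"
 by (simp add: antipode_alpha counit_smult counit_alpha)
 finally have "counit H (?e (S h)) = counit H (?e h)"
 by simp
 then show ?thesis
 by (simp add: counit_smult eps_one)
qed

definition cou where
 "cou V x = sw V x (%a v. counit H a *[V] v)"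

lemma cou_bil: "md K V ==> bilin K H V V (%a v. counit H a *[V] v)"
 using action_bilin[OF lact_triv] by (simp add: triv_def[abs_def])

lemma cou_lin [simp]: "md K V ==> cou V : Lin K (H><V) V"
 using sw_lin[OF mod_H _ _ cou_bil] by (simp add: cou_def[abs_def])

lemma cou_cl [simp]: "[|module K V; x<:(H><V)|] ==> cou V x<:V"
 by (rule lcl[OF cou_lin])

lemma cou_pure [simp]: "[|module K V; a<:H; v<:V|] ==> cou V (pt H V a v) = counit H a *[V] v"
 using sw_pure[OF mod_H _ _ cou_bil] by (simp add: cou_def)

lemma sm_closed' [simp]: "[|module K V; c<:K; v<:V|] ==> c *[V] v<:V"
 by (rule module.smult_closed)

lemma sm_assoc': "[|module K V; c<:K; d<:K; v<:V|] ==> (c .[K] d) *[V] v = c *[V] (d *[V] v)"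
 by (rule module.smult_assoc1)

lemma sm_one' [simp]: "[|module K V; v<:V|] ==> 1[K] *[V] v = v"
 by (rule module.smult_one)

lemma cou_eqv:
 assumes [simp]: "md K V"
 shows "eqv (H><V) V (cou V) (Lg H V L) (triv V)"
 and "eqv (H><V) V (cou V) (Lg H V R) (triv V)"
 and "lact V b ==> eqv (H><V) V (cou V) (Rg H V b) b"
proof -
 show "eqv (H><V) V (cou V) (Lg H V L) (triv V)"
 by (rule eqv_pure) (simp_all add: lmul_apply triv_def eps_mult sm_assoc')
 show "eqv (H><V) V (cou V) (Lg H V R) (triv V)"
 by (rule eqv_pure)
 (simp_all add: rmul_apply triv_def eps_mult eps_S sm_assoc' K.m_comm)
 show "eqv (H><V) V (cou V) (Rg H V b) b" if "lact V b"
 using that by (intro eqv_pure) (simp_all add: lact_cl[of V] linear_maps_smult[OF action_linear])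
qed

lemma cou_ract:
 assumes [simp]: "md K V" "lact V b"
 shows "eqv (H><V) V (cou V) (ract V b) b"
proof -
 have "eqv (H><V) V (cou V) (ract V b) (dg V (dg V (triv V) b) (triv V))"
 unfolding ract_def by (intro eqv_diag) (simp_all add: cou_eqv)
 then show ?thesis
 by (simp add: eqv_def)
qed

abbreviation "c2 x \<equiv> sw H x (%p q. counit H q *[H] p)"

lemma c2_bilin: "bilin K H H H (%p q. counit H q *[H] p)"
 by (rule bil_flip[OF cou_bil]) simp

lemma c2_lin [simp]: "(%x. c2 x) : Lin K HH H"
 by (rule sw_lin[OF mod_H mod_H mod_H c2_bilin])

lemma c2_cl [simp]: "x<:HH ==> c2 x<:H"
 by (rule lcl[OF c2_lin])

lemma c2_pure [simp]: "[|p<:H; q<:H|] ==> c2 (t2 K H p q) = counit H q *[H] p"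
 by (rule sw_pure[OF mod_H mod_H mod_H c2_bilin])

lemma c2_mult:
 assumes x: "x<:HH" and y: "y<:HH"
 shows "c2 (x**y) = c2 x##c2 y"
proof (rule ext_pure[OF mod_H mod_H mod_H linc[OF H2_mult_lin(1)[OF y] c2_lin]
 linc[OF c2_lin H_mult_lin(1)] x])
 fix p q assume [simp]: "p<:H" "q<:H"
 show "c2 (t2 K H p q**y) = c2 (t2 K H p q)##c2 y"
 by (rule ext_pure[OF mod_H mod_H mod_H linc[OF H2_mult_lin(2) c2_lin]
 linc[OF c2_lin H_mult_lin(2)] y])
 (simp_all add: eps_mult H.smult_mult_left H.smult_mult_right K.m_comm flip: sm_assoc')
qed (simp_all add: y)

lemma c2_S_cop: "h<:H ==> c2 (acop h) = S h"
proof -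
 assume [simp]: "h<:H"
 have "c2 (acop h) = sw H (comul H h) (%p q. c2 (t2 K H (S q) (S p)))"
 unfolding acop_def by (rule sw_lin_im[OF mod_H mod_H c2_lin]) simp_all
 also have "... = S (sw H (comul H h) (%p q. counit H p *[H] q))"
 by (rule sw_H_lin) (simp_all add: antipode_linear eps_S linear_maps_smult[OF antipode_linear])
 finally show ?thesis
 by (simp add: counit_left)
qed

text \<open>Under \<open>c2\<close> the legs in the second factor become trivial, so both
  associators of \<open>EV_twist_a\<close> disappear.\<close>

lemma c2_twist_a:
 assumes [simp]: "x<:HH" "w<:HH"
 shows "c2 (x**twist_a K H**w) = c2 x##qalpha H##c2 w"
proof -
 let ?u = "%t. c2 (EV aal t)"
 let ?c = "dg T2 (lr lm1) (lr lm2)"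
 have lin [simp]: "?u : Lin K T2 H"
 by (rule linc[OF EV_lin c2_lin]) simp
 have i: "eqv T2 H ?u (lr lm2) (triv H)" "eqv T2 H ?u (ll rm2) (triv H)"
 by (rule eqv_pure; simp add: lmul_apply rmul_apply c2_mult eps_S triv_def
 H.smult_mult_left H.smult_mult_right counit_alpha)+
 have tr: "eqv T2 H ?u (triv T2) (triv H)"
 by (rule eqv_triv) simp
 have cu: "equ T2 ?u (lr lm2) (triv T2)" "equ T2 ?u (ll rm2) (triv T2)"
 using i tr by (simp_all add: equ_def eqv_def)
 have "c2 (x**twist_a K H**w) = ?u (Phi T2 (ll rm1) (lr lm1) (lr lm2) (Ph T2 (ll rm2) (ll rm1) ?c (pT2 x w)))"
 using EV_twist_a[of "pT2 x w"] by simp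
 also have "... = ?u (Ph T2 (ll rm2) (ll rm1) ?c (pT2 x w))"
 by (rule Ph_un_triv(6)[OF _ lin]) (simp_all add: cu)
 also have "... = ?u (pT2 x w)"
 by (rule Ph_un_triv(1)[OF _ lin]) (simp_all add: cu)
 finally show ?thesis
 by (simp add: c2_mult counit_alpha)
qed

text \<open>\<open>twist_f\<close> is normalised by an antipode axiom. The normalisation passes to
  its inverse because \<open>c2\<close> is multiplicative.\<close>

lemma c2_twist_g: "c2 twist_g = 1[H]"
proof -
 have "c2 (twist_f K H) = sw3 H (reassoc_inv K H)
 (%p q r. c2 (acop p**twist_a K H**comul H (q##qbeta H##S r)))"
 unfolding twist_f_alt by (rule sw3_lin_im[OF c2_lin]) simp_all
 also have "... = sw3 H (reassoc_inv K H) (%p q r. S p##qalpha H##q##qbeta H##S r)"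
 by (rule sw3_cong) (simp_all add: c2_twist_a c2_S_cop counit_right H.m_assoc)
 finally have "c2 (twist_f K H) = 1[H]"
 by (simp add: antipode_reassoc_inv)
 moreover have "c2 (twist_f K H)##c2 twist_g = c2 1[HH]"
 by (simp flip: c2_mult add: twist_f_twist_g)
 ultimately show ?thesis
 by (simp add: one_HH eps_one)
qed

context
 fixes V and b
 assumes V [simp]: "md K V" and b [simp]: "lact V b"
begin

text \<open>The counit on the inner copy makes \<open>?q\<close> and \<open>?q'\<close> trivial. The
  three associators of \<open>nabla\<close> disappear one by one, and \<open>c2_twist_g\<close>
  removes the twist.\<close>

lemma cou_nabla:
 assumes r [simp]: "r<:(H><V)"
 shows "tmR H V (cou V) (nabla V b r) = r"
proof -
 let ?T = "H><(H><V)" and ?u = "tmR H V (cou V)"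
 let ?p = "Lg H (H><V) L" and ?q = "Rg H (H><V) (Lg H V L)" and ?c = "Rg H (H><V) (Rg H V b)"
 and ?q' = "Rg H (H><V) (Lg H V R)" and ?p' = "Lg H (H><V) R"
 have lin [simp]: "?u : Lin K ?T (H><V)" by simp
 have "Rg H V (triv V) h t = triv (H><V) h t" if "h<:H" and t: "t<:(H><V)" for h t
 by (rule ext_pure[OF mod_H V _ action_linear[OF lact_legR] action_linear[OF lact_triv] t])
 (simp_all add: that triv_def linear_maps_smult[OF lin_pure(1)])
 moreover have "eqv ?T (H><V) ?u ?q (Rg H V (triv V))" "eqv ?T (H><V) ?u ?q' (Rg H V (triv V))"
 by (rule ten_map_eqv(2); simp add: cou_eqv)+
 moreover have "eqv ?T (H><V) ?u (triv ?T) (triv (H><V))"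
 by (rule eqv_triv) simp
 moreover have "?u t<:(H><V)" if "t<:?T" for t
 by (rule lcl[OF lin that])
 ultimately have cu: "equ ?T ?u ?q (triv ?T)" "equ ?T ?u ?q' (triv ?T)"
 by (simp_all add: equ_def eqv_def)
 have "?u (nabla V b r) = ?u (Phi ?T (dg ?T ?p (dg ?T ?q ?c)) ?q' ?p' (Ph ?T ?p ?q ?c (dup V r)))"
 unfolding nabla_def Let_def by (rule Ph_un_triv(5)[OF _ lin]) (simp_all add: cu)
 also have "... = ?u (Ph ?T ?p ?q ?c (dup V r))"
 by (rule Ph_un_triv(4)[OF _ lin]) (simp_all add: cu)
 also have "... = ?u (dup V r)"
 by (rule Ph_un_triv(3)[OF _ lin]) (simp_all add: cu)
 also have "... = r"
 proof (rule ext_pure[OF mod_H V _ linc[OF dup_lin lin] lin_mp_id r])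
 fix a v assume [simp]: "a<:H" "v<:V"
 have "?u (ins V v x) = pt H V (c2 x) v" if x: "x<:HH" for x
 by (rule ext_pure[OF mod_H mod_H _ linc[OF ins_lin lin] linc[OF c2_lin lin_pure(2)] x])
 (simp_all add: linear_maps_smult[OF lin_pure(1)] linear_maps_smult[OF lin_pure(2)])
 then show "?u (dup V (pt H V a v)) = pt H V a v"
 by (simp add: c2_mult counit_right c2_twist_g)
 qed simp_all
 finally show ?thesis .
qed

lemma cou_theta:
 assumes r [simp]: "r<:(H><V)"
 shows "cou V (theta V b r) = cou V r"
proof -
 let ?T = "H><(H><V)" and ?u = "%t. cou V (evm H V L t)"
 let ?p = "Rg H (H><V) (Lg H V L)" and ?c = "Rg H (H><V) (Rg H V b)"
 and ?q = "Rg H (H><V) (Lg H V R)" and ?l = "Lg H (H><V) L"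
 have lin [simp]: "?u : Lin K ?T V"
 by (rule linc[OF evm_lin cou_lin]) simp_all
 have "eqv ?T V ?u ?q (triv V)"
 by (rule eqv_pure2[where z = L])
 (simp_all add: rmul_apply lmul_apply triv_def eps_mult eps_S counit_alpha sm_assoc' K.m_ac)
 moreover have "eqv ?T V ?u (triv ?T) (triv V)"
 by (rule eqv_triv) simp
 ultimately have cu: "equ ?T ?u ?q (triv ?T)"
 by (simp_all add: equ_def eqv_def)
 have "cou V (theta V b r) = ?u (pt H (H><V) 1[H] r)"
 unfolding theta_def thetahat_def by (rule Ph_un_triv(3)[OF _ lin]) (simp_all add: cu)
 also have "... = cou V r"
 by (rule ext_pure[OF mod_H V V linc[OF lin_pure(1) lin] cou_lin r])
 (simp_all add: lmul_apply eps_mult counit_alpha)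
 finally show ?thesis .
qed

end

section \<open>The hexagon\<close>

text \<open>For \<open>V = W\<close> and \<open>G = g\<close> this is the hexagon axiom of a
  half-braiding. Keeping \<open>G\<close> apart allows a map \<open>g\<close> into another object
  \<open>V\<close>, with \<open>G\<close> the half-braiding of \<open>W\<close>;
  \<open>colinear\<close> needs this form.\<close>

definition hexagon where
 "hexagon Z z z' W a V b G g \<longleftrightarrow> (\<forall>t \<in> carrier (Z><W).
 chat Z V g z' (Ph (Z><W) (Lg Z W z) (Rg Z W a) (Lg Z W z') (chat Z W G z t))
 = Ph (Z><V) (Lg Z V z) (Lg Z V z') (Rg Z V b)
 (chat Z V g (dg Z z z') (Ph (Z><W) (Rg Z W a) (Lg Z W z) (Lg Z W z') t)))"

lemma hexagonD:
 "[|hexagon Z z z' W a V b G g; t<:(Z><W)|]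
 ==> chat Z V g z' (Ph (Z><W) (Lg Z W z) (Rg Z W a) (Lg Z W z') (chat Z W G z t))
 = Ph (Z><V) (Lg Z V z) (Lg Z V z') (Rg Z V b)
 (chat Z V g (dg Z z z') (Ph (Z><W) (Rg Z W a) (Lg Z W z) (Lg Z W z') t))"
 by (simp add: hexagon_def)

lemma chat_theta_comp:
 assumes [simp]: "md K Z" "md K V" "md K W" "lact V b" "lact Z z"
 "d : Lin K W (H><V)" and t: "t<:(Z><W)"
 shows "chat Z V (%w. theta V b (d w)) z t = thetahat Z V b z (tmR Z (H><V) d t)"
proof -
 have [simp]: "(%w. theta V b (d w)) : Lin K W (H><V)"
 by (rule linc[OF assms(6) theta_lin]) simp_all
 have "tmR Z V (%v. v) (chat Z V (%w. theta V b (d w)) z t) = chat Z V (theta V b) z (tmR Z (H><V) d t)"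
 proof (rule chat_nat_r[where W = W and V = V])
 show "theta V b (d w) = tmR H V (%v. v) (theta V b (d w))" if "w<:W" for w
 by (rule ext_pure[OF mod_H assms(2) _ lin_mp_id tm_simps(1)])
 (simp_all add: lcl[OF theta_lin] lcl[OF assms(6) that])
 qed (simp_all add: t)
 moreover have "tmR Z V (%v. v) x = x" if x: "x<:(Z><V)" for x
 by (rule ext_pure[OF assms(1,2) _ tm_simps(1) lin_mp_id x]) simp_all
 moreover have "tmR Z (H><V) d t<:(Z><(H><V))"
 by (rule lcl[OF tm_simps(1) t]) simp_all
 moreover have "chat Z V (%w. theta V b (d w)) z t<:(Z><V)"
 by (rule chat_cl[where W = W]) (simp_all add: t)
 ultimately show ?thesis
 by (simp add: chat_theta)
qed

lemma hex_cofree: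
 assumes [simp]: "md K Z" "md K V" "lact V b" "lact Z z" "lact Z z'" "com Z z z'" "com Z z' z"
 shows "hexagon Z z z' (H><V) (ract V b) V b (%r. theta (H><V) (ract V b) (nabla V b r)) (theta V b)"
 unfolding hexagon_def
proof
 fix t assume t: "t<:(Z><(H><V))"
 let ?U = "Z><(H><V)"
 let ?F = "%t. thetahat Z V b z' (Ph ?U (Lg Z (H><V) z) (Rg Z (H><V) (ract V b)) (Lg Z (H><V) z')
 (thetahat Z (H><V) (ract V b) z (tmR Z (H><(H><V)) (nabla V b) t)))"
 let ?G = "%t. Ph (Z><V) (Lg Z V z) (Lg Z V z') (Rg Z V b) (thetahat Z V b (dg Z z z')
 (Ph ?U (Rg Z (H><V) (ract V b)) (Lg Z (H><V) z) (Lg Z (H><V) z') t))"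
 have "?F t = ?G t"
 proof (rule ext_pure[OF assms(1) _ _ _ _ t])
 show "?F : Lin K ?U (Z><V)"
 by (rule linc[OF linc[OF linc[OF tm_simps(1) thetahat_lin] op3_lin] thetahat_lin])
 simp_all
 show "?G : Lin K ?U (Z><V)"
 by (rule linc[OF linc[OF op3_lin thetahat_lin] op3_lin]) simp_all
 show "?F (pt Z (H><V) s r) = ?G (pt Z (H><V) s r)" if "s<:Z" "r<:(H><V)" for s r
 using thetahat_nabla[of Z V z z' b s r] that by simp
 qed simp_all
 moreover have "thetahat Z (H><V) (ract V b) z (tmR Z (H><(H><V)) (nabla V b) t)<:?U"
 proof (rule thetahat_cl)
 show "tmR Z (H><(H><V)) (nabla V b) t<:(Z><(H><(H><V)))"
 by (rule lcl[OF tm_simps(1) t]) simp_all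
 qed simp_all
 ultimately show "chat Z V (theta V b) z' (Ph ?U (Lg Z (H><V) z) (Rg Z (H><V) (ract V b)) (Lg Z (H><V) z')
 (chat Z (H><V) (%r. theta (H><V) (ract V b) (nabla V b r)) z t))
 = Ph (Z><V) (Lg Z V z) (Lg Z V z') (Rg Z V b) (chat Z V (theta V b) (dg Z z z')
 (Ph ?U (Rg Z (H><V) (ract V b)) (Lg Z (H><V) z) (Lg Z (H><V) z') t))"
 using t by (simp add: chat_theta chat_theta_comp[where W = "H><V" and d = "nabla V b"])
qed

text \<open>Coassociativity makes \<open>d\<close> compatible with the half-braidings of
  \<open>M\<close> and of \<open>R(M)\<close>, so the hexagon of the cofree object can be pulled
  back along \<open>d\<close>.\<close>

lemma hex_coaction:
 assumes [simp]: "md K Z" "md K M" "lact M a" "lact Z z" "lact Z z'" "com Z z z'" "com Z z' z"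
 and d [simp]: "d : Lin K M (H><M)" and i: "eqv M (H><M) d a (ract M a)"
 and co: "!!m. m<:M ==> nabla M a (d m) = tmR H (H><M) d (d m)"
 shows "hexagon Z z z' M a M a (%m. theta M a (d m)) (%m. theta M a (d m))"
 unfolding hexagon_def
proof
 fix t assume t [simp]: "t<:(Z><M)"
 let ?RM = "H><M" and ?g = "%m. theta M a (d m)" and ?d = "tmR Z (H><M) d"
 have g [simp]: "?g : Lin K M (H><M)"
 by (rule linc[OF d theta_lin]) simp_all
 have d_cl [simp]: "?d t<:(Z><?RM)" if "t<:(Z><M)" for t
 by (rule lcl[OF tm_simps(1) that]) simp_all
 have di: "eqv (Z><M) (Z><?RM) ?d (Rg Z M a) (Rg Z ?RM (ract M a))"
 "eqv (Z><M) (Z><?RM) ?d (Lg Z M z) (Lg Z ?RM z)"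
 "eqv (Z><M) (Z><?RM) ?d (Lg Z M z') (Lg Z ?RM z')"
 by (rule ten_map_eqv; simp add: i)+
 let ?y = "thetahat Z M a z (?d t)"
 have "?d (Ph (Z><M) (Lg Z M z) (Rg Z M a) (Lg Z M z') ?y)
 = Ph (Z><?RM) (Lg Z ?RM z) (Rg Z ?RM (ract M a)) (Lg Z ?RM z') (?d ?y)"
 by (rule op3_nat) (simp_all add: di)
 moreover have "?d ?y = thetahat Z ?RM (ract M a) z (tmR Z (H><?RM) (tmR H ?RM d) (?d t))"
 by (rule thetahat_nat_r) (simp_all add: i)
 moreover have "tmR Z (H><?RM) (tmR H ?RM d) (?d t) = tmR Z (H><?RM) (nabla M a) (?d t)"
 by (rule ext_pure[OF assms(1,2) _ linc[OF tm_simps(1) tm_simps(1)]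
 linc[OF tm_simps(1) tm_simps(1)] t])
 (simp_all add: co lcl[OF d])
 moreover have "chat Z ?RM (%r. theta ?RM (ract M a) (nabla M a r)) z (?d t)
 = thetahat Z ?RM (ract M a) z (tmR Z (H><?RM) (nabla M a) (?d t))"
 by (rule chat_theta_comp[where W = ?RM]) simp_all
 moreover have "chat Z M (theta M a) z' (Ph (Z><?RM) (Lg Z ?RM z) (Rg Z ?RM (ract M a)) (Lg Z ?RM z')
 (chat Z ?RM (%r. theta ?RM (ract M a) (nabla M a r)) z (?d t)))
 = Ph (Z><M) (Lg Z M z) (Lg Z M z') (Rg Z M a) (chat Z M (theta M a) (dg Z z z')
 (Ph (Z><?RM) (Rg Z ?RM (ract M a)) (Lg Z ?RM z) (Lg Z ?RM z') (?d t)))"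
 by (rule hexagonD[OF hex_cofree]) simp_all
 moreover have "Ph (Z><?RM) (Rg Z ?RM (ract M a)) (Lg Z ?RM z) (Lg Z ?RM z') (?d t)
 = ?d (Ph (Z><M) (Rg Z M a) (Lg Z M z) (Lg Z M z') t)"
 by (rule op3_nat[symmetric]) (simp_all add: di)
 moreover have "Ph (Z><?RM) (Lg Z ?RM z) (Rg Z ?RM (ract M a)) (Lg Z ?RM z')
 (thetahat Z ?RM (ract M a) z (tmR Z (H><?RM) (nabla M a) (?d t)))<:(Z><?RM)"
 using lcl[OF tm_simps(1)[of Z ?RM Z "H><?RM" "%v. v" "nabla M a"], of "?d t"]
 by simp
 ultimately show "chat Z M ?g z' (Ph (Z><M) (Lg Z M z) (Rg Z M a) (Lg Z M z') (chat Z M ?g z t))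
 = Ph (Z><M) (Lg Z M z) (Lg Z M z') (Rg Z M a)
 (chat Z M ?g (dg Z z z') (Ph (Z><M) (Rg Z M a) (Lg Z M z) (Lg Z M z') t))"
 by (simp add: chat_theta_comp[where W = M and d = d] chat_theta)
qed

end

context quasi_hopf_algebra
begin

section \<open>Tensor products of half-braidings\<close>

context
 fixes W and V
 and W' and V'
 and a and b and a' and b'
 and g and g'
 and X and i and j
 assumes mods [simp]: "md K W" "md K V" "md K W'" "md K V'"
 and acts [simp]: "lact W a" "lact V b" "lact W' a'" "lact V' b'"
 and g' [simp]: "g' : Lin K W' (H><V')"
 and i [simp]: "!!x. x \<in> X ==> i x : Lin K W W'" and j [simp]: "!!x. x \<in> X ==> j x : Lin K V V'"
 and ia: "!!x. x \<in> X ==> eqv W W' (i x) a a'" and jb: "!!x. x \<in> X ==> eqv V V' (j x) b b'"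
 and gi: "!!x w. [|x \<in> X; w<:W|] ==> g' (i x w) = tmR H V' (j x) (g w)"
begin

text \<open>By \<open>gen\<close> the maps \<open>i x\<close> jointly determine linear maps on
  \<open>W'\<close>, and the property is tested on each of them. In the applications
  \<open>i x\<close> inserts a fixed vector into a passive tensor factor.\<close>

lemma fst1_k_spec:
 assumes gen: "!!F G w'. [|F : Lin K W' (H><V'); G : Lin K W' (H><V');
 !!x w. [|x \<in> X; w<:W|] ==> F (i x w) = G (i x w); w'<:W'|] ==> F w' = G w'"
 and fk: "first_kind W a V b g"
 shows "first_kind W' a' V' b' g'"
 unfolding first_kind_def
proof (intro conjI ballI)
 note [simp] = fst1_k_lin[OF fk]
 show "g' : Lin K W' (H><V')" by simp
 fix h w' assume h [simp]: "h<:H" and w': "w'<:W'"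
 show "chat H V' g' L (dg (H><W') (Rg H W' a') (Lg H W' L) h (pt H W' 1[H] w'))
 = dg (H><V') (Lg H V' L) (Rg H V' b') h (g' w')"
 proof (rule gen[OF _ _ _ w'])
 show "(%w'. chat H V' g' L (dg (H><W') (Rg H W' a') (Lg H W' L) h (pt H W' 1[H] w')))
 : Lin K W' (H><V')"
 by (rule linc[OF linc[OF lin_pure(1) action_linear[OF lact_diag]] chat_lin]) simp_all
 show "(%w'. dg (H><V') (Lg H V' L) (Rg H V' b') h (g' w')) : Lin K W' (H><V')"
 by (rule linc[OF g' action_linear[OF lact_diag]]) simp_all
 fix x w assume [simp]: "x \<in> X" "w<:W"
 let ?p = "pt H W 1[H] w" and ?i = "tmR H W' (i x)" and ?j = "tmR H V' (j x)"
 have "pt H W' 1[H] (i x w) = ?i ?p"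
 by simp
 moreover have "eqv (H><W) (H><W') ?i (dg (H><W) (Rg H W a) (Lg H W L))
 (dg (H><W') (Rg H W' a') (Lg H W' L))"
 by (rule eqv_diag) (simp_all add: ten_map_eqv ia)
 then have "dg (H><W') (Rg H W' a') (Lg H W' L) h (?i ?p) = ?i (dg (H><W) (Rg H W a) (Lg H W L) h ?p)"
 by (simp add: eqv_def)
 moreover have "chat H V' g' L (?i (dg (H><W) (Rg H W a) (Lg H W L) h ?p))
 = ?j (chat H V g L (dg (H><W) (Rg H W a) (Lg H W L) h ?p))"
 by (rule chat_nat_r[where W = W, symmetric]) (simp_all add: gi)
 moreover have "chat H V g L (dg (H><W) (Rg H W a) (Lg H W L) h ?p)
 = dg (H><V) (Lg H V L) (Rg H V b) h (g w)"
 using fk by (simp add: first_kind_def)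
 moreover have "eqv (H><V) (H><V') ?j (dg (H><V) (Lg H V L) (Rg H V b))
 (dg (H><V') (Lg H V' L) (Rg H V' b'))"
 by (rule eqv_diag) (simp_all add: ten_map_eqv jb)
 then have "?j (dg (H><V) (Lg H V L) (Rg H V b) h (g w)) = dg (H><V') (Lg H V' L) (Rg H V' b') h (?j (g w))"
 by (simp add: eqv_def lcl[OF fst1_k_lin[OF fk]])
 ultimately show "chat H V' g' L (dg (H><W') (Rg H W' a') (Lg H W' L) h (pt H W' 1[H] (i x w)))
 = dg (H><V') (Lg H V' L) (Rg H V' b') h (g' (i x w))"
 by (simp only: gi \<open>x \<in> X\<close> \<open>w<:W\<close>)
 qed
qed

lemma hex_spec:
 fixes Z
 assumes Z [simp]: "md K Z" "lact Z z" "lact Z z'" "com Z z z'" "com Z z' z"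
 and gen: "!!F G w'. [|F : Lin K W' (Z><V'); G : Lin K W' (Z><V');
 !!x w. [|x \<in> X; w<:W|] ==> F (i x w) = G (i x w); w'<:W'|] ==> F w' = G w'"
 and G [simp]: "G : Lin K W (H><W)" "G' : Lin K W' (H><W')"
 and g [simp]: "g : Lin K W (H><V)"
 and Gi: "!!x w. [|x \<in> X; w<:W|] ==> G' (i x w) = tmR H W' (i x) (G w)"
 and hex: "hexagon Z z z' W a V b G g"
 shows "hexagon Z z z' W' a' V' b' G' g'"
 unfolding hexagon_def
proof
 fix t assume t: "t<:(Z><W')"
 let ?F = "%t. chat Z V' g' z' (Ph (Z><W') (Lg Z W' z) (Rg Z W' a') (Lg Z W' z') (chat Z W' G' z t))"
 let ?G = "%t. Ph (Z><V') (Lg Z V' z) (Lg Z V' z') (Rg Z V' b')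
 (chat Z V' g' (dg Z z z') (Ph (Z><W') (Rg Z W' a') (Lg Z W' z) (Lg Z W' z') t))"
 have F: "?F : Lin K (Z><W') (Z><V')"
 by (rule linc[OF linc[OF chat_lin op3_lin] chat_lin]) simp_all
 have G: "?G : Lin K (Z><W') (Z><V')"
 by (rule linc[OF linc[OF op3_lin chat_lin] op3_lin]) simp_all
 show "?F t = ?G t"
 proof (rule ext_pure[OF Z(1) mods(3) _ F G t])
 fix s w' assume s [simp]: "s<:Z" and w': "w'<:W'"
 show "?F (pt Z W' s w') = ?G (pt Z W' s w')"
 proof (rule gen[OF linc[OF lin_pure(1) F] linc[OF lin_pure(1) G] _ w'])
 fix x w assume x [simp]: "x \<in> X" and w [simp]: "w<:W"
 let ?i = "tmR Z W' (i x)" and ?j = "tmR Z V' (j x)" and ?t = "pt Z W s w"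
 have it: "pt Z W' s (i x w) = ?i ?t" by simp
 have ii: "eqv (Z><W) (Z><W') ?i (Rg Z W a) (Rg Z W' a')"
 "eqv (Z><W) (Z><W') ?i (Lg Z W z) (Lg Z W' z)"
 "eqv (Z><W) (Z><W') ?i (Lg Z W z') (Lg Z W' z')"
 by (rule ten_map_eqv; simp add: ia)+
 have jj: "eqv (Z><V) (Z><V') ?j (Rg Z V b) (Rg Z V' b')"
 "eqv (Z><V) (Z><V') ?j (Lg Z V z) (Lg Z V' z)"
 "eqv (Z><V) (Z><V') ?j (Lg Z V z') (Lg Z V' z')"
 by (rule ten_map_eqv; simp add: jb)+
 have cG: "chat Z W' G' z (?i t) = ?i (chat Z W G z t)" if "t<:(Z><W)" for t
 by (rule chat_nat_r[where W = W, symmetric]) (simp_all add: Gi that)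
 have cg: "chat Z V' g' y (?i t) = ?j (chat Z V g y t)" if "t<:(Z><W)" "lact Z y" for t y
 by (rule chat_nat_r[where W = W, symmetric]) (simp_all add: gi that)
 have cl [simp]: "chat Z W G z t<:(Z><W)" "chat Z V g (dg Z z z') t<:(Z><V)"
 if "t<:(Z><W)" for t
 by (rule chat_cl[where W = W]; simp add: that)+
 have "Ph (Z><W') (Lg Z W' z) (Rg Z W' a') (Lg Z W' z') (?i t)
 = ?i (Ph (Z><W) (Lg Z W z) (Rg Z W a) (Lg Z W z') t)" if "t<:(Z><W)" for t
 by (rule op3_nat[symmetric]) (simp_all add: ii that)
 then have "?F (?i ?t) = ?j (chat Z V g z' (Ph (Z><W) (Lg Z W z) (Rg Z W a) (Lg Z W z') (chat Z W G z ?t)))"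
 by (simp add: cG cg del: tm_simps(2) chat_pure)
 also have "... = ?j (Ph (Z><V) (Lg Z V z) (Lg Z V z') (Rg Z V b)
 (chat Z V g (dg Z z z') (Ph (Z><W) (Rg Z W a) (Lg Z W z) (Lg Z W z') ?t)))"
 by (subst hexagonD[OF hex]) simp_all
 also have "... = Ph (Z><V') (Lg Z V' z) (Lg Z V' z') (Rg Z V' b')
 (?j (chat Z V g (dg Z z z') (Ph (Z><W) (Rg Z W a) (Lg Z W z) (Lg Z W z') ?t)))"
 by (rule op3_nat) (simp_all add: jj)
 also have "?j (chat Z V g (dg Z z z') (Ph (Z><W) (Rg Z W a) (Lg Z W z) (Lg Z W z') ?t))
 = chat Z V' g' (dg Z z z') (?i (Ph (Z><W) (Rg Z W a) (Lg Z W z) (Lg Z W z') ?t))"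
 by (rule cg[symmetric]) simp_all
 also have "?i (Ph (Z><W) (Rg Z W a) (Lg Z W z) (Lg Z W z') ?t)
 = Ph (Z><W') (Rg Z W' a') (Lg Z W' z) (Lg Z W' z') (?i ?t)"
 by (rule op3_nat) (simp_all add: ii)
 finally show "?F (pt Z W' s (i x w)) = ?G (pt Z W' s (i x w))"
 by (simp only: it)
 qed simp_all
 qed simp
qed

end

section \<open>A half-braiding next to a passive factor\<close>

definition extL where
 "extL A' B g t = sw (H><(A'><B)) t (%x y. tmR H (A'><B) (%v. pt A' B v y) (g x))"

definition extR where
 "extR A B' g t = sw (H><(A><B')) t (%x y. tmR H (A><B') (pt A B' x) (g y))"

context
 fixes A and C and B
 and g
 assumes mods [simp]: "md K A" "md K B" "md K C" and g [simp]: "g : Lin K A (H><C)"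
begin

lemma extL_bil: "bilin K A B (H><(C><B)) (%x y. tmR H (C><B) (%v. pt C B v y) (g x))"
 by (rule bil_comp_args[OF bil_flip[OF tmR_bil[OF mods(2) mod_H mods(3) _ bil_flip[OF pure_ten_bil]]] g lin_mp_id])
 simp_all

lemma extR_bil: "bilin K B A (H><(B><C)) (%x y. tmR H (B><C) (pt B C x) (g y))"
 by (rule bil_comp_args[OF tmR_bil[OF mods(2) mod_H mods(3) _ pure_ten_bil] lin_mp_id g]) simp_all

lemma extL_lin [simp]: "extL C B g : Lin K (A><B) (H><(C><B))"
 using sw_lin[OF mods(1,2) _ extL_bil] by (simp add: extL_def[abs_def])

lemma extR_lin [simp]: "extR B C g : Lin K (B><A) (H><(B><C))"
 using sw_lin[OF mods(2,1) _ extR_bil] by (simp add: extR_def[abs_def])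

lemma extL_pure: "[|x<:A; y<:B|] ==> extL C B g (pt A B x y) = tmR H (C><B) (%v. pt C B v y) (g x)"
 using sw_pure[OF mods(1,2) _ extL_bil] by (simp add: extL_def)

lemma extR_pure: "[|x<:A; y<:B|] ==> extR B C g (pt B A y x) = tmR H (B><C) (pt B C y) (g x)"
 using sw_pure[OF mods(2,1) _ extR_bil] by (simp add: extR_def)

lemma ext_spec:
 assumes [simp]: "lact B be"
 shows "eqv (A><B) (H><(C><B)) (extL C B g) (Rg A B be) (Rg H (C><B) (Rg C B be))"
 and "eqv (B><A) (H><(B><C)) (extR B C g) (Lg B A be) (Rg H (B><C) (Lg B C be))"
proof -
 have cl: "g x<:(H><C)" if "x<:A" for x
 by (rule lcl[OF g that])
 show "eqv (A><B) (H><(C><B)) (extL C B g) (Rg A B be) (Rg H (C><B) (Rg C B be))"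
 proof (rule eqv_pure)
 fix h x y assume [simp]: "h<:H" "x<:A" and y [simp]: "y<:B"
 have [simp]: "be h y<:B" by (simp add: lact_cl[of B])
 have "tmR H (C><B) (%v. pt C B v (be h y)) r = Rg H (C><B) (Rg C B be) h (tmR H (C><B) (%v. pt C B v y) r)"
 if r: "r<:(H><C)" for r
 proof (rule ext_pure[OF mod_H mods(3) _ _ _ r])
 have act: "lact (H><(C><B)) (Rg H (C><B) (Rg C B be))" by simp
 show "(%r. Rg H (C><B) (Rg C B be) h (tmR H (C><B) (%v. pt C B v y) r)) : Lin K (H><C) (H><(C><B))"
 by (rule linc[OF tm_simps(1) action_linear[OF act]]) (simp_all add: lin_pure)
 qed (simp_all add: lin_pure)
 then show "extL C B g (Rg A B be h (pt A B x y)) = Rg H (C><B) (Rg C B be) h (extL C B g (pt A B x y))"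
 by (simp add: extL_pure cl)
 qed simp_all
 show "eqv (B><A) (H><(B><C)) (extR B C g) (Lg B A be) (Rg H (B><C) (Lg B C be))"
 proof (rule eqv_pure)
 fix h y x assume [simp]: "h<:H" "x<:A" and y [simp]: "y<:B"
 have [simp]: "be h y<:B" by (simp add: lact_cl[of B])
 have "tmR H (B><C) (pt B C (be h y)) r = Rg H (B><C) (Lg B C be) h (tmR H (B><C) (pt B C y) r)"
 if r: "r<:(H><C)" for r
 proof (rule ext_pure[OF mod_H mods(3) _ _ _ r])
 have act: "lact (H><(B><C)) (Rg H (B><C) (Lg B C be))" by simp
 show "(%r. Rg H (B><C) (Lg B C be) h (tmR H (B><C) (pt B C y) r)) : Lin K (H><C) (H><(B><C))"
 by (rule linc[OF tm_simps(1) action_linear[OF act]]) (simp_all add: lin_pure)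
 qed (simp_all add: lin_pure)
 then show "extR B C g (Lg B A be h (pt B A y x)) = Rg H (B><C) (Lg B C be) h (extR B C g (pt B A y x))"
 by (simp add: extR_pure cl)
 qed simp_all
qed

end

lemma fst1_k_ext:
 assumes [simp]: "md K A" "md K B" "md K C" "lact A a" "lact C c" and fk: "first_kind A a C c g"
 shows "first_kind (A><B) (Lg A B a) (C><B) (Lg C B c) (extL C B g)"
 and "first_kind (B><A) (Rg B A a) (B><C) (Rg B C c) (extR B C g)"
proof -
 note [simp] = fst1_k_lin[OF fk]
 show "first_kind (A><B) (Lg A B a) (C><B) (Lg C B c) (extL C B g)"
 proof (rule fst1_k_spec[where X = "carrier B" and i = "%y x. pt A B x y" and j = "%y x. pt C B x y", OF _ _ _ _ _ _ _ _ _ _ _ _ _ _ _ fk])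
 fix F G t
 assume F: "F : Lin K (A><B) (H><(C><B))" and G: "G : Lin K (A><B) (H><(C><B))"
 and eq: "!!x w. [|x<:B; w<:A|] ==> F (pt A B w x) = G (pt A B w x)" and t: "t<:(A><B)"
 show "F t = G t"
 by (rule ext_pure[OF assms(1) assms(2) _ F G t]) (simp_all add: eq)
 qed (simp_all add: lin_pure pure_eqv extL_pure)
 show "first_kind (B><A) (Rg B A a) (B><C) (Rg B C c) (extR B C g)"
 proof (rule fst1_k_spec[where X = "carrier B" and i = "pt B A" and j = "pt B C", OF _ _ _ _ _ _ _ _ _ _ _ _ _ _ _ fk])
 fix F G t
 assume F: "F : Lin K (B><A) (H><(B><C))" and G: "G : Lin K (B><A) (H><(B><C))"
 and eq: "!!x w. [|x<:B; w<:A|] ==> F (pt B A x w) = G (pt B A x w)" and t: "t<:(B><A)"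
 show "F t = G t"
 by (rule ext_pure[OF assms(2) assms(1) _ F G t]) (simp_all add: eq)
 qed (simp_all add: lin_pure pure_eqv extR_pure)
qed

lemma hex_ext:
 assumes [simp]: "md K Z" "lact Z z" "lact Z z'" "com Z z z'" "com Z z' z"
 "md K A" "md K B" "md K C" "lact A a" "lact C c"
 and g [simp]: "g : Lin K A (H><C)" "G : Lin K A (H><A)"
 and hex: "hexagon Z z z' A a C c G g"
 shows "hexagon Z z z' (A><B) (Lg A B a) (C><B) (Lg C B c) (extL A B G) (extL C B g)"
 and "hexagon Z z z' (B><A) (Rg B A a) (B><C) (Rg B C c) (extR B A G) (extR B C g)"
proof -
 show "hexagon Z z z' (A><B) (Lg A B a) (C><B) (Lg C B c) (extL A B G) (extL C B g)"
 proof (rule hex_spec[where X = "carrier B" and i = "%y x. pt A B x y" and j = "%y x. pt C B x y", OF _ _ _ _ _ _ _ _ _ _ _ _ _ _ _ _ _ _ _ _ _ _ _ _ hex])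
 fix F G t
 assume F: "F : Lin K (A><B) (Z><(C><B))" and G: "G : Lin K (A><B) (Z><(C><B))"
 and eq: "!!x w. [|x<:B; w<:A|] ==> F (pt A B w x) = G (pt A B w x)" and t: "t<:(A><B)"
 show "F t = G t"
 by (rule ext_pure[OF assms(6) assms(7) _ F G t]) (simp_all add: eq)
 qed (simp_all add: lin_pure pure_eqv extL_pure)
 show "hexagon Z z z' (B><A) (Rg B A a) (B><C) (Rg B C c) (extR B A G) (extR B C g)"
 proof (rule hex_spec[where X = "carrier B" and i = "pt B A" and j = "pt B C", OF _ _ _ _ _ _ _ _ _ _ _ _ _ _ _ _ _ _ _ _ _ _ _ _ hex])
 fix F G t
 assume F: "F : Lin K (B><A) (Z><(B><C))" and G: "G : Lin K (B><A) (Z><(B><C))"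
 and eq: "!!x w. [|x<:B; w<:A|] ==> F (pt B A x w) = G (pt B A x w)" and t: "t<:(B><A)"
 show "F t = G t"
 by (rule ext_pure[OF assms(7) assms(6) _ F G t]) (simp_all add: eq)
 qed (simp_all add: lin_pure pure_eqv extR_pure)
qed

end

context quasi_hopf_algebra
begin

text \<open>Two ways from \<open>((a b) z) z'\<close> to \<open>z (z' (a b))\<close>: moving \<open>a b\<close> past \<open>z\<close> and then past \<open>z'\<close>, or past
 the product of both at once.\<close>

lemma maclane_hex:
 assumes mods [simp]: "md K T" "md K U" "md K W"
 and L: "legs T [z, z', a, b]" "legs U [z2, z2', a2, b2]" "legs W [z3, z3', a3, b3]"
 and lin [simp]: "kA : Lin K T T" "kB : Lin K T T" "kAd : Lin K U U"
 "cB : Lin K T U" "cB' : Lin K T U" "cA : Lin K U W" "cA' : Lin K U W"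
 and kB: "eqv T T kB (dg T b z) (dg T z b)" "eqv T T kB a a" "eqv T T kB z' z'"
 and kA: "eqv T T kA (dg T a z) (dg T z a)" "eqv T T kA b b" "eqv T T kA z' z'"
 and kAd: "eqv U U kAd (dg U a2 z2) (dg U z2 a2)" "eqv U U kAd b2 b2" "eqv U U kAd z2' z2'"
 and cB: "eqv T U cB (dg T b z') (dg U z2' b2)" "eqv T U cB a a2" "eqv T U cB z z2"
 and cA: "eqv U W cA (dg U a2 z2') (dg W z3' a3)" "eqv U W cA b2 b3" "eqv U W cA z2 z3"
 and hexB: "!!t. t<:T ==> cB (Ph T z b z' (kB t)) = Ph U z2 z2' b2 (cB' (Ph T b z z' t))"
 and hexA: "!!t. t<:U ==> cA (Ph U z2 a2 z2' (kAd t)) = Ph W z3 z3' a3 (cA' (Ph U a2 z2 z2' t))"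
 and comm: "!!t. t<:T ==> kAd (cB t) = cB (kA t)"
 and t [simp]: "t<:T"
 shows "Ph W z3' a3 b3 (cA (Phi U a2 z2' b2 (cB (Ph T a b z' (Ph T z (dg T a b) z'
 (Ph T z a b (kA (Phi T a z b (kB (Ph T a b z t))))))))))
 = Ph W z3 z3' (dg W a3 b3) (Ph W (dg W z3 z3') a3 b3 (cA' (Phi U a2 (dg U z2 z2') b2
 (cB' (Ph T a b (dg T z z') (Ph T (dg T a b) z z' t))))))"
proof -
 note [simp] = L[simplified] lin[THEN lcl]
 define x1 where "x1 = Ph T a b z t"
 define x2 where "x2 = kB x1"
 define x3 where "x3 = Phi T a z b x2"
 define x4 where "x4 = kA x3"
 define y where "y = Ph T (dg T a z) b z' x3"
 \<comment> \<open>Up to associators the hexagon for \<open>b\<close> ends in \<open>w\<close>, and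
   the hexagon for \<open>a\<close> is applied at \<open>w\<close>.\<close>
 define w where "w = Phi U (dg U a2 z2) z2' b2 (cB y)"
 define v where "v = cA (Ph U z2 a2 z2' (kAd w))"
 have cl [simp]: "x1<:T" "x2<:T" "x3<:T" "x4<:T" "y<:T"
 "w<:U" "v<:W"
 by (simp_all add: x1_def x2_def x3_def x4_def y_def w_def v_def)
 have "cB' (Ph T a b (dg T z z') (Ph T (dg T a b) z z' t)) = cB' (Ph T b z z' (Ph T a (dg T b z) z' x1))"
 unfolding x1_def by (subst Ph_pent) simp_all
 moreover have "Ph U z2 z2' b2 (cB' (Ph T b z z' (Ph T a (dg T b z) z' x1)))
 = cB (Ph T z b z' (kB (Ph T a (dg T b z) z' x1)))"
 by (rule hexB[symmetric]) simp
 moreover have "kB (Ph T a (dg T b z) z' x1) = Ph T a (dg T z b) z' x2"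
 unfolding x2_def by (rule op3_nat) (simp_all add: kB)
 moreover have "Ph T z b z' (Ph T a (dg T z b) z' x2) = Ph T a z (dg T b z') y"
 using Ph_pent[of T a z b z' x3] unfolding y_def by (simp add: x3_def)
 moreover have "cB (Ph T a z (dg T b z') y) = Ph U a2 z2 (dg U z2' b2) (cB y)"
 by (rule op3_nat) (simp_all add: cB)
 moreover have "Ph U a2 z2 (dg U z2' b2) (cB y) = Ph U z2 z2' b2 (Ph U a2 (dg U z2 z2') b2 (Ph U a2 z2 z2' w))"
 using Ph_pent[of U a2 z2 z2' b2 w] by (simp add: w_def)
 ultimately have "Ph U z2 z2' b2 (cB' (Ph T a b (dg T z z') (Ph T (dg T a b) z z' t)))
 = Ph U z2 z2' b2 (Ph U a2 (dg U z2 z2') b2 (Ph U a2 z2 z2' w))"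
 by (simp only:)
 then have "Phi U z2 z2' b2 (Ph U z2 z2' b2 (cB' (Ph T a b (dg T z z') (Ph T (dg T a b) z z' t))))
 = Phi U z2 z2' b2 (Ph U z2 z2' b2 (Ph U a2 (dg U z2 z2') b2 (Ph U a2 z2 z2' w)))"
 by (simp only:)
 then have 1: "Phi U a2 (dg U z2 z2') b2 (cB' (Ph T a b (dg T z z') (Ph T (dg T a b) z z' t))) = Ph U a2 z2 z2' w"
 by simp
 have "cA' (Ph U a2 z2 z2' w) = Phi W z3 z3' a3 v"
 using hexA[of w] by (simp add: v_def)
 moreover have "Ph W z3 z3' (dg W a3 b3) (Ph W (dg W z3 z3') a3 b3 (Phi W z3 z3' a3 v))
 = Ph W z3' a3 b3 (Ph W z3 (dg W z3' a3) b3 v)"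
 by (subst Ph_pent) simp_all
 moreover have "Ph W z3 (dg W z3' a3) b3 v = cA (Ph U z2 (dg U a2 z2') b2 (Ph U z2 a2 z2' (kAd w)))"
 unfolding v_def by (rule op3_nat[symmetric]) (simp_all add: cA)
 moreover have "Ph U z2 (dg U a2 z2') b2 (Ph U z2 a2 z2' (kAd w))
 = Phi U a2 z2' b2 (Ph U z2 a2 (dg U z2' b2) (cB (kA y)))"
 proof -
 have "kAd w = Phi U (dg U z2 a2) z2' b2 (kAd (cB y))"
 unfolding w_def by (rule op3_nat) (simp_all add: kAd)
 then have "Ph U (dg U z2 a2) z2' b2 (kAd w) = cB (kA y)"
 by (simp add: comm)
 then show ?thesis
 using Ph_pent[of U z2 a2 z2' b2 "kAd w"] by simp
 qed
 moreover have "kA y = Ph T (dg T z a) b z' x4"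
 unfolding y_def x4_def by (rule op3_nat) (simp_all add: kA)
 moreover have "Ph U z2 a2 (dg U z2' b2) (cB (Ph T (dg T z a) b z' x4))
 = cB (Ph T z a (dg T b z') (Ph T (dg T z a) b z' x4))"
 by (rule op3_nat[symmetric]) (simp_all add: cB)
 moreover have "Ph T z a (dg T b z') (Ph T (dg T z a) b z' x4) = Ph T a b z' (Ph T z (dg T a b) z' (Ph T z a b x4))"
 by (rule Ph_pent) simp_all
 ultimately show ?thesis
 unfolding 1 x4_def x3_def x2_def x1_def by (simp only:)
qed

section \<open>The half-braiding of a tensor product\<close>

abbreviation "mA Z A B a \<equiv> Rg Z (A><B) (Lg A B a)"
abbreviation "mB Z A B b \<equiv> Rg Z (A><B) (Rg A B b)"
abbreviation "mS Z A B z \<equiv> Lg Z (A><B) z"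
abbreviation "dact A a B b \<equiv> dg (A><B) (Lg A B a) (Rg A B b)"

text \<open>The standard composite: reassociate, exchange \<open>b\<close> with \<open>z\<close>,
  reassociate back, exchange \<open>a\<close> with \<open>z\<close>, reassociate.\<close>

definition tcomp where
 "tcomp Z A a C c gA B b D d gB z t =
 Ph (Z><(C><D)) (mS Z C D z) (mA Z C D c) (mB Z C D d) (chat Z (C><D) (extL C D gA) z
 (Phi (Z><(A><D)) (mA Z A D a) (mS Z A D z) (mB Z A D d) (chat Z (A><D) (extR A D gB) z
 (Ph (Z><(A><B)) (mA Z A B a) (mB Z A B b) (mS Z A B z) t))))"

text \<open>The corresponding first kind coaction, obtained at 1 in the regular module;
  \<open>chat_htens\<close> recovers \<open>tcomp\<close> for every \<open>Z\<close>.\<close>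

definition htens where
 "htens A a C c gA B b D d gB t = tcomp H A a C c gA B b D d gB L (pt H (A><B) 1[H] t)"

lemma tmL_state_eqv:
 assumes "md K Z" "md K S''" "md K E" "md K F" "lact Z z" "lact S'' z'"
 and "f : Lin K Z S''" "eqv Z S'' f z z'"
 shows "eqv (Z><(E><F)) (S''><(E><F)) (tmL S'' (E><F) f) (mS Z E F z) (mS S'' E F z')"
 and "lact E e ==> eqv (Z><(E><F)) (S''><(E><F)) (tmL S'' (E><F) f) (mA Z E F e) (mA S'' E F e)"
 and "lact F e' ==> eqv (Z><(E><F)) (S''><(E><F)) (tmL S'' (E><F) f) (mB Z E F e') (mB S'' E F e')"
 using assms by (simp_all add: ten_map_eqv)

context
 fixes A and C
 and B and D
 and a and c and b and d
 and gA and gB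
 assumes mods [simp]: "md K A" "md K B" "md K C" "md K D"
 and acts [simp]: "lact A a" "lact B b" "lact C c" "lact D d"
 and gA: "first_kind A a C c gA" and gB: "first_kind B b D d gB"
begin

lemmas [simp] = fst1_k_lin[OF gA] fst1_k_lin[OF gB]

context
 fixes Z and z
 assumes Z [simp]: "md K Z" "lact Z z"
begin

lemma chat_extL_eqv:
 assumes [simp]: "md K E"
 shows "eqv (Z><(A><E)) (Z><(C><E)) (chat Z (C><E) (extL C E gA) z)
 (dg (Z><(A><E)) (mA Z A E a) (mS Z A E z)) (dg (Z><(C><E)) (mS Z C E z) (mA Z C E c))"
 and "lact E e ==> eqv (Z><(A><E)) (Z><(C><E)) (chat Z (C><E) (extL C E gA) z) (mB Z A E e) (mB Z C E e)"
 and "[|lact Z rh; com Z rh z|] ==> eqv (Z><(A><E)) (Z><(C><E))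
 (chat Z (C><E) (extL C E gA) z) (mS Z A E rh) (mS Z C E rh)"
 by (rule fst1_k_eqv chat_eqv_r chat_eqv_l;
 simp add: fst1_k_ext(1)[OF _ _ _ _ _ gA] ext_spec)+

lemma chat_extR_eqv:
 assumes [simp]: "md K E"
 shows "eqv (Z><(E><B)) (Z><(E><D)) (chat Z (E><D) (extR E D gB) z)
 (dg (Z><(E><B)) (mB Z E B b) (mS Z E B z)) (dg (Z><(E><D)) (mS Z E D z) (mB Z E D d))"
 and "lact E e ==> eqv (Z><(E><B)) (Z><(E><D)) (chat Z (E><D) (extR E D gB) z) (mA Z E B e) (mA Z E D e)"
 and "[|lact Z rh; com Z rh z|] ==> eqv (Z><(E><B)) (Z><(E><D))
 (chat Z (E><D) (extR E D gB) z) (mS Z E B rh) (mS Z E D rh)"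
 by (rule fst1_k_eqv chat_eqv_r chat_eqv_l;
 simp add: fst1_k_ext(2)[OF _ _ _ _ _ gB] ext_spec)+

lemma tcomp_lin [simp]: "tcomp Z A a C c gA B b D d gB z : Lin K (Z><(A><B)) (Z><(C><D))"
 unfolding tcomp_def[abs_def]
 by (rule linc[OF linc[OF linc[OF linc[OF
 op3_lin chat_lin] op3_lin] chat_lin] op3_lin]) simp_all

lemma tcomp_eqv:
 "eqv (Z><(A><B)) (Z><(C><D)) (tcomp Z A a C c gA B b D d gB z)
 (dg (Z><(A><B)) (dg (Z><(A><B)) (mA Z A B a) (mB Z A B b)) (mS Z A B z))
 (dg (Z><(C><D)) (mS Z C D z) (dg (Z><(C><D)) (mA Z C D c) (mB Z C D d)))"
proof -
 let ?T = "Z><(A><B)" and ?T2 = "Z><(A><D)" and ?T3 = "Z><(C><D)"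
 have 1: "eqv ?T ?T (Ph ?T (mA Z A B a) (mB Z A B b) (mS Z A B z))
 (dg ?T (dg ?T (mA Z A B a) (mB Z A B b)) (mS Z A B z))
 (dg ?T (mA Z A B a) (dg ?T (mB Z A B b) (mS Z A B z)))"
 by simp
 have 2: "eqv ?T ?T2 (chat Z (A><D) (extR A D gB) z)
 (dg ?T (mA Z A B a) (dg ?T (mB Z A B b) (mS Z A B z)))
 (dg ?T2 (mA Z A D a) (dg ?T2 (mS Z A D z) (mB Z A D d)))"
 by (rule eqv_diag) (simp_all add: chat_extR_eqv)
 have 3: "eqv ?T2 ?T2 (Phi ?T2 (mA Z A D a) (mS Z A D z) (mB Z A D d))
 (dg ?T2 (mA Z A D a) (dg ?T2 (mS Z A D z) (mB Z A D d)))
 (dg ?T2 (dg ?T2 (mA Z A D a) (mS Z A D z)) (mB Z A D d))"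
 by simp
 have 4: "eqv ?T2 ?T3 (chat Z (C><D) (extL C D gA) z)
 (dg ?T2 (dg ?T2 (mA Z A D a) (mS Z A D z)) (mB Z A D d))
 (dg ?T3 (dg ?T3 (mS Z C D z) (mA Z C D c)) (mB Z C D d))"
 by (rule eqv_diag) (simp_all add: chat_extL_eqv)
 have 5: "eqv ?T3 ?T3 (Ph ?T3 (mS Z C D z) (mA Z C D c) (mB Z C D d))
 (dg ?T3 (dg ?T3 (mS Z C D z) (mA Z C D c)) (mB Z C D d))
 (dg ?T3 (mS Z C D z) (dg ?T3 (mA Z C D c) (mB Z C D d)))"
 by simp
 have l1: "Ph ?T (mA Z A B a) (mB Z A B b) (mS Z A B z) : Lin K ?T ?T" by simp
 have l2: "chat Z (A><D) (extR A D gB) z : Lin K ?T ?T2" by simp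
 have l3: "Phi ?T2 (mA Z A D a) (mS Z A D z) (mB Z A D d) : Lin K ?T2 ?T2" by simp
 have l4: "chat Z (C><D) (extL C D gA) z : Lin K ?T2 ?T3" by simp
 note l12 = linc[OF l1 l2] and l123 = linc[OF linc[OF l1 l2] l3]
 show ?thesis
 unfolding tcomp_def[abs_def]
 by (rule eqv_comp[OF eqv_comp[OF eqv_comp[OF eqv_comp[OF 1 2 l1] 3 l12] 4 l123] 5
 linc[OF l123 l4]])
qed

end

lemma tcomp_nat_l:
 assumes [simp]: "md K Z" "md K S''" "lact Z z" "lact S'' z'"
 and f [simp]: "f : Lin K Z S''" and i: "eqv Z S'' f z z'" and t: "t<:(Z><(A><B))"
 shows "tmL S'' (C><D) f (tcomp Z A a C c gA B b D d gB z t)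
 = tcomp S'' A a C c gA B b D d gB z' (tmL S'' (A><B) f t)"
proof -
 note ii = tmL_state_eqv[OF assms(1,2) _ _ assms(3,4) f i]
 define x1 where "x1 = Ph (Z><(A><B)) (mA Z A B a) (mB Z A B b) (mS Z A B z) t"
 define x2 where "x2 = chat Z (A><D) (extR A D gB) z x1"
 define x3 where "x3 = Phi (Z><(A><D)) (mA Z A D a) (mS Z A D z) (mB Z A D d) x2"
 define x4 where "x4 = chat Z (C><D) (extL C D gA) z x3"
 have cl [simp]: "x1<:(Z><(A><B))" "x2<:(Z><(A><D))" "x3<:(Z><(A><D))"
 "x4<:(Z><(C><D))"
 proof -
 show 1: "x1<:(Z><(A><B))" by (simp add: x1_def t)
 show 2: "x2<:(Z><(A><D))"
 unfolding x2_def by (rule chat_cl[OF _ _ _ _ _ 1]) simp_all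
 show 3: "x3<:(Z><(A><D))" by (simp add: x3_def 2)
 show "x4<:(Z><(C><D))"
 unfolding x4_def by (rule chat_cl[OF _ _ _ _ _ 3]) simp_all
 qed
 have "tmL S'' (A><B) f x1 = Ph (S''><(A><B)) (mA S'' A B a) (mB S'' A B b) (mS S'' A B z') (tmL S'' (A><B) f t)"
 unfolding x1_def by (rule op3_nat) (simp_all add: ii t)
 moreover have "tmL S'' (A><D) f x2 = chat S'' (A><D) (extR A D gB) z' (tmL S'' (A><B) f x1)"
 unfolding x2_def by (rule chat_nat_l) (simp_all add: i)
 moreover have "tmL S'' (A><D) f x3 = Phi (S''><(A><D)) (mA S'' A D a) (mS S'' A D z') (mB S'' A D d) (tmL S'' (A><D) f x2)"
 unfolding x3_def by (rule op3_nat) (simp_all add: ii)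
 moreover have "tmL S'' (C><D) f x4 = chat S'' (C><D) (extL C D gA) z' (tmL S'' (A><D) f x3)"
 unfolding x4_def by (rule chat_nat_l) (simp_all add: i)
 moreover have "tmL S'' (C><D) f (Ph (Z><(C><D)) (mS Z C D z) (mA Z C D c) (mB Z C D d) x4)
 = Ph (S''><(C><D)) (mS S'' C D z') (mA S'' C D c) (mB S'' C D d) (tmL S'' (C><D) f x4)"
 by (rule op3_nat) (simp_all add: ii)
 ultimately show ?thesis
 by (simp only: tcomp_def x1_def[symmetric] x2_def[symmetric] x3_def[symmetric] x4_def[symmetric])
qed

lemma htens_lin [simp]: "htens A a C c gA B b D d gB : Lin K (A><B) (H><(C><D))"
 unfolding htens_def[abs_def] by (rule linc[OF lin_pure(1) tcomp_lin]) simp_all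

lemma chat_htens:
 assumes [simp]: "md K Z" "lact Z z" and t: "t<:(Z><(A><B))"
 shows "chat Z (C><D) (htens A a C c gA B b D d gB) z t = tcomp Z A a C c gA B b D d gB z t"
proof (rule chat_eqI[OF _ _ _ _ _ _ _ t])
 fix s w assume [simp]: "s<:Z" "w<:(A><B)"
 show "tcomp Z A a C c gA B b D d gB z (tmL Z (A><B) (%h. z h s) (pt H (A><B) 1[H] w))
 = tmL Z (C><D) (%h. z h s) (htens A a C c gA B b D d gB w)"
 unfolding htens_def by (rule tcomp_nat_l[symmetric]) (simp_all add: lact_orbit_eqv)
qed simp_all

lemma htens_fst1_k: "first_kind (A><B) (dact A a B b) (C><D) (dact C c D d) (htens A a C c gA B b D d gB)"
 unfolding first_kind_def
proof (intro conjI ballI)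
 fix h w assume [simp]: "h<:H" "w<:(A><B)"
 let ?T = "H><(A><B)" and ?U = "H><(C><D)" and ?o = "pt H (A><B) 1[H] w"
 have 1: "dg ?T (Rg H (A><B) (dact A a B b)) (mS H A B L) h ?o
 = dg ?T (dg ?T (mA H A B a) (mB H A B b)) (mS H A B L) h ?o"
 by (rule diag_cong) (simp_all add: diag_legR)
 have cl: "htens A a C c gA B b D d gB w<:?U"
 by (rule lcl[OF htens_lin]) simp
 have "dg ?U (mS H C D L) (dg ?U (mA H C D c) (mB H C D d)) h (htens A a C c gA B b D d gB w)
 = dg ?U (mS H C D L) (Rg H (C><D) (dact C c D d)) h (htens A a C c gA B b D d gB w)"
 by (rule diag_cong) (simp_all add: diag_legR cl)
 moreover have "tcomp H A a C c gA B b D d gB L (dg ?T (dg ?T (mA H A B a) (mB H A B b)) (mS H A B L) h ?o)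
 = dg ?U (mS H C D L) (dg ?U (mA H C D c) (mB H C D d)) h (htens A a C c gA B b D d gB w)"
 unfolding htens_def by (rule eqvD[OF tcomp_eqv]) simp_all
 ultimately show "chat H (C><D) (htens A a C c gA B b D d gB) L (dg ?T (Rg H (A><B) (dact A a B b)) (mS H A B L) h ?o)
 = dg ?U (mS H C D L) (Rg H (C><D) (dact C c D d)) h (htens A a C c gA B b D d gB w)"
 by (simp add: 1 chat_htens)
qed simp

text \<open>The two maps work on different factors of the tensor product, and on \<open>Z\<close>
  they use the commuting actions \<open>z\<close> and \<open>z'\<close>.\<close>

lemma chat_ext_cm:
 assumes [simp]: "md K Z" "lact Z z" "lact Z z'" "com Z z z'" "com Z z' z"
 and GA [simp]: "GA : Lin K A (H><A)" and t: "t<:(Z><(A><B))"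
 shows "chat Z (A><D) (extL A D GA) z (chat Z (A><D) (extR A D gB) z' t)
 = chat Z (A><D) (extR A D gB) z' (chat Z (A><B) (extL A B GA) z t)"
proof -
 let ?T2 = "Z><(A><D)" and ?T = "Z><(A><B)"
 let ?k = "chat Z (A><B) (extL A B GA) z" and ?k2 = "chat Z (A><D) (extL A D GA) z"
 and ?c = "chat Z (A><D) (extR A D gB) z'"
 let ?J = "%x. tmR Z (A><D) (pt A D x)"
 have kl: "?k : Lin K ?T ?T" "?k2 : Lin K ?T2 ?T2" and cl: "?c : Lin K ?T ?T2"
 by simp_all
 have J: "bilin K A (Z><D) ?T2 ?J"
 by (rule tmR_bil) (simp_all add: pure_ten_bil)
 have *: "?k2 (?c (pt Z (A><B) s (pt A B x y))) = ?c (?k (pt Z (A><B) s (pt A B x y)))"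
 if [simp]: "s<:Z" "x<:A" "y<:B" for s x y
 proof -
 have Gx: "GA x<:(H><A)" by (rule lcl[OF GA]) simp
 let ?q = "chat Z D gB z' (pt Z B s y)"
 have q: "?q<:(Z><D)"
 by (rule chat_cl[where W = B]) simp_all
 have cJ: "?c (pt Z (A><B) s' (pt A B x' y)) = ?J x' (chat Z D gB z' (pt Z B s' y))"
 if [simp]: "s'<:Z" "x'<:A" for s' x'
 proof -
 have "?J x' (chat Z D gB z' (pt Z B s' y)) = ?c (tmR Z (A><B) (pt A B x') (pt Z B s' y))"
 by (rule chat_nat_r[where W = B]) (simp_all add: lin_pure extR_pure)
 then show ?thesis
 by (simp add: lin_pure)
 qed
 have lin1: "(%q. sw ?T2 (GA x) (%h x'. ?J x' (Lg Z D z h q))) : Lin K (Z><D) ?T2"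
 proof (rule sw_lin_par[OF mod_H mods(1) _ _ _ _ Gx])
 show "bilin K H A ?T2 (%h x'. ?J x' (Lg Z D z h q))" if "q<:(Z><D)" for q
 by (rule bil_comp_args[OF bil_flip[OF J] bilin_left[OF action_bilin] lin_mp_id]) (simp_all add: that)
 show "(%t. ?J x' (Lg Z D z h t)) : Lin K (Z><D) ?T2" if "h<:H" "x'<:A" for h x'
 by (rule linc[OF action_linear[of K H] bilin_right[OF J]]) (simp_all add: that)
 qed simp_all
 have "?k2 (?J x ?q) = sw ?T2 (GA x) (%h x'. ?J x' (Lg Z D z h ?q))"
 proof (rule ext_pure[OF assms(1) mods(4) _ linc[OF bilin_right[OF J] kl(2)] lin1 q])
 fix s' y' assume [simp]: "s'<:Z" "y'<:D"
 have "sw ?T2 (GA x) (%h x'. ?J x' (Lg Z D z h (pt Z D s' y')))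
 = tmL Z (A><D) (%h. z h s') (tmR H (A><D) (%v. pt A D v y') (GA x))"
 by (rule sw_eqI[OF mod_H mods(1) _ linc[OF tm_simps(1) tm_simps(1)] _ Gx])
 (simp_all add: lin_pure lact_cl[of Z])
 then show "?k2 (?J x (pt Z D s' y')) = sw ?T2 (GA x) (%h x'. ?J x' (Lg Z D z h (pt Z D s' y')))"
 by (simp add: lin_pure extL_pure)
 qed simp_all
 also have "... = sw ?T2 (GA x) (%h x'. ?c (pt Z (A><B) (z h s) (pt A B x' y)))"
 proof (rule sw_cong[OF mod_H mods(1) _ Gx])
 fix h x' assume [simp]: "h<:H" "x'<:A"
 have "eqv (Z><B) (Z><D) (chat Z D gB z') (Lg Z B z) (Lg Z D z)"
 by (rule chat_eqv_l) simp_all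
 then have e1: "chat Z D gB z' (Lg Z B z h (pt Z B s y)) = Lg Z D z h ?q"
 by (rule eqvD) simp_all
 have e2: "pt Z B (z h s) y = Lg Z B z h (pt Z B s y)"
 by simp
 have "?c (pt Z (A><B) (z h s) (pt A B x' y)) = ?J x' (chat Z D gB z' (pt Z B (z h s) y))"
 by (rule cJ) (simp_all add: lact_cl[of Z])
 then show "?J x' (Lg Z D z h ?q) = ?c (pt Z (A><B) (z h s) (pt A B x' y))"
 by (simp only: e1 e2)
 qed
 also have "... = ?c (tmL Z (A><B) (%h. z h s) (tmR H (A><B) (%v. pt A B v y) (GA x)))"
 by (rule sw_eqI[OF mod_H mods(1) _ linc[OF linc[OF tm_simps(1) tm_simps(1)] cl] _ Gx])
 (simp_all add: lin_pure lact_cl[of Z])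
 finally have "?k2 (?J x ?q) = ?c (tmL Z (A><B) (%h. z h s) (tmR H (A><B) (%v. pt A B v y) (GA x)))" .
 moreover have "?k (pt Z (A><B) s (pt A B x y)) = tmL Z (A><B) (%h. z h s) (tmR H (A><B) (%v. pt A B v y) (GA x))"
 by (simp add: extL_pure)
 ultimately show ?thesis
 by (simp only: cJ that)
 qed
 have F: "(%t. ?k2 (?c t)) : Lin K ?T ?T2" and G: "(%t. ?c (?k t)) : Lin K ?T ?T2"
 by (rule linc[OF cl kl(2)] linc[OF kl(1) cl])+
 show ?thesis
 proof (rule ext_pure[OF assms(1) _ _ F G t])
 show "?k2 (?c (pt Z (A><B) s x)) = ?c (?k (pt Z (A><B) s x))" if "s<:Z" and x: "x<:(A><B)" for s x
 by (rule ext_pure[OF mods(1,2) _ linc[OF lin_pure(1) F] linc[OF lin_pure(1) G] x])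
 (simp_all add: that * del: chat_pure)
 qed simp_all
qed

text \<open>An application of \<open>maclane_hex\<close> with both hexagons supplied by
  \<open>hex_ext\<close>. The equations \<open>rA\<close> to \<open>dz3\<close> split the actions on
  the products and on \<open>Z\<close> into the single legs that it expects.\<close>

lemma hex_htens:
 assumes Z [simp]: "md K Z" "lact Z z" "lact Z z'" "com Z z z'" "com Z z' z"
 and GA: "first_kind A a A a GA" and GB: "first_kind B b B b GB"
 and hexA: "hexagon Z z z' A a C c GA gA" and hexB: "hexagon Z z z' B b D d GB gB"
 shows "hexagon Z z z' (A><B) (dact A a B b) (C><D) (dact C c D d)
 (htens A a A a GA B b B b GB) (htens A a C c gA B b D d gB)"
 unfolding hexagon_def
proof
 fix t assume t [simp]: "t<:(Z><(A><B))"
 note [simp] = fst1_k_lin[OF GA] fst1_k_lin[OF GB]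
 let ?T = "Z><(A><B)" and ?T2 = "Z><(A><D)" and ?T3 = "Z><(C><D)"
 have rA: "Ph ?T (mS Z A B z) (Rg Z (A><B) (dact A a B b)) (mS Z A B z') x
 = Ph ?T (mS Z A B z) (dg ?T (mA Z A B a) (mB Z A B b)) (mS Z A B z') x" if "x<:?T" for x
 by (rule op3_cong) (simp_all add: that diag_legR)
 have rA': "Ph ?T (Rg Z (A><B) (dact A a B b)) (mS Z A B z) (mS Z A B z') t
 = Ph ?T (dg ?T (mA Z A B a) (mB Z A B b)) (mS Z A B z) (mS Z A B z') t"
 by (rule op3_cong) (simp_all add: diag_legR)
 have rC: "Ph ?T3 (mS Z C D z) (mS Z C D z') (Rg Z (C><D) (dact C c D d)) x
 = Ph ?T3 (mS Z C D z) (mS Z C D z') (dg ?T3 (mA Z C D c) (mB Z C D d)) x" if "x<:?T3" for x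
 by (rule op3_cong) (simp_all add: that diag_legR)
 have dz: "Phi ?T2 (mA Z A D a) (mS Z A D (dg Z z z')) (mB Z A D d) x
 = Phi ?T2 (mA Z A D a) (dg ?T2 (mS Z A D z) (mS Z A D z')) (mB Z A D d) x" if "x<:?T2" for x
 by (rule op3_cong) (simp_all add: that diag_legL)
 have dz1: "Ph ?T (mA Z A B a) (mB Z A B b) (mS Z A B (dg Z z z')) x
 = Ph ?T (mA Z A B a) (mB Z A B b) (dg ?T (mS Z A B z) (mS Z A B z')) x" if "x<:?T" for x
 by (rule op3_cong) (simp_all add: that diag_legL)
 have dz3: "Ph ?T3 (mS Z C D (dg Z z z')) (mA Z C D c) (mB Z C D d) x
 = Ph ?T3 (dg ?T3 (mS Z C D z) (mS Z C D z')) (mA Z C D c) (mB Z C D d) x" if "x<:?T3" for x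
 by (rule op3_cong) (simp_all add: that diag_legL)
 let ?kA = "chat Z (A><B) (extL A B GA) z" and ?kB = "chat Z (A><B) (extR A B GB) z"
 and ?kA2 = "chat Z (A><D) (extL A D GA) z"
 let ?cB = "chat Z (A><D) (extR A D gB)" and ?cA = "chat Z (C><D) (extL C D gA)"
 note kB = quasi_hopf_algebra.chat_extR_eqv[OF quasi_hopf_algebra_axioms mods(1,2,1,2) acts(1,2,1,2) GA GB Z(1,2) mods(1)]
 and kA = quasi_hopf_algebra.chat_extL_eqv[OF quasi_hopf_algebra_axioms mods(1,2,1,2) acts(1,2,1,2) GA GB Z(1,2) mods(2)]
 and kA2 = quasi_hopf_algebra.chat_extL_eqv[OF quasi_hopf_algebra_axioms mods(1,2,1,2) acts(1,2,1,2) GA GB Z(1,2) mods(4)]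
 have cB: "?cB y x<:?T2" if "x<:?T" "lact Z y" for x y
 by (rule chat_cl[OF _ _ _ _ _ that(1)]) (simp_all add: that(2))
 have cA: "?cA y x<:?T3" if "x<:?T2" "lact Z y" for x y
 by (rule chat_cl[OF _ _ _ _ _ that(1)]) (simp_all add: that(2))
 have kcl: "?kA x<:?T" "?kB x<:?T" if "x<:?T" for x
 by (rule chat_cl[OF _ _ _ _ _ that]; simp)+
 have m: "Ph ?T3 (mS Z C D z') (mA Z C D c) (mB Z C D d) (?cA z' (Phi ?T2 (mA Z A D a) (mS Z A D z') (mB Z A D d)
 (?cB z' (Ph ?T (mA Z A B a) (mB Z A B b) (mS Z A B z') (Ph ?T (mS Z A B z) (dg ?T (mA Z A B a) (mB Z A B b)) (mS Z A B z')
 (Ph ?T (mS Z A B z) (mA Z A B a) (mB Z A B b) (?kA (Phi ?T (mA Z A B a) (mS Z A B z) (mB Z A B b)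
 (?kB (Ph ?T (mA Z A B a) (mB Z A B b) (mS Z A B z) t))))))))))
 = Ph ?T3 (mS Z C D z) (mS Z C D z') (dg ?T3 (mA Z C D c) (mB Z C D d))
 (Ph ?T3 (dg ?T3 (mS Z C D z) (mS Z C D z')) (mA Z C D c) (mB Z C D d) (?cA (dg Z z z')
 (Phi ?T2 (mA Z A D a) (dg ?T2 (mS Z A D z) (mS Z A D z')) (mB Z A D d) (?cB (dg Z z z')
 (Ph ?T (mA Z A B a) (mB Z A B b) (dg ?T (mS Z A B z) (mS Z A B z'))
 (Ph ?T (dg ?T (mA Z A B a) (mB Z A B b)) (mS Z A B z) (mS Z A B z') t))))))"
 by (rule maclane_hex[where kAd = ?kA2])
 (simp_all add: kA kB kA2 chat_extL_eqv chat_extR_eqv chat_ext_cm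
 hexagonD[OF hex_ext(1)[OF _ _ _ _ _ _ _ _ _ _ _ _ hexA]] hexagonD[OF hex_ext(2)[OF _ _ _ _ _ _ _ _ _ _ _ _ hexB]])
 have tk: "chat Z (A><B) (htens A a A a GA B b B b GB) z t = tcomp Z A a A a GA B b B b GB z t"
 by (rule quasi_hopf_algebra.chat_htens[OF quasi_hopf_algebra_axioms mods(1,2,1,2) acts(1,2,1,2) GA GB]) simp_all
 show "chat Z (C><D) (htens A a C c gA B b D d gB) z'
 (Ph ?T (mS Z A B z) (Rg Z (A><B) (dact A a B b)) (mS Z A B z') (chat Z (A><B) (htens A a A a GA B b B b GB) z t))
 = Ph ?T3 (mS Z C D z) (mS Z C D z') (Rg Z (C><D) (dact C c D d))
 (chat Z (C><D) (htens A a C c gA B b D d gB) (dg Z z z')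
 (Ph ?T (Rg Z (A><B) (dact A a B b)) (mS Z A B z) (mS Z A B z') t))"
 unfolding tk rA'
 using m by (simp add: chat_htens tcomp_def rA rC dz dz1 dz3 cA cB kcl)
qed

end

end

context quasi_hopf_algebra
begin

section \<open>Colinearity\<close>

lemma thetahat_eqv_l:
 assumes [simp]: "md K Z" "md K V" "lact V b" "lact Z z" and rh: "lact Z rh" "com Z rh z"
 shows "eqv (Z><(H><V)) (Z><V) (thetahat Z V b z) (Lg Z (H><V) rh) (Lg Z V rh)"
 unfolding eqv_def legL_def
proof (intro ballI)
 fix h t assume h: "h<:H" and t: "t<:(Z><(H><V))"
 show "thetahat Z V b z (tmL Z (H><V) (rh h) t) = tmL Z V (rh h) (thetahat Z V b z t)"
 by (rule thetahat_nat_l[symmetric]) (simp_all add: rh h t eqv_def commutingD[OF rh(2)])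
qed

lemma ract_nat:
 assumes [simp]: "md K V" "md K V'" "lact V b" "lact V' b'" "k : Lin K V V'"
 and i: "eqv V V' k b b'"
 shows "eqv (H><V) (H><V') (tmR H V' k) (ract V b) (ract V' b')"
 unfolding ract_def by (intro eqv_diag) (simp_all add: ten_map_eqv i)

definition asc where
 "asc V t = sw (H><(H><V)) t (%y v. ins V v y)"

context
 fixes V
 assumes V [simp]: "md K V"
begin

lemma asc_bil: "bilin K HH V (H><(H><V)) (%y v. ins V v y)"
 by (rule bil_flip[OF ins_bil]) simp

lemma asc_lin [simp]: "asc V : Lin K (HH><V) (H><(H><V))"
 using sw_lin[OF mod_H2 V _ asc_bil] by (simp add: asc_def[abs_def])

lemma asc_pure [simp]: "[|y<:HH; v<:V|] ==> asc V (pt HH V y v) = ins V v y"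
 using sw_pure[OF mod_H2 V _ asc_bil] by (simp add: asc_def)

lemma asc_ins:
 assumes [simp]: "x<:H" and r: "r<:(H><V)"
 shows "asc V (tmL HH V (t2 K H x) r) = pt H (H><V) x r"
 by (rule ext_pure[OF mod_H V _ linc[OF tm_simps(1) asc_lin] lin_pure(1) r])
 (simp_all add: lin_t2)

end

text \<open>Adds \<beta> as a second component next to the factor \<open>H\<close>, hence a
  coevaluation for the legs \<open>lm2\<close> and \<open>rm2\<close>.\<close>

abbreviation "ib U \<equiv> tmL HH U (%x. t2 K H x (qbeta H))"

lemma ib_eqv:
 assumes [simp]: "md K U"
 shows "eqv (H><U) (HH><U) (ib U) (Lg H U L) (Lg HH U lm1)"
 and "lact U rh ==> eqv (H><U) (HH><U) (ib U) (Rg H U rh) (Rg HH U rh)"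
 by (intro ten_map_eqv; simp add: lin_t2 eqv_def lmul_apply)+

lemma ib_invariant:
 assumes [simp]: "md K U" and q: "q<:(H><U)"
 shows "eq_at (ib U q) (dg (HH><U) (Lg HH U lm2) (Lg HH U rm2)) (triv (HH><U))"
 unfolding eq_at_def
proof
 fix h assume [simp]: "h<:H"
 have l: "lact (HH><U) (dg (HH><U) (Lg HH U lm2) (Lg HH U rm2))" by simp
 have ib [simp]: "ib U : Lin K (H><U) (HH><U)"
 by (simp add: lin_t2)
 show "dg (HH><U) (Lg HH U lm2) (Lg HH U rm2) h (ib U q) = triv (HH><U) h (ib U q)"
 proof (rule ext_pure[OF mod_H assms(1) _ linc[OF ib action_linear[OF l]]
 linc[OF ib action_linear[OF lact_triv]] q])
 fix x w assume [simp]: "x<:H" "w<:U"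
 have "dg HH lm2 rm2 h (t2 K H x (qbeta H)) = sw HH (comul H h) (%p q. t2 K H x (p##qbeta H##S q))"
 unfolding diag_sw[OF mod_H2]
 by (rule sw_cong[OF mod_H mod_H]) (simp_all add: lmul_apply rmul_apply H.m_assoc)
 also have "... = t2 K H x (sw H (comul H h) (%p q. p##qbeta H##S q))"
 by (rule sw_lin_im[OF mod_H mod_H lin_t2(1), symmetric]) simp_all
 finally show "dg (HH><U) (Lg HH U lm2) (Lg HH U rm2) h (ib U (pt H U x w))
 = triv (HH><U) h (ib U (pt H U x w))"
 by (simp add: lin_t2 diag_legL_pure antipode_beta triv_def linear_maps_smult[OF lin_t2(1)]
 linear_maps_smult[OF lin_pure(2)])
 qed simp_all
qed

lemma lm_rm_com [simp]: "com HH lm1 rm2" "com HH rm2 lm1" "com HH lm2 rm1" "com HH rm1 lm2"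
 by (simp_all add: commuting_def lmul_def rmul_def H2.m_assoc)

context
 fixes V and b
 assumes V [simp]: "md K V" and b [simp]: "lact V b"
begin

text \<open>This is \<open>second_theta\<close> carried out in the second copy of \<open>H\<close>,
  while the first copy is passive.\<close>

lemma thetahat_ib:
 assumes q: "q<:(H><(H><V))"
 shows "asc V (thetahat HH V b lm2 (Phi (HH><(H><V)) (Rg HH (H><V) (ract V b)) (Lg HH (H><V) lm2)
 (Lg HH (H><V) rm2) (ib (H><V) q))) = q"
proof -
 let ?RV = "H><V"
 let ?U = "HH><?RV"
 have ib [simp]: "ib ?RV : Lin K (H><?RV) ?U"
 by (simp add: lin_t2)
 show ?thesis
 proof (rule ext_pure[OF mod_H _ _ _ lin_mp_id q])
 show "(%q. asc V (thetahat HH V b lm2 (Phi ?U (Rg HH ?RV (ract V b)) (Lg HH ?RV lm2) (Lg HH ?RV rm2) (ib ?RV q))))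
 : Lin K (H><?RV) (H><?RV)"
 by (rule linc[OF linc[OF linc[OF ib op3_lin] thetahat_lin] asc_lin]) simp_all
 fix x r assume [simp]: "x<:H" "r<:?RV"
 let ?f = "t2 K H x"
 have f [simp]: "?f : Lin K H HH" by (simp add: lin_t2)
 have i: "eqv H HH ?f L lm2" "eqv H HH ?f R rm2"
 by (simp_all add: eqv_def lmul_apply rmul_apply)
 let ?y = "Phi (H><?RV) (Rg H ?RV (ract V b)) (Lg H ?RV L) (Lg H ?RV R) (pt H ?RV (qbeta H) r)"
 have "ib ?RV (pt H ?RV x r) = tmL HH ?RV ?f (pt H ?RV (qbeta H) r)"
 by (simp add: lin_t2)
 moreover have "Phi ?U (Rg HH ?RV (ract V b)) (Lg HH ?RV lm2) (Lg HH ?RV rm2) (tmL HH ?RV ?f (pt H ?RV (qbeta H) r))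
 = tmL HH ?RV ?f ?y"
 by (rule op3_nat[symmetric]) (simp_all add: ten_map_eqv i)
 moreover have "thetahat HH V b lm2 (tmL HH ?RV ?f ?y) = tmL HH V ?f (thetahat H V b L ?y)"
 by (rule thetahat_nat_l[symmetric]) (simp_all add: i)
 moreover have "thetahat H V b L ?y = r"
 using second_theta[OF V b, of r] by (simp add: second_def chat_theta)
 ultimately show "asc V (thetahat HH V b lm2 (Phi ?U (Rg HH ?RV (ract V b)) (Lg HH ?RV lm2) (Lg HH ?RV rm2)
 (ib ?RV (pt H ?RV x r)))) = pt H ?RV x r"
 by (simp only: asc_ins[OF V] \<open>x<:H\<close> \<open>r<:?RV\<close>)
 qed simp_all
qed

context
 fixes W and a
 assumes W [simp]: "md K W" and a [simp]: "lact W a"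
begin

text \<open>A morphism \<open>j\<close> from \<open>W\<close> to \<open>R(R(V))\<close> is determined by the action of \<open>W\<close> on two factors that it induces.\<close>

definition two_fold where
 "two_fold Z z z' j t = thetahat Z V b z' (Ph (Z><(H><V)) (Lg Z (H><V) z) (Rg Z (H><V) (ract V b))
 (Lg Z (H><V) z') (thetahat Z (H><V) (ract V b) z (tmR Z (H><(H><V)) j t)))"

text \<open>By \<open>thetahat_ib\<close> the value of the first universal map is recovered from a
  second one. The \<beta> inserted for this can be moved ahead of the first universal map, and the
  two maps then form \<open>two_fold\<close>.\<close>

lemma two_fold_det:
 assumes j [simp]: "j : Lin K W (H><(H><V))"
 and i: "eqv W (H><(H><V)) j a (ract (H><V) (ract V b))"
 and t0 [simp]: "t0<:(H><W)"
 shows "thetahat H (H><V) (ract V b) L (tmR H (H><(H><V)) j t0)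
 = asc V (Ph (HH><V) (Lg HH V lm1) (dg (HH><V) (Lg HH V lm2) (Rg HH V b)) (Lg HH V rm2)
 (two_fold HH lm1 lm2 j (Phi (HH><W) (dg (HH><W) (Rg HH W a) (Lg HH W lm1)) (Lg HH W lm2) (Lg HH W rm2) (ib W t0))))"
proof -
 let ?RV = "H><V" and ?RRV = "H><(H><V)" and ?U = "HH><(H><V)" and ?X = "HH><V"
 let ?v = "Rg HH ?RV (ract V b)" and ?z = "Lg HH ?RV lm1" and ?l = "Lg HH ?RV lm2" and ?r = "Lg HH ?RV rm2"
 define q where "q = thetahat H ?RV (ract V b) L (tmR H ?RRV j t0)"
 have jt [simp]: "tmR H ?RRV j t0<:(H><?RRV)"
 by (rule lcl[OF tm_simps(1) t0]) simp_all
 have q [simp]: "q<:(H><?RV)"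
 unfolding q_def by (rule thetahat_cl) simp_all
 have ibl: "ib E : Lin K (H><E) (HH><E)" if "md K E" for E :: "('k, 'w, 'l) module_scheme"
 using that by (simp add: lin_t2)
 have ibq [simp]: "ib ?RV q<:?U"
 by (rule lcl[OF tm_simps(1) q]) (simp_all add: lin_t2)
 have ibt [simp]: "ib W t0<:(HH><W)"
 by (rule lcl[OF ibl t0]) simp
 let ?t' = "Phi ?U (dg ?U ?z ?v) ?l ?r (ib ?RV q)"
 let ?s = "Phi (HH><W) (dg (HH><W) (Rg HH W a) (Lg HH W lm1)) (Lg HH W lm2) (Lg HH W rm2) (ib W t0)"
 have js [simp]: "tmR HH ?RRV j t<:(HH><?RRV)" if "t<:(HH><W)" for t
 by (rule lcl[OF tm_simps(1) that]) simp_all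
 have t': "?t' = thetahat HH ?RV (ract V b) lm1 (tmR HH ?RRV j ?s)"
 proof -
 have "ib ?RV q = thetahat HH ?RV (ract V b) lm1 (ib ?RRV (tmR H ?RRV j t0))"
 unfolding q_def by (rule thetahat_nat_l) (simp_all add: lin_t2 eqv_def lmul_apply)
 moreover have "ib ?RRV (tmR H ?RRV j t0) = tmR HH ?RRV j (ib W t0)"
 by (rule ext_pure[OF mod_H W _ linc[OF tm_simps(1) tm_simps(1)]
 linc[OF tm_simps(1) tm_simps(1)] t0])
 (simp_all add: lin_t2 lcl[OF j])
 moreover have "Phi ?U (dg ?U ?z ?v) ?l ?r (thetahat HH ?RV (ract V b) lm1 (tmR HH ?RRV j (ib W t0)))
 = thetahat HH ?RV (ract V b) lm1 (Phi (HH><?RRV) (dg (HH><?RRV) (Rg HH ?RRV (ract ?RV (ract V b))) (Lg HH ?RRV lm1))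
 (Lg HH ?RRV lm2) (Lg HH ?RRV rm2) (tmR HH ?RRV j (ib W t0)))"
 by (rule op3_nat[symmetric]) (simp_all add: thetahat_eqv thetahat_eqv_l)
 moreover have "Phi (HH><?RRV) (dg (HH><?RRV) (Rg HH ?RRV (ract ?RV (ract V b))) (Lg HH ?RRV lm1))
 (Lg HH ?RRV lm2) (Lg HH ?RRV rm2) (tmR HH ?RRV j (ib W t0)) = tmR HH ?RRV j ?s"
 by (rule op3_nat[symmetric]) (simp_all add: ten_map_eqv i eqv_diag)
 ultimately show ?thesis by (simp only:)
 qed
 \<comment> \<open>The inserted \<beta> is a coevaluation for \<open>?l ?r\<close>, so
   \<open>coev_shift_r\<close> brings in the spectator \<open>?z\<close>, which is the leg of the
   first universal map.\<close>
 have "Phi ?U ?v ?l ?r (ib ?RV q) = Ph ?U ?z (dg ?U ?v ?l) ?r (Ph ?U ?z ?v ?l ?t')"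
 proof -
 have "Ph ?U ?z ?v ?l ?t' = Phi ?U ?z (dg ?U ?v ?l) ?r (Phi ?U ?v ?l ?r (ib ?RV q))"
 by (rule coev_shift_r[symmetric]) (simp_all add: ib_invariant)
 then show ?thesis by simp
 qed
 moreover have "thetahat HH V b lm2 (Ph ?U ?z (dg ?U ?v ?l) ?r (Ph ?U ?z ?v ?l ?t'))
 = Ph ?X (Lg HH V lm1) (dg ?X (Lg HH V lm2) (Rg HH V b)) (Lg HH V rm2) (thetahat HH V b lm2 (Ph ?U ?z ?v ?l ?t'))"
 by (rule op3_nat) (simp_all add: thetahat_eqv thetahat_eqv_l)
 moreover have "thetahat HH V b lm2 (Ph ?U ?z ?v ?l ?t') = two_fold HH lm1 lm2 j ?s"
 unfolding two_fold_def t' ..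
 ultimately show ?thesis
 using thetahat_ib[OF q] by (simp only: q_def)
qed

text \<open>Both sides are intertwiners from \<open>W\<close> to \<open>R(R(V))\<close>, and such a
  map is recovered from its \<open>two_fold\<close>. The two values agree in \<open>key\<close>: one
  is computed by the hexagon of the cofree object, the other by the hypothesis
  \<open>hex\<close>.\<close>

lemma colinear:
 assumes g: "first_kind W a V b g" and G: "first_kind W a W a G"
 and hex: "hexagon HH lm1 lm2 W a V b G g" and w [simp]: "w<:W"
 shows "nabla V b (second W a V g w) = tmR H (H><V) (second W a V g) (second W a W G w)"
proof -
 let ?RV = "H><V" and ?RRV = "H><(H><V)"
 define h2 where "h2 = second W a V g"
 define d2 where "d2 = second W a W G"
 have h2 [simp]: "h2 : Lin K W ?RV" and d2 [simp]: "d2 : Lin K W (H><W)"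
 unfolding h2_def d2_def by (simp_all add: second_lin[OF _ _ _ _ g] second_lin[OF _ _ _ _ G])
 have h2i: "eqv W ?RV h2 a (ract V b)" and d2i: "eqv W (H><W) d2 a (ract W a)"
 unfolding h2_def d2_def by (simp_all add: second_eqv[OF _ _ _ _ g] second_eqv[OF _ _ _ _ G])
 define j1 where "j1 w = nabla V b (h2 w)" for w
 define j2 where "j2 w = tmR H ?RV h2 (d2 w)" for w
 have th2 [simp]: "tmR H ?RV h2 : Lin K (H><W) ?RRV" by simp
 have j1 [simp]: "j1 : Lin K W ?RRV" and j2 [simp]: "j2 : Lin K W ?RRV"
 unfolding j1_def[abs_def] j2_def[abs_def]
 by (rule linc[OF h2 nabla_lin] linc[OF d2 th2]; simp)+
 have j1i: "eqv W ?RRV j1 a (ract ?RV (ract V b))"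
 unfolding j1_def[abs_def] by (rule eqv_comp[OF h2i nabla_eqv h2]) simp_all
 have j2i: "eqv W ?RRV j2 a (ract ?RV (ract V b))"
 unfolding j2_def[abs_def] by (rule eqv_comp[OF d2i ract_nat d2]) (simp_all add: h2i)
 note [simp] = fst1_k_lin[OF g] fst1_k_lin[OF G]
 have D2: "thetahat HH V b z (tmR HH ?RV h2 t) = chat HH V g z t" if "lact HH z" and t: "t<:(HH><W)" for z t
 by (rule ext_pure[OF mod_H2 W _ linc[OF tm_simps(1) thetahat_lin] chat_lin t])
 (simp_all add: that(1) h2_def[symmetric] thetahat_second[OF _ _ _ _ g, unfolded h2_def[symmetric]] del: chat_pure)
 have D2': "thetahat HH W a z (tmR HH (H><W) d2 t) = chat HH W G z t" if "lact HH z" and t: "t<:(HH><W)" for z t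
 by (rule ext_pure[OF mod_H2 W _ linc[OF tm_simps(1) thetahat_lin] chat_lin t])
 (simp_all add: that(1) thetahat_second[OF _ _ _ _ G, unfolded d2_def[symmetric]] del: chat_pure)
 have th [simp]: "tmR HH ?RV h2 t<:(HH><?RV)" if "t<:(HH><W)" for t
 by (rule lcl[OF tm_simps(1) that]) simp_all
 have td [simp]: "tmR HH (H><W) d2 t<:(HH><(H><W))" if "t<:(HH><W)" for t
 by (rule lcl[OF tm_simps(1) that]) simp_all
 have hi: "eqv (HH><W) (HH><?RV) (tmR HH ?RV h2) (Rg HH W a) (Rg HH ?RV (ract V b))"
 "lact HH z ==> eqv (HH><W) (HH><?RV) (tmR HH ?RV h2) (Lg HH W z) (Lg HH ?RV z)" for z
 by (rule ten_map_eqv; simp add: h2i)+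
 have key: "two_fold HH lm1 lm2 j1 t = two_fold HH lm1 lm2 j2 t" if t [simp]: "t<:(HH><W)" for t
 proof -
 have "tmR HH ?RRV j1 t = tmR HH ?RRV (nabla V b) (tmR HH ?RV h2 t)"
 by (rule ext_pure[OF mod_H2 W _ tm_simps(1) linc[OF tm_simps(1) tm_simps(1)] t])
 (simp_all add: j1_def lcl[OF h2])
 moreover have "thetahat HH ?RV (ract V b) lm1 (tmR HH ?RRV (nabla V b) (tmR HH ?RV h2 t))
 = chat HH ?RV (%r. theta ?RV (ract V b) (nabla V b r)) lm1 (tmR HH ?RV h2 t)"
 by (rule chat_theta_comp[symmetric, where W = ?RV]) simp_all
 moreover have "Ph (HH><?RV) (Lg HH ?RV lm1) (Rg HH ?RV (ract V b)) (Lg HH ?RV lm2)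
 (chat HH ?RV (%r. theta ?RV (ract V b) (nabla V b r)) lm1 (tmR HH ?RV h2 t))<:(HH><?RV)"
 proof -
 have "chat HH ?RV (%r. theta ?RV (ract V b) (nabla V b r)) lm1 (tmR HH ?RV h2 t)<:(HH><?RV)"
 by (rule chat_cl[where W = ?RV]) (simp_all add: linc[OF nabla_lin theta_lin])
 then show ?thesis by simp
 qed
 ultimately have "two_fold HH lm1 lm2 j1 t = chat HH V (theta V b) lm2 (Ph (HH><?RV) (Lg HH ?RV lm1) (Rg HH ?RV (ract V b)) (Lg HH ?RV lm2)
 (chat HH ?RV (%r. theta ?RV (ract V b) (nabla V b r)) lm1 (tmR HH ?RV h2 t)))"
 by (simp add: two_fold_def chat_theta)
 also have "... = Ph (HH><V) (Lg HH V lm1) (Lg HH V lm2) (Rg HH V b) (chat HH V (theta V b) (dg HH lm1 lm2)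
 (Ph (HH><?RV) (Rg HH ?RV (ract V b)) (Lg HH ?RV lm1) (Lg HH ?RV lm2) (tmR HH ?RV h2 t)))"
 by (rule hexagonD[OF hex_cofree]) simp_all
 also have "Ph (HH><?RV) (Rg HH ?RV (ract V b)) (Lg HH ?RV lm1) (Lg HH ?RV lm2) (tmR HH ?RV h2 t)
 = tmR HH ?RV h2 (Ph (HH><W) (Rg HH W a) (Lg HH W lm1) (Lg HH W lm2) t)"
 by (rule op3_nat[symmetric]) (simp_all add: hi)
 also have "chat HH V (theta V b) (dg HH lm1 lm2) (tmR HH ?RV h2 (Ph (HH><W) (Rg HH W a) (Lg HH W lm1) (Lg HH W lm2) t))
 = chat HH V g (dg HH lm1 lm2) (Ph (HH><W) (Rg HH W a) (Lg HH W lm1) (Lg HH W lm2) t)"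
 by (simp add: chat_theta D2)
 also have "Ph (HH><V) (Lg HH V lm1) (Lg HH V lm2) (Rg HH V b) ... = chat HH V g lm2
 (Ph (HH><W) (Lg HH W lm1) (Rg HH W a) (Lg HH W lm2) (chat HH W G lm1 t))"
 by (rule hexagonD[OF hex t, symmetric])
 also have "... = two_fold HH lm1 lm2 j2 t"
 proof -
 have c [simp]: "chat HH W G lm1 t<:(HH><W)"
 by (rule chat_cl[where W = W]) simp_all
 have "tmR HH ?RRV j2 t = tmR HH ?RRV (tmR H ?RV h2) (tmR HH (H><W) d2 t)"
 by (rule ext_pure[OF mod_H2 W _ tm_simps(1) linc[OF tm_simps(1) tm_simps(1)] t])
 (simp_all add: j2_def lcl[OF d2])
 moreover have "thetahat HH ?RV (ract V b) lm1 (tmR HH ?RRV (tmR H ?RV h2) (tmR HH (H><W) d2 t))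
 = tmR HH ?RV h2 (thetahat HH W a lm1 (tmR HH (H><W) d2 t))"
 by (rule thetahat_nat_r[symmetric]) (simp_all add: h2i)
 moreover have "Ph (HH><?RV) (Lg HH ?RV lm1) (Rg HH ?RV (ract V b)) (Lg HH ?RV lm2) (tmR HH ?RV h2 (chat HH W G lm1 t))
 = tmR HH ?RV h2 (Ph (HH><W) (Lg HH W lm1) (Rg HH W a) (Lg HH W lm2) (chat HH W G lm1 t))"
 by (rule op3_nat[symmetric]) (simp_all add: hi)
 ultimately show ?thesis
 by (simp add: two_fold_def D2 D2')
 qed
 finally show ?thesis .
 qed
 let ?t = "Phi (H><W) (Rg H W a) (Lg H W L) (Lg H W R) (pt H W (qbeta H) w)"
 \<comment> \<open>Here \<open>second_theta\<close> is used for the object \<open>R(V)\<close>: a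
   vector of \<open>R(R(V))\<close> is recovered from its image under the universal map.\<close>
 have rec: "j w = thetahat H ?RV (ract V b) L (tmR H ?RRV j ?t)"
 if j [simp]: "j : Lin K W ?RRV" and i: "eqv W ?RRV j a (ract ?RV (ract V b))" for j
 proof -
 have jw [simp]: "j w<:?RRV"
 by (rule lcl[OF j]) simp
 have "tmR H ?RRV j ?t = Phi (H><?RRV) (Rg H ?RRV (ract ?RV (ract V b))) (Lg H ?RRV L) (Lg H ?RRV R) (tmR H ?RRV j (pt H W (qbeta H) w))"
 by (rule op3_nat) (simp_all add: ten_map_eqv i)
 then show ?thesis
 using second_theta[of ?RV "ract V b" "j w"] by (simp add: second_def chat_theta)
 qed
 have "ib W ?t<:(HH><W)"
 by (rule lcl[OF tm_simps(1)[where V = H and W = W]]) (simp_all add: lin_t2)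
 then have "j1 w = j2 w"
 unfolding rec[OF j1 j1i] rec[OF j2 j2i]
 by (subst (1 2) two_fold_det) (simp_all add: j1i j2i key)
 then show ?thesis
 by (simp add: j1_def j2_def h2_def d2_def)
qed

end

end

end

context quasi_hopf_algebra
begin

section \<open>Naturality\<close>

lemma ten_map_id [simp]:
 assumes "md K E" "md K F" and x: "x<:(E><F)"
 shows "tm K E F (%x. x) (%x. x) x = x"
 by (rule ext_pure[OF assms(1,2) _ _ lin_mp_id x]) (simp_all add: assms)

lemma chat_comp:
 assumes [simp]: "md K Z" "md K V" "md K W" "md K W'" "lact Z z"
 "g : Lin K W' (H><V)" and l [simp]: "l : Lin K W W'" and t: "t<:(Z><W)"
 shows "chat Z V (%w. g (l w)) z t = chat Z V g z (tmR Z W' l t)"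
proof (rule ext_pure[OF assms(1,3) _ chat_lin linc[OF tm_simps(1) chat_lin] t])
 show "(%w. g (l w)) : Lin K W (H><V)"
 by (rule linc[OF l]) simp
 then show "chat Z V (%w. g (l w)) z (pt Z W s w) = chat Z V g z (tmR Z W' l (pt Z W s w))"
 if "s<:Z" "w<:W" for s w
 using that by (simp add: lcl[OF l])
qed simp_all

lemma fst1_k_comp:
 assumes [simp]: "md K V" "md K W" "md K W'" "lact W a" "lact W' a'" and g: "first_kind W' a' V b g"
 and l [simp]: "l : Lin K W W'" and i: "eqv W W' l a a'"
 shows "first_kind W a V b (%w. g (l w))"
 unfolding first_kind_def
proof (intro conjI ballI)
 note [simp] = fst1_k_lin[OF g] lcl[OF l]
 show "(%w. g (l w)) : Lin K W (H><V)"
 by (rule linc[OF l]) simp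
 fix h w assume [simp]: "h<:H" "w<:W"
 let ?D = "dg (H><W) (Rg H W a) (Lg H W L)" and ?D' = "dg (H><W') (Rg H W' a') (Lg H W' L)"
 have "eqv (H><W) (H><W') (tmR H W' l) ?D ?D'"
 by (rule eqv_diag) (simp_all add: ten_map_eqv i)
 then have "tmR H W' l (?D h (pt H W 1[H] w)) = ?D' h (pt H W' 1[H] (l w))"
 by (simp add: eqv_def)
 moreover have "chat H V (%w. g (l w)) L (?D h (pt H W 1[H] w)) = chat H V g L (tmR H W' l (?D h (pt H W 1[H] w)))"
 by (rule chat_comp[where W = W]) simp_all
 ultimately show "chat H V (%w. g (l w)) L (?D h (pt H W 1[H] w)) = dg (H><V) (Lg H V L) (Rg H V b) h (g (l w))"
 using g by (simp add: first_kind_def)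
qed

lemma second_nat:
 assumes [simp]: "md K V" "md K W" "md K W'" "md K V'" "lact W a" "lact W' a'"
 and g [simp]: "g : Lin K W (H><V)" and g' [simp]: "g' : Lin K W' (H><V')"
 and k [simp]: "k : Lin K W W'" and l [simp]: "l : Lin K V V'"
 and i: "eqv W W' k a a'" and eq: "!!w. w<:W ==> g' (k w) = tmR H V' l (g w)"
 and w [simp]: "w<:W"
 shows "second W' a' V' g' (k w) = tmR H V' l (second W a V g w)"
proof -
 let ?t = "Phi (H><W) (Rg H W a) (Lg H W L) (Lg H W R) (pt H W (qbeta H) w)"
 have "pt H W' (qbeta H) (k w) = tmR H W' k (pt H W (qbeta H) w)"
 by simp
 moreover have "Phi (H><W') (Rg H W' a') (Lg H W' L) (Lg H W' R) (tmR H W' k (pt H W (qbeta H) w)) = tmR H W' k ?t"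
 by (rule op3_nat[symmetric]) (simp_all add: ten_map_eqv i)
 moreover have "chat H V' g' L (tmR H W' k ?t) = tmR H V' l (chat H V g L ?t)"
 by (rule chat_nat_r[where W = W, symmetric]) (simp_all add: eq)
 ultimately show ?thesis
 by (simp only: second_def)
qed

lemma ten_map_state_eqv:
 assumes [simp]: "md K Z" "md K A" "md K B" "md K C" "md K D" "lact Z z" "lact A a" "lact B b"
 "lact C c" "lact D d" "k : Lin K A C" "l : Lin K B D"
 and i: "eqv A C k a c" "eqv B D l b d"
 shows "eqv (Z><(A><B)) (Z><(C><D)) (tmR Z (C><D) (tm K C D k l)) (mS Z A B z) (mS Z C D z)"
 and "eqv (Z><(A><B)) (Z><(C><D)) (tmR Z (C><D) (tm K C D k l)) (mA Z A B a) (mA Z C D c)"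
 and "eqv (Z><(A><B)) (Z><(C><D)) (tmR Z (C><D) (tm K C D k l)) (mB Z A B b) (mB Z C D d)"
 by (simp_all add: ten_map_eqv i)

lemma ext_nat:
 assumes [simp]: "md K A" "md K E" "md K C" "md K A2" "md K C2" "md K E2"
 and g [simp]: "g : Lin K A (H><C)" "g2 : Lin K A2 (H><C2)"
 and k [simp]: "k : Lin K A A2" "l : Lin K C C2" "e : Lin K E E2"
 and eq: "!!x. x<:A ==> g2 (k x) = tmR H C2 l (g x)"
 shows "t<:(A><E) ==> extL C2 E2 g2 (tm K A2 E2 k e t) = tmR H (C2><E2) (tm K C2 E2 l e) (extL C E g t)"
 and "s<:(E><A) ==> extR E2 C2 g2 (tm K E2 A2 e k s) = tmR H (E2><C2) (tm K E2 C2 e l) (extR E C g s)"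
proof -
 note [simp] = lcl[OF k(1)] lcl[OF k(2)] lcl[OF k(3)]
 have gx: "g x<:(H><C)" if "x<:A" for x
 by (rule lcl[OF g(1) that])
 show "extL C2 E2 g2 (tm K A2 E2 k e t) = tmR H (C2><E2) (tm K C2 E2 l e) (extL C E g t)"
 if t: "t<:(A><E)"
 proof (rule ext_pure[OF assms(1,2) _ linc[OF tm_simps(1) extL_lin]
 linc[OF extL_lin tm_simps(1)] t])
 fix x y assume [simp]: "x<:A" "y<:E"
 have "tmR H (C2><E2) (%v. pt C2 E2 v (e y)) (tmR H C2 l r)
 = tmR H (C2><E2) (tm K C2 E2 l e) (tmR H (C><E) (%v. pt C E v y) r)" if r: "r<:(H><C)" for r
 by (rule ext_pure[OF mod_H assms(3) _ linc[OF tm_simps(1) tm_simps(1)]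
 linc[OF tm_simps(1) tm_simps(1)] r]) (simp_all add: lin_pure)
 then show "extL C2 E2 g2 (tm K A2 E2 k e (pt A E x y)) = tmR H (C2><E2) (tm K C2 E2 l e) (extL C E g (pt A E x y))"
 by (simp add: extL_pure[where A = A2] extL_pure[where A = A] eq gx)
 qed simp_all
 show "extR E2 C2 g2 (tm K E2 A2 e k s) = tmR H (E2><C2) (tm K E2 C2 e l) (extR E C g s)"
 if s: "s<:(E><A)"
 proof (rule ext_pure[OF assms(2,1) _ linc[OF tm_simps(1) extR_lin]
 linc[OF extR_lin tm_simps(1)] s])
 fix y x assume [simp]: "x<:A" "y<:E"
 have "tmR H (E2><C2) (pt E2 C2 (e y)) (tmR H C2 l r)
 = tmR H (E2><C2) (tm K E2 C2 e l) (tmR H (E><C) (pt E C y) r)" if r: "r<:(H><C)" for r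
 by (rule ext_pure[OF mod_H assms(3) _ linc[OF tm_simps(1) tm_simps(1)]
 linc[OF tm_simps(1) tm_simps(1)] r]) (simp_all add: lin_pure)
 then show "extR E2 C2 g2 (tm K E2 A2 e k (pt E A y x)) = tmR H (E2><C2) (tm K E2 C2 e l) (extR E C g (pt E A y x))"
 by (simp add: extR_pure[where A = A2] extR_pure[where A = A] eq gx)
 qed simp_all
qed

lemma htens_nat:
 assumes m [simp]: "md K A" "md K B" "md K C" "md K D" "md K A2" "md K B2" "md K C2" "md K D2"
 and [simp]: "lact A a" "lact B b" "lact C c" "lact D d" "lact A2 a2" "lact B2 b2" "lact C2 c2'" "lact D2 d2"
 and gA: "first_kind A a C c gA" and gB: "first_kind B b D d gB"
 and gA2: "first_kind A2 a2 C2 c2' gA2" and gB2: "first_kind B2 b2 D2 d2 gB2"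
 and k [simp]: "kA : Lin K A A2" "kB : Lin K B B2" "lC : Lin K C C2" "lD : Lin K D D2"
 and i: "eqv A A2 kA a a2" "eqv B B2 kB b b2" "eqv C C2 lC c c2'" "eqv D D2 lD d d2"
 and eqA: "!!x. x<:A ==> gA2 (kA x) = tmR H C2 lC (gA x)"
 and eqB: "!!x. x<:B ==> gB2 (kB x) = tmR H D2 lD (gB x)" and t [simp]: "t<:(A><B)"
 shows "htens A2 a2 C2 c2' gA2 B2 b2 D2 d2 gB2 (tm K A2 B2 kA kB t)
 = tmR H (C2><D2) (tm K C2 D2 lC lD) (htens A a C c gA B b D d gB t)"
proof -
 note [simp] = fst1_k_lin[OF gA] fst1_k_lin[OF gB] fst1_k_lin[OF gA2] fst1_k_lin[OF gB2]
 let ?m1 = "tmR H (A2><B2) (tm K A2 B2 kA kB)" and ?m2 = "tmR H (A2><D2) (tm K A2 D2 kA lD)"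
 and ?m3 = "tmR H (C2><D2) (tm K C2 D2 lC lD)"
 define x0 where "x0 = pt H (A><B) 1[H] t"
 define x1 where "x1 = Ph (H><(A><B)) (mA H A B a) (mB H A B b) (mS H A B L) x0"
 define x2 where "x2 = chat H (A><D) (extR A D gB) L x1"
 define x3 where "x3 = Phi (H><(A><D)) (mA H A D a) (mS H A D L) (mB H A D d) x2"
 define x4 where "x4 = chat H (C><D) (extL C D gA) L x3"
 have cl0 [simp]: "x0<:(H><(A><B))" and cl1 [simp]: "x1<:(H><(A><B))"
 by (simp_all add: x0_def x1_def)
 have cl2 [simp]: "x2<:(H><(A><D))"
 unfolding x2_def by (rule chat_cl[OF _ _ _ _ _ cl1]) simp_all
 have cl3 [simp]: "x3<:(H><(A><D))" by (simp add: x3_def)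
 have cl4 [simp]: "x4<:(H><(C><D))"
 unfolding x4_def by (rule chat_cl[OF _ _ _ _ _ cl3]) simp_all
 have "pt H (A2><B2) 1[H] (tm K A2 B2 kA kB t) = ?m1 x0"
 by (simp add: x0_def)
 moreover have "?m1 x1 = Ph (H><(A2><B2)) (mA H A2 B2 a2) (mB H A2 B2 b2) (mS H A2 B2 L) (?m1 x0)"
 unfolding x1_def
 by (rule op3_nat)
 (simp_all add: ten_map_state_eqv[where z = L and a = a and b = b and c = a2 and d = b2] i)
 moreover have "?m2 x2 = chat H (A2><D2) (extR A2 D2 gB2) L (?m1 x1)"
 unfolding x2_def
 by (rule chat_nat_r[where W = "A><B"]) (simp_all add: ext_nat(2)[where A = B and C = D and E = A and g = gB and l = lD] eqB)
 moreover have "?m2 x3 = Phi (H><(A2><D2)) (mA H A2 D2 a2) (mS H A2 D2 L) (mB H A2 D2 d2) (?m2 x2)"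
 unfolding x3_def
 by (rule op3_nat)
 (simp_all add: ten_map_state_eqv[where z = L and a = a and b = d and c = a2 and d = d2] i)
 moreover have "?m3 x4 = chat H (C2><D2) (extL C2 D2 gA2) L (?m2 x3)"
 unfolding x4_def
 by (rule chat_nat_r[where W = "A><D"]) (simp_all add: ext_nat(1)[where A = A and C = C and E = D and g = gA and l = lC] eqA)
 moreover have "?m3 (Ph (H><(C><D)) (mS H C D L) (mA H C D c) (mB H C D d) x4)
 = Ph (H><(C2><D2)) (mS H C2 D2 L) (mA H C2 D2 c2') (mB H C2 D2 d2) (?m3 x4)"
 by (rule op3_nat)
 (simp_all add: ten_map_state_eqv[where z = L and a = c and b = d and c = c2' and d = d2] i)
 ultimately show ?thesis
 by (simp only: htens_def tcomp_def x0_def[symmetric] x1_def[symmetric] x2_def[symmetric] x3_def[symmetric] x4_def[symmetric])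
qed

section \<open>The braiding of a comodule is invertible\<close>

definition mua where
 "mua y = sw H y (%s x. s##qalpha H##x)"

lemma mua_bil: "bilin K H H H (%s x. s##qalpha H##x)"
 by (rule bil_comp_args[OF alg_mult_bil[OF alg_H] H_mult_lin(1) lin_mp_id]) simp

lemma mua_lin [simp]: "mua : Lin K HH H"
 using sw_lin[OF mod_H mod_H mod_H mua_bil] by (simp add: mua_def[abs_def])

lemma mua_cl [simp]: "y<:HH ==> mua y<:H"
 by (rule lcl[OF mua_lin])

lemma mua_pure [simp]: "[|s<:H; x<:H|] ==> mua (t2 K H s x) = s##qalpha H##x"
 using sw_pure[OF mod_H mod_H mod_H mua_bil] by (simp add: mua_def)

lemma mua_eqv:
 shows "eqv HH H mua rm2 R" and "eqv HH H mua lm1 L"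
 and "eqv HH H mua (dg HH rm1 lm2) (triv H)"
proof -
 show "eqv HH H mua rm2 R" "eqv HH H mua lm1 L"
 by (rule eqv_pure; simp add: rmul_apply lmul_apply H.m_assoc)+
 show "eqv HH H mua (dg HH rm1 lm2) (triv H)"
 proof (rule eqv_pure)
 fix h s x assume [simp]: "h<:H" "s<:H" "x<:H"
 have "mua (dg HH rm1 lm2 h (t2 K H s x)) = sw H (comul H h) (%p q. mua (rm1 p (lm2 q (t2 K H s x))))"
 by (rule un_triv_diag_aux) simp_all
 also have "... = s##sw H (comul H h) (%p q. S p##qalpha H##q)##x"
 by (rule sw_H_lin[where u = "%y. s##y##x", OF linc[OF H_mult_lin(2) H_mult_lin(1)]])
 (simp_all add: rmul_apply lmul_apply H.m_assoc)
 finally show "mua (dg HH rm1 lm2 h (t2 K H s x)) = triv H h (mua (t2 K H s x))"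
 by (simp add: antipode_alpha triv_def H.smult_mult_left H.smult_mult_right)
 qed simp_all
qed

text \<open>Coevaluation followed by the half-braiding. On a pure tensor it places the second kind
  coaction of the vector of \<open>M\<close> next to the passive first component; see
  \<open>coins_pure\<close>.\<close>

definition coins where
 "coins M a d t = chat HH M (%m. theta M a (d m)) lm2
 (Phi (HH><M) (Rg HH M a) (Lg HH M lm2) (Lg HH M rm2) (ib M t))"

text \<open>The usual inverse of a half-braiding with a dual object: coevaluate, braid with the
  object itself (\<open>lm2\<close>), and evaluate \<open>rm1\<close> against \<open>lm2\<close>. It
  inverts the braiding with \<open>R\<close>, the dual of the regular module.\<close>

definition cinv where
 "cinv M a d t = tmL H M mua (Phi (HH><M) (Lg HH M rm1) (Lg HH M lm2) (Rg HH M a)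
 (Phi (HH><M) (Lg HH M rm1) (dg (HH><M) (Lg HH M lm2) (Rg HH M a)) (Lg HH M rm2) (coins M a d t)))"

context
 fixes M and a and d
 assumes M [simp]: "md K M" and a [simp]: "lact M a" and d [simp]: "d : Lin K M (H><M)"
 and da: "eqv M (H><M) d a (ract M a)"
 and coassoc: "!!m. m<:M ==> nabla M a (d m) = tmR H (H><M) d (d m)"
 and counit: "!!m. m<:M ==> cou M (d m) = m"
begin

abbreviation (input) "dl \<equiv> %m. theta M a (d m)"
abbreviation (input) "HM \<equiv> HH><M"
abbreviation (input) "cP \<equiv> Lg HH M rm1"
abbreviation (input) "cL \<equiv> Lg HH M lm2"
abbreviation (input) "cR \<equiv> Lg HH M rm2"
abbreviation (input) "cM \<equiv> Rg HH M a"
abbreviation (input) "u0 \<equiv> tmL H M mua"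

lemma dl_fst1_k: "first_kind M a M a dl"
 by (rule fst1_k_comp[OF _ _ _ _ _ theta_fst1_k d da]) simp_all

lemma dl_lin [simp]: "dl : Lin K M (H><M)"
 by (rule fst1_k_lin[OF dl_fst1_k])

lemma dl_cl [simp]: "m<:M ==> theta M a (d m)<:(H><M)"
 by (rule lcl[OF dl_lin])

lemma dl_eps: "m<:M ==> cou M (theta M a (d m)) = m"
 by (simp add: cou_theta lcl[OF d] counit)

lemma dl_hex:
 "[|module K Z; lact Z z; lact Z z'; com Z z z'; com Z z' z|] ==> hexagon Z z z' M a M a dl dl"
 by (rule hex_coaction) (simp_all add: da coassoc)

lemma second_dl: "m<:M ==> second M a M dl m = d m"
proof -
 assume m [simp]: "m<:M"
 have dm: "d m<:(H><M)" by (rule lcl[OF d m])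
 have cl: "second M a M dl m<:(H><M)"
 by (rule lcl[OF second_lin[OF _ _ _ _ dl_fst1_k]]) simp_all
 have "second (H><M) (ract M a) M (theta M a) (d m) = tmR H M (%v. v) (second M a M dl m)"
 proof (rule second_nat)
 show "theta M a (d m) = tmR H M (%v. v) (theta M a (d m))" if "m<:M" for m
 using that by simp
 qed (simp_all add: da)
 then show ?thesis
 by (simp add: second_theta dm cl)
qed

text \<open>Braiding with the unit object is trivial by the counit axiom, and only the orbit of
  \<open>s\<close> enters.\<close>

lemma chat_dl_eps:
 assumes "md K Z" "lact Z z" "m<:M" and s: "s<:Z" "!!h. h<:H ==> z h s = triv Z h s"
 shows "chat Z M dl z (pt Z M s m) = pt Z M s m"
proof -
 have lin: "(%h. z h s) : Lin K H Z"
 by (rule lact_orbit_lin) (simp_all add: assms)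
 have "tmL Z M (%h. z h s) r = pt Z M s (cou M r)" if r: "r<:(H><M)" for r
 by (rule ext_pure[OF mod_H M _ tm_simps(1) linc[OF cou_lin lin_pure(1)] r])
 (simp_all add: assms lin triv_def linear_maps_smult[OF lin_pure(1)] linear_maps_smult[OF lin_pure(2)])
 then show ?thesis
 using assms by (simp add: dl_eps)
qed

lemma ib_lin [simp]: "ib M : Lin K (H><M) HM"
 by (simp add: lin_t2)

lemma ib_cl [simp]: "t<:(H><M) ==> ib M t<:HM"
 by (rule lcl[OF ib_lin])

lemma coins_lin [simp]: "coins M a d : Lin K (H><M) HM"
 unfolding coins_def[abs_def] by (rule linc[OF linc[OF ib_lin op3_lin] chat_lin]) simp_all

lemma cinv_lin: "cinv M a d : Lin K (H><M) (H><M)"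
 unfolding cinv_def[abs_def]
 by (rule linc[OF linc[OF linc[OF coins_lin op3_lin] op3_lin] tm_simps(1)])
 simp_all

lemma coins_pure:
 assumes [simp]: "s<:H" "m<:M"
 shows "coins M a d (pt H M s m) = tmL HH M (t2 K H s) (d m)"
proof -
 let ?f = "t2 K H s"
 have f [simp]: "?f : Lin K H HH" by (simp add: lin_t2)
 have i: "eqv H HH ?f L lm2" "eqv H HH ?f R rm2"
 by (simp_all add: eqv_def lmul_apply rmul_apply)
 let ?t = "Phi (H><M) (Rg H M a) (Lg H M L) (Lg H M R) (pt H M (qbeta H) m)"
 have "ib M (pt H M s m) = tmL HH M ?f (pt H M (qbeta H) m)"
 by (simp add: lin_t2)
 moreover have "Phi HM cM cL cR (tmL HH M ?f (pt H M (qbeta H) m)) = tmL HH M ?f ?t"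
 by (rule op3_nat[symmetric]) (simp_all add: ten_map_eqv i)
 moreover have "chat HH M dl lm2 (tmL HH M ?f ?t) = tmL HH M ?f (chat H M dl L ?t)"
 by (rule chat_nat_l[symmetric]) (simp_all add: i)
 moreover have "chat H M dl L ?t = d m"
 using second_dl[of m] by (simp add: second_def)
 ultimately show ?thesis
 by (simp only: coins_def)
qed

lemma u0_lin [simp]: "u0 : Lin K HM (H><M)"
 by simp

lemma u0_co: "equ HM u0 (dg HM cP cL) (triv HM)"
proof -
 have "eqv HM (H><M) u0 (Lg HH M (dg HH rm1 lm2)) (Lg H M (triv H))"
 by (rule ten_map_eqv(1)) (simp_all add: mua_eqv)
 moreover have "Lg H M (triv H) h t = triv (H><M) h t" if "h<:H" and t: "t<:(H><M)" for h t
 by (rule ext_pure[OF mod_H M _ action_linear[OF lact_legL] action_linear[OF lact_triv] t])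
 (simp_all add: that triv_def linear_maps_smult[OF lin_pure(2)])
 moreover have "eqv HM (H><M) u0 (triv HM) (triv (H><M))"
 by (rule eqv_triv) simp
 moreover have "u0 t<:(H><M)" if "t<:HM" for t
 by (rule lcl[OF u0_lin that])
 ultimately show ?thesis
 by (simp add: equ_def eqv_def diag_legL)
qed

text \<open>A snake between the \<beta> of \<open>ib\<close> and the \<alpha> of \<open>mua\<close>,
  with \<open>M\<close> passive.\<close>

lemma u0_ib:
 assumes t: "t<:(H><M)"
 shows "u0 (Phi HM cP cL cR (ib M t)) = t"
proof (rule ext_pure[OF mod_H M _ linc[OF linc[OF ib_lin op3_lin] u0_lin] lin_mp_id t])
 fix s m assume [simp]: "s<:H" "m<:M"
 let ?t = "pt HH M (t2 K H s (qbeta H)) m"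
 have "u0 (Phi HM cP cL cR ?t) = sw3 (H><M) (reassoc_inv K H) (%p q r. u0 (cP p (cL q (cR r ?t))))"
 by (rule Ph_lin_im) simp_all
 also have "... = pt H M (s##sw3 H (reassoc_inv K H) (%p q r. S p##qalpha H##q##qbeta H##S r)) m"
 by (rule sw3_H_lin[where u = "%x. pt H M (s##x) m", OF linc[OF H_mult_lin(2) lin_pure(2)]])
 (simp_all add: lmul_apply rmul_apply H.m_assoc)
 finally show "u0 (Phi HM cP cL cR (ib M (pt H M s m))) = pt H M s m"
 by (simp add: antipode_reassoc_inv lin_t2)
qed simp_all

lemma chat_HM_cl [simp]: "[|lact HH z; t<:HM|] ==> chat HH M dl z t<:HM"
 by (rule chat_cl[where W = M]) simp_all

text \<open>The hexagon merges the braidings with \<open>rm1\<close> and \<open>lm2\<close> into one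
  with \<open>dg HH rm1 lm2\<close>. \<open>mua\<close> carries that action to the trivial one,
  where the braiding is the identity, and a snake remains.\<close>

lemma cinv_l:
 assumes t [simp]: "t<:(H><M)"
 shows "cinv M a d (chat H M dl R t) = t"
proof -
 let ?c = "chat HH M dl"
 have ibc: "ib M (chat H M dl R t) = ?c rm1 (ib M t)"
 by (rule chat_nat_l) (simp_all add: lin_t2 eqv_def rmul_apply)
 have cP: "eqv HM HM (?c rm1) (dg HM cM cP) (dg HM cP cM)" "eqv HM HM (?c rm1) cL cL"
 "eqv HM HM (?c rm1) cR cR"
 by (simp_all add: fst1_k_eqv[OF _ _ _ _ _ _ dl_fst1_k] chat_eqv_l)
 have cL: "eqv HM HM (?c lm2) (dg HM cM cL) (dg HM cL cM)" "eqv HM HM (?c lm2) cP cP"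
 "eqv HM HM (?c lm2) cR cR"
 by (simp_all add: fst1_k_eqv[OF _ _ _ _ _ _ dl_fst1_k] chat_eqv_l)
 let ?t = "?c rm1 (ib M t)" and ?v = "Phi HM (dg HM cM cP) cL cR (ib M t)"
 have at: "eq_at (ib M t) (dg HM cL cR) (triv HM)"
 by (rule ib_invariant) simp_all
 have at': "eq_at ?t (dg HM cL cR) (triv HM)"
 by (rule at_image[OF _ at eqv_diag eqv_triv]) (simp_all add: cP)
 have "Phi HM cP (dg HM cL cM) cR (?c lm2 (Phi HM cM cL cR ?t)) = ?c lm2 (Phi HM cP (dg HM cM cL) cR (Phi HM cM cL cR ?t))"
 by (rule op3_nat[symmetric]) (simp_all add: cL)
 moreover have "Phi HM cP (dg HM cM cL) cR (Phi HM cM cL cR ?t) = Ph HM cP cM cL (Phi HM (dg HM cP cM) cL cR ?t)"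
 by (rule coev_shift_r) (simp_all add: at')
 moreover have "Phi HM (dg HM cP cM) cL cR ?t = ?c rm1 ?v"
 by (rule op3_nat[symmetric]) (simp_all add: cP)
 moreover have "?c lm2 (Ph HM cP cM cL (?c rm1 ?v)) = Ph HM cP cL cM (?c (dg HH rm1 lm2) (Ph HM cM cP cL ?v))"
 by (rule hexagonD[OF dl_hex]) simp_all
 ultimately have "cinv M a d (chat H M dl R t) = u0 (?c (dg HH rm1 lm2) (Ph HM cM cP cL ?v))"
 unfolding cinv_def coins_def ibc by (simp only:) simp
 also have "... = chat H M dl (triv H) (u0 (Ph HM cM cP cL ?v))"
 by (rule chat_nat_l) (simp_all add: mua_eqv)
 also have "... = u0 (Ph HM cM cP cL ?v)"
 proof -
 have "chat H M dl (triv H) y = y" if y: "y<:(H><M)" for y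
 by (rule ext_pure[OF mod_H M _ chat_lin lin_mp_id y]) (simp_all add: chat_dl_eps del: chat_pure)
 moreover have "u0 (Ph HM cM cP cL ?v)<:(H><M)"
 by (rule lcl[OF u0_lin]) simp
 ultimately show ?thesis by simp
 qed
 also have "... = u0 (Phi HM cP cL cR (ib M t))"
 by (rule coll_shift_r[where U = "H><M"]) (simp_all add: at u0_co)
 also have "... = t"
 by (rule u0_ib) simp
 finally show ?thesis .
qed

text \<open>Here the hexagon merges the braidings with \<open>L\<close> and \<open>R\<close> into
  one with their diagonal action, which is trivial at the inserted \<beta>.\<close>

lemma cinv_r:
 assumes t: "t<:(H><M)"
 shows "chat H M dl R (cinv M a d t) = t"
proof (rule ext_pure[OF mod_H M _ linc[OF cinv_lin chat_lin] lin_mp_id t])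
 fix s m assume [simp]: "s<:H" "m<:M"
 let ?c = "chat HH M dl rm2" and ?t = "pt HH M (t2 K H s (qbeta H)) m"
 have c: "eqv HM HM ?c (dg HM cM cR) (dg HM cR cM)" "eqv HM HM ?c cP cP" "eqv HM HM ?c cL cL"
 by (simp_all add: fst1_k_eqv[OF _ _ _ _ _ _ dl_fst1_k] chat_eqv_l)
 define \<tau> where "\<tau> = coins M a d (pt H M s m)"
 have \<tau> [simp]: "\<tau> <: HM"
 unfolding \<tau>_def by (rule lcl[OF coins_lin]) simp
 let ?y = "Phi HM cP cL cM (Phi HM cP (dg HM cL cM) cR \<tau>)"
 let ?v = "Ph HM cL cM cR \<tau>"
 \<comment> \<open>The pentagon exposes \<open>cP cL\<close> as the pair to be evaluated and
   \<open>cM cR\<close> as the pair to be braided.\<close>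
 have y: "?y = Phi HM (dg HM cP cL) cM cR (Phi HM cP cL (dg HM cM cR) ?v)"
 proof -
 have "Ph HM cP cL (dg HM cM cR) (Ph HM (dg HM cP cL) cM cR ?y) = Ph HM cL cM cR (Ph HM cP (dg HM cL cM) cR (Ph HM cP cL cM ?y))"
 by (rule Ph_pent) simp_all
 then have "Ph HM cP cL (dg HM cM cR) (Ph HM (dg HM cP cL) cM cR ?y) = ?v"
 by simp
 moreover have "Phi HM (dg HM cP cL) cM cR (Phi HM cP cL (dg HM cM cR) (Ph HM cP cL (dg HM cM cR) (Ph HM (dg HM cP cL) cM cR ?y))) = ?y"
 by simp
 ultimately show ?thesis by (simp only:)
 qed
 have cu: "equ HM (%t. u0 (?c t)) (dg HM cP cL) (triv HM)"
 proof -
 have "eqv HM HM ?c (dg HM cP cL) (dg HM cP cL)"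
 by (rule eqv_diag) (simp_all add: c)
 moreover have "eqv HM HM ?c (triv HM) (triv HM)"
 by (rule eqv_triv) simp
 ultimately show ?thesis
 using u0_co by (simp add: equ_def eqv_def)
 qed
 have u0c: "(%t. u0 (?c t)) : Lin K HM (H><M)"
 by (rule linc[OF chat_lin u0_lin]) simp_all
 have "chat H M dl R (cinv M a d (pt H M s m)) = u0 (?c ?y)"
 unfolding cinv_def \<tau>_def[symmetric] by (rule chat_nat_l[symmetric]) (simp_all add: mua_eqv)
 also have "... = u0 (?c (Phi HM cP cL (dg HM cM cR) ?v))"
 unfolding y by (rule Ph_un_triv(2)[OF _ u0c]) (simp_all add: cu)
 also have "?c (Phi HM cP cL (dg HM cM cR) ?v) = Phi HM cP cL (dg HM cR cM) (?c ?v)"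
 by (rule op3_nat) (simp_all add: c)
 also have "?c ?v = Ph HM cL cR cM ?t"
 proof -
 let ?f = "t2 K H s"
 have f [simp]: "?f : Lin K H HH" by (simp add: lin_t2)
 have i: "eqv H HH ?f L lm2" "eqv H HH ?f R rm2"
 by (simp_all add: eqv_def lmul_apply rmul_apply)
 let ?b = "pt H M (qbeta H) m"
 let ?b' = "Phi (H><M) (Rg H M a) (Lg H M L) (Lg H M R) ?b"
 have dm [simp]: "d m<:(H><M)" by (rule lcl[OF d]) simp
 have "\<tau> = tmL HH M ?f (d m)"
 by (simp add: \<tau>_def coins_pure)
 moreover have "Ph HM cL cM cR (tmL HH M ?f (d m)) = tmL HH M ?f (Ph (H><M) (Lg H M L) (Rg H M a) (Lg H M R) (d m))"
 by (rule op3_nat[symmetric]) (simp_all add: ten_map_eqv i)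
 moreover have "?c (tmL HH M ?f (Ph (H><M) (Lg H M L) (Rg H M a) (Lg H M R) (d m)))
 = tmL HH M ?f (chat H M dl R (Ph (H><M) (Lg H M L) (Rg H M a) (Lg H M R) (d m)))"
 by (rule chat_nat_l[symmetric]) (simp_all add: i)
 moreover have "d m = chat H M dl L ?b'"
 using second_dl[of m] by (simp add: second_def)
 moreover have "chat H M dl R (Ph (H><M) (Lg H M L) (Rg H M a) (Lg H M R) (chat H M dl L ?b'))
 = Ph (H><M) (Lg H M L) (Lg H M R) (Rg H M a) (chat H M dl (dg H L R) (Ph (H><M) (Rg H M a) (Lg H M L) (Lg H M R) ?b'))"
 by (rule hexagonD[OF dl_hex]) simp_all
 moreover have "Ph (H><M) (Rg H M a) (Lg H M L) (Lg H M R) ?b' = ?b"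
 by simp
 moreover have "chat H M dl (dg H L R) ?b = ?b"
 proof (rule chat_dl_eps)
 fix h assume [simp]: "h<:H"
 have "dg H L R h (qbeta H) = sw H (comul H h) (%p q. p##qbeta H##S q)"
 unfolding diag_sw[OF mod_H]
 by (intro sw_cong[OF mod_H mod_H]) (simp_all add: lmul_apply rmul_apply H.m_assoc)
 then show "dg H L R h (qbeta H) = triv H h (qbeta H)"
 by (simp add: antipode_beta triv_def)
 qed simp_all
 moreover have "tmL HH M ?f (Ph (H><M) (Lg H M L) (Lg H M R) (Rg H M a) ?b) = Ph HM cL cR cM (tmL HH M ?f ?b)"
 by (rule op3_nat) (simp_all add: ten_map_eqv i)
 moreover have "tmL HH M ?f ?b = ?t"
 by simp
 ultimately show ?thesis by metis
 qed
 also have "Phi HM cP cL (dg HM cR cM) (Ph HM cL cR cM ?t) = Ph HM (dg HM cP cL) cR cM (Phi HM cP cL cR ?t)"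
 proof (rule coev_shift_l[symmetric])
 show "eq_at ?t (dg HM cL cR) (triv HM)"
 using ib_invariant[of M "pt H M s m"] by (simp add: lin_t2)
 qed simp_all
 also have "u0 (Ph HM (dg HM cP cL) cR cM (Phi HM cP cL cR ?t)) = u0 (Phi HM cP cL cR ?t)"
 by (rule Ph_un_triv(1)[OF _ u0_lin]) (simp_all add: u0_co)
 also have "... = pt H M s m"
 using u0_ib[of "pt H M s m"] by (simp add: lin_t2)
 finally show "chat H M dl R (cinv M a d (pt H M s m)) = pt H M s m" .
qed simp_all

end

end

context quasi_hopf_algebra
begin

section \<open>Linear isomorphisms\<close>

definition lbij where
 "lbij V W f \<longleftrightarrow> f : Lin K V W \<and>
 (\<exists>g \<in> Lin K W V. (\<forall>x \<in> carrier V. g (f x) = x) \<and> (\<forall>y \<in> carrier W. f (g y) = y))"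

lemma lbijI:
 "[|f : Lin K V W; g : Lin K W V; !!x. x<:V ==> g (f x) = x; !!y. y<:W ==> f (g y) = y|]
 ==> lbij V W f"
 unfolding lbij_def by (intro conjI bexI[of _ g] ballI; simp)

lemma lbij_lin: "lbij V W f ==> f : Lin K V W"
 by (simp add: lbij_def)

lemma lbij_sym:
 assumes "lbij V W f"
 obtains g where "lbij W V g" "!!x. x<:V ==> g (f x) = x" "!!y. y<:W ==> f (g y) = y"
proof -
 obtain g where g: "g : Lin K W V" "\<forall>x \<in> carrier V. g (f x) = x" "\<forall>y \<in> carrier W. f (g y) = y"
 using assms unfolding lbij_def by (elim conjE bexE)
 then have "lbij W V g"
 by (intro lbijI[OF g(1) lbij_lin[OF assms]]) simp_all
 then show ?thesis
 by (rule that) (erule bspec[OF g(2)], erule bspec[OF g(3)])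
qed

lemma lbij_comp:
 assumes f: "lbij U V f" and g: "lbij V W g"
 shows "lbij U W (%x. g (f x))"
proof -
 obtain f' where f': "lbij V U f'" "!!x. x<:U ==> f' (f x) = x" "!!y. y<:V ==> f (f' y) = y"
 using lbij_sym[OF f] by metis
 obtain g' where g': "lbij W V g'" "!!x. x<:V ==> g' (g x) = x" "!!y. y<:W ==> g (g' y) = y"
 using lbij_sym[OF g] by metis
 note l = f[THEN lbij_lin] g[THEN lbij_lin] f'(1)[THEN lbij_lin] g'(1)[THEN lbij_lin]
 show ?thesis
 by (rule lbijI[OF linc[OF l(1,2)] linc[OF l(4,3)]])
 (simp_all add: f' g' l[THEN lcl])
qed

lemma lbij_cong:
 assumes f: "lbij V W f" and eq: "!!x. x<:V ==> f' x = f x"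
 and f': "f' : Lin K V W"
 shows "lbij V W f'"
proof -
 obtain g where g: "lbij W V g" "!!x. x<:V ==> g (f x) = x" "!!y. y<:W ==> f (g y) = y"
 using lbij_sym[OF f] by metis
 show ?thesis
 by (rule lbijI[OF f' lbij_lin[OF g(1)]])
 (simp_all add: eq g lcl[OF lbij_lin[OF g(1)]])
qed

lemma lbij_op3:
 assumes "md K T" "legs T [a, b, c]"
 shows "lbij T T (Ph T a b c)" "lbij T T (Phi T a b c)"
 using assms by (auto intro!: lbijI[of "Ph T a b c" T T "Phi T a b c"] lbijI[of "Phi T a b c" T T "Ph T a b c"])

lemma lbij_ten:
 assumes [simp]: "md K V" "md K W" "md K E" and f: "lbij V W f"
 shows "lbij (V><E) (W><E) (tmL W E f)" and "lbij (E><V) (E><W) (tmR E W f)"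
proof -
 obtain g where g: "lbij W V g" "!!x. x<:V ==> g (f x) = x" "!!y. y<:W ==> f (g y) = y"
 using lbij_sym[OF f] by metis
 note l [simp] = lbij_lin[OF f] lbij_lin[OF g(1)] and [simp] = lcl[OF lbij_lin[OF f]]
 lcl[OF lbij_lin[OF g(1)]]
 show "lbij (V><E) (W><E) (tmL W E f)"
 proof (rule lbijI)
 show "tmL V E g (tmL W E f x) = x" if x: "x<:(V><E)" for x
 by (rule ext_pure[OF assms(1,3) _ linc[OF tm_simps(1) tm_simps(1)] lin_mp_id x])
 (simp_all add: g)
 show "tmL W E f (tmL V E g x) = x" if x: "x<:(W><E)" for x
 by (rule ext_pure[OF assms(2,3) _ linc[OF tm_simps(1) tm_simps(1)] lin_mp_id x])
 (simp_all add: g)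
 qed simp_all
 show "lbij (E><V) (E><W) (tmR E W f)"
 proof (rule lbijI)
 show "tmR E V g (tmR E W f x) = x" if x: "x<:(E><V)" for x
 by (rule ext_pure[OF assms(3,1) _ linc[OF tm_simps(1) tm_simps(1)] lin_mp_id x])
 (simp_all add: g)
 show "tmR E W f (tmR E V g x) = x" if x: "x<:(E><W)" for x
 by (rule ext_pure[OF assms(3,2) _ linc[OF tm_simps(1) tm_simps(1)] lin_mp_id x])
 (simp_all add: g)
 qed simp_all
qed

section \<open>Permutations of three tensor factors\<close>

definition flip where
 "flip A B C t = sw (B><(A><C)) t (%x y. tmR B (A><C) (pt A C x) y)"

definition asl where
 "asl A B C t = sw (A><(B><C)) t (%x y. tmR A (B><C) (%v. pt B C v y) x)"

definition asr where
 "asr A B C t = sw ((A><B)><C) t (%x y. tmL (A><B) C (pt A B x) y)"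

context
 fixes A and B and C
 assumes mods [simp]: "md K A" "md K B" "md K C"
begin

lemma flip_bil: "bilin K A (B><C) (B><(A><C)) (%x y. tmR B (A><C) (pt A C x) y)"
 by (rule tmR_bil) (simp_all add: pure_ten_bil)

lemma asl_bil: "bilin K (A><B) C (A><(B><C)) (%x y. tmR A (B><C) (%v. pt B C v y) x)"
 by (rule bil_flip[OF tmR_bil[OF _ _ _ _ bil_flip]]) (simp_all add: pure_ten_bil)

lemma asr_bil: "bilin K A (B><C) ((A><B)><C) (%x y. tmL (A><B) C (pt A B x) y)"
 by (rule tmL_bil) (simp_all add: pure_ten_bil)

lemma flip_lin [simp]: "flip A B C : Lin K (A><(B><C)) (B><(A><C))"
 using sw_lin[OF mods(1) _ _ flip_bil] by (simp add: flip_def[abs_def])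

lemma asl_lin [simp]: "asl A B C : Lin K ((A><B)><C) (A><(B><C))"
 using sw_lin[OF _ mods(3) _ asl_bil] by (simp add: asl_def[abs_def])

lemma asr_lin [simp]: "asr A B C : Lin K (A><(B><C)) ((A><B)><C)"
 using sw_lin[OF mods(1) _ _ asr_bil] by (simp add: asr_def[abs_def])

lemma flip_pure1: "[|x<:A; r<:(B><C)|] ==> flip A B C (pt A (B><C) x r) = tmR B (A><C) (pt A C x) r"
 using sw_pure[OF mods(1) _ _ flip_bil] by (simp add: flip_def)

lemma asl_pure1: "[|r<:(A><B); y<:C|] ==> asl A B C (pt (A><B) C r y) = tmR A (B><C) (%v. pt B C v y) r"
 using sw_pure[OF _ mods(3) _ asl_bil] by (simp add: asl_def)

lemma asr_pure1: "[|x<:A; r<:(B><C)|] ==> asr A B C (pt A (B><C) x r) = tmL (A><B) C (pt A B x) r"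
 using sw_pure[OF mods(1) _ _ asr_bil] by (simp add: asr_def)

lemma perm_pure [simp]:
 assumes "x<:A" "y<:B" "z<:C"
 shows "flip A B C (pt A (B><C) x (pt B C y z)) = pt B (A><C) y (pt A C x z)"
 and "asl A B C (pt (A><B) C (pt A B x y) z) = pt A (B><C) x (pt B C y z)"
 and "asr A B C (pt A (B><C) x (pt B C y z)) = pt (A><B) C (pt A B x y) z"
 using assms by (simp_all add: flip_pure1 asl_pure1 asr_pure1 lin_pure)

lemma ext_pure3:
 assumes "md K U"
 shows "[|F : Lin K (A><(B><C)) U; G : Lin K (A><(B><C)) U; t<:(A><(B><C));
 !!x y z. [|x<:A; y<:B; z<:C|]
 ==> F (pt A (B><C) x (pt B C y z)) = G (pt A (B><C) x (pt B C y z))|] ==> F t = G t"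
 and "[|F' : Lin K ((A><B)><C) U; G' : Lin K ((A><B)><C) U; t'<:((A><B)><C);
 !!x y z. [|x<:A; y<:B; z<:C|]
 ==> F' (pt (A><B) C (pt A B x y) z) = G' (pt (A><B) C (pt A B x y) z)|] ==> F' t' = G' t'"
proof -
 show "F t = G t"
 if F: "F : Lin K (A><(B><C)) U" and G: "G : Lin K (A><(B><C)) U" and t: "t<:(A><(B><C))"
 and eq: "!!x y z. [|x<:A; y<:B; z<:C|]
 ==> F (pt A (B><C) x (pt B C y z)) = G (pt A (B><C) x (pt B C y z))"
 proof (rule ext_pure[OF mods(1) _ assms F G t])
 show "F (pt A (B><C) x r) = G (pt A (B><C) x r)" if "x<:A" and r: "r<:(B><C)" for x r
 by (rule ext_pure[OF mods(2,3) assms linc[OF lin_pure(1) F] linc[OF lin_pure(1) G] r])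
 (simp_all add: eq that)
 qed simp
 show "F' t' = G' t'"
 if F: "F' : Lin K ((A><B)><C) U" and G: "G' : Lin K ((A><B)><C) U" and t: "t'<:((A><B)><C)"
 and eq: "!!x y z. [|x<:A; y<:B; z<:C|]
 ==> F' (pt (A><B) C (pt A B x y) z) = G' (pt (A><B) C (pt A B x y) z)"
 proof (rule ext_pure[OF _ mods(3) assms F G t])
 show "F' (pt (A><B) C r z) = G' (pt (A><B) C r z)" if "z<:C" and r: "r<:(A><B)" for z r
 by (rule ext_pure[OF mods(1,2) assms linc[OF lin_pure(2) F] linc[OF lin_pure(2) G] r])
 (simp_all add: eq that)
 qed simp
qed

end

lemma flip_flip:
 assumes [simp]: "md K A" "md K B" "md K C" and t: "t<:(A><(B><C))"
 shows "flip B A C (flip A B C t) = t"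
 by (rule ext_pure3(1)[OF assms(1-3) _ linc[OF flip_lin flip_lin] lin_mp_id t]) simp_all

lemma lbij_perm:
 assumes [simp]: "md K A" "md K B" "md K C"
 shows "lbij (A><(B><C)) (B><(A><C)) (flip A B C)"
 and "lbij ((A><B)><C) (A><(B><C)) (asl A B C)" and "lbij (A><(B><C)) ((A><B)><C) (asr A B C)"
proof -
 show "lbij (A><(B><C)) (B><(A><C)) (flip A B C)"
 by (rule lbijI[OF flip_lin flip_lin]) (simp_all add: flip_flip)
 have a: "asr A B C (asl A B C t) = t" if t: "t<:((A><B)><C)" for t
 by (rule ext_pure3(2)[OF assms _ linc[OF asl_lin asr_lin] lin_mp_id t]) simp_all
 have a': "asl A B C (asr A B C t) = t" if t: "t<:(A><(B><C))" for t
 by (rule ext_pure3(1)[OF assms _ linc[OF asr_lin asl_lin] lin_mp_id t]) simp_all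
 show "lbij ((A><B)><C) (A><(B><C)) (asl A B C)" "lbij (A><(B><C)) ((A><B)><C) (asr A B C)"
 by (rule lbijI[OF asl_lin asr_lin] lbijI[OF asr_lin asl_lin]; simp add: a a')+
qed

section \<open>The Hopf operators\<close>

text \<open>\<beta> is inserted for both factors at once. By \<open>coev_shift_r\<close> it can be
  made to meet \<open>b\<close> first, where it turns \<open>gB\<close> into its second kind
  coaction.\<close>

lemma second_htens:
 assumes [simp]: "md K A" "md K B" "md K C" "md K D" "lact A a" "lact B b" "lact C c" "lact D d"
 and gA: "first_kind A a C c gA" and gB: "first_kind B b D d gB" and w: "w<:(A><B)"
 shows "second (A><B) (dact A a B b) (C><D) (htens A a C c gA B b D d gB) w
 = Ph (H><(C><D)) (mS H C D L) (mA H C D c) (mB H C D d) (chat H (C><D) (extL C D gA) L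
 (Phi (H><(A><D)) (mA H A D a) (mS H A D L) (mB H A D d)
 (Phi (H><(A><D)) (mA H A D a) (dg (H><(A><D)) (mS H A D L) (mB H A D d)) (mS H A D R)
 (extR A D (second B b D gB) w))))"
proof -
 note [simp] = fst1_k_lin[OF gA] fst1_k_lin[OF gB] second_lin[OF _ _ _ _ gB]
 let ?T = "H><(A><B)" and ?T2 = "H><(A><D)" and ?t = "pt H (A><B) (qbeta H) w"
 let ?a = "mA H A B a" and ?b = "mB H A B b" and ?l = "mS H A B L" and ?r = "mS H A B R"
 let ?c = "chat H (A><D) (extR A D gB) L"
 have t [simp]: "?t<:?T" by (simp add: w)
 have 1: "Phi ?T (Rg H (A><B) (dact A a B b)) ?l ?r ?t = Phi ?T (dg ?T ?a ?b) ?l ?r ?t"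
 by (rule op3_cong) (simp_all add: diag_legR)
 have 2: "Ph ?T ?a ?b ?l (Phi ?T (dg ?T ?a ?b) ?l ?r ?t) = Phi ?T ?a (dg ?T ?b ?l) ?r (Phi ?T ?b ?l ?r ?t)"
 by (rule coev_shift_r[symmetric]) (simp_all add: beta_invariant_pure[OF assms(1,5)] w)
 have 3: "?c (Phi ?T ?a (dg ?T ?b ?l) ?r (Phi ?T ?b ?l ?r ?t))
 = Phi ?T2 (mA H A D a) (dg ?T2 (mS H A D L) (mB H A D d)) (mS H A D R) (?c (Phi ?T ?b ?l ?r ?t))"
 by (rule op3_nat) (simp_all add: chat_extR_eqv[OF assms(1-8) gA gB])
 have 4: "?c (Phi ?T ?b ?l ?r (pt H (A><B) (qbeta H) w)) = extR A D (second B b D gB) w"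
 proof (rule ext_pure[OF assms(1,2) _ _ extR_lin w])
 show "(%w. ?c (Phi ?T ?b ?l ?r (pt H (A><B) (qbeta H) w))) : Lin K (A><B) ?T2"
 by (rule linc[OF linc[OF lin_pure(1) op3_lin] chat_lin]) simp_all
 fix x y assume [simp]: "x<:A" "y<:B"
 let ?i = "tmR H (A><B) (pt A B x)"
 let ?s = "Phi (H><B) (Rg H B b) (Lg H B L) (Lg H B R) (pt H B (qbeta H) y)"
 have "pt H (A><B) (qbeta H) (pt A B x y) = ?i (pt H B (qbeta H) y)"
 by (simp add: lin_pure)
 moreover have "Phi ?T ?b ?l ?r (?i (pt H B (qbeta H) y)) = ?i ?s"
 by (rule op3_nat[symmetric]) (simp_all add: lin_pure ten_map_eqv pure_eqv)
 moreover have "?c (?i ?s) = tmR H (A><D) (pt A D x) (chat H D gB L ?s)"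
 by (rule chat_nat_r[where W = B, symmetric]) (simp_all add: lin_pure extR_pure)
 ultimately have "?c (Phi ?T ?b ?l ?r (pt H (A><B) (qbeta H) (pt A B x y)))
 = tmR H (A><D) (pt A D x) (second B b D gB y)"
 by (simp only: second_def)
 then show "?c (Phi ?T ?b ?l ?r (pt H (A><B) (qbeta H) (pt A B x y))) = extR A D (second B b D gB) (pt A B x y)"
 by (simp add: extR_pure[where A = B])
 qed simp_all
 show ?thesis
 unfolding second_def[of "A><B"] 1
 by (subst chat_htens[OF assms(1-8) gA gB]) (simp_all add: tcomp_def 2 3 4)
qed

text \<open>Places the two copies of \<open>H\<close> on which \<open>cinv\<close> works inside
  \<open>H><((H><X)><M)\<close>, for a fixed vector \<open>x\<close> of \<open>X\<close>.\<close>

definition lam where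
 "lam X M x t = asl H (H><X) M (tmL (H><(H><X)) M
 (%y. sw (H><(H><X)) y (%s x'. pt H (H><X) x' (pt H X s x))) t)"

text \<open>The inverse half-braiding, applied to the factors \<open>H\<close> and \<open>M\<close> of \<open>(H \<otimes> X) \<otimes> M\<close>.\<close>

definition ct where
 "ct X M a d w = flip X H M (tmR X (H><M) (cinv M a d) (flip H X M (asl H X M w)))"

context
 fixes M and a and d
 and X and b
 assumes M [simp]: "md K M" and a [simp]: "lact M a" and d [simp]: "d : Lin K M (H><M)"
 and da: "eqv M (H><M) d a (ract M a)"
 and coassoc: "!!m. m<:M ==> nabla M a (d m) = tmR H (H><M) d (d m)"
 and counit: "!!m. m<:M ==> cou M (d m) = m"
 and X [simp]: "md K X" and b [simp]: "lact X b"
begin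

abbreviation (input) "dM \<equiv> %m. theta M a (d m)"
abbreviation (input) "RX \<equiv> H><X"

lemmas [simp] = dl_lin[OF M a d da coassoc counit] cinv_lin[OF M a d da coassoc counit]

lemma lbij_chat_R: "lbij (H><M) (H><M) (chat H M dM R)" and lbij_cinv: "lbij (H><M) (H><M) (cinv M a d)"
 by (rule lbijI[of _ _ _ "cinv M a d"] lbijI[of _ _ _ "chat H M dM R"];
 simp add: cinv_l[OF M a d da coassoc counit] cinv_r[OF M a d da coassoc counit])+

text \<open>S intertwines the regular module with its dual, the legs \<open>L\<close> and
  \<open>R\<close>. So the two braidings correspond under S, and its bijectivity transports
  invertibility from one to the other.\<close>

lemma lbij_chat_L:
 assumes "bijective_antipode H"
 shows "lbij (H><M) (H><M) (chat H M dM L)"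
proof -
 have bij: "bij_betw S (carrier H) (carrier H)"
 using assms by (simp add: bijective_antipode_def)
 let ?T = "antipode_inv H"
 have cl: "?T h<:H" if "h<:H" for h
 using inv_into_into[of h S "carrier H"] bij that by (simp add: antipode_inv_def bij_betw_def)
 have ST: "S (?T h) = h" if "h<:H" for h
 using that bij by (simp add: antipode_inv_def bij_betw_inv_into_right)
 have TS: "?T (S h) = h" if "h<:H" for h
 using that bij by (simp add: antipode_inv_def bij_betw_inv_into_left)
 have lin: "?T : Lin K H H"
 proof (rule lin_mapsI)
 show "?T (x +[H] y) = ?T x +[H] ?T y" if [simp]: "x<:H" "y<:H" for x y
 using TS[of "?T x +[H] ?T y"] by (simp add: cl ST linear_maps_add[OF antipode_linear])
 show "?T (c *[H] x) = c *[H] ?T x" if [simp]: "c<:K" "x<:H" for c x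
 using TS[of "c *[H] ?T x"] by (simp add: cl ST linear_maps_smult[OF antipode_linear])
 qed (simp add: cl)
 have S: "lbij H H S" and T: "lbij H H ?T"
 by (rule lbijI[OF antipode_linear lin] lbijI[OF lin antipode_linear]; simp add: ST TS)+
 note tS = lbij_ten(1)[OF mod_H mod_H M S] and tT = lbij_ten(1)[OF mod_H mod_H M T]
 have i: "eqv H H S L R"
 by (simp add: eqv_def lmul_apply rmul_apply antipode_mult)
 show ?thesis
 proof (rule lbij_cong[OF lbij_comp[OF lbij_comp[OF tS lbij_chat_R] tT]])
 fix t assume t: "t<:(H><M)"
 have c: "chat H M dM L t<:(H><M)"
 by (rule chat_cl[OF _ _ _ _ _ t]) simp_all
 have "tmL H M ?T (chat H M dM R (tmL H M S t)) = tmL H M ?T (tmL H M S (chat H M dM L t))"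
 by (subst chat_nat_l[where z' = R]) (simp_all add: antipode_linear i t)
 also have "... = chat H M dM L t"
 by (rule ext_pure[OF mod_H M _ linc[OF tm_simps(1) tm_simps(1)] lin_mp_id c])
 (simp_all add: antipode_linear lin TS)
 finally show "chat H M dM L t = tmL H M ?T (chat H M dM R (tmL H M S t))" by simp
 qed simp
qed

lemma lbij_chat_extL:
 assumes "bijective_antipode H"
 shows "lbij (H><(M><X)) (H><(M><X)) (chat H (M><X) (extL M X dM) L)"
proof (rule lbij_cong[OF lbij_comp[OF lbij_comp[OF lbij_perm(3) lbij_ten(1)[OF _ _ _ lbij_chat_L[OF assms]]] lbij_perm(2)]])
 fix t assume t: "t<:(H><(M><X))"
 show "chat H (M><X) (extL M X dM) L t = asl H M X (tmL (H><M) X (chat H M dM L) (asr H M X t))"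
 proof (rule ext_pure3(1)[OF mod_H M X _ chat_lin linc[OF linc[OF asr_lin tm_simps(1)] asl_lin] t])
 fix s m x assume [simp]: "s<:H" "m<:M" "x<:X"
 have c: "chat H M dM L (pt H M s m)<:(H><M)"
 by (rule chat_cl[where W = M]) simp_all
 have "tmR H (M><X) (%v. pt M X v x) (chat H M dM L (pt H M s m))
 = chat H (M><X) (extL M X dM) L (tmR H (M><X) (%v. pt M X v x) (pt H M s m))"
 by (rule chat_nat_r[where W = M]) (simp_all add: lin_pure extL_pure)
 then show "chat H (M><X) (extL M X dM) L (pt H (M><X) s (pt M X m x))
 = asl H M X (tmL (H><M) X (chat H M dM L) (asr H M X (pt H (M><X) s (pt M X m x))))"
 using c by (simp add: asl_pure1 lin_pure del: chat_pure)
 qed simp_all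
qed simp_all

abbreviation (input) "hopfR \<equiv> second (M><RX) (dact M a RX (ract X b)) (M><X)
 (htens M a M a dM RX (ract X b) X b (theta X b))"
abbreviation (input) "hopfL \<equiv> second (RX><M) (dact RX (ract X b) M a) (X><M)
 (htens RX (ract X b) X b (theta X b) M a M a dM)"

lemma fst1_kinds:
 shows "first_kind M a M a dM" and "first_kind RX (ract X b) X b (theta X b)"
 by (simp_all add: dl_fst1_k[OF M a d da coassoc counit] theta_fst1_k)

text \<open>In \<open>second_htens\<close> the second kind coaction of the universal map is the
  identity. The first stage is therefore the permutation \<open>flip\<close>; the others are
  associators and the half-braiding of \<open>M\<close> with the regular module.\<close>

lemma lbij_hopfR:
 assumes "bijective_antipode H"
 shows "lbij (M><RX) (H><(M><X)) hopfR"
proof -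
 let ?T = "H><(M><X)"
 have e: "extR M X (second RX (ract X b) X (theta X b)) w = flip M H X w" if w: "w<:(M><RX)" for w
 unfolding extR_def flip_def by (rule sw_cong[OF M _ _ w]) (simp_all add: second_theta)
 have legs: "legs ?T [mS H M X L, mA H M X a, mB H M X b]" "legs ?T [mA H M X a, mS H M X L, mB H M X b]"
 "legs ?T [mA H M X a, dg ?T (mS H M X L) (mB H M X b), mS H M X R]"
 by simp_all
 have T: "md K ?T" by simp
 show ?thesis
 by (rule lbij_cong[OF lbij_comp[OF lbij_comp[OF lbij_comp[OF lbij_comp[OF lbij_perm(1) lbij_op3(2)[OF T legs(3)]]
 lbij_op3(2)[OF T legs(2)]] lbij_chat_extL[OF assms]] lbij_op3(1)[OF T legs(1)]]])
 (simp_all add: second_htens[OF _ _ _ _ _ _ _ _ fst1_kinds] e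
 second_lin[OF _ _ _ _ htens_fst1_k[OF _ _ _ _ _ _ _ _ fst1_kinds]])
qed

lemma lam_aux:
 assumes [simp]: "x<:X"
 shows "(%y. sw (H><RX) y (%s x'. pt H RX x' (pt H X s x))) : Lin K HH (H><RX)"
 and "[|s<:H; x'<:H|] ==> sw (H><RX) (t2 K H s x') (%s x'. pt H RX x' (pt H X s x)) = pt H RX x' (pt H X s x)"
proof -
 have b: "bilin K H H (H><RX) (%s x'. pt H RX x' (pt H X s x))"
 by (rule bil_comp_args[OF bil_flip[OF pure_ten_bil] lin_pure(2) lin_mp_id]) simp_all
 show "(%y. sw (H><RX) y (%s x'. pt H RX x' (pt H X s x))) : Lin K HH (H><RX)"
 by (rule sw_lin[OF mod_H mod_H _ b]) simp
 show "sw (H><RX) (t2 K H s x') (%s x'. pt H RX x' (pt H X s x)) = pt H RX x' (pt H X s x)"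
 if "s<:H" "x'<:H"
 by (rule sw_pure[OF mod_H mod_H _ b that]) simp
qed

lemma lam_lin [simp]: "x<:X ==> lam X M x : Lin K (HH><M) (H><(RX><M))"
 unfolding lam_def[abs_def]
 by (rule linc[OF tm_simps(1) asl_lin]) (simp_all add: lam_aux)

lemma lam_pure [simp]:
 "[|x<:X; s<:H; x'<:H; m<:M|]
 ==> lam X M x (pt HH M (t2 K H s x') m) = pt H (RX><M) x' (pt RX M (pt H X s x) m)"
 by (simp add: lam_def lam_aux)

lemma eqv_pureL:
 assumes U: "md K U" and u: "u : Lin K (HH><M) U" and rh: "lact (HH><M) rh" and sg: "lact U sg"
 and eq: "!!h s x m. [|h<:H; s<:H; x<:H; m<:M|]
 ==> u (rh h (pt HH M (t2 K H s x) m)) = sg h (u (pt HH M (t2 K H s x) m))"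
 shows "eqv (HH><M) U u rh sg"
 unfolding eqv_def
proof (intro ballI)
 fix h t assume h: "h<:H" and t: "t<:(HH><M)"
 show "u (rh h t) = sg h (u t)"
 by (rule ext_pure3(2)[OF mod_H mod_H M U linc[OF action_linear[OF rh h] u]
 linc[OF u action_linear[OF sg h]] t]) (simp add: eq h)
qed

lemma lbij_ct: "lbij (RX><M) (H><(X><M)) (ct X M a d)"
 unfolding ct_def[abs_def]
 by (rule lbij_comp[OF lbij_comp[OF lbij_comp[OF lbij_perm(2) lbij_perm(1)] lbij_ten(2)[OF _ _ _ lbij_cinv]] lbij_perm(1)])
 simp_all

text \<open>The factor \<open>H\<close> of \<open>R(X)\<close> and the one created by the coaction
  of \<open>M\<close> are the two copies on which \<open>cinv\<close> works; \<open>X\<close> is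
  carried along through \<open>lam\<close>.\<close>

lemma ct_alt:
 assumes w: "w<:(RX><M)"
 shows "chat H (X><M) (extL X M (almap X)) L
 (Phi (H><(RX><M)) (mA H RX M (Lg H X R)) (mS H RX M L) (mB H RX M a)
 (Phi (H><(RX><M)) (mA H RX M (Lg H X R)) (dg (H><(RX><M)) (mS H RX M L) (mB H RX M a)) (mS H RX M R)
 (extR RX M d w))) = ct X M a d w"
proof -
 let ?T = "H><(RX><M)"
 let ?p = "mA H RX M (Lg H X R)" and ?l = "mS H RX M L" and ?r = "mS H RX M R" and ?m = "mB H RX M a"
 let ?u = "chat H (X><M) (extL X M (almap X)) L"
 let ?F = "%w. ?u (Phi ?T ?p ?l ?m (Phi ?T ?p (dg ?T ?l ?m) ?r (extR RX M d w)))"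
 have F: "?F : Lin K (RX><M) (H><(X><M))"
 by (rule linc[OF linc[OF linc[OF extR_lin op3_lin] op3_lin] chat_lin]) simp_all
 have ul: "?u : Lin K ?T (H><(X><M))" by simp
 show ?thesis
 proof (rule ext_pure3(2)[OF mod_H X M _ F lbij_lin[OF lbij_ct] w])
 fix s x m assume [simp]: "s<:H" "x<:X" "m<:M"
 let ?U = "HH><M"
 let ?cP = "Lg HH M rm1" and ?cL = "Lg HH M lm2" and ?cR = "Lg HH M rm2" and ?cM = "Rg HH M a"
 have i: "eqv ?U ?T (lam X M x) ?cP ?p" "eqv ?U ?T (lam X M x) ?cL ?l" "eqv ?U ?T (lam X M x) ?cR ?r"
 "eqv ?U ?T (lam X M x) ?cM ?m"
 by (rule eqv_pureL; simp add: rmul_apply lmul_apply lact_cl[of M])+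
 have dm: "d m<:(H><M)" by (rule lcl[OF d]) simp
 let ?q = "tmL HH M (t2 K H s) (d m)"
 have q [simp]: "?q<:?U"
 by (rule lcl[OF tm_simps(1) dm]) (simp_all add: lin_t2)
 have "tmR H (RX><M) (pt RX M (pt H X s x)) r = lam X M x (tmL HH M (t2 K H s) r)" if r: "r<:(H><M)" for r
 by (rule ext_pure[OF mod_H M _ tm_simps(1) linc[OF tm_simps(1) lam_lin] r])
 (simp_all add: lin_pure lin_t2)
 then have "extR RX M d (pt RX M (pt H X s x) m) = lam X M x ?q"
 by (simp add: extR_pure[where A = M] dm)
 moreover have "Phi ?T ?p (dg ?T ?l ?m) ?r (lam X M x ?q) = lam X M x (Phi ?U ?cP (dg ?U ?cL ?cM) ?cR ?q)"
 by (rule op3_nat[symmetric]) (simp_all add: i eqv_diag)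
 moreover have "Phi ?T ?p ?l ?m (lam X M x (Phi ?U ?cP (dg ?U ?cL ?cM) ?cR ?q))
 = lam X M x (Phi ?U ?cP ?cL ?cM (Phi ?U ?cP (dg ?U ?cL ?cM) ?cR ?q))"
 by (rule op3_nat[symmetric]) (simp_all add: i)
 moreover have "?u (lam X M x t) = tmR H (X><M) (pt X M x) (tmL H M mua t)" if t: "t<:?U" for t
 by (rule ext_pure3(2)[OF mod_H mod_H M _ linc[OF lam_lin ul]
 linc[OF tm_simps(1) tm_simps(1)] t])
 (simp_all add: lin_pure extL_pure[where A = RX] lmul_apply)
 moreover have "ct X M a d (pt RX M (pt H X s x) m) = tmR H (X><M) (pt X M x) (cinv M a d (pt H M s m))"
 proof -
 have "cinv M a d (pt H M s m)<:(H><M)"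
 by (rule lcl[OF cinv_lin[OF M a d da coassoc counit]]) simp_all
 then show ?thesis
 by (simp add: ct_def flip_pure1[where A = X and B = H and C = M and x = x and r = "cinv M a d (pt H M s m)"])
 qed
 moreover have "cinv M a d (pt H M s m) = tmL H M mua (Phi ?U ?cP ?cL ?cM (Phi ?U ?cP (dg ?U ?cL ?cM) ?cR ?q))"
 by (simp add: cinv_def coins_pure[OF M a d da coassoc counit])
 ultimately show "?F (pt RX M (pt H X s x) m) = ct X M a d (pt RX M (pt H X s x) m)"
 by simp
 qed simp_all
qed

lemma hopfL_pure_ext:
 assumes "md K U" "F : Lin K (H><(RX><M)) U" "G : Lin K (H><(RX><M)) U"
 and t: "t<:(H><(RX><M))"
 and eq: "!!s r x m. [|s<:H; r<:H; x<:X; m<:M|]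
 ==> F (pt H (RX><M) s (pt RX M (pt H X r x) m)) = G (pt H (RX><M) s (pt RX M (pt H X r x) m))"
 shows "F t = G t"
proof (rule ext_pure[OF mod_H _ assms(1-3) t])
 show "F (pt H (RX><M) s y) = G (pt H (RX><M) s y)" if "s<:H" and y: "y<:(RX><M)" for s y
 by (rule ext_pure3(2)[OF mod_H X M assms(1) linc[OF lin_pure(1) assms(2)]
 linc[OF lin_pure(1) assms(3)] y]) (simp_all add: eq that)
qed simp

text \<open>The dual leg of \<open>R(X)\<close> is evaluated against the component that the coaction
  of \<open>M\<close> has produced. This is the pattern of \<open>cinv\<close>, so the inverse
  half-braiding appears; \<open>hopf_l_coherence\<close> separates it from the associators.\<close>

lemma lbij_hopfL: "lbij (RX><M) (H><(X><M)) hopfL"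
proof -
 let ?W = "RX><M"
 let ?T = "H><?W" and ?U = "H><(X><M)"
 \<comment> \<open>The legs \<open>y1\<close>, \<open>y2\<close>, \<open>p\<close> make up the
   action on \<open>R(X)\<close>; \<open>l\<close>, \<open>m\<close>, \<open>r\<close> make up the
   action on the image of \<open>M\<close> under its coaction.\<close>
 define y1 y2 p l m r where "y1 = mA H RX M (Lg H X L)" and "y2 = mA H RX M (Rg H X b)"
 and "p = mA H RX M (Lg H X R)" and "l = mS H RX M L" and "m = mB H RX M a" and "r = mS H RX M R"
 note defs = y1_def y2_def p_def l_def m_def r_def
 define y where "y = dg ?T y1 y2"
 let ?L = "mS H X M L" and ?b = "mA H X M b" and ?a = "mB H X M a" and ?R = "mS H X M R"
 let ?u = "chat H (X><M) (extL X M (almap X)) L"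
 have legs: "legs ?T [y1, y2, p, l, m, r]"
 unfolding defs by simp
 note [simp] = legs[simplified]
 have L: "legs ?T [y, p, l, m, r]"
 unfolding y_def by simp
 note [simp] = L[simplified]
 have u [simp]: "?u : Lin K ?T ?U" by simp
 have up: "?u (pt H ?W s (pt RX M (pt H X q x) n)) = pt H (X><M) (q##qalpha H##s) (pt X M x n)"
 if "s<:H" "q<:H" "x<:X" "n<:M" for s q x n
 using that by (simp add: extL_pure[where A = RX] lin_pure lmul_apply)
 have iU: "eqv ?T ?U ?u rh sg"
 if rh: "lact ?T rh" and sg: "lact ?U sg" and eq: "!!h s q x n. [|h<:H; s<:H; q<:H; x<:X; n<:M|]
 ==> ?u (rh h (pt H ?W s (pt RX M (pt H X q x) n))) = sg h (?u (pt H ?W s (pt RX M (pt H X q x) n)))" for rh sg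
 unfolding eqv_def
 proof (intro ballI)
 fix h t assume h: "h<:H" and t: "t<:?T"
 show "?u (rh h t) = sg h (?u t)"
 by (rule hopfL_pure_ext[OF _ linc[OF action_linear[OF rh h] u] linc[OF u action_linear[OF sg h]] t])
 (simp_all add: eq h)
 qed
 have ui: "eqv ?T ?U ?u y1 ?L" "eqv ?T ?U ?u y2 ?b" "eqv ?T ?U ?u m ?a" "eqv ?T ?U ?u r ?R"
 unfolding defs
 by (rule iU; simp add: up lmul_apply rmul_apply H.m_assoc lact_cl[of X] lact_cl[of M] del: chat_pure)+
 have uc: "equ ?T ?u (dg ?T p l) (triv ?T)"
 proof -
 have "eqv ?T ?U ?u (dg ?T p l) (triv ?U)"
 proof (rule iU)
 fix h s q x n assume [simp]: "h<:H" "s<:H" "q<:H" "x<:X" "n<:M"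
 let ?t = "pt H ?W s (pt RX M (pt H X q x) n)"
 have "?u (dg ?T p l h ?t) = sw ?U (comul H h) (%h1 h2. ?u (p h1 (l h2 ?t)))"
 by (rule un_triv_diag_aux) simp_all
 also have "... = pt H (X><M) (q##sw H (comul H h) (%h1 h2. S h1##qalpha H##h2)##s) (pt X M x n)"
 unfolding defs
 by (rule sw_H_lin[where u = "%z. pt H (X><M) (q##z##s) (pt X M x n)",
 OF linc[OF linc[OF H_mult_lin(2) H_mult_lin(1)] lin_pure(2)]])
 (simp_all add: up lmul_apply rmul_apply H.m_assoc del: chat_pure)
 finally show "?u (dg ?T p l h ?t) = triv ?U h (?u ?t)"
 by (simp add: antipode_alpha up triv_def H.smult_mult_left H.smult_mult_right
 linear_maps_smult[OF lin_pure(2)] del: chat_pure)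
 qed simp_all
 then show ?thesis
 using eqvD[OF eqv_triv[OF u]] by (simp add: equ_def eqv_def)
 qed
 have rW: "Lg RX M (ract X b) h t = dg ?W (dg ?W (Lg RX M (Lg H X L)) (Lg RX M (Rg H X b))) (Lg RX M (Lg H X R)) h t"
 if "h<:H" "t<:?W" for h t
 proof -
 have "dg ?W (dg ?W (Lg RX M (Lg H X L)) (Lg RX M (Rg H X b))) (Lg RX M (Lg H X R)) h t
 = dg ?W (Lg RX M (dg RX (Lg H X L) (Rg H X b))) (Lg RX M (Lg H X R)) h t"
 by (rule diag_cong) (simp_all add: that diag_legL)
 then show ?thesis
 using that by (simp add: diag_legL ract_def)
 qed
 have rT: "mA H RX M (ract X b) h t = dg ?T y p h t" if "h<:H" "t<:?T" for h t
 proof -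
 have "mA H RX M (ract X b) h t
 = Rg H ?W (dg ?W (dg ?W (Lg RX M (Lg H X L)) (Lg RX M (Rg H X b))) (Lg RX M (Lg H X R))) h t"
 by (rule legR_cong) (simp_all add: that rW)
 also have "... = dg ?T (Rg H ?W (dg ?W (Lg RX M (Lg H X L)) (Lg RX M (Rg H X b)))) p h t"
 unfolding p_def by (rule diag_legR[symmetric]) (simp_all add: that)
 also have "... = dg ?T y p h t"
 unfolding y_def y1_def y2_def by (rule diag_cong) (simp_all add: that diag_legR)
 finally show ?thesis .
 qed
 have ch: "chat H (X><M) (extL X M (theta X b)) L t = ?u (Ph ?T y p l t)" if t: "t<:?T" for t
 proof (rule hopfL_pure_ext[OF _ _ linc[OF op3_lin u] t])
 fix s q x n assume [simp]: "s<:H" "q<:H" "x<:X" "n<:M"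
 let ?i = "tmR H ?W (%r. pt RX M r n)" and ?j = "tmR H (X><M) (%x. pt X M x n)" and ?t = "pt H RX s (pt H X q x)"
 let ?V = "H><RX"
 have it: "pt H ?W s (pt RX M (pt H X q x) n) = ?i ?t"
 by (simp add: lin_pure)
 have "chat H (X><M) (extL X M (theta X b)) L (?i ?t) = ?j (chat H X (theta X b) L ?t)"
 by (rule chat_nat_r[where W = RX, symmetric]) (simp_all add: lin_pure extL_pure)
 moreover have "chat H X (theta X b) L ?t = evm H X L (Ph ?V (dg ?V (Rg H RX (Lg H X L)) (Rg H RX (Rg H X b)))
 (Rg H RX (Lg H X R)) (Lg H RX L) ?t)"
 by (simp add: chat_theta thetahat_def del: chat_pure)
 moreover have "?j (evm H X L t') = ?u (?i t')" if "t'<:?V" for t'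
 unfolding evm_def by (rule chat_nat_r[where W = RX]) (simp_all add: lin_pure extL_pure that)
 moreover have "?i (Ph ?V (dg ?V (Rg H RX (Lg H X L)) (Rg H RX (Rg H X b))) (Rg H RX (Lg H X R)) (Lg H RX L) ?t)
 = Ph ?T y p l (?i ?t)"
 unfolding y_def defs
 by (rule op3_nat)
 (simp_all add: lin_pure ten_map_eqv pure_eqv eqv_diag)
 ultimately show "chat H (X><M) (extL X M (theta X b)) L (pt H ?W s (pt RX M (pt H X q x) n))
 = ?u (Ph ?T y p l (pt H ?W s (pt RX M (pt H X q x) n)))"
 unfolding it by simp
 qed simp_all
 have e: "extR RX M (second M a M dM) w = extR RX M d w" if w: "w<:?W" for w
 unfolding extR_def by (rule sw_cong[OF _ M _ w]) (simp_all add: second_dl[OF M a d da coassoc counit])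
 have ed: "eqv ?W ?T (extR RX M d) (Lg RX M (Lg H X L)) y1" "eqv ?W ?T (extR RX M d) (Lg RX M (Rg H X b)) y2"
 "eqv ?W ?T (extR RX M d) (Lg RX M (Lg H X R)) p"
 unfolding defs by (simp_all add: ext_spec)
 have em: "eqv ?W ?T (extR RX M d) (Rg RX M a) (dg ?T (dg ?T l m) r)"
 proof (rule eqv_pure)
 fix h q n assume [simp]: "h<:H" "q<:RX" "n<:M"
 have dn: "d n<:(H><M)" by (rule lcl[OF d]) simp
 have "eqv (H><M) ?T (tmR H ?W (pt RX M q)) (ract M a) (dg ?T (dg ?T l m) r)"
 unfolding ract_def defs
 by (intro eqv_diag) (simp_all add: lin_pure ten_map_eqv pure_eqv)
 then show "extR RX M d (Rg RX M a h (pt RX M q n)) = dg ?T (dg ?T l m) r h (extR RX M d (pt RX M q n))"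
 by (simp add: extR_pure[where A = M] lact_cl[of M] eqvD[OF da] eqvD dn)
 qed simp_all
 let ?c = "Ph ?W (dg ?W (Lg RX M (Lg H X L)) (Lg RX M (Rg H X b))) (Lg RX M (Lg H X R)) (Rg RX M a)"
 have eq: "hopfL w = Ph ?U ?L ?b ?a (Phi ?U (dg ?U ?L ?b) ?a ?R (ct X M a d (?c w)))" if w [simp]: "w<:?W" for w
 proof -
 let ?t = "extR RX M d w"
 have t [simp]: "?t<:?T"
 by (rule lcl[OF extR_lin w]) simp_all
 have "hopfL w = Ph ?U ?L ?b ?a (chat H (X><M) (extL X M (theta X b)) L
 (Phi ?T (mA H RX M (ract X b)) l m (Phi ?T (mA H RX M (ract X b)) (dg ?T l m) r ?t)))"
 unfolding defs by (subst second_htens[OF _ _ _ _ _ _ _ _ fst1_kinds(2,1)]) (simp_all add: e)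
 also have "Phi ?T (mA H RX M (ract X b)) (dg ?T l m) r ?t = Phi ?T (dg ?T y p) (dg ?T l m) r ?t"
 by (rule op3_cong) (simp_all add: rT)
 also have "Phi ?T (mA H RX M (ract X b)) l m (Phi ?T (dg ?T y p) (dg ?T l m) r ?t)
 = Phi ?T (dg ?T y p) l m (Phi ?T (dg ?T y p) (dg ?T l m) r ?t)"
 by (rule op3_cong) (simp_all add: rT)
 also have "chat H (X><M) (extL X M (theta X b)) L (Phi ?T (dg ?T y p) l m (Phi ?T (dg ?T y p) (dg ?T l m) r ?t))
 = ?u (Ph ?T y p l (Phi ?T (dg ?T y p) l m (Phi ?T (dg ?T y p) (dg ?T l m) r ?t)))"
 by (rule ch) simp
 also have "... = ?u (Phi ?T y m r (Phi ?T p l m (Phi ?T p (dg ?T l m) r (Ph ?T y p (dg ?T (dg ?T l m) r) ?t))))"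
 by (rule hopf_l_coherence[where U = ?U]) (simp_all add: uc)
 also have "Ph ?T y p (dg ?T (dg ?T l m) r) ?t = extR RX M d (?c w)"
 unfolding y_def by (rule op3_nat[symmetric]) (simp_all add: ed em eqv_diag)
 also have "?u (Phi ?T y m r (Phi ?T p l m (Phi ?T p (dg ?T l m) r (extR RX M d (?c w)))))
 = Phi ?U (dg ?U ?L ?b) ?a ?R (?u (Phi ?T p l m (Phi ?T p (dg ?T l m) r (extR RX M d (?c w)))))"
 proof -
 have "extR RX M d (?c w)<:?T"
 by (rule lcl[OF extR_lin[where A = M and B = RX and C = M]]) simp_all
 then show ?thesis
 unfolding y_def by (intro op3_nat) (simp_all add: ui eqv_diag)
 qed
 also have "?u (Phi ?T p l m (Phi ?T p (dg ?T l m) r (extR RX M d (?c w)))) = ct X M a d (?c w)"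
 unfolding defs by (rule ct_alt) simp
 finally show ?thesis .
 qed
 have lU: "legs ?U [?L, ?b, ?a]" "legs ?U [dg ?U ?L ?b, ?a, ?R]"
 and lW: "legs ?W [dg ?W (Lg RX M (Lg H X L)) (Lg RX M (Rg H X b)), Lg RX M (Lg H X R), Rg RX M a]"
 by simp_all
 have "hopfL : Lin K ?W ?U"
 by (rule second_lin[OF _ _ _ _ htens_fst1_k[OF _ _ _ _ _ _ _ _ fst1_kinds(2,1)]]) simp_all
 from lbij_cong[OF lbij_comp[OF lbij_comp[OF lbij_comp[OF lbij_op3(1)[OF _ lW] lbij_ct] lbij_op3(2)[OF _ lU(2)]]
 lbij_op3(1)[OF _ lU(1)]] eq this]
 show ?thesis by simp
qed

end

end

section \<open>Identifying the objects of the statement\<close>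

text \<open>The constructions on records only see the module fields of their arguments.\<close>

definition same_module :: "('k, 'a, 'm) module_scheme => ('k, 'a, 'n) module_scheme => bool" where
 "same_module V A \<longleftrightarrow> module.truncate V = module.truncate A"

lemma sm_mod_refl [simp]: "same_module V V"
 by (simp add: same_module_def)

lemma sm_mod_fl:
 assumes "same_module V A"
 shows "carrier V = carrier A" "mult V = mult A" "one V = one A" "zero V = zero A" "add V = add A" "smult V = smult A"
 using assms by (simp_all add: same_module_def module.defs)

lemma ten_rel_mono:
 assumes "(xs, ys) \<in> tensor_rel K V W" "same_module V A" "same_module W B"
 shows "(xs, ys) \<in> tensor_rel K A B"
 using assms(1)
proof induction
 case (sym xs ys)
 show ?case by (rule tensor_rel.sym[OF sym.IH])
next
 case (trans xs ys zs)
 show ?case by (rule tensor_rel.trans[OF trans.IH])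
next
 case (cong xs xs' ys ys')
 show ?case by (rule tensor_rel.cong[OF cong.IH])
qed (simp_all add: sm_mod_fl[OF assms(2)] sm_mod_fl[OF assms(3)] tensor_rel.refl tensor_rel.comm
 tensor_rel.add_left tensor_rel.add_right tensor_rel.smult tensor_rel.zero)

lemma sm_mod_ten_rel:
 assumes "same_module V A" "same_module W B"
 shows "tensor_rel K V W = tensor_rel K A B"
proof -
 have "same_module A V" "same_module B W"
 using assms by (simp_all add: same_module_def)
 then show ?thesis
 using ten_rel_mono[OF _ assms] ten_rel_mono[where V = A and A = V and W = B and B = W] by (intro equalityI subrelI)
qed

lemma sm_mod_ten:
 assumes "same_module V A" "same_module W B"
 shows "tp K V W = tp K A B" "pu K V W = pu K A B"
 "tm K V W = tm K A B"
proof -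
 note [simp] = sm_mod_fl[OF assms(1)] sm_mod_fl[OF assms(2)] sm_mod_ten_rel[OF assms]
 have [simp]: "tensor_class K V W = tensor_class K A B"
 by (rule ext) (simp add: tensor_class_def)
 show [simp]: "pu K V W = pu K A B"
 by (intro ext) (simp add: pure_tensor_def)
 show [simp]: "tp K V W = tp K A B"
 by (simp add: tensor_prod_def)
 show "tm K V W = tm K A B"
 by (intro ext) (simp add: tensor_map_def)
qed

lemma sm_mod_lin_mp:
 "[|same_module V A; same_module W B|] ==> Lin K V W = Lin K A B"
 by (simp add: linear_maps_def sm_mod_fl[of V A] sm_mod_fl[of W B])

lemma sm_mod_sw: "same_module V A ==> sw V = sw A"
 by (intro ext) (simp add: sw_def sm_mod_fl[of V A])

lemma sm_mod_objects:
 "same_module (forget M) M"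
 "same_module (hmod_tensor K H V W) (tp K V W)"
 "same_module (yd_tensor K H V' W') (tp K V' W')"
 "same_module (R_obj K H U) (tp K H U)"
 by (simp_all add: same_module_def forget_def hmod_tensor_def yd_tensor_def R_obj_def hmod.defs ydmod.defs module.defs)

lemma object_fl:
 "act (forget M) = act M"
 "act (hmod_tensor K H V W) = (%h x. sw (tp K V W) (comul H h)
 (%h1 h2. tm K V W (act V h1) (act W h2) x))"
 "act (yd_tensor K H V' W') = act (hmod_tensor K H V' W')"
 "coact (yd_tensor K H V' W') = (%t. let HVW = tp K H (tp K V' W') in
 sw HVW (pR K H) (%p1 p2. sw HVW (tensor_coact1 K H V' W' (act (hmod_tensor K H V' W') p1 t)) (%a u.
 pu K H (tp K V' W') (a .[H] p2) u)))"
 "act (R_obj K H U) = (%h x. sw (tp K H U) x (adj_tensor K H U h))"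
 "coact (R_obj K H U) = (%x. sw (tp K H (tp K H U)) x (omega_tensor K H U))"
 by (simp_all add: forget_def hmod_tensor_def yd_tensor_def R_obj_def hmod.defs ydmod.defs module.defs)

lemma sm_mod_trans: "[|same_module U V; same_module V W|] ==> same_module U W"
 by (simp add: same_module_def)

section \<open>Models of the objects in the statement\<close>

context quasi_hopf_algebra
begin

text \<open>\<open>V\<close> is a record such as \<open>hmod_tensor\<close> or \<open>R_obj\<close>
  produces. The model replaces it by a plain tensor product with an action built from legs, which
  agrees with that of \<open>V\<close> on the carrier.\<close>

definition hmod_model :: "('k, 'h, 'v, 'z) hmod_scheme => ('k, 'v, 'm) module_scheme => ('h => 'v => 'v) => bool" where
 "hmod_model V A a \<longleftrightarrow> same_module V A \<and> module K A \<and> lact A a \<and> (\<forall>h \<in> carrier H. \<forall>v \<in> carrier A. act V h v = a h v)"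

definition ydmod_model :: "('k, 'h, 'v) ydmod => ('k, 'v, 'm) module_scheme => ('h => 'v => 'v)
 => ('v => ('h, 'v) tensor) => bool" where
 "ydmod_model V A a d \<longleftrightarrow> hmod_model V A a \<and> d : Lin K A (H><A) \<and> (\<forall>v \<in> carrier A. coact V v = d v)"

lemma hmod_modelD:
 assumes "hmod_model V A a"
 shows "same_module V A" "md K A" "lact A a" "[|h<:H; v<:A|] ==> act V h v = a h v"
 using assms by (simp_all add: hmod_model_def)

lemma ydmod_modelD:
 assumes "ydmod_model V A a d"
 shows "hmod_model V A a" "d : Lin K A (H><A)" "v<:A ==> coact V v = d v"
 using assms by (simp_all add: ydmod_model_def)

lemma lact_act:
 assumes "left_module K H V"
 shows "lact V (act V)"
proof -
 interpret left_module K H V by fact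
 show ?thesis
 by (auto simp: action_def act_mult act_one intro!: bilinI lin_mapsI act_closed act_add_left act_add_right
 act_smult_left act_smult_right)
qed

lemma hmod_model_refl: "left_module K H V ==> hmod_model V V (act V)"
 by (simp add: hmod_model_def lact_act left_module.module)

lemma ydmod_model_refl: "yd_module K H M ==> ydmod_model M M (act M) (coact M)"
 by (simp add: ydmod_model_def hmod_model_refl yd_module.axioms(1) yd_module.coact_linear)

lemma hmod_model_forget:
 assumes "hmod_model M A a"
 shows "hmod_model (forget M) A a"
 using assms sm_mod_trans[OF sm_mod_objects(1)[of M], of A] by (simp add: hmod_model_def object_fl)

lemma lact_cong:
 assumes "md K V" "lact V b" and eq: "!!h v. [|h<:H; v<:V|] ==> b' h v = b h v"
 shows "lact V b'"
proof -
 have "b' h : Lin K V V" if "h<:H" for h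
 by (rule lin_mp_cong[OF action_linear[OF assms(2) that] assms(1)]) (simp add: eq that)
 moreover have "(%h. b' h v) : Lin K H V" if "v<:V" for v
 by (rule lin_mp_cong[OF lact_orbit_lin[OF assms(2) that] mod_H]) (simp add: eq that)
 ultimately have "bilin K H V V b'"
 by (simp add: bilin_def)
 then show ?thesis
 using assms(2) by (auto simp: action_def eq lact_cl[OF assms(2)])
qed

lemma hmod_model_ten:
 assumes V: "hmod_model V A a" and W: "hmod_model W B b"
 shows "hmod_model (hmod_tensor K H V W) (A><B) (dact A a B b)"
proof -
 note s = hmod_modelD(1)[OF V] hmod_modelD(1)[OF W]
 note [simp] = hmod_modelD(2,3)[OF V] hmod_modelD(2,3)[OF W] sm_mod_ten[OF s]
 have "act (hmod_tensor K H V W) h t = dact A a B b h t" if h: "h<:H" and t: "t<:(A><B)" for h t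
 proof -
 have "tm K A B (act V p) (act W q) t = Lg A B a p (Rg A B b q t)" if [simp]: "p<:H" "q<:H" for p q
 proof -
 have legs: "lact (A><B) (Lg A B a)" "lact (A><B) (Rg A B b)"
 by simp_all
 have l [simp]: "a p : Lin K A A" "b q : Lin K B B"
 using that by (auto intro: action_linear[OF hmod_modelD(3)[OF V]] action_linear[OF hmod_modelD(3)[OF W]])
 have "tm K A B (act V p) (act W q) t = tm K A B (a p) (b q) t"
 by (rule ten_map_cong[OF _ _ _ _ _ _ t]) (simp_all add: hmod_modelD(4)[OF V] hmod_modelD(4)[OF W])
 also have "... = Lg A B a p (Rg A B b q t)"
 by (rule ext_pure[OF _ _ _ tm_simps(1) linc[OF action_linear[OF legs(2)] action_linear[OF legs(1)]] t])
 (simp_all add: lact_cl[of A] lact_cl[of B])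
 finally show ?thesis .
 qed
 then have "sw (A><B) (comul H h) (%p q. tm K A B (act V p) (act W q) t)
 = sw (A><B) (comul H h) (%p q. Lg A B a p (Rg A B b q t))"
 by (intro sw_cong[OF mod_H mod_H _ De_cl[OF h]])
 then show ?thesis
 by (simp add: object_fl diag_sw)
 qed
 then show ?thesis
 using sm_mod_objects(2)[of K H V W] by (simp add: hmod_model_def)
qed

end

lemma sm_mod_mod:
 assumes "same_module V A" "md K A"
 shows "md K V"
proof -
 have "md K V \<longleftrightarrow> module K A"
 unfolding module_def module_axioms_def abelian_group_def abelian_group_axioms_def abelian_monoid_def
 comm_group_def group_def group_axioms_def comm_monoid_def comm_monoid_axioms_def monoid_def Units_def
 by (simp only: sm_mod_fl[OF assms(1)] monoid.select_convs partial_object.select_convs)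
 with assms(2) show ?thesis by simp
qed

lemma sm_mod_legs:
 assumes "same_module V A" "same_module W B"
 shows "legL K V W = legL K A B" "legR K V W = legR K A B"
 by (simp_all add: legL_def[abs_def] legR_def[abs_def] sm_mod_ten[OF assms])

context quasi_hopf_algebra
begin

lemma nabla_cong:
 assumes [simp]: "md K V" "lact V b" "lact V b'"
 and eq: "!!h v. [|h<:H; v<:V|] ==> b h v = b' h v" and r [simp]: "r<:(H><V)"
 shows "nabla V b r = nabla V b' r"
proof -
 let ?HV = "H><V"
 let ?T = "H><?HV"
 let ?p = "Lg H ?HV L" and ?q = "Rg H ?HV (Lg H V L)" and ?q' = "Rg H ?HV (Lg H V R)" and ?p' = "Lg H ?HV R"
 let ?c = "%b. Rg H ?HV (Rg H V b)"
 have c0: "Rg H V b h t = Rg H V b' h t" if "h<:H" "t<:?HV" for h t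
 by (rule legR_cong) (simp_all add: that eq)
 have c: "?c b h t = ?c b' h t" if "h<:H" "t<:?T" for h t
 by (rule legR_cong) (simp_all add: that c0)
 have qc: "dg ?T ?q (?c b) h t = dg ?T ?q (?c b') h t" if "h<:H" "t<:?T" for h t
 by (rule diag_cong) (simp_all add: that c)
 have pqc: "dg ?T ?p (dg ?T ?q (?c b)) h t = dg ?T ?p (dg ?T ?q (?c b')) h t" if "h<:H" "t<:?T" for h t
 by (rule diag_cong) (simp_all add: that qc)
 have d [simp]: "dup V r<:?T"
 by (rule lcl[OF dup_lin]) simp_all
 have "Ph ?T ?p ?q (?c b) (dup V r) = Ph ?T ?p ?q (?c b') (dup V r)"
 by (rule op3_cong) (simp_all add: c)
 moreover have "Phi ?T (dg ?T ?p (dg ?T ?q (?c b))) ?q' ?p' t = Phi ?T (dg ?T ?p (dg ?T ?q (?c b'))) ?q' ?p' t"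
 if "t<:?T" for t
 by (rule op3_cong) (simp_all add: pqc that)
 moreover have "Ph ?T ?p (dg ?T ?q (?c b)) ?q' t = Ph ?T ?p (dg ?T ?q (?c b')) ?q' t" if "t<:?T" for t
 by (rule op3_cong) (simp_all add: qc that)
 ultimately show ?thesis
 by (simp add: nabla_def Let_def)
qed

text \<open>The adjoint action is the iterated coproduct read through three legs, and the coaction
  with \<omega> is identified by \<open>omega_ten_nabla\<close>.\<close>

lemma ydmod_model_R_obj:
 assumes V: "hmod_model V A a"
 shows "ydmod_model (R_obj K H V) (H><A) (ract A a) (nabla A a)"
proof -
 note s = hmod_modelD(1)[OF V]
 note [simp] = hmod_modelD(2,3)[OF V] sm_mod_ten[OF sm_mod_refl s] sm_mod_legs[OF sm_mod_refl s]
 have V' [simp]: "md K V"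
 by (rule sm_mod_mod[OF s]) simp
 have act [simp]: "lact A (act V)"
 by (rule lact_cong[of A a]) (simp_all add: hmod_modelD(4)[OF V])
 have lV [simp]: "lact V (act V)"
 using act by (simp only: action_def bilin_def sm_mod_fl[OF s] sm_mod_lin_mp[OF s s]
 sm_mod_lin_mp[OF sm_mod_refl s] sm_mod_lin_mp[OF s sm_mod_refl])
 have "act (R_obj K H V) h x = ract A a h x" if h [simp]: "h<:H" and x: "x<:(H><A)" for h x
 proof -
 have ra: "lact (H><A) (ract A a)" by simp
 have "adj_tensor K H V h p v = ract A a h (pt H A p v)" if [simp]: "p<:H" "v<:A" for p v
 proof -
 have "ract A a h (pt H A p v) = sw3 (H><A) (iterated_comul K H h) (%p' q r. Lg H A L p' (Rg H A a q (Lg H A R r (pt H A p v))))"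
 proof -
 have "ract A a h (pt H A p v) = op3 (H><A) (iterated_comul K H h) (Lg H A L) (Rg H A a) (Lg H A R) (pt H A p v)"
 unfolding ract_def by (rule op3_it_De[symmetric]) simp_all
 also have "... = sw3 (H><A) (iterated_comul K H h) (%p' q r. Lg H A L p' (Rg H A a q (Lg H A R r (pt H A p v))))"
 by (rule op3_sw3) (simp_all add: it_De_cl[OF mod_H, OF h])
 finally show ?thesis .
 qed
 also have "... = adj_tensor K H V h p v"
 unfolding adj_tensor_def
 by (simp, rule sw3_cong) (simp_all add: lmul_apply rmul_apply lact_cl[of A] hmod_modelD(4)[OF V] H.m_assoc it_De_cl[OF mod_H])
 finally show ?thesis ..
 qed
 then show ?thesis
 unfolding object_fl by (simp, intro sw_eqI[OF _ _ _ action_linear[OF ra h] _ x]) simp_all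
 qed
 moreover have "coact (R_obj K H V) x = nabla A a x" if x: "x<:(H><A)" for x
 proof -
 have "nabla V b = nabla A b" for b
 by (intro ext) (simp add: nabla_def dup_def ins_def Let_def)
 then have "omega_tensor K H V p v = nabla A a (pt H A p v)" if [simp]: "p<:H" "v<:A" for p v
 using omega_ten_nabla[of V p v] nabla_cong[of A "act V" a "pt H A p v"]
 by (simp add: sm_mod_fl(1)[OF s] hmod_modelD(4)[OF V])
 then show ?thesis
 unfolding object_fl by (simp, intro sw_eqI[OF _ _ _ nabla_lin _ x]) simp_all
 qed
 moreover have "same_module (R_obj K H V) (H><A)"
 using sm_mod_objects(4)[of K H V] by simp
 ultimately show ?thesis
 by (simp add: ydmod_model_def hmod_model_def)
qed

section \<open>The coaction formulas with \<open>qR\<close> and \<open>pR\<close>\<close>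

lemma evm_pure_gen:
 assumes [simp]: "md K V" "x<:H" and y: "y<:(H><V)"
 shows "evm H V L (pt H (H><V) x y) = tmL H V (%a. a##(qalpha H##x)) y"
 by (rule ext_pure[OF _ _ _ linc[OF lin_pure(1) evm_lin] tm_simps(1) y])
 (simp_all add: lmul_apply H.m_assoc)

lemma antipode_inv:
 assumes "bijective_antipode H" "h<:H"
 shows "antipode_inv H h<:H" "S (antipode_inv H h) = h"
 using assms unfolding bijective_antipode_def antipode_inv_def
 by (auto simp: bij_betw_def intro!: inv_into_into f_inv_into_f)

text \<open>The inverse antipode in \<open>qR\<close> is followed by S in the coaction:
  \<open>S (antipode_inv H (qalpha H##r)##q)\<close> is \<open>S q##(qalpha H##r)\<close>. This is
  the evaluation that defines \<open>theta\<close>, while \<Delta> of the first component gives its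
  remaining leg.\<close>

lemma coact1_theta:
 assumes bij: "bijective_antipode H" and V: "ydmod_model V A a d" and v [simp]: "v<:A"
 shows "coact1 K H V v = theta A a (d v)"
proof -
 note hV = ydmod_modelD(1)[OF V]
 note [simp] = hmod_modelD(2,3)[OF hV] sm_mod_ten[OF sm_mod_refl hmod_modelD(1)[OF hV]]
 lcl[OF ydmod_modelD(2)[OF V]] ydmod_modelD(3)[OF V]
 let ?U = "H><A" and ?T = "H><(H><A)"
 let ?D = "dg ?U (Lg H A L) (Rg H A a)"
 let ?p = "Rg H ?U (Lg H A L)" and ?q = "Rg H ?U (Rg H A a)" and ?p' = "Rg H ?U (Lg H A R)" and ?z = "Lg H ?U L"
 let ?g = "%x c. sw ?U (d v) (%p u. pt H A (x##p##c) u)"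
 have rl [simp]: "(%c. tmL H A (%p. p##S c) r) : Lin K H ?U" if "r<:?U" for r
 proof -
 have "bilin K H H H (%c p. p##S c)"
 by (rule bil_flip[OF bil_comp_args[OF alg_mult_bil[OF alg_H] lin_mp_id antipode_linear]])
 from bilin_left[OF tmL_bil[OF _ _ _ _ this] that] show ?thesis by simp
 qed
 have D [simp]: "lact ?U ?D" by simp
 have inner: "sw ?U (d v) (%p u. pt H A (q11##p##S q2) (act V q12 u))
 = Lg H A L q11 (Rg H A a q12 (tmL H A (%p. p##S q2) (d v)))"
 if [simp]: "q11<:H" "q12<:H" "q2<:H" for q11 q12 q2
 proof (rule sw_eqI)
 have l: "lact ?U (Lg H A L)" "lact ?U (Rg H A a)" by simp_all
 show "(%r. Lg H A L q11 (Rg H A a q12 (tmL H A (%p. p##S q2) r))) : Lin K ?U ?U"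
 by (rule linc[OF linc[OF tm_simps(1) action_linear[OF l(2)]] action_linear[OF l(1)]]) simp_all
 qed (simp_all add: lmul_apply lact_cl[of A] hmod_modelD(4)[OF hV] H.m_assoc)
 have tl [simp]: "tmL H A (%p. p##c) r<:?U" if "r<:?U" "c<:H" for c r
 by (rule lcl[OF tm_simps(1) that(1)]) (simp_all add: that)
 have mid: "sw ?U (comul H q1) (%q11 q12. sw ?U (d v) (%p u. pt H A (q11##p##S q2) (act V q12 u)))
 = ?D q1 (tmL H A (%p. p##S q2) (d v))" if [simp]: "q1<:H" "q2<:H" for q1 q2
 proof -
 have "?D q1 (tmL H A (%p. p##S q2) (d v)) = sw ?U (comul H q1) (%p q. Lg H A L p (Rg H A a q (tmL H A (%p. p##S q2) (d v))))"
 by (simp add: diag_sw)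
 also have "... = sw ?U (comul H q1) (%q11 q12. sw ?U (d v) (%p u. pt H A (q11##p##S q2) (act V q12 u)))"
 by (rule sw_cong[OF mod_H mod_H]) (simp_all add: inner)
 finally show ?thesis ..
 qed
 define F where "F x = sw ?U x (%q1 q2. ?D q1 (tmL H A (%p. p##S q2) (d v)))" for x
 have bil: "bilin K H H ?U (%q1 q2. ?D q1 (tmL H A (%p. p##S q2) (d v)))"
 by (rule bil_comp_args[OF action_bilin[OF D] lin_mp_id rl]) simp
 have F [simp]: "F : Lin K HH ?U"
 unfolding F_def[abs_def] by (rule sw_lin[OF mod_H mod_H _ bil]) simp
 have Fp: "F (t2 K H q1 q2) = ?D q1 (tmL H A (%p. p##S q2) (d v))" if "q1<:H" "q2<:H" for q1 q2
 unfolding F_def by (rule sw_pure[OF mod_H mod_H _ bil that]) simp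
 have cl: "t2 K H p (antipode_inv H (qalpha H##r)##q)<:HH"
 if "p<:H" "q<:H" "r<:H" for p q r
 using that antipode_inv[OF bij] by simp
 have qR: "qR K H<:HH"
 unfolding qR_def by (rule sw3_cl) (simp_all add: cl)
 have "coact1 K H V v = F (qR K H)"
 unfolding coact1_def Let_def
 by (simp, rule sw_eqI[OF mod_H mod_H _ F _ qR]) (simp_all add: mid Fp)
 also have "... = sw3 ?U (reassoc H) (%p q r. F (t2 K H p (antipode_inv H (qalpha H##r)##q)))"
 unfolding qR_def by (rule sw3_lin_im) (simp_all add: cl)
 also have "... = sw3 ?U (reassoc H) (%p q r. evm H A L (dg ?T ?p ?q p (?p' q (?z r (pt H ?U 1[H] (d v))))))"
 proof (rule sw3_cong)
 fix p q r assume [simp]: "p<:H" "q<:H" "r<:H"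
 let ?y = "antipode_inv H (qalpha H##r)"
 have [simp]: "?y<:H" "S (?y##q) = S q##(qalpha H##r)"
 by (simp_all add: antipode_inv[OF bij] antipode_mult)
 have lR: "Lg H A R q s<:?U" if "s<:?U" for s
 proof -
 have "lact ?U (Lg H A R)" by simp
 from lcl[OF action_linear[OF this] that] show ?thesis by simp
 qed
 have eq: "tmL H A (%a. a##(qalpha H##r)) (Lg H A R q s) = tmL H A (%p. p##S (?y##q)) s" if s: "s<:?U" for s
 proof (rule ext_pure[OF mod_H _ _ linc[OF _ tm_simps(1)] tm_simps(1) s])
 have "lact ?U (Lg H A R)" by simp
 from action_linear[OF this] show "(%s. Lg H A R q s) : Lin K ?U ?U" by simp
 qed (simp_all add: rmul_apply H.m_assoc)
 have "evm H A L (dg ?T ?p ?q p (?p' q (?z r (pt H ?U 1[H] (d v)))))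
 = evm H A L (dg ?T ?p ?q p (pt H ?U r (Lg H A R q (d v))))"
 by (simp add: lmul_apply lR)
 also have "... = ?D p (evm H A L (pt H ?U r (Lg H A R q (d v))))"
 by (rule eqvD[OF eqv_diag[OF _ _ _ _ _ evm_eqv_mult evm_eqv_r]]) (simp_all add: lR)
 also have "... = ?D p (tmL H A (%p. p##S (?y##q)) (d v))"
 by (simp only: evm_pure_gen[OF _ _ lR] eq hmod_modelD(2)[OF hV] \<open>r<:H\<close> lcl[OF ydmod_modelD(2)[OF V] v])
 finally show "F (t2 K H p (?y##q)) = evm H A L (dg ?T ?p ?q p (?p' q (?z r (pt H ?U 1[H] (d v)))))"
 by (simp add: Fp del: \<open>S (?y##q) = S q##(qalpha H##r)\<close>)
 qed simp
 also have "... = evm H A L (sw3 ?T (reassoc H) (%p q r. dg ?T ?p ?q p (?p' q (?z r (pt H ?U 1[H] (d v))))))"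
 by (rule sw3_lin_im[symmetric]) (simp_all add: lact_cl[of ?T] lact_cl[of ?U] lmul_apply)
 also have "... = theta A a (d v)"
 by (simp add: theta_def thetahat_def op3_sw3)
 finally show ?thesis .
qed

end

context quasi_hopf_algebra
begin

text \<open>The second component of \<open>pR\<close> is the \<beta> of the inserted coevaluation
  with its two legs already applied, and the first component is the leg \<open>a\<close>.\<close>

lemma second_pR:
 assumes [simp]: "md K W" "md K V" "lact W a" and g [simp]: "g : Lin K W (H><V)"
 and w [simp]: "w<:W"
 shows "sw (H><V) (pR K H) (%p q. tmL H V (%x. x##q) (g (a p w))) = second W a V g w"
proof -
 define F where "F x = chat H V g L (sw (H><W) x (%p q. pt H W q (a p w)))" for x
 have bil: "bilin K H H (H><W) (%p q. pt H W q (a p w))"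
 by (rule bil_flip[OF bil_comp_args[OF pure_ten_bil lin_mp_id lact_orbit_lin]]) simp_all
 have F [simp]: "F : Lin K HH (H><V)"
 unfolding F_def[abs_def] by (rule linc[OF sw_lin[OF mod_H mod_H _ bil] chat_lin]) simp_all
 have Fp: "F (t2 K H p q) = chat H V g L (pt H W q (a p w))" if "p<:H" "q<:H" for p q
 unfolding F_def using that by (simp add: sw_pure[OF mod_H mod_H _ bil] del: chat_pure)
 have pR: "pR K H<:HH"
 unfolding pR_def by (rule sw3_cl) simp_all
 have "sw (H><V) (pR K H) (%p q. tmL H V (%x. x##q) (g (a p w))) = F (pR K H)"
 by (rule sw_eqI[OF mod_H mod_H _ F _ pR]) (simp_all add: Fp lact_cl[of W] lmul_def)
 also have "... = sw3 (H><V) (reassoc_inv K H) (%x y z. F (t2 K H x (y##qbeta H##S z)))"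
 unfolding pR_def by (rule sw3_lin_im) simp_all
 also have "... = sw3 (H><V) (reassoc_inv K H) (%x y z. chat H V g L
 (Rg H W a x (Lg H W L y (Lg H W R z (pt H W (qbeta H) w)))))"
 by (rule sw3_cong) (simp_all add: Fp lmul_apply rmul_apply H.m_assoc lact_cl[of W] del: chat_pure)
 also have "... = second W a V g w"
 unfolding second_def
 by (simp add: op3_sw3, rule sw3_lin_im[symmetric])
 (simp_all add: lmul_apply rmul_apply lact_cl[of W])
 finally show ?thesis .
qed

text \<open>The two coactions enter a sum over their components independently of the order of summation.\<close>

lemma sw_two_coactions:
 assumes [simp]: "md K A" "md K B" "md K U"
 and X [simp]: "X : Lin K (H><(A><B)) U"
 and r' [simp]: "r'<:(H><A)" and r [simp]: "r<:(H><B)"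
 shows "sw U r' (%p v. sw U r (%q w. X (pt H (A><B) (p##q) (pt A B v w))))
 = X (chat H (A><B) (%w. tmR H (A><B) (%v. pt A B v w) r') L r)"
proof -
 let ?T = "H><(A><B)"
 have gb: "bilin K B (H><A) ?T (%w. tmR H (A><B) (%v. pt A B v w))"
 by (rule tmR_bil[OF _ _ _ _ bil_flip[OF pure_ten_bil]]) simp_all
 have g [simp]: "(%w. tmR H (A><B) (%v. pt A B v w) s) : Lin K B ?T" if "s<:(H><A)" for s
 by (rule bilin_left[OF gb that])
 have inner: "sw U r (%q w. X (pt H (A><B) (p##q) (pt A B v w)))
 = X (chat H (A><B) (%w. tmR H (A><B) (%v. pt A B v w) (pt H A p v)) L r)"
 if [simp]: "p<:H" "v<:A" for p v
 by (rule sw_eqI[OF mod_H _ _ linc[OF chat_lin X] _ r]) (simp_all add: lmul_apply lin_pure)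
 have "(%s. chat H (A><B) (%w. tmR H (A><B) (%v. pt A B v w) s) L r) : Lin K (H><A) ?T"
 unfolding chat_def
 proof (rule sw_lin_par[OF mod_H assms(2) _ _ _ _ r])
 fix s assume [simp]: "s<:(H><A)"
 show "bilin K H B ?T (%h w. tmL H (A><B) (%x. L x h) (tmR H (A><B) (%v. pt A B v w) s))"
 by (rule chat_bil) simp_all
 next
 fix h w assume [simp]: "h<:H" "w<:B"
 show "(%s. tmL H (A><B) (%x. L x h) (tmR H (A><B) (%v. pt A B v w) s)) : Lin K (H><A) ?T"
 by (rule linc[OF tm_simps(1) tm_simps(1)]) (simp_all add: lin_pure)
 qed simp_all
 from sw_eqI[OF mod_H assms(1,3) linc[OF this X] _ r'] inner show ?thesis
 by simp
qed

context
 fixes A :: "('k, 'a, 'q) module_scheme" and B :: "('k, 'b, 'm) module_scheme"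
 and a :: "'h => 'a => 'a" and b :: "'h => 'b => 'b" and d :: "'a => ('h, 'a) tensor" and e :: "'b => ('h, 'b) tensor"
 and V :: "('k, 'h, 'a) ydmod" and W :: "('k, 'h, 'b) ydmod"
 assumes bij: "bijective_antipode H" and V: "ydmod_model V A a d" and W: "ydmod_model W B b e"
 and gA: "first_kind A a A a (%x. theta A a (d x))" and gB: "first_kind B b B b (%x. theta B b (e x))"
begin

text \<open>The copies \<open>z\<close>, \<open>y\<close>, \<open>x\<close> of the reassociator and
  its inverse are the three associators of \<open>tcomp\<close>, in the order in which they
  act.\<close>

lemma ten_coact1_htens:
 assumes t: "t<:(A><B)"
 shows "tensor_coact1 K H V W t
 = htens A a A a (%x. theta A a (d x)) B b B b (%x. theta B b (e x)) t"
proof -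
 note hV = ydmod_modelD(1)[OF V] and hW = ydmod_modelD(1)[OF W]
 define gA gB where "gA x = theta A a (d x)" and "gB y = theta B b (e y)" for x y
 note fk = gA[folded gA_def[abs_def]] gB[folded gB_def[abs_def]]
 note [simp] = hmod_modelD(2,3)[OF hV] hmod_modelD(2,3)[OF hW]
 sm_mod_ten[OF hmod_modelD(1)[OF hV] hmod_modelD(1)[OF hW]]
 fst1_k_lin[OF fk(1)] fst1_k_lin[OF fk(2)]
 coact1_theta[OF bij V, folded gA_def] coact1_theta[OF bij W, folded gB_def]
 lact_cl[OF hmod_modelD(3)[OF hV]] lact_cl[OF hmod_modelD(3)[OF hW]]
 hmod_modelD(4)[OF hV] hmod_modelD(4)[OF hW]
 have gcl [simp]: "gA x<:(H><A)" if "x<:A" for x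
 by (rule lcl[OF fst1_k_lin[OF fk(1)] that])
 have gcl' [simp]: "gB x<:(H><B)" if "x<:B" for x
 by (rule lcl[OF fst1_k_lin[OF fk(2)] that])
 let ?AB = "A><B"
 let ?T = "H><?AB"
 let ?s = "mS H A B L" and ?a = "mA H A B a" and ?b = "mB H A B b"
 let ?G = "chat H ?AB (extL A B gA) L" and ?E = "chat H ?AB (extR A B gB) L"
 have lac: "lact ?T ?s" "lact ?T ?a" "lact ?T ?b" by simp_all
 note lin = action_linear[OF lac(1)] action_linear[OF lac(2)] action_linear[OF lac(3)]
 note cl [simp] = lact_cl[OF lac(1)] lact_cl[OF lac(2)] lact_cl[OF lac(3)]
 have G: "?G : Lin K ?T ?T" and E: "?E : Lin K ?T ?T" by simp_all
 note [simp] = lcl[OF G] lcl[OF E]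
 have "htens A a A a gA B b B b gB : Lin K ?AB ?T"
 by (rule htens_lin[OF _ _ _ _ _ _ _ _ fk]) simp_all
 then show ?thesis
 unfolding tensor_coact1_def Let_def gA_def[abs_def, symmetric] gB_def[abs_def, symmetric]
 proof (simp, intro sw_eqI[OF hmod_modelD(2)[OF hV] hmod_modelD(2)[OF hW] _ _ _ t])
 fix v w assume [simp]: "v<:A" "w<:B"
 let ?t0 = "pt H ?AB 1[H] (pt A B v w)"
 let ?X = "%x1 x2 x3 u. ?s x1 (?a x2 (?b x3 u))" and ?Y = "%y1 y2 y3 u. ?a y1 (?s y2 (?b y3 u))"
 and ?Z = "%z1 z2 z3 u. ?a z1 (?b z2 (?s z3 u))"
 have X: "?X x1 x2 x3 : Lin K ?T ?T" if "x1<:H" "x2<:H" "x3<:H" for x1 x2 x3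
 by (rule linc[OF linc[OF lin(3) lin(2)] lin(1)]) (simp_all add: that)
 have Y: "?Y x1 x2 x3 : Lin K ?T ?T" if "x1<:H" "x2<:H" "x3<:H" for x1 x2 x3
 by (rule linc[OF linc[OF lin(3) lin(1)] lin(2)]) (simp_all add: that)
 have XG: "(%u. ?X x1 x2 x3 (?G u)) : Lin K ?T ?T" if "x1<:H" "x2<:H" "x3<:H" for x1 x2 x3
 by (rule linc[OF G X[OF that]])
 have XGYE: "(%u. ?X x1 x2 x3 (?G (?Y y1 y2 y3 (?E u)))) : Lin K ?T ?T"
 if "x1<:H" "x2<:H" "x3<:H" "y1<:H" "y2<:H" "y3<:H"
 for x1 x2 x3 y1 y2 y3
 by (rule linc[OF linc[OF E Y] XG]) (simp_all add: that)
 \<comment> \<open>For fixed components of the three reassociators, the double sum over both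
   coactions is a composite of single legs and the two half-braidings.\<close>
 have key: "sw ?T (gA (a (y1##z1) v)) (%p v0. sw ?T (gB (b z2 w)) (%q w0.
 pt H ?AB (x1##p##y2##q##z3) (pt A B (a x2 v0) (b (x3##y3) w0))))
 = ?X x1 x2 x3 (?G (?Y y1 y2 y3 (?E (?Z z1 z2 z3 ?t0))))"
 if [simp]: "x1<:H" "x2<:H" "x3<:H" "y1<:H" "y2<:H" "y3<:H"
 "z1<:H" "z2<:H" "z3<:H" for x1 x2 x3 y1 y2 y3 z1 z2 z3
 proof -
 let ?r' = "gA (a y1 (a z1 v))" and ?r = "gB (b z2 w)"
 let ?y = "tm K H B (%q. y2##q##z3) (b y3)"
 have by3 [simp]: "b y3 : Lin K B B" by (rule action_linear[OF hmod_modelD(3)[OF hW]]) simp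
 have yl [simp]: "(%q. y2##q##z3) : Lin K H H"
 by (rule linc[OF H_mult_lin(2) H_mult_lin(1)]) simp_all
 have y: "?y : Lin K (H><B) (H><B)" by simp
 let ?C = "%r. chat H ?AB (%w. tmR H ?AB (%v. pt A B v w) ?r') L r"
 have gb: "bilin K B (H><A) ?T (%w. tmR H ?AB (%v. pt A B v w))"
 by (rule tmR_bil[OF _ _ _ _ bil_flip[OF pure_ten_bil]]) simp_all
 have C: "?C : Lin K (H><B) ?T"
 by (rule chat_lin[OF _ _ _ bilin_left[OF gb]]) simp_all
 have ext: "?G (?Y y1 y2 y3 (tmL H ?AB (%h. L h z3) (tmR H ?AB (pt A B (a z1 v)) r))) = ?C (?y r)"
 if r: "r<:(H><B)" for r
 by (rule ext_pure[OF _ _ _ linc[OF linc[OF linc[OF tm_simps(1) tm_simps(1)] Y] G]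
 linc[OF y C] r])
 (simp_all add: lin_pure lmul_apply H.m_assoc extL_pure[where A = A] chat_pure[where V = ?AB and W = B, OF _ _ _ bilin_left[OF gb]])
 have yr: "sw ?T ?r' (%p v0. sw ?T ?r (%q w0. pt H ?AB (x1##p##y2##q##z3) (pt A B (a x2 v0) (b (x3##y3) w0))))
 = sw ?T ?r' (%p v0. sw ?T (?y ?r) (%q w0. ?X x1 x2 x3 (pt H ?AB (p##q) (pt A B v0 w0))))"
 proof (rule sw_cong[OF mod_H])
 fix p v0 assume [simp]: "p<:H" "v0<:A"
 have bil: "bilin K H B ?T (%q w0. ?X x1 x2 x3 (pt H ?AB (p##q) (pt A B v0 w0)))"
 by (rule bil_comp_lin[OF bil_comp_args[OF pure_ten_bil H_mult_lin(2) lin_pure(1)] X]) simp_all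
 have sl: "(%r. sw ?T r (%q w0. ?X x1 x2 x3 (pt H ?AB (p##q) (pt A B v0 w0)))) : Lin K (H><B) ?T"
 by (rule sw_lin[OF mod_H _ _ bil]) simp_all
 show "sw ?T ?r (%q w0. pt H ?AB (x1##p##y2##q##z3) (pt A B (a x2 v0) (b (x3##y3) w0)))
 = sw ?T (?y ?r) (%q w0. ?X x1 x2 x3 (pt H ?AB (p##q) (pt A B v0 w0)))"
 by (rule sw_eqI[OF mod_H _ _ linc[OF y sl]])
 (simp_all add: sw_pure[OF mod_H _ _ bil] lmul_apply H.m_assoc action_mult[OF hmod_modelD(3)[OF hW]])
 qed simp_all
 have yr' [simp]: "?y ?r<:(H><B)" by (rule lcl[OF y]) simp
 have "?E (?Z z1 z2 z3 ?t0) = tmL H ?AB (%h. L h z3) (tmR H ?AB (pt A B (a z1 v)) ?r)"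
 by (simp add: lmul_apply extR_pure[where A = B])
 then show ?thesis
 using sw_two_coactions[OF _ _ _ X, of x1 x2 x3 ?r' "?y ?r"] yr
 by (simp add: action_mult[OF hmod_modelD(3)[OF hV]] ext)
 qed
 have Zcl: "?Z z1 z2 z3 ?t0<:?T" if "z1<:H" "z2<:H" "z3<:H" for z1 z2 z3
 by (simp add: that lmul_apply)
 have "htens A a A a gA B b B b gB (pt A B v w) = sw3 ?T (reassoc H) (%x1 x2 x3. ?X x1 x2 x3
 (?G (Phi ?T ?a ?s ?b (?E (Ph ?T ?a ?b ?s ?t0)))))"
 unfolding htens_def tcomp_def by (rule op3_sw3) simp_all
 also have "... = sw3 ?T (reassoc H) (%x1 x2 x3. sw3 ?T (reassoc_inv K H) (%y1 y2 y3. sw3 ?T (reassoc H) (%z1 z2 z3.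
 ?X x1 x2 x3 (?G (?Y y1 y2 y3 (?E (?Z z1 z2 z3 ?t0)))))))"
 proof (rule sw3_cong)
 fix x1 x2 x3 assume x: "x1<:H" "x2<:H" "x3<:H"
 have "?X x1 x2 x3 (?G (Phi ?T ?a ?s ?b (?E (Ph ?T ?a ?b ?s ?t0))))
 = ?X x1 x2 x3 (?G (sw3 ?T (reassoc_inv K H) (%y1 y2 y3. ?Y y1 y2 y3 (?E (Ph ?T ?a ?b ?s ?t0)))))"
 by (subst op3_sw3) simp_all
 also have "... = sw3 ?T (reassoc_inv K H) (%y1 y2 y3. ?X x1 x2 x3 (?G (?Y y1 y2 y3 (?E (Ph ?T ?a ?b ?s ?t0)))))"
 by (rule sw3_lin_im[OF XG[OF x]]) simp_all
 also have "... = sw3 ?T (reassoc_inv K H) (%y1 y2 y3. sw3 ?T (reassoc H) (%z1 z2 z3.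
 ?X x1 x2 x3 (?G (?Y y1 y2 y3 (?E (?Z z1 z2 z3 ?t0))))))"
 proof (rule sw3_cong)
 fix y1 y2 y3 assume y: "y1<:H" "y2<:H" "y3<:H"
 have "Ph ?T ?a ?b ?s ?t0 = sw3 ?T (reassoc H) (%z1 z2 z3. ?Z z1 z2 z3 ?t0)"
 by (rule op3_sw3) simp_all
 then show "?X x1 x2 x3 (?G (?Y y1 y2 y3 (?E (Ph ?T ?a ?b ?s ?t0)))) = sw3 ?T (reassoc H) (%z1 z2 z3.
 ?X x1 x2 x3 (?G (?Y y1 y2 y3 (?E (?Z z1 z2 z3 ?t0)))))"
 using sw3_lin_im[OF XGYE[OF x y] _ _ Zcl, where x = "reassoc H"] by simp
 qed simp
 finally show "?X x1 x2 x3 (?G (Phi ?T ?a ?s ?b (?E (Ph ?T ?a ?b ?s ?t0)))) = ..." .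
 qed simp
 also have "... = sw3 ?T (reassoc H) (%x1 x2 x3. sw3 ?T (reassoc_inv K H) (%y1 y2 y3. sw3 ?T (reassoc H) (%z1 z2 z3.
 sw ?T (coact1 K H V (act V (y1##z1) v)) (%p v0. sw ?T (coact1 K H W (act W z2 w)) (%q w0.
 pt H ?AB (x1##p##y2##q##z3) (pt A B (act V x2 v0) (act W (x3##y3) w0)))))))"
 proof (intro sw3_cong)
 fix x1 x2 x3 y1 y2 y3 z1 z2 z3
 assume h [simp]: "x1<:H" "x2<:H" "x3<:H" "y1<:H" "y2<:H" "y3<:H"
 "z1<:H" "z2<:H" "z3<:H"
 have "sw ?T (gA (a (y1##z1) v)) (%p v0. sw ?T (gB (b z2 w)) (%q w0.
 pt H ?AB (x1##p##y2##q##z3) (pt A B (act V x2 v0) (act W (x3##y3) w0))))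
 = sw ?T (gA (a (y1##z1) v)) (%p v0. sw ?T (gB (b z2 w)) (%q w0.
 pt H ?AB (x1##p##y2##q##z3) (pt A B (a x2 v0) (b (x3##y3) w0))))"
 by (intro sw_cong[OF mod_H hmod_modelD(2)[OF hV]] sw_cong[OF mod_H hmod_modelD(2)[OF hW]]) simp_all
 then show "?X x1 x2 x3 (?G (?Y y1 y2 y3 (?E (?Z z1 z2 z3 ?t0)))) = sw ?T (coact1 K H V (act V (y1##z1) v)) (%p v0.
 sw ?T (coact1 K H W (act W z2 w)) (%q w0. pt H ?AB (x1##p##y2##q##z3) (pt A B (act V x2 v0) (act W (x3##y3) w0))))"
 using key[OF h] by simp
 qed simp_all
 finally show "sw3 ?T (reassoc H) (%x1 x2 x3. sw3 ?T (reassoc_inv K H) (%y1 y2 y3. sw3 ?T (reassoc H) (%z1 z2 z3.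
 sw ?T (coact1 K H V (act V (y1##z1) v)) (%p v0. sw ?T (coact1 K H W (act W z2 w)) (%q w0.
 pt H ?AB (x1##p##y2##q##z3) (pt A B (act V x2 v0) (act W (x3##y3) w0)))))))
 = htens A a A a gA B b B b gB (pt A B v w)" ..
 qed simp_all
qed

lemma ydmod_model_ten:
 "ydmod_model (yd_tensor K H V W) (A><B) (dact A a B b)
 (second (A><B) (dact A a B b) (A><B) (htens A a A a (%x. theta A a (d x)) B b B b (%x. theta B b (e x))))"
proof -
 note hV = ydmod_modelD(1)[OF V] and hW = ydmod_modelD(1)[OF W]
 note [simp] = hmod_modelD(2,3)[OF hV] hmod_modelD(2,3)[OF hW]
 sm_mod_ten[OF hmod_modelD(1)[OF hV] hmod_modelD(1)[OF hW]]
 note T = hmod_model_ten[OF hV hW]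
 let ?U = "H><(A><B)"
 define g where "g = htens A a A a (%x. theta A a (d x)) B b B b (%x. theta B b (e x))"
 have fk: "first_kind (A><B) (dact A a B b) (A><B) (dact A a B b) g"
 unfolding g_def by (rule htens_fst1_k[OF _ _ _ _ _ _ _ _ gA gB]) simp_all
 note g [simp] = fst1_k_lin[OF fk]
 have "coact (yd_tensor K H V W) t = second (A><B) (dact A a B b) (A><B) g t" if t [simp]: "t<:(A><B)" for t
 proof -
 have pR: "pR K H<:HH"
 unfolding pR_def by (rule sw3_cl) simp_all
 have "sw ?U (tensor_coact1 K H V W (act (hmod_tensor K H V W) p t)) (%x u. pt H (A><B) (x##q) u)
 = tmL H (A><B) (%x. x##q) (g (dact A a B b p t))" if [simp]: "p<:H" "q<:H" for p q
 proof -
 have [simp]: "dact A a B b p t<:(A><B)" by simp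
 have "tensor_coact1 K H V W (act (hmod_tensor K H V W) p t) = g (dact A a B b p t)"
 by (simp add: hmod_modelD(4)[OF T] ten_coact1_htens g_def)
 moreover have "sw ?U (g (dact A a B b p t)) (%x u. pt H (A><B) (x##q) u) = tmL H (A><B) (%x. x##q) (g (dact A a B b p t))"
 by (rule sw_eqI[where W = "A><B", OF mod_H _ _ tm_simps(1)]) (simp_all add: lcl[OF g])
 ultimately show ?thesis by simp
 qed
 then have "sw ?U (pR K H) (%p q. sw ?U (tensor_coact1 K H V W (act (hmod_tensor K H V W) p t)) (%x u. pt H (A><B) (x##q) u))
 = sw ?U (pR K H) (%p q. tmL H (A><B) (%x. x##q) (g (dact A a B b p t)))"
 by (intro sw_cong[OF mod_H mod_H _ pR])
 also have "... = second (A><B) (dact A a B b) (A><B) g t"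
 by (rule second_pR) simp_all
 finally show ?thesis
 by (simp add: object_fl Let_def)
 qed
 moreover have "second (A><B) (dact A a B b) (A><B) g : Lin K (A><B) ?U"
 by (rule second_lin[OF _ _ _ _ fk]) simp_all
 moreover have "same_module (yd_tensor K H V W) (A><B)"
 using sm_mod_objects(3)[of K H V W] by simp
 ultimately show ?thesis
 using T by (simp add: ydmod_model_def hmod_model_def object_fl g_def)
qed

end

end

context quasi_hopf_algebra
begin

section \<open>The comparison with the statement\<close>

text \<open>Naturality of \<open>thetahat\<close> along the counit, which intertwines
  \<open>ract V b\<close> with \<open>b\<close>, reduces this to \<open>cou_nabla\<close>.\<close>

lemma cou_theta_nabla:
 assumes [simp]: "md K V" "lact V b" and r [simp]: "r<:(H><V)"
 shows "tmR H V (cou V) (theta (H><V) (ract V b) (nabla V b r)) = theta V b r"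
proof -
 have [simp]: "nabla V b r<:(H><(H><V))"
 by (rule lcl[OF nabla_lin]) simp_all
 have "tmR H V (cou V) (theta (H><V) (ract V b) (nabla V b r))
 = thetahat H V b L (tmR H (H><V) (tmR H V (cou V)) (pt H (H><(H><V)) 1[H] (nabla V b r)))"
 unfolding theta_def by (rule thetahat_nat_r) (simp_all add: cou_ract)
 then show ?thesis
 by (simp add: theta_def cou_nabla)
qed

context
 fixes A :: "('k, 'a, 'q) module_scheme" and B :: "('k, 'b, 'm) module_scheme"
 and C :: "('k, 'c, 'p) module_scheme" and D :: "('k, 'd, 'l) module_scheme"
 and a :: "'h => 'a => 'a" and b :: "'h => 'b => 'b" and c :: "'h => 'c => 'c" and d :: "'h => 'd => 'd"
 and k :: "'a => ('h, 'c) tensor" and l :: "'b => ('h, 'd) tensor"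
 assumes mods [simp]: "md K A" "md K B" "md K C" "md K D"
 and acts [simp]: "lact A a" "lact B b" "lact C c" "lact D d"
 and k [simp]: "k : Lin K A (H><C)" and l [simp]: "l : Lin K B (H><D)"
 and ki: "eqv A (H><C) k a (ract C c)" and li: "eqv B (H><D) l b (ract D d)"
begin

abbreviation (input) "RC \<equiv> H><C"
abbreviation (input) "RD \<equiv> H><D"
abbreviation (input) "hopf \<equiv> second (A><B) (dact A a B b) (C><D)
 (htens A a C c (%x. theta C c (k x)) B b D d (%x. theta D d (l x)))"
abbreviation (input) "gRR \<equiv> htens RC (ract C c) RC (ract C c) (%r. theta RC (ract C c) (nabla C c r))
 RD (ract D d) RD (ract D d) (%r. theta RD (ract D d) (nabla D d r))"

lemma hopf_fst1_kinds:
 "first_kind A a C c (%x. theta C c (k x))" "first_kind B b D d (%x. theta D d (l x))"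
 by (rule fst1_k_comp[OF _ _ _ _ _ theta_fst1_k]; simp add: ki li)+

lemma nabla_fst1_kinds:
 "first_kind RC (ract C c) RC (ract C c) (%r. theta RC (ract C c) (nabla C c r))"
 "first_kind RD (ract D d) RD (ract D d) (%r. theta RD (ract D d) (nabla D d r))"
 by (rule fst1_k_comp[OF _ _ _ _ _ theta_fst1_k nabla_lin nabla_eqv]; simp)+

text \<open>The left side is the composite that defines the Hopf operators. Counits applied after
  the half-braidings of the cofree objects leave the universal maps, and by naturality of
  \<open>second\<close> the result is one coaction of a tensor product of two maps.\<close>

lemma cofree_comparison:
 assumes t [simp]: "t<:(A><B)"
 shows "tmR H (C><D) (tm K C D (cou C) (cou D))
 (second (RC><RD) (dact RC (ract C c) RD (ract D d)) (RC><RD) gRR (tm K RC RD k l t)) = hopf t"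
proof -
 let ?W = "RC><RD" and ?w = "dact RC (ract C c) RD (ract D d)"
 define g where "g = htens RC (ract C c) C c (theta C c) RD (ract D d) D d (theta D d)"
 have g [simp]: "g : Lin K ?W (H><(C><D))"
 unfolding g_def by (rule htens_lin[OF _ _ _ _ _ _ _ _ theta_fst1_k theta_fst1_k]) simp_all
 have gR [simp]: "gRR : Lin K ?W (H><?W)"
 by (rule htens_lin[OF _ _ _ _ _ _ _ _ nabla_fst1_kinds]) simp_all
 have gh [simp]: "htens A a C c (%x. theta C c (k x)) B b D d (%x. theta D d (l x)) : Lin K (A><B) (H><(C><D))"
 by (rule htens_lin[OF _ _ _ _ _ _ _ _ hopf_fst1_kinds]) simp_all
 have cl [simp]: "tm K RC RD k l t<:?W"
 by (rule lcl[OF tm_simps(1) t]) simp_all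
 have id: "g w = tmR H (C><D) (tm K C D (cou C) (cou D)) (gRR w)" if w: "w<:?W" for w
 proof -
 have "g (tm K RC RD (%x. x) (%x. x) w) = tmR H (C><D) (tm K C D (cou C) (cou D)) (gRR w)"
 unfolding g_def
 by (rule htens_nat[OF _ _ _ _ _ _ _ _ _ _ _ _ _ _ _ _ nabla_fst1_kinds theta_fst1_k theta_fst1_k])
 (simp_all add: cou_ract cou_theta_nabla w)
 then show ?thesis by (simp add: w)
 qed
 have nat: "g (tm K RC RD k l w) = tmR H (C><D) (%x. x)
 (htens A a C c (%x. theta C c (k x)) B b D d (%x. theta D d (l x)) w)" if w: "w<:(A><B)" for w
 proof -
 have cl: "theta C c (k x)<:RC" if "x<:A" for x
 by (rule lcl[OF linc[OF k theta_lin] that]) simp_all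
 have cl': "theta D d (l x)<:RD" if "x<:B" for x
 by (rule lcl[OF linc[OF l theta_lin] that]) simp_all
 have "g (tm K RC RD k l w) = tmR H (C><D) (tm K C D (%x. x) (%x. x))
 (htens A a C c (%x. theta C c (k x)) B b D d (%x. theta D d (l x)) w)"
 unfolding g_def
 by (rule htens_nat[OF _ _ _ _ _ _ _ _ _ _ _ _ _ _ _ _ hopf_fst1_kinds theta_fst1_k theta_fst1_k])
 (simp_all add: ki li w cl cl')
 also have "... = tmR H (C><D) (%x. x) (htens A a C c (%x. theta C c (k x)) B b D d (%x. theta D d (l x)) w)"
 by (rule ten_map_cong[OF mod_H _ _ _ _ _ lcl[OF gh w]]) simp_all
 finally show ?thesis .
 qed
 have ti: "eqv (A><B) ?W (tm K RC RD k l) (dact A a B b) ?w"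
 by (rule eqv_diag) (simp_all add: ten_map_eqv ki li)
 have "tmR H (C><D) (tm K C D (cou C) (cou D)) (second ?W ?w ?W gRR (tm K RC RD k l t))
 = second ?W ?w (C><D) g (tm K RC RD k l t)"
 by (rule second_nat[where k = "%x. x", symmetric]) (simp_all add: id)
 also have "... = tmR H (C><D) (%x. x) (hopf t)"
 by (rule second_nat) (simp_all add: nat ti)
 also have "... = hopf t"
 proof -
 have "first_kind (A><B) (dact A a B b) (C><D) (dact C c D d) (htens A a C c (%x. theta C c (k x)) B b D d (%x. theta D d (l x)))"
 by (rule htens_fst1_k[OF _ _ _ _ _ _ _ _ hopf_fst1_kinds]) simp_all
 from lcl[OF second_lin[OF _ _ _ _ this] t] show ?thesis by simp
 qed
 finally show ?thesis .
qed

end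

text \<open>A linear inverse of a morphism is itself compatible with action and coaction, so a
  linear bijection suffices.\<close>

lemma yd_isoI:
 assumes V: "ydmod_model V A a d" and W: "ydmod_model W B b e" and f: "lbij A B f"
 and fi: "eqv A B f a b" and fc: "!!x. x<:A ==> e (f x) = tmR H B f (d x)"
 and F: "!!x. x<:A ==> F x = f x"
 shows "F \<in> yd_iso K H V W"
proof -
 note hV = ydmod_modelD(1)[OF V] and hW = ydmod_modelD(1)[OF W]
 note sV = hmod_modelD(1)[OF hV] and sW = hmod_modelD(1)[OF hW]
 note [simp] = hmod_modelD(2,3)[OF hV] hmod_modelD(2,3)[OF hW] sm_mod_lin_mp[OF sV sW]
 sm_mod_lin_mp[OF sW sV] sm_mod_fl(1)[OF sV] sm_mod_fl(1)[OF sW]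
 sm_mod_ten[OF sm_mod_refl sV] sm_mod_ten[OF sm_mod_refl sW]
 lact_cl[OF hmod_modelD(3)[OF hV]] lact_cl[OF hmod_modelD(3)[OF hW]]
 ydmod_modelD(3)[OF V] ydmod_modelD(3)[OF W] hmod_modelD(4)[OF hV] hmod_modelD(4)[OF hW]
 obtain g where g: "lbij B A g" and gf: "!!x. x<:A ==> g (f x) = x" and fg: "!!y. y<:B ==> f (g y) = y"
 using lbij_sym[OF f] by metis
 note fl [simp] = lbij_lin[OF f] and gl [simp] = lbij_lin[OF g]
 note [simp] = lcl[OF fl] lcl[OF gl]
 lcl[OF ydmod_modelD(2)[OF V]] lcl[OF ydmod_modelD(2)[OF W]]
 have Fl: "F : Lin K A B"
 by (rule lin_mp_cong[OF fl]) (simp_all add: F)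
 have TF: "tm K H B (%x. x) F z = tmR H B f z" if "z<:(H><A)" for z
 by (rule ten_map_cong[OF mod_H _ _ _ _ _ that]) (simp_all add: F)
 have "F \<in> yd_hom K H V W"
 using fi by (simp add: yd_hom_def Fl F id_def TF fc eqv_def)
 moreover have "g \<in> yd_hom K H W V"
 proof -
 have "g (b h y) = a h (g y)" if [simp]: "h<:H" "y<:B" for h y
 using gf[of "a h (g y)"] eqvD[OF fi, of h "g y"] by (simp add: fg)
 moreover have "d (g y) = tmR H A g (e y)" if [simp]: "y<:B" for y
 proof -
 have "tmR H A g (tmR H B f z) = z" if z: "z<:(H><A)" for z
 by (rule ext_pure[OF mod_H _ _ linc[OF tm_simps(1) tm_simps(1)] lin_mp_id z])
 (simp_all add: gf)
 then show ?thesis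
 using fc[of "g y"] by (simp add: fg)
 qed
 ultimately show ?thesis
 by (simp add: yd_hom_def id_def)
 qed
 ultimately show ?thesis
 unfolding yd_iso_def by (auto simp: F gf fg intro!: bexI[of _ g])
qed

text \<open>Serves both Hopf operators: one of \<open>k\<close> and \<open>l\<close> is the identity
  of \<open>R(X)\<close>, the other is the coaction of \<open>M\<close>. Bijectivity is the
  hypothesis \<open>lb\<close>; colinearity comes from the hexagons through \<open>hex_htens\<close>
  and \<open>colinear\<close>.\<close>

lemma R2_yd_iso:
 assumes bij: "bijective_antipode H" and X: "hmod_model X C c" and Y: "hmod_model Y D d"
 and V: "ydmod_model V A a dA" and W: "ydmod_model W B b dB"
 and fks: "first_kind A a A a (%x. theta A a (dA x))" "first_kind B b B b (%x. theta B b (dB x))"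
 and k [simp]: "k : Lin K A (H><C)" and l [simp]: "l : Lin K B (H><D)"
 and ki: "eqv A (H><C) k a (ract C c)" and li: "eqv B (H><D) l b (ract D d)"
 and hexs: "hexagon HH lm1 lm2 A a C c (%x. theta A a (dA x)) (%x. theta C c (k x))"
 "hexagon HH lm1 lm2 B b D d (%x. theta B b (dB x)) (%x. theta D d (l x))"
 and lb: "lbij (A><B) (H><(C><D)) (second (A><B) (dact A a B b) (C><D)
 (htens A a C c (%x. theta C c (k x)) B b D d (%x. theta D d (l x))))"
 shows "R2 K H X Y \<circ> tm K (R_obj K H X) (R_obj K H Y) k l
 \<in> yd_iso K H (yd_tensor K H V W) (R_obj K H (hmod_tensor K H X Y))"
proof (rule yd_isoI[OF ydmod_model_ten[OF bij V W fks] ydmod_model_R_obj[OF hmod_model_ten[OF X Y]] lb])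
 note sX = hmod_modelD(1)[OF X] and sY = hmod_modelD(1)[OF Y]
 note [simp] = hmod_modelD(2,3)[OF ydmod_modelD(1)[OF V]] hmod_modelD(2,3)[OF ydmod_modelD(1)[OF W]]
 hmod_modelD(2,3)[OF X] hmod_modelD(2,3)[OF Y]
 let ?g = "htens A a C c (%x. theta C c (k x)) B b D d (%x. theta D d (l x))"
 let ?G = "htens A a A a (%x. theta A a (dA x)) B b B b (%x. theta B b (dB x))"
 have kl: "first_kind A a C c (%x. theta C c (k x))" "first_kind B b D d (%x. theta D d (l x))"
 by (rule fst1_k_comp[OF _ _ _ _ _ theta_fst1_k]; simp add: ki li)+
 have fg: "first_kind (A><B) (dact A a B b) (C><D) (dact C c D d) ?g"
 by (rule htens_fst1_k[OF _ _ _ _ _ _ _ _ kl]) simp_all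
 have fG: "first_kind (A><B) (dact A a B b) (A><B) (dact A a B b) ?G"
 by (rule htens_fst1_k[OF _ _ _ _ _ _ _ _ fks]) simp_all
 show "eqv (A><B) (H><(C><D)) (second (A><B) (dact A a B b) (C><D) ?g) (dact A a B b) (ract (C><D) (dact C c D d))"
 by (rule second_eqv[OF _ _ _ _ fg]) simp_all
 have hex: "hexagon HH lm1 lm2 (A><B) (dact A a B b) (C><D) (dact C c D d) ?G ?g"
 by (rule hex_htens[OF _ _ _ _ _ _ _ _ kl _ _ _ _ _ fks hexs]) simp_all
 fix t assume t: "t<:(A><B)"
 show "nabla (C><D) (dact C c D d) (second (A><B) (dact A a B b) (C><D) ?g t)
 = tmR H (H><(C><D)) (second (A><B) (dact A a B b) (C><D) ?g) (second (A><B) (dact A a B b) (A><B) ?G t)"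
 by (rule colinear[OF _ _ _ _ fg fG hex t]) simp_all
 have counits: "adj_counit H X = cou C" "adj_counit H Y = cou D"
 by (intro ext; simp add: adj_counit_def cou_def sm_mod_sw[OF sX] sm_mod_sw[OF sY]
 sm_mod_fl[OF sX] sm_mod_fl[OF sY])+
 have RX: "ydmod_model (R_obj K H X) (H><C) (ract C c) (nabla C c)" and RY: "ydmod_model (R_obj K H Y) (H><D) (ract D d) (nabla D d)"
 by (rule ydmod_model_R_obj[OF X] ydmod_model_R_obj[OF Y])+
 note nf = nabla_fst1_kinds[where k = k and l = l and A = A and B = B and C = C and D = D and a = a and b = b and c = c and d = d]
 have RR: "ydmod_model (yd_tensor K H (R_obj K H X) (R_obj K H Y)) ((H><C)><(H><D)) (dact (H><C) (ract C c) (H><D) (ract D d))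
 (second ((H><C)><(H><D)) (dact (H><C) (ract C c) (H><D) (ract D d)) ((H><C)><(H><D))
 (htens (H><C) (ract C c) (H><C) (ract C c) (%r. theta (H><C) (ract C c) (nabla C c r))
 (H><D) (ract D d) (H><D) (ract D d) (%r. theta (H><D) (ract D d) (nabla D d r))))"
 by (rule ydmod_model_ten[OF bij RX RY]; rule nf; simp add: ki li)
 have kt: "tm K (H><C) (H><D) k l t<:((H><C)><(H><D))"
 by (rule lcl[OF tm_simps(1) t]) simp_all
 have "same_module (hmod_tensor K H X Y) (C><D)"
 by (rule hmod_modelD(1)[OF hmod_model_ten[OF X Y]])
 note eqs = sm_mod_ten(3)[OF sm_mod_refl this] sm_mod_ten(3)[OF sX sY]
 sm_mod_ten(3)[OF hmod_modelD(1)[OF ydmod_modelD(1)[OF RX]] hmod_modelD(1)[OF ydmod_modelD(1)[OF RY]]]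
 show "(R2 K H X Y \<circ> tm K (R_obj K H X) (R_obj K H Y) k l) t
 = second (A><B) (dact A a B b) (C><D) ?g t"
 using cofree_comparison[of A B C D a b c d k l t] ydmod_modelD(3)[OF RR kt]
 by (simp add: R2_def R_map_def adj_unit_def counits id_def ki li t eqs)
qed

lemma yd_mod_comodule:
 assumes M: "yd_module K H M"
 shows "eqv M (H><M) (coact M) (act M) (ract M (act M))"
 and "m<:M ==> nabla M (act M) (coact M m) = tmR H (H><M) (coact M) (coact M m)"
 and "m<:M ==> cou M (coact M m) = m"
proof -
 interpret M: yd_module K H M by fact
 note model = ydmod_model_refl[OF M]
 note R = ydmod_model_R_obj[OF hmod_model_forget[OF ydmod_modelD(1)[OF model]]]
 note [simp] = M.module M.act_closed lact_act[OF M.left_module_axioms] lcl[OF M.coact_linear]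
 sm_mod_ten[OF sm_mod_refl sm_mod_objects(1)[of M]]
 have "sw (H><M) r (adj_tensor K H M h) = ract M (act M) h r" if "h<:H" "r<:(H><M)" for h r
 using hmod_modelD(4)[OF ydmod_modelD(1)[OF R] that] by (simp add: object_fl adj_tensor_def[abs_def])
 then show "eqv M (H><M) (coact M) (act M) (ract M (act M))"
 by (simp add: eqv_def M.coact_act)
 assume m [simp]: "m<:M"
 have "sw (H><(H><M)) (coact M m) (omega_tensor K H M) = nabla M (act M) (coact M m)"
 using ydmod_modelD(3)[OF R, of "coact M m"] by (simp add: object_fl omega_tensor_def[abs_def])
 then show "nabla M (act M) (coact M m) = tmR H (H><M) (coact M) (coact M m)"
 using M.coact_coassoc[OF m] by (simp add: tensor_map_def)
 show "cou M (coact M m) = m"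
 using M.coact_counit[OF m] by (simp add: cou_def)
qed

context
 fixes X :: "('k, 'h, 'x) hmod" and M :: "('k, 'h, 'm) ydmod"
 assumes bij: "bijective_antipode H" and X: "left_module K H X" and M: "yd_module K H M"
begin

lemma hopf_operators:
 "hopf_left K H X M \<in> yd_iso K H (yd_tensor K H (R_obj K H X) M) (R_obj K H (hmod_tensor K H X (forget M)))"
 "hopf_right K H X M \<in> yd_iso K H (yd_tensor K H M (R_obj K H X)) (R_obj K H (hmod_tensor K H (forget M) X))"
proof -
 interpret M: yd_module K H M by fact
 note hX = hmod_model_refl[OF X] and dM = ydmod_model_refl[OF M]
 note hM = hmod_model_forget[OF ydmod_modelD(1)[OF dM]]
 note [simp] = hmod_modelD(2,3)[OF hX] hmod_modelD(2,3)[OF hM] M.coact_linear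
 note co = yd_mod_comodule[OF M]
 note RX = ydmod_model_R_obj[OF hX]
 note dl = dl_fst1_k[of M "act M" "coact M"] dl_hex[of M "act M" "coact M"]
 have fX: "first_kind (H><X) (ract X (act X)) (H><X) (ract X (act X)) (%r. theta (H><X) (ract X (act X)) (nabla X (act X) r))"
 by (rule fst1_k_comp[OF _ _ _ _ _ theta_fst1_k nabla_lin nabla_eqv]) simp_all
 have fM: "first_kind M (act M) M (act M) (%m. theta M (act M) (coact M m))"
 by (rule dl(1)) (simp_all add: co)
 have hexX: "hexagon HH lm1 lm2 (H><X) (ract X (act X)) X (act X) (%r. theta (H><X) (ract X (act X)) (nabla X (act X) r))
 (%r. theta X (act X) r)"
 by (rule hex_cofree) simp_all
 have hexM: "hexagon HH lm1 lm2 M (act M) M (act M) (%m. theta M (act M) (coact M m)) (%m. theta M (act M) (coact M m))"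
 by (rule dl(2)) (simp_all add: co)
 have "lbij ((H><X)><M) (H><(X><M)) (second ((H><X)><M) (dact (H><X) (ract X (act X)) M (act M)) (X><M)
 (htens (H><X) (ract X (act X)) X (act X) (%r. theta X (act X) r) M (act M) M (act M) (%m. theta M (act M) (coact M m))))"
 by (rule lbij_hopfL) (simp_all add: co)
 from R2_yd_iso[where k = "%x. x", OF bij hX hM RX dM fX fM _ _ _ _ hexX hexM this]
 show "hopf_left K H X M \<in> yd_iso K H (yd_tensor K H (R_obj K H X) M) (R_obj K H (hmod_tensor K H X (forget M)))"
 by (simp add: hopf_left_def id_def adj_unit_def[abs_def] co(1))
 have "lbij (M><(H><X)) (H><(M><X)) (second (M><(H><X)) (dact M (act M) (H><X) (ract X (act X))) (M><X)
 (htens M (act M) M (act M) (%m. theta M (act M) (coact M m)) (H><X) (ract X (act X)) X (act X) (%r. theta X (act X) r)))"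
 by (rule lbij_hopfR[OF _ _ _ _ _ _ _ _ bij]) (simp_all add: co)
 from R2_yd_iso[where l = "%x. x", OF bij hM hX dM RX fM fX _ _ _ _ hexM hexX this]
 show "hopf_right K H X M \<in> yd_iso K H (yd_tensor K H M (R_obj K H X)) (R_obj K H (hmod_tensor K H (forget M) X))"
 by (simp add: hopf_right_def id_def adj_unit_def[abs_def] co(1))
qed

end

end

theorem theorem5p9:
  fixes K :: "('k, 'r) ring_scheme"
    and H :: "('k, 'h) quasi_hopf"
    and X :: "('k, 'h, 'x) hmod"
    and M :: "('k, 'h, 'm) ydmod"
  assumes "quasi_hopf_algebra K H"
    and "bijective_antipode H"
    and "left_module K H X"
    and "yd_module K H M"
  shows "hopf_left K H X M \<in>
           yd_iso K H (yd_tensor K H (R_obj K H X) M) (R_obj K H (hmod_tensor K H X (forget M)))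
       \<and> hopf_right K H X M \<in>
           yd_iso K H (yd_tensor K H M (R_obj K H X)) (R_obj K H (hmod_tensor K H (forget M) X))"
proof -
  interpret quasi_hopf_algebra K H by fact
  show ?thesis
    by (rule conjI[OF hopf_operators[OF assms(2-4)]])
qed

end
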